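(* Assume (A1), (A2) and (B2) (defined in the context). Then the weak solution $u^\varepsilon$ of the microscopic problem satisfies, with a constant $C>0$ independent of $\varepsilon$, $$\|u_L^\varepsilon\|_{L^\infty(0,T;L^2(\Omega_L^\varepsilon))}+\|u_R^\varepsilon\|_{L^\infty(0,T;L^2(\Omega_R^\varepsilon))}+\frac1{\sqrt\varepsilon}\|u_M^\varepsilon\|_{L^\infty(0,T;L^2(\Omega_M^\varepsilon))}\le C,$$ $$\Big\|\frac{\partial u_L^\varepsilon}{\partial t}\Big\|_{L^\infty(0,T;L^2(\Omega_L^\varepsilon))}+\Big\|\frac{\partial u_R^\varepsilon}{\partial t}\Big\|_{L^\infty(0,T;L^2(\Omega_R^\varepsilon))}+\frac1{\sqrt\varepsilon}\Big\|\frac{\partial u_M^\varepsilon}{\partial t}\Big\|_{L^\infty(0,T;L^2(\Omega_M^\varepsilon))}\le C,$$ $$\|\nabla u_L^\varepsilon\|_{L^\infty(0,T;L^2(\Omega_L^\varepsilon))}+\|\nabla u_R^\varepsilon\|_{L^\infty(0,T;L^2(\Omega_R^\varepsilon))}+\frac1{\sqrt\varepsilon}\|\nabla u_M^\varepsilon\|_{L^\infty(0,T;L^2(\Omega_M^\varepsilon))}\le C.$$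
   Context: **Geometry.** Let $\ell,h,T>0$. The parameter $\varepsilon>0$ ranges over small numbers with $h=N\varepsilon$, $N\in\mathbb N$. Put $\Omega=(-\ell,\ell)\times(0,h)$, $\Omega_L^\varepsilon=(-\ell,-\varepsilon/2)\times(0,h)$, $\Omega_M^\varepsilon=(-\varepsilon/2,\varepsilon/2)\times(0,h)$, $\Omega_R^\varepsilon=(\varepsilon/2,\ell)\times(0,h)$, $\Omega_L=(-\ell,0)\times(0,h)$, $\Sigma=\{0\}\times(0,h)$ (identified with $(0,h)$), $Y=(-\tfrac12,\tfrac12)\times(0,1)$, $\mathcal T=Z=(0,1)$. For $g$ on $\Omega$, $g_L^\varepsilon,g_M^\varepsilon,g_R^\varepsilon$ denote restrictions to $\Omega_L^\varepsilon,\Omega_M^\varepsilon,\Omega_R^\varepsilon$. $H^1_\sharp(\Omega)$: periodic $H^1$ functions on $\Omega$ (i.e. $\Omega$ identified with a torus). **(A1)** $D_L,D_R,\rho_L,\rho_R>0$ are constants; $\rho_M^\varepsilon(t,x)=\rho_M(t,x_2,\frac t\varepsilon,\frac x\varepsilon,\frac{x_2}{\varepsilon^2})$, $D_M^\varepsilon(t,x)=D_M(t,x_2,\frac t\varepsilon,\frac x\varepsilon,\frac{x_2}{\varepsilon^2})$ with scalar $\rho_M,D_M\in W^{1,\infty}((0,T)\times\Sigma\times\mathcal T\times Y\times Z)$ (variables $(t,x_2,\tau,y,z)$) periodic in $\tau,y_2,z$, and there are positive constants with $\rho_{min}\le\rho_M^\varepsilon\le\rho_{max}$, $D_{min}\le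 D_M^\varepsilon\le D_{max}$. **(A2)** $v_1\in C_c^2(\Omega_L)$, $v_2\in C_c^1(\Omega_L)$, $f_L\in C_c^2((0,T)\times\Omega_L)$, and $\varepsilon$ is so small that these are supported in $\Omega_L^\varepsilon$, resp. $(0,T)\times\Omega_L^\varepsilon$ ($v_1,v_2,f_L$ are extended by zero). **(B2)** There is a constant $c>0$ such that the layer coefficients have the travelling-wave form $\rho_M^\varepsilon(t,x)=\rho_M\big(\frac{x_1}\varepsilon,\frac{x_2-ct}\varepsilon\big)$ and $D_M^\varepsilon(t,x)=D_M\big(\frac{x_1}\varepsilon,\frac{x_2-ct}\varepsilon\big)$ (functions on $Y$ that are periodic in the second variable), and there exist $\lambda_L,\lambda_M,\lambda_R>0$ with $D_L-c^2\rho_L>\lambda_L$, $D_R-c^2\rho_R>\lambda_R$ and $D_M^\varepsilon-c^2\rho_M^\varepsilon>\lambda_M$. **Microscopic problem.** Let $\hat\rho^\varepsilon=\rho_L,\frac1\varepsilon\rho_M^\varepsilon,\rho_R$ and $\hat D^\varepsilon=D_L,\frac1\varepsilon D_M^\varepsilon,D_R$ in $\Omega_L^\varepsilon,\Omega_M^\varepsilon,\Omega_R^\varepsilon$ respectively. The weak solution $u^\varepsilon$ is the (unique) function $u^\varepsilon\in L^2(0,T;H^1_\sharp(\Omega))$ with $\partial_tu^\varepsilon\in L^2(0,T;L^2(\Omega))$, $u^\varepsilon(0)=v_1$, and $$-\int_0^T\!\!\int_\Omega\hat\rho^\varepsilon\partial_tu^\varepsilon\partial_t\phi+\int_0^T\!\!\int_\Omega\hat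 D^\varepsilon\nabla u^\varepsilon\cdot\nabla\phi=\int_0^T\!\!\int_\Omega f_L\phi+\int_\Omega\rho_Lv_2\phi(0)$$ for all $\phi\in L^2(0,T;H^1_\sharp(\Omega))$ with $\partial_t\phi\in L^2(0,T;L^2(\Omega))$, $\phi(T)=0$. *)

theory Defs
  imports "HOL-Analysis.Analysis" "HOL-Probability.Essential_Supremum"
begin

section \<open>Test functions\<close>

primrec Ck_on :: "nat \<Rightarrow> 'a::euclidean_space set \<Rightarrow> ('a \<Rightarrow> real) \<Rightarrow> bool" where
  "Ck_on 0 S f \<longleftrightarrow> continuous_on S f"
| "Ck_on (Suc k) S f \<longleftrightarrow> (\<forall>x\<in>S. f differentiable (at x)) \<and>
     (\<forall>b\<in>Basis. Ck_on k S (\<lambda>x. frechet_derivative f (at x) b))"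

definition smooth_fun_on :: "'a::euclidean_space set \<Rightarrow> ('a \<Rightarrow> real) \<Rightarrow> bool" where
  "smooth_fun_on S f \<longleftrightarrow> (\<forall>k. Ck_on k S f)"

definition supp :: "('a::topological_space \<Rightarrow> real) \<Rightarrow> 'a set" where
  "supp f = closure {x. f x \<noteq> 0}"

text \<open>Functions with compact support in the open set \<open>S\<close> are total functions that vanish outside
  \<open>S\<close>, so that their extension by zero is built in.\<close>

definition Ck_compact :: "nat \<Rightarrow> 'a::euclidean_space set \<Rightarrow> ('a \<Rightarrow> real) \<Rightarrow> bool" where
  "Ck_compact k S f \<longleftrightarrow> Ck_on k S f \<and> compact (supp f) \<and> supp f \<subseteq> S"

definition test_function :: "'a::euclidean_space set \<Rightarrow> ('a \<Rightarrow> real) \<Rightarrow> bool" where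
  "test_function S f \<longleftrightarrow> smooth_fun_on S f \<and> compact (supp f) \<and> supp f \<subseteq> S"


section \<open>Lebesgue and Sobolev spaces\<close>

text \<open>Elements of Lebesgue spaces are given by Borel measurable representatives.\<close>

definition eL2norm :: "'a::euclidean_space set \<Rightarrow> ('a \<Rightarrow> 'b::real_normed_vector) \<Rightarrow> ennreal" where
  "eL2norm S f =
     (let I = (\<integral>\<^sup>+ x\<in>S. ennreal ((norm (f x))\<^sup>2) \<partial>lborel)
      in if I = \<infinity> then \<infinity> else ennreal (sqrt (enn2real I)))"

definition in_L2 :: "'a::euclidean_space set \<Rightarrow> ('a \<Rightarrow> 'b::euclidean_space) \<Rightarrow> bool" where
  "in_L2 S f \<longleftrightarrow> f \<in> borel_measurable (restrict_space lborel S) \<and> eL2norm S f < \<infinity>"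

definition in_Linf :: "'a::euclidean_space set \<Rightarrow> ('a \<Rightarrow> 'b::euclidean_space) \<Rightarrow> bool" where
  "in_Linf S f \<longleftrightarrow> f \<in> borel_measurable (restrict_space lborel S) \<and>
     (\<exists>K::real. AE x\<in>S in lborel. norm (f x) \<le> K)"

definition weak_gradient ::
  "'a::euclidean_space set \<Rightarrow> ('a \<Rightarrow> real) \<Rightarrow> ('a \<Rightarrow> 'a) \<Rightarrow> bool" where
  "weak_gradient S f g \<longleftrightarrow> (\<forall>\<psi>. test_function S \<psi> \<longrightarrow> (\<forall>b\<in>Basis.
     (LINT x:S|lborel. f x * frechet_derivative \<psi> (at x) b) =
     - (LINT x:S|lborel. (g x \<bullet> b) * \<psi> x)))"

definition in_W1inf :: "'a::euclidean_space set \<Rightarrow> ('a \<Rightarrow> real) \<Rightarrow> bool" where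
  "in_W1inf S f \<longleftrightarrow> in_Linf S f \<and> (\<exists>g. in_Linf S g \<and> weak_gradient S f g)"


section \<open>Geometry\<close>

type_synonym point = "real \<times> real"

definition Omega :: "real \<Rightarrow> real \<Rightarrow> point set" where
  "Omega l h = {-l<..<l} \<times> {0<..<h}"

definition Omega_left :: "real \<Rightarrow> real \<Rightarrow> point set" where
  "Omega_left l h = {-l<..<0} \<times> {0<..<h}"

definition Omega_L :: "real \<Rightarrow> real \<Rightarrow> real \<Rightarrow> point set" where
  "Omega_L l h \<epsilon> = {-l<..<-\<epsilon>/2} \<times> {0<..<h}"

definition Omega_M :: "real \<Rightarrow> real \<Rightarrow> point set" where
  "Omega_M h \<epsilon> = {-\<epsilon>/2<..<\<epsilon>/2} \<times> {0<..<h}"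

definition Omega_R :: "real \<Rightarrow> real \<Rightarrow> real \<Rightarrow> point set" where
  "Omega_R l h \<epsilon> = {\<epsilon>/2<..<l} \<times> {0<..<h}"

definition eps_range :: "real \<Rightarrow> real \<Rightarrow> real set" where
  "eps_range h \<epsilon>\<^sub>0 = {\<epsilon>. 0 < \<epsilon> \<and> \<epsilon> < \<epsilon>\<^sub>0 \<and> (\<exists>N::nat. h = real N * \<epsilon>)}"


section \<open>Bochner spaces\<close>

text \<open>A function of time with values in a space of functions on \<open>\<Omega>\<close> is represented by a jointly
  measurable \<open>u\<close>, with \<open>u t x\<close> its value at time \<open>t\<close> and position \<open>x\<close>. As the value spaces used here
  are separable Hilbert spaces, joint measurability gives strong measurability.\<close>

definition in_L2_L2 ::
  "real \<Rightarrow> point set \<Rightarrow> (real \<Rightarrow> point \<Rightarrow> 'b::euclidean_space) \<Rightarrow> bool" where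
  "in_L2_L2 T S u \<longleftrightarrow>
     (\<lambda>(t, x). u t x) \<in> borel_measurable (restrict_space lborel ({0<..<T} \<times> S)) \<and>
     (\<integral>\<^sup>+ t\<in>{0<..<T}. (eL2norm S (u t))\<^sup>2 \<partial>lborel) < \<infinity>"

definition Linf_L2_norm ::
  "real \<Rightarrow> point set \<Rightarrow> (real \<Rightarrow> point \<Rightarrow> 'b::euclidean_space) \<Rightarrow> ennreal" where
  "Linf_L2_norm T S u = esssup (restrict_space lborel {0<..<T}) (\<lambda>t. eL2norm S (u t))"

text \<open>Weak differentiability on the torus obtained from \<open>\<Omega>\<close> by identifying opposite sides: the
  smooth functions on the torus are the smooth periodic functions on the plane.\<close>

definition torus_test_function :: "real \<Rightarrow> real \<Rightarrow> (point \<Rightarrow> real) \<Rightarrow> bool" where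
  "torus_test_function l h \<psi> \<longleftrightarrow> smooth_fun_on UNIV \<psi> \<and>
     (\<forall>x. \<psi> (x + (2 * l, 0)) = \<psi> x \<and> \<psi> (x + (0, h)) = \<psi> x)"

definition torus_weak_gradient ::
  "real \<Rightarrow> real \<Rightarrow> (point \<Rightarrow> real) \<Rightarrow> (point \<Rightarrow> point) \<Rightarrow> bool" where
  "torus_weak_gradient l h f g \<longleftrightarrow> (\<forall>\<psi>. torus_test_function l h \<psi> \<longrightarrow> (\<forall>b\<in>Basis.
     (LINT x:Omega l h|lborel. f x * frechet_derivative \<psi> (at x) b) =
     - (LINT x:Omega l h|lborel. (g x \<bullet> b) * \<psi> x)))"

text \<open>\<open>u\<close> belongs to \<open>L\<^sup>2(0,T;H\<^sup>1)\<close> over the torus and has spatial gradient \<open>Gu\<close>.\<close>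

definition in_L2_H1per ::
  "real \<Rightarrow> real \<Rightarrow> real \<Rightarrow> (real \<Rightarrow> point \<Rightarrow> real) \<Rightarrow> (real \<Rightarrow> point \<Rightarrow> point) \<Rightarrow> bool" where
  "in_L2_H1per T l h u Gu \<longleftrightarrow>
     in_L2_L2 T (Omega l h) u \<and> in_L2_L2 T (Omega l h) Gu \<and>
     (AE t\<in>{0<..<T} in lborel. torus_weak_gradient l h (u t) (Gu t))"

text \<open>The vector-valued identity \<open>\<integral> \<psi>' u dt = - \<integral> \<psi> w dt\<close> in \<open>L\<^sup>2(S)\<close>, for all test
  functions \<open>\<psi>\<close> on \<open>(0,T)\<close>.\<close>

definition weak_time_derivative ::
  "real \<Rightarrow> point set \<Rightarrow> (real \<Rightarrow> point \<Rightarrow> real) \<Rightarrow> (real \<Rightarrow> point \<Rightarrow> real) \<Rightarrow> bool" where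
  "weak_time_derivative T S u w \<longleftrightarrow> (\<forall>\<psi>. test_function {0<..<T} \<psi> \<longrightarrow>
     (AE x\<in>S in lborel.
       (LINT t:{0<..<T}|lborel. deriv \<psi> t * u t x) = - (LINT t:{0<..<T}|lborel. \<psi> t * w t x)))"

text \<open>The value \<open>u(s)\<close> is that of the representative of \<open>u\<close> in \<open>C([0,T];L\<^sup>2(S))\<close>.\<close>

definition time_trace ::
  "real \<Rightarrow> point set \<Rightarrow> (real \<Rightarrow> point \<Rightarrow> real) \<Rightarrow> real \<Rightarrow> (point \<Rightarrow> real) \<Rightarrow> bool" where
  "time_trace T S u s f \<longleftrightarrow> (\<exists>w.
     (\<forall>t\<in>{0..T}. in_L2 S (w t)) \<and>
     (\<forall>r\<in>{0..T}. ((\<lambda>t. eL2norm S (\<lambda>x. w t x - w r x)) \<longlongrightarrow> 0) (at r within {0..T})) \<and>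
     (AE t\<in>{0<..<T} in lborel. AE x\<in>S in lborel. w t x = u t x) \<and>
     w s = f)"


section \<open>Coefficients and data\<close>

type_synonym profile = "real \<times> real \<times> real \<times> point \<times> real \<Rightarrow> real"

text \<open>Arguments of a profile are \<open>(t, x\<^sub>2, \<tau>, y, z)\<close>.\<close>

definition micro_coeff :: "profile \<Rightarrow> real \<Rightarrow> real \<Rightarrow> point \<Rightarrow> real" where
  "micro_coeff f \<epsilon> t x = f (t, snd x, t / \<epsilon>, x /\<^sub>R \<epsilon>, snd x / \<epsilon>\<^sup>2)"

definition profile_domain ::
  "real \<Rightarrow> real \<Rightarrow> (real \<times> real \<times> real \<times> point \<times> real) set" where
  "profile_domain T h = {0<..<T} \<times> {0<..<h} \<times> UNIV \<times> ({-1/2<..<1/2} \<times> UNIV) \<times> UNIV"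

text \<open>Periodic functions live on the periodically extended domain, so that \<open>W\<^sup>1\<^sup>,\<^sup>\<infinity>\<close>-regularity
  also holds across cell boundaries. Continuity selects the representative for which
  the composition in \<^const>\<open>micro_coeff\<close> makes sense. The period in \<open>\<tau>\<close> is not normalised to \<open>1\<close>:
  a travelling wave of speed \<open>c\<close>, with period \<open>1\<close> in \<open>y\<^sub>2\<close>, has \<open>\<tau>\<close>-period \<open>1/c\<close>.\<close>

definition periodic_profile :: "real \<Rightarrow> real \<Rightarrow> profile \<Rightarrow> bool" where
  "periodic_profile T h f \<longleftrightarrow>
     continuous_on (profile_domain T h) f \<and> in_W1inf (profile_domain T h) f \<and>
     (\<exists>p>0. \<forall>t\<in>{0<..<T}. \<forall>x\<^sub>2\<in>{0<..<h}. \<forall>\<tau>. \<forall>y\<^sub>1\<in>{-1/2<..<1/2}. \<forall>y\<^sub>2 z.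
        f (t, x\<^sub>2, \<tau> + p, (y\<^sub>1, y\<^sub>2), z) = f (t, x\<^sub>2, \<tau>, (y\<^sub>1, y\<^sub>2), z) \<and>
        f (t, x\<^sub>2, \<tau>, (y\<^sub>1, y\<^sub>2 + 1), z) = f (t, x\<^sub>2, \<tau>, (y\<^sub>1, y\<^sub>2), z) \<and>
        f (t, x\<^sub>2, \<tau>, (y\<^sub>1, y\<^sub>2), z + 1) = f (t, x\<^sub>2, \<tau>, (y\<^sub>1, y\<^sub>2), z))"

definition assumption_A1 ::
  "real \<Rightarrow> real \<Rightarrow> real set \<Rightarrow> real \<Rightarrow> real \<Rightarrow> real \<Rightarrow> real \<Rightarrow> profile \<Rightarrow> profile \<Rightarrow> bool" where
  "assumption_A1 T h E D\<^sub>L D\<^sub>R \<rho>\<^sub>L \<rho>\<^sub>R D\<^sub>M \<rho>\<^sub>M \<longleftrightarrow>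
     D\<^sub>L > 0 \<and> D\<^sub>R > 0 \<and> \<rho>\<^sub>L > 0 \<and> \<rho>\<^sub>R > 0 \<and>
     periodic_profile T h D\<^sub>M \<and> periodic_profile T h \<rho>\<^sub>M \<and>
     (\<exists>\<rho>min \<rho>max Dmin Dmax. \<rho>min > 0 \<and> \<rho>max > 0 \<and> Dmin > 0 \<and> Dmax > 0 \<and>
       (\<forall>\<epsilon>\<in>E. \<forall>t\<in>{0<..<T}. \<forall>x\<in>Omega_M h \<epsilon>.
          \<rho>min \<le> micro_coeff \<rho>\<^sub>M \<epsilon> t x \<and> micro_coeff \<rho>\<^sub>M \<epsilon> t x \<le> \<rho>max \<and>
          Dmin \<le> micro_coeff D\<^sub>M \<epsilon> t x \<and> micro_coeff D\<^sub>M \<epsilon> t x \<le> Dmax))"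

definition assumption_A2 ::
  "real \<Rightarrow> real \<Rightarrow> real \<Rightarrow> real set \<Rightarrow> (point \<Rightarrow> real) \<Rightarrow> (point \<Rightarrow> real) \<Rightarrow>
   (real \<Rightarrow> point \<Rightarrow> real) \<Rightarrow> bool" where
  "assumption_A2 T l h E v\<^sub>1 v\<^sub>2 f\<^sub>L \<longleftrightarrow>
     Ck_compact 2 (Omega_left l h) v\<^sub>1 \<and>
     Ck_compact 1 (Omega_left l h) v\<^sub>2 \<and>
     Ck_compact 2 ({0<..<T} \<times> Omega_left l h) (\<lambda>(t, x). f\<^sub>L t x) \<and>
     (\<forall>\<epsilon>\<in>E. supp v\<^sub>1 \<subseteq> Omega_L l h \<epsilon> \<and> supp v\<^sub>2 \<subseteq> Omega_L l h \<epsilon> \<and>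
        supp (\<lambda>(t, x). f\<^sub>L t x) \<subseteq> {0<..<T} \<times> Omega_L l h \<epsilon>)"

definition travelling_wave ::
  "real \<Rightarrow> real \<Rightarrow> real set \<Rightarrow> real \<Rightarrow> profile \<Rightarrow> (real \<Rightarrow> real \<Rightarrow> real) \<Rightarrow> bool" where
  "travelling_wave T h E c f g \<longleftrightarrow>
     (\<forall>y\<^sub>1\<in>{-1/2<..<1/2}. \<forall>y\<^sub>2. g y\<^sub>1 (y\<^sub>2 + 1) = g y\<^sub>1 y\<^sub>2) \<and>
     (\<forall>\<epsilon>\<in>E. \<forall>t\<in>{0<..<T}. \<forall>x\<in>Omega_M h \<epsilon>.
        micro_coeff f \<epsilon> t x = g (fst x / \<epsilon>) ((snd x - c * t) / \<epsilon>))"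

definition assumption_B2 ::
  "real \<Rightarrow> real \<Rightarrow> real set \<Rightarrow> real \<Rightarrow> real \<Rightarrow> real \<Rightarrow> real \<Rightarrow> profile \<Rightarrow> profile \<Rightarrow> bool" where
  "assumption_B2 T h E D\<^sub>L D\<^sub>R \<rho>\<^sub>L \<rho>\<^sub>R D\<^sub>M \<rho>\<^sub>M \<longleftrightarrow>
     (\<exists>c>0. (\<exists>g. travelling_wave T h E c \<rho>\<^sub>M g) \<and> (\<exists>g. travelling_wave T h E c D\<^sub>M g) \<and>
       (\<exists>lam\<^sub>L>0. D\<^sub>L - c\<^sup>2 * \<rho>\<^sub>L > lam\<^sub>L) \<and>
       (\<exists>lam\<^sub>R>0. D\<^sub>R - c\<^sup>2 * \<rho>\<^sub>R > lam\<^sub>R) \<and>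
       (\<exists>lam\<^sub>M>0. \<forall>\<epsilon>\<in>E. \<forall>t\<in>{0<..<T}. \<forall>x\<in>Omega_M h \<epsilon>.
          micro_coeff D\<^sub>M \<epsilon> t x - c\<^sup>2 * micro_coeff \<rho>\<^sub>M \<epsilon> t x > lam\<^sub>M))"


section \<open>The microscopic problem\<close>

text \<open>The value on the two interfaces (a null set) is immaterial.\<close>

definition hat_coeff ::
  "real \<Rightarrow> real \<Rightarrow> real \<Rightarrow> real \<Rightarrow> profile \<Rightarrow> real \<Rightarrow> real \<Rightarrow> point \<Rightarrow> real" where
  "hat_coeff l h \<epsilon> a\<^sub>L a\<^sub>M a\<^sub>R t x =
     (if x \<in> Omega_L l h \<epsilon> then a\<^sub>L
      else if x \<in> Omega_M h \<epsilon> then 1 / \<epsilon> * micro_coeff a\<^sub>M \<epsilon> t x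
      else if x \<in> Omega_R l h \<epsilon> then a\<^sub>R
      else 0)"

text \<open>\<open>u\<close> is the weak solution, \<open>du\<close> its time derivative and \<open>Gu\<close> its spatial gradient; likewise
  \<open>d\<phi>\<close>, \<open>G\<phi>\<close> and \<open>\<phi>\<^sub>0\<close> stand for the derivatives and the initial value of \<open>\<phi>\<close>.\<close>

definition weak_solution ::
  "real \<Rightarrow> real \<Rightarrow> real \<Rightarrow> real \<Rightarrow> real \<Rightarrow> real \<Rightarrow> real \<Rightarrow> real \<Rightarrow> profile \<Rightarrow> profile \<Rightarrow>
   (point \<Rightarrow> real) \<Rightarrow> (point \<Rightarrow> real) \<Rightarrow> (real \<Rightarrow> point \<Rightarrow> real) \<Rightarrow>
   (real \<Rightarrow> point \<Rightarrow> real) \<Rightarrow> (real \<Rightarrow> point \<Rightarrow> real) \<Rightarrow> (real \<Rightarrow> point \<Rightarrow> point) \<Rightarrow> bool" where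
  "weak_solution T l h \<epsilon> D\<^sub>L D\<^sub>R \<rho>\<^sub>L \<rho>\<^sub>R D\<^sub>M \<rho>\<^sub>M v\<^sub>1 v\<^sub>2 f\<^sub>L u du Gu \<longleftrightarrow>
     in_L2_H1per T l h u Gu \<and>
     in_L2_L2 T (Omega l h) du \<and> weak_time_derivative T (Omega l h) u du \<and>
     time_trace T (Omega l h) u 0 v\<^sub>1 \<and>
     (\<forall>\<phi> d\<phi> G\<phi> \<phi>\<^sub>0.
        in_L2_H1per T l h \<phi> G\<phi> \<longrightarrow>
        in_L2_L2 T (Omega l h) d\<phi> \<longrightarrow> weak_time_derivative T (Omega l h) \<phi> d\<phi> \<longrightarrow>
        time_trace T (Omega l h) \<phi> 0 \<phi>\<^sub>0 \<longrightarrow> time_trace T (Omega l h) \<phi> T (\<lambda>x. 0) \<longrightarrow>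
        - (LINT t:{0<..<T}|lborel. LINT x:Omega l h|lborel.
              hat_coeff l h \<epsilon> \<rho>\<^sub>L \<rho>\<^sub>M \<rho>\<^sub>R t x * du t x * d\<phi> t x)
        + (LINT t:{0<..<T}|lborel. LINT x:Omega l h|lborel.
              hat_coeff l h \<epsilon> D\<^sub>L D\<^sub>M D\<^sub>R t x * (Gu t x \<bullet> G\<phi> t x))
        = (LINT t:{0<..<T}|lborel. LINT x:Omega l h|lborel. f\<^sub>L t x * \<phi> t x)
        + (LINT x:Omega l h|lborel. \<rho>\<^sub>L * v\<^sub>2 x * \<phi>\<^sub>0 x))"

end

theory Submission
 imports Defs
begin

text \<open>The coefficients are invariant under shifts along the space-time direction \<open>(1, (0, c))\<close>.
  Hence \<open>\<partial>\<^sub>t u + c \<partial>\<^sub>2 u\<close> is a natural multiplier: testing with it leaves no derivative of the coefficients,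
  and yields control of the energy density
  \<open>\<rho> (\<partial>\<^sub>t u)\<^sup>2 / 2 + c \<rho> \<partial>\<^sub>t u \<partial>\<^sub>2 u + D |\<nabla>u|\<^sup>2 / 2\<close>, which is coercive because \<open>D - c\<^sup>2 \<rho> > 0\<close>. As \<open>u\<close> is not
  regular enough, the multiplier is replaced by a symmetric difference quotient along that direction (with \<open>u\<close>
  continued to negative times by \<open>v\<^sub>1 + t v\<^sub>2\<close>), cut off in time; discrete integration by parts gives the energy
  inequality in the limit. The source is absorbed on its support, where the coefficients are constant.\<close>

text \<open>The quotient is centred because of signs. Paired with its own centred difference, a
  function leaves after one shift only the product of Z with its translate, times a difference of
  the cutoff. A one-sided quotient would also leave squared increments over the step, with opposite
  signs in the kinetic and the elastic part, and nothing bounds those. The price is paid at time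
  zero: what remains on a time strip of width k must be of order k before the division by k. For the
  velocity, the unknown parts cancel against the initial term of the weak formulation. For the
  gradient, one integration by parts in space puts a second derivative on the initial value. The
  solution is known through weak derivatives only, with exceptional sets depending on the test
  function, so it first has to be recovered as a primitive in time at almost every point. Uniformity
  in \<epsilon> holds because the data see only the constants of the left region, while the factor
  1/\<epsilon> of the layer acts in the coercivity alone.\<close>

lemma borel_fst [measurable]:
 fixes f :: "_ => 'b::second_countable_topology \<times> 'c::second_countable_topology"
 shows "f \<in> borel_measurable M ==> (%x. fst (f x)) \<in> borel_measurable M"
 by (rule measurable_compose[OF _ borel_measurable_continuous_onI]) (auto intro: continuous_intros)

lemma borel_snd [measurable]:
 fixes f :: "_ => 'b::second_countable_topology \<times> 'c::second_countable_topology"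
 shows "f \<in> borel_measurable M ==> (%x. snd (f x)) \<in> borel_measurable M"
 by (rule measurable_compose[OF _ borel_measurable_continuous_onI]) (auto intro: continuous_intros)

lemma measurable_id_borel_prod [measurable]:
 "(%x. x) \<in> measurable borel
  (borel \<Otimes>\<^sub>M (borel :: 'c::second_countable_topology measure) :: ('b::second_countable_topology \<times> 'c) measure)"
 by (simp add: borel_prod)

section \<open>Translations of the torus and of space-time\<close>

text \<open>The representative of x modulo p in the half-open interval from a to a + p.\<close>

definition wrap1 :: "real => real => real => real" where
 "wrap1 a p x = x - p * \<lfloor>(x - a) / p\<rfloor>"

lemma wrap1_measurable [measurable]: "wrap1 a p \<in> borel_measurable borel"
 unfolding wrap1_def by measurable

lemma wrap1_in:
 assumes "p > 0" shows "wrap1 a p x \<in> {a..<a+p}"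
proof -
 have "\<lfloor>(x - a) / p\<rfloor> \<le> (x - a) / p" "(x - a) / p < \<lfloor>(x - a) / p\<rfloor> + 1" by linarith+
 then have "p * \<lfloor>(x - a) / p\<rfloor> \<le> x - a" "x - a < p * (\<lfloor>(x - a) / p\<rfloor> + 1)"
  using assms by (simp_all only: pos_le_divide_eq pos_divide_less_eq mult.commute)
 then show ?thesis by (auto simp: wrap1_def algebra_simps)
qed

lemma wrap1_id: "x \<in> {a..<a+p} ==> wrap1 a p x = x"
proof -
 assume x: "x \<in> {a..<a+p}"
 then have "p > 0" by auto
 then have "\<lfloor>(x - a) / p\<rfloor> = 0" using x by (intro floor_unique) (auto simp: field_simps)
 then show ?thesis by (simp add: wrap1_def)
qed

lemma wrap1_periodic:
 assumes "p > 0" shows "wrap1 a p (x + p * of_int m) = wrap1 a p x"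
proof -
 have "(x + p * of_int m - a) / p = (x - a) / p + of_int m" using assms by (simp add: field_simps)
 then show ?thesis by (simp add: wrap1_def algebra_simps)
qed

lemma wrap1_wrap1:
 assumes "p > 0" shows "wrap1 a p (wrap1 a p x + s) = wrap1 a p (x + s)"
proof -
 have "wrap1 a p x + s = (x + s) + p * of_int (- \<lfloor>(x - a) / p\<rfloor>)" by (simp add: wrap1_def algebra_simps)
 then show ?thesis using wrap1_periodic[OF assms] by metis
qed

text \<open>Only the remainder \<open>r\<close> of the shift matters. The translated window reaches
  beyond a + p by a piece of length r, and periodicity moves that piece back to the start of the
  window. Half-open windows make the pieces fit without overlap.\<close>

lemma nn_integral_wrap1:
 fixes f :: "real => ennreal"
 assumes [measurable]: "f \<in> borel_measurable borel" and p: "p > 0"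
 shows "(\<integral>\<^sup>+x\<in>{a..<a+p}. f (wrap1 a p (x + s)) \<partial>lborel) = (\<integral>\<^sup>+x\<in>{a..<a+p}. f x \<partial>lborel)"
proof -
 define r where "r = wrap1 0 p s"
 have r: "0 \<le> r" "r < p" using wrap1_in[OF p, of 0 s] by (auto simp: r_def)
 have per: "wrap1 a p (x + s) = wrap1 a p (x + r)" for x
 proof -
  have "x + s = (x + r) + p * of_int \<lfloor>(s - 0) / p\<rfloor>" by (simp add: r_def wrap1_def)
  then show ?thesis using wrap1_periodic[OF p] by metis
 qed
 let ?P = "%x. f (wrap1 a p x)"
 have "(\<integral>\<^sup>+x\<in>{a..<a+p}. f (wrap1 a p (x + s)) \<partial>lborel) = (\<integral>\<^sup>+x. ?P (x + r) * indicator {a..<a+p} x \<partial>lborel)"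
  by (simp add: per)
 also have "\<dots> = (\<integral>\<^sup>+x. ?P x * indicator {a+r..<a+p+r} x \<partial>lborel)"
  by (subst nn_integral_real_affine[where c=1 and t=r and f="%x. ?P x * indicator {a+r..<a+p+r} x"])
   (auto intro!: nn_integral_cong simp: indicator_def add.commute)
 also have "\<dots> = (\<integral>\<^sup>+x. ?P x * indicator {a+r..<a+p} x + ?P x * indicator {a+p..<a+p+r} x \<partial>lborel)"
  using r by (intro nn_integral_cong) (auto simp: indicator_def)
 also have "\<dots> = (\<integral>\<^sup>+x. ?P x * indicator {a+r..<a+p} x \<partial>lborel) + (\<integral>\<^sup>+x. ?P x * indicator {a+p..<a+p+r} x \<partial>lborel)"
  by (subst nn_integral_add) auto
 also have "(\<integral>\<^sup>+x. ?P x * indicator {a+p..<a+p+r} x \<partial>lborel) = (\<integral>\<^sup>+x. ?P x * indicator {a..<a+r} x \<partial>lborel)"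
  using wrap1_periodic[OF p, of a _ 1]
  by (subst nn_integral_real_affine[where c=1 and t=p])
   (auto intro!: nn_integral_cong simp: indicator_def add.commute)
 also have "(\<integral>\<^sup>+x. ?P x * indicator {a+r..<a+p} x \<partial>lborel) + (\<integral>\<^sup>+x. ?P x * indicator {a..<a+r} x \<partial>lborel)
  = (\<integral>\<^sup>+x. ?P x * indicator {a+r..<a+p} x + ?P x * indicator {a..<a+r} x \<partial>lborel)"
  by (subst nn_integral_add) auto
 also have "\<dots> = (\<integral>\<^sup>+x\<in>{a..<a+p}. f x \<partial>lborel)"
  using r by (intro nn_integral_cong) (auto simp: indicator_def wrap1_id)
 finally show ?thesis .
qed

lemma distr_preserving:
 assumes [measurable]: "g \<in> measurable M M"
  and "\<And>f. f \<in> borel_measurable M ==> (\<integral>\<^sup>+x. f (g x) \<partial>M) = (\<integral>\<^sup>+x. f x \<partial>M :: ennreal)"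
 shows "distr M M g = M"
proof (rule measure_eqI)
 fix A assume A [measurable]: "A \<in> sets (distr M M g)"
 then have [measurable]: "A \<in> sets M" by simp
 have "emeasure (distr M M g) A = (\<integral>\<^sup>+x. indicator A x \<partial>distr M M g)" using A by (subst nn_integral_indicator) auto
 also have "\<dots> = (\<integral>\<^sup>+x. indicator A (g x) \<partial>M)" by (subst nn_integral_distr) auto
 also have "\<dots> = emeasure M A" by (subst assms(2)) auto
 finally show "emeasure (distr M M g) A = emeasure M A" .
qed simp

locale torus =
 fixes l h :: real
 assumes l_pos: "l > 0" and h_pos: "h > 0"
begin

text \<open>Lebesgue measure of the rectangle, but carried by the Borel sets of the whole plane:
  measurability is plain Borel measurability, and functions may be composed with translations
  without leaving the space.\<close>

definition N :: "point measure" where "N = density lborel (indicator (Omega l h))"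

text \<open>Time runs over the whole line, so that every translation of space-time preserves the
  measure. Functions on (0,T) enter through their extension by zero.\<close>

definition M3 :: "(real \<times> point) measure" where "M3 = lborel \<Otimes>\<^sub>M N"

definition wrp :: "point => point" where "wrp x = (wrap1 (-l) (2*l) (fst x), wrap1 0 h (snd x))"

definition shf :: "point => point => point" where "shf z x = wrp (x + z)"

definition Shf :: "real \<times> point => real \<times> point => real \<times> point" where
 "Shf z p = (fst p + fst z, shf (snd z) (snd p))"

lemma Omega_open [simp]: "open (Omega l h)" unfolding Omega_def by (intro open_Times) auto

lemma Omega_sets [measurable]: "Omega l h \<in> sets borel" by simp

lemma Omega_bounded [simp]: "bounded (Omega l h)"
 unfolding Omega_def by (intro bounded_Times) auto

lemma sets_N [measurable_cong, simp]: "sets N = sets borel" by (simp add: N_def)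
lemma space_N [simp]: "space N = UNIV" by (simp add: N_def)
lemma sets_M3 [measurable_cong, simp]: "sets M3 = sets borel"
 unfolding M3_def borel_prod[symmetric, where 'a=real and 'b=point] by (intro sets_pair_measure_cong) auto
lemma space_M3 [simp]: "space M3 = UNIV" by (simp add: M3_def space_pair_measure)

lemma measurable_N [simp]: "measurable N = measurable borel" by (rule ext) (rule measurable_cong_sets; simp)
lemma measurable_M3 [simp]: "measurable M3 = measurable borel" by (rule ext) (rule measurable_cong_sets; simp)

lemma nn_integral_N:
 "f \<in> borel_measurable borel ==> (\<integral>\<^sup>+x. f x \<partial>N) = (\<integral>\<^sup>+x\<in>Omega l h. f x \<partial>lborel)"
 unfolding N_def by (subst nn_integral_density) (auto simp: mult.commute)

lemma emeasure_N: "A \<in> sets borel ==> emeasure N A = emeasure lborel (A \<inter> Omega l h)"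
 by (simp add: N_def emeasure_density Int_commute indicator_inter_arith[symmetric])

lemma finite_N: "finite_measure N"
proof
 have "emeasure N (space N) = emeasure lborel (Omega l h)" by (simp add: emeasure_N)
 also have "\<dots> < \<infinity>" by (rule emeasure_bounded_finite) simp
 finally show "emeasure N (space N) \<noteq> \<infinity>" by simp
qed

sublocale N: finite_measure N by (rule finite_N)
sublocale P: pair_sigma_finite lborel N ..
sublocale P2: pair_sigma_finite N lborel ..

lemma AE_N: "(AE x in N. P x) \<longleftrightarrow> (AE x\<in>Omega l h in lborel. P x)"
 unfolding N_def by (subst AE_density) (auto simp: indicator_def split: if_splits intro!: AE_cong)

lemma AE_N_Omega: "AE x in N. x \<in> Omega l h"
 by (simp add: AE_N)

lemma integral_N:
 fixes f :: "point => 'b::{banach, second_countable_topology}"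
 assumes "f \<in> borel_measurable borel"
 shows "integral\<^sup>L N f = (LINT x:Omega l h|lborel. f x)"
 unfolding N_def set_lebesgue_integral_def using assms
 by (subst integral_density[of f lborel "indicat_real (Omega l h)", symmetric]) (auto simp: ennreal_indicator)

lemma integrable_N:
 fixes f :: "point => 'b::{banach, second_countable_topology}"
 assumes "f \<in> borel_measurable borel"
 shows "integrable N f \<longleftrightarrow> set_integrable lborel (Omega l h) f"
 unfolding N_def set_integrable_def using assms
 by (subst integrable_density[of f lborel "indicat_real (Omega l h)", symmetric]) (auto simp: ennreal_indicator)

lemma wrp_measurable [measurable]: "wrp \<in> borel_measurable borel"
 unfolding wrp_def by (measurable)

lemma shf_measurable [measurable]: "shf z \<in> borel_measurable borel"
 unfolding shf_def by measurable

lemma Shf_measurable [measurable]: "Shf z \<in> borel_measurable borel"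
 unfolding Shf_def by measurable

lemma shf_measurable2 [measurable]: "(%p. shf (fst p) (snd p)) \<in> borel_measurable borel"
 unfolding shf_def by measurable

text \<open>The half-open intervals differ from the open rectangle by null lines. They are kept in
  the unsimplified form \<open>{a..<a + p}\<close>, to which \<open>nn_integral_wrap1\<close>
  applies in each variable.\<close>

lemma nn_integral_N_iter:
 assumes [measurable]: "f \<in> borel_measurable borel"
 shows "(\<integral>\<^sup>+x. f x \<partial>N) = (\<integral>\<^sup>+x1\<in>{-l..<-l + 2*l}. (\<integral>\<^sup>+x2\<in>{0..<0+h}. f (x1,x2) \<partial>lborel) \<partial>lborel)"
proof -
 have [measurable]: "f \<in> borel_measurable (borel \<Otimes>\<^sub>M borel)" by (simp add: borel_prod)
 have "(\<integral>\<^sup>+x. f x \<partial>N) = (\<integral>\<^sup>+x. f x * indicator (Omega l h) x \<partial>(lborel \<Otimes>\<^sub>M lborel))"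
  by (simp add: nn_integral_N lborel_prod)
 also have "\<dots> = (\<integral>\<^sup>+x1. (\<integral>\<^sup>+x2. f (x1,x2) * indicator (Omega l h) (x1,x2) \<partial>lborel) \<partial>lborel)"
  by (subst lborel.nn_integral_fst[symmetric]) (auto simp: lborel_prod)
 also have "\<dots> = (\<integral>\<^sup>+x1. (\<integral>\<^sup>+x2. f (x1,x2) * indicator {0..<0+h} x2 \<partial>lborel) * indicator {-l..<-l+2*l} x1 \<partial>lborel)"
 proof (rule nn_integral_cong_AE)
  show "AE x1 in lborel. (\<integral>\<^sup>+x2. f (x1,x2) * indicator (Omega l h) (x1,x2) \<partial>lborel) =
   (\<integral>\<^sup>+x2. f (x1,x2) * indicator {0..<0+h} x2 \<partial>lborel) * indicator {-l..<-l+2*l} x1"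
   using AE_lborel_singleton[of "-l"]
  proof eventually_elim
   fix x1 assume x1: "x1 \<noteq> -l"
   have "(\<integral>\<^sup>+x2. f (x1,x2) * indicator (Omega l h) (x1,x2) \<partial>lborel) =
    (\<integral>\<^sup>+x2. f (x1,x2) * indicator {0..<0+h} x2 * indicator {-l..<-l+2*l} x1 \<partial>lborel)"
    by (rule nn_integral_cong_AE, use AE_lborel_singleton[of 0] in eventually_elim)
     (use x1 in \<open>auto simp: indicator_def Omega_def\<close>)
   then show "(\<integral>\<^sup>+x2. f (x1,x2) * indicator (Omega l h) (x1,x2) \<partial>lborel) =
   (\<integral>\<^sup>+x2. f (x1,x2) * indicator {0..<0+h} x2 \<partial>lborel) * indicator {-l..<-l+2*l} x1"
    by (simp add: nn_integral_multc)
  qed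
 qed
 finally show ?thesis .
qed

lemma nn_integral_shf:
 assumes [measurable]: "f \<in> borel_measurable borel"
 shows "(\<integral>\<^sup>+x. f (shf z x) \<partial>N) = (\<integral>\<^sup>+x. f x \<partial>N)"
proof -
 have p: "2 * l > 0" using l_pos by simp
 have [measurable]: "f \<in> borel_measurable (borel \<Otimes>\<^sub>M borel)" by (simp add: borel_prod)
 have "(\<integral>\<^sup>+x. f (shf z x) \<partial>N) = (\<integral>\<^sup>+x1\<in>{-l..<-l + 2*l}. (\<integral>\<^sup>+x2\<in>{0..<0+h}. f (wrap1 (-l) (2*l) (x1 + fst z), wrap1 0 h (x2 + snd z)) \<partial>lborel) \<partial>lborel)"
  by (subst nn_integral_N_iter) (auto simp: shf_def wrp_def)
 also have "\<dots> = (\<integral>\<^sup>+x1\<in>{-l..<-l + 2*l}. (\<integral>\<^sup>+x2\<in>{0..<0+h}. f (wrap1 (-l) (2*l) (x1 + fst z), x2) \<partial>lborel) \<partial>lborel)"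
  by (intro nn_integral_cong arg_cong2[where f="(*)"] refl nn_integral_wrap1 h_pos) auto
 also have "\<dots> = (\<integral>\<^sup>+x1\<in>{-l..<-l + 2*l}. (\<integral>\<^sup>+x2\<in>{0..<0+h}. f (x1, x2) \<partial>lborel) \<partial>lborel)"
 proof (rule nn_integral_wrap1[where f="%x1. (\<integral>\<^sup>+x2\<in>{0..<0+h}. f (x1, x2) \<partial>lborel)"])
  have "f \<in> borel_measurable (borel \<Otimes>\<^sub>M lborel)"
   using assms by (simp add: borel_prod[symmetric] cong: measurable_cong_sets sets_pair_measure_cong)
  moreover have "(%p. indicator {0..<0+h} (snd p) :: ennreal) \<in> borel_measurable (borel \<Otimes>\<^sub>M lborel)"
   by (intro measurable_compose[OF measurable_snd]) auto
  ultimately have "(%(x1, x2). f (x1, x2) * indicator {0..<0+h} x2) \<in> borel_measurable (borel \<Otimes>\<^sub>M lborel)"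
   unfolding split_beta prod.collapse by (rule borel_measurable_times_ennreal)
  then show "(%x1. (\<integral>\<^sup>+x2\<in>{0..<0+h}. f (x1, x2) \<partial>lborel)) \<in> borel_measurable borel"
   by (rule lborel.borel_measurable_nn_integral)
 qed (rule p)
 also have "\<dots> = (\<integral>\<^sup>+x. f x \<partial>N)" by (subst nn_integral_N_iter) auto
 finally show ?thesis .
qed

lemma distr_shf: "distr N N (shf z) = N"
 by (rule distr_preserving) (auto simp: nn_integral_shf)

lemma nn_integral_Shf:
 assumes [measurable]: "f \<in> borel_measurable borel"
 shows "(\<integral>\<^sup>+x. f (Shf z x) \<partial>M3) = (\<integral>\<^sup>+x. f x \<partial>M3)"
proof -
 have [measurable]: "f \<in> borel_measurable (borel \<Otimes>\<^sub>M borel)" by (simp add: borel_prod)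
 have m[measurable]: "f \<in> borel_measurable (lborel \<Otimes>\<^sub>M N)" using assms by (simp add: M3_def[symmetric])
 have "(\<integral>\<^sup>+x. f (Shf z x) \<partial>M3) = (\<integral>\<^sup>+t. (\<integral>\<^sup>+x. f (t + fst z, shf (snd z) x) \<partial>N) \<partial>lborel)"
  unfolding M3_def by (subst N.nn_integral_fst[symmetric]) (auto simp: Shf_def M3_def[symmetric])
 also have "\<dots> = (\<integral>\<^sup>+t. (\<integral>\<^sup>+x. f (t + fst z, x) \<partial>N) \<partial>lborel)"
  by (intro nn_integral_cong nn_integral_shf) auto
 also have "\<dots> = (\<integral>\<^sup>+t. (\<integral>\<^sup>+x. f (t, x) \<partial>N) \<partial>lborel)"
  by (subst (2) nn_integral_real_affine[where c=1 and t="fst z"]) (auto simp: add.commute)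
 also have "\<dots> = (\<integral>\<^sup>+x. f x \<partial>M3)" unfolding M3_def by (subst N.nn_integral_fst) auto
 finally show ?thesis .
qed

lemma distr_Shf: "distr M3 M3 (Shf z) = M3"
 by (rule distr_preserving) (auto simp: nn_integral_Shf)

lemma AE_shf: "AE x in N. P x ==> AE x in N. P (shf z x)"
 by (rule AE_distrD[of "shf z" N N]) (simp, simp only: distr_shf)

lemma AE_Shf: "AE x in M3. P x ==> AE x in M3. P (Shf z x)"
 by (rule AE_distrD[of "Shf z" M3 M3]) (simp, simp only: distr_Shf)

lemma integral_shf:
 fixes f :: "point => 'b::{banach, second_countable_topology}"
 assumes [measurable]: "f \<in> borel_measurable borel"
 shows "(LINT x|N. f (shf z x)) = (LINT x|N. f x)"
 using integral_distr[of "shf z" N N f] by (simp add: distr_shf)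

lemma integrable_shf:
 fixes f :: "point => 'b::{banach, second_countable_topology}"
 assumes "f \<in> borel_measurable borel"
 shows "integrable N (%x. f (shf z x)) \<longleftrightarrow> integrable N f"
 using integrable_distr_eq[of "shf z" N N f] assms by (simp add: distr_shf)

lemma integral_Shf:
 fixes f :: "real \<times> point => 'b::{banach, second_countable_topology}"
 assumes [measurable]: "f \<in> borel_measurable borel"
 shows "(LINT x|M3. f (Shf z x)) = (LINT x|M3. f x)"
 using integral_distr[of "Shf z" M3 M3 f] by (simp add: distr_Shf)

lemma integrable_Shf:
 fixes f :: "real \<times> point => 'b::{banach, second_countable_topology}"
 assumes "f \<in> borel_measurable borel"
 shows "integrable M3 (%x. f (Shf z x)) \<longleftrightarrow> integrable M3 f"
 using integrable_distr_eq[of "Shf z" M3 M3 f] assms by (simp add: distr_Shf)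

end

section \<open>Square integrable functions\<close>

definition sqint :: "'a measure => ('a => real) => bool" where
 "sqint M f \<longleftrightarrow> f \<in> borel_measurable M \<and> integrable M (%x. (f x)^2)"

lemma sqint_measurable [measurable_dest]: "sqint M f ==> f \<in> borel_measurable M"
 by (simp add: sqint_def)

lemma sqint_mult:
 assumes f: "sqint M f" and g: "sqint M g"
 shows "integrable M (%x. f x * g x)"
proof (rule Bochner_Integration.integrable_bound[of M "%x. (f x)^2 + (g x)^2"])
 note [measurable] = sqint_measurable[OF f] sqint_measurable[OF g]
 show "(%x. f x * g x) \<in> borel_measurable M" by measurable
 have "\<bar>a * b\<bar> \<le> a^2 + b^2" for a b :: real
  using sum_squares_bound[of "\<bar>a\<bar>" "\<bar>b\<bar>"] zero_le_power2[of a] zero_le_power2[of b]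
  unfolding abs_mult power2_abs by linarith
 then show "AE x in M. norm (f x * g x) \<le> norm ((f x)^2 + (g x)^2)" by auto
qed (use assms in \<open>auto simp: sqint_def\<close>)

lemma sqint_bound:
 assumes f: "sqint M f" and [measurable]: "g \<in> borel_measurable M" and le: "AE x in M. \<bar>g x\<bar> \<le> C * \<bar>f x\<bar>"
 shows "sqint M g"
 unfolding sqint_def
proof
 show "integrable M (%x. (g x)^2)"
 proof (rule Bochner_Integration.integrable_bound[of M "%x. C^2 * (f x)^2"])
  show "AE x in M. norm ((g x)^2) \<le> norm (C^2 * (f x)^2)"
   using le
  proof eventually_elim
   case (elim x)
   then have "\<bar>g x\<bar>^2 \<le> (C * \<bar>f x\<bar>)^2" by (intro power_mono) auto
   then show ?case by (simp add: power_mult_distrib)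
  qed
 qed (use f in \<open>auto simp: sqint_def\<close>)
qed fact

lemma sqint_bounded_mult:
 assumes f: "sqint M f" and [measurable]: "g \<in> borel_measurable M" and le: "\<And>x. \<bar>g x\<bar> \<le> C"
 shows "sqint M (%x. g x * f x)"
proof -
 note [measurable] = sqint_measurable[OF f]
 show ?thesis
 by (rule sqint_bound[OF f, of _ C]) (auto simp: abs_mult intro!: mult_right_mono le)
qed

lemma sqint_add:
 assumes f: "sqint M f" and g: "sqint M g"
 shows "sqint M (%x. f x + g x)"
proof -
 note [measurable] = sqint_measurable[OF f] sqint_measurable[OF g]
 have "(%x. (f x + g x)^2) = (%x. (f x)^2 + (g x)^2 + 2 * (f x * g x))" by (auto simp: power2_sum)
 moreover have "integrable M \<dots>"
  using f g sqint_mult[OF f g] by (auto simp: sqint_def)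
 ultimately show ?thesis by (auto simp: sqint_def)
qed

lemma sqint_cmult: "sqint M f ==> sqint M (%x. c * f x)"
 by (auto simp: sqint_def power_mult_distrib)

lemma sqint_diff: "sqint M f ==> sqint M g ==> sqint M (%x. f x - g x)"
 using sqint_add[of M f "%x. (-1) * g x"] sqint_cmult[of M g "-1"] by simp

lemma sqint_finite_imp_integrable:
 assumes "finite_measure M" "sqint M f" shows "integrable M f"
proof -
 interpret finite_measure M by fact
 have "sqint M (%x. 1)" by (simp add: sqint_def)
 from sqint_mult[OF assms(2) this] show ?thesis by simp
qed

text \<open>This weighted form takes the place of Cauchy-Schwarz for pairings: no square roots
  occur, and limit arguments reduce to a choice of \<open>e\<close>.\<close>

lemma sqint_Young:
 assumes f: "sqint M f" and g: "sqint M g" and "e > 0"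
 shows "\<bar>LINT x|M. f x * g x\<bar> \<le> e * (LINT x|M. (f x)^2) + (LINT x|M. (g x)^2) / e"
proof -
 have "\<bar>LINT x|M. f x * g x\<bar> \<le> (LINT x|M. \<bar>f x * g x\<bar>)" by (rule integral_abs_bound)
 also have "\<dots> \<le> (LINT x|M. e * (f x)^2 + (g x)^2 / e)"
 proof (rule integral_mono)
  show "integrable M (%x. \<bar>f x * g x\<bar>)" using sqint_mult[OF f g] by simp
  show "integrable M (%x. e * (f x)^2 + (g x)^2 / e)" using f g by (auto simp: sqint_def)
  fix x
  have "2 * \<bar>f x\<bar> * \<bar>g x\<bar> \<le> e * (f x)^2 + (g x)^2 / e"
  proof -
   have "0 \<le> (e * \<bar>f x\<bar> - \<bar>g x\<bar>)^2" by simp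
   then have "2 * (e * (\<bar>f x\<bar> * \<bar>g x\<bar>)) \<le> e^2 * (f x)^2 + (g x)^2"
    by (simp add: power2_diff power_mult_distrib algebra_simps)
   then have "2 * (e * (\<bar>f x\<bar> * \<bar>g x\<bar>)) / e \<le> (e^2 * (f x)^2 + (g x)^2) / e" using \<open>e > 0\<close> by (intro divide_right_mono) auto
   then show ?thesis using \<open>e > 0\<close> by (simp add: add_divide_distrib power2_eq_square)
  qed
  moreover have "0 \<le> \<bar>f x\<bar> * \<bar>g x\<bar>" by simp
  ultimately show "\<bar>f x * g x\<bar> \<le> e * (f x)^2 + (g x)^2 / e" unfolding abs_mult by linarith
 qed
 also have "\<dots> = e * (LINT x|M. (f x)^2) + (LINT x|M. (g x)^2) / e"
  using f g by (subst Bochner_Integration.integral_add) (auto simp: sqint_def)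
 finally show ?thesis .
qed

lemma LIMSEQ_0_less:
 fixes X :: "nat => real"
 assumes "X \<longlonglongrightarrow> 0" "r > 0" obtains n0 where "\<And>n. n \<ge> n0 ==> X n < r"
 using order_tendstoD(2)[OF assms] by (auto simp: eventually_sequentially)

text \<open>With the weight in Young's inequality chosen first, the share of \<open>a\<close> is
  below r/2; the share of \<open>f n\<close> then tends to zero with that weight fixed. The summand
  1 in \<open>A + 1\<close> covers A = 0.\<close>

lemma sqint_weak_limit:
 assumes a: "sqint M a" and f: "\<And>n. sqint M (f n)"
  and lim: "(%n. LINT x|M. (f n x)^2) \<longlonglongrightarrow> 0"
 shows "(%n. LINT x|M. a x * f n x) \<longlonglongrightarrow> 0"
proof (rule LIMSEQ_I)
 fix r :: real assume r: "r > 0"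
 define A where "A = (LINT x|M. (a x)^2)"
 have A: "A \<ge> 0" by (simp add: A_def)
 define e where "e = r / (2 * (A + 1))"
 have e: "e > 0" using r A by (simp add: e_def)
 have eA: "e * A < r/2"
 proof -
  have "e * A < e * (A + 1)" using e by simp
  also have "\<dots> = r / 2" using A by (simp add: e_def field_simps)
  finally show ?thesis .
 qed
 have "eventually (%n. (LINT x|M. (f n x)^2) < e * (r/2)) sequentially"
  using e r by (intro order_tendstoD(2)[OF lim]) auto
 then obtain n0 where n0: "\<And>n. n \<ge> n0 ==> (LINT x|M. (f n x)^2) < e * (r/2)"
  by (auto simp: eventually_sequentially)
 have "\<bar>LINT x|M. a x * f n x\<bar> < r" if "n \<ge> n0" for n
 proof -
  have "\<bar>LINT x|M. a x * f n x\<bar> \<le> e * A + (LINT x|M. (f n x)^2) / e"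
   unfolding A_def by (rule sqint_Young[OF a f e])
  moreover have "(LINT x|M. (f n x)^2) / e < r/2" using n0[OF that] e by (simp add: field_simps)
  ultimately show ?thesis using eA by linarith
 qed
 then show "\<exists>no. \<forall>n\<ge>no. norm ((LINT x|M. a x * f n x) - 0) < r" by auto
qed

section \<open>Fubini's theorem and continuity of translations in the mean\<close>

context torus begin

lemma nn_integral_M3:
 assumes [measurable]: "f \<in> borel_measurable borel"
 shows "(\<integral>\<^sup>+p. f p \<partial>M3) = (\<integral>\<^sup>+t. (\<integral>\<^sup>+x. f (t, x) \<partial>N) \<partial>lborel)"
proof -
 have [measurable]: "f \<in> borel_measurable (lborel \<Otimes>\<^sub>M N)" using assms by (simp add: M3_def[symmetric])
 show ?thesis unfolding M3_def by (subst N.nn_integral_fst) auto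
qed

lemma AE_M3_fst: "AE p in M3. P p ==> AE t in lborel. AE x in N. P (t, x)"
 unfolding M3_def by (rule P.AE_pair)

lemma pred_M3:
 fixes P :: "real \<times> point => bool"
 shows "Measurable.pred borel P ==> {p \<in> space (lborel \<Otimes>\<^sub>M N). P p} \<in> sets (lborel \<Otimes>\<^sub>M N)"
proof -
 assume "Measurable.pred borel P"
 then have "{p \<in> space M3. P p} \<in> sets M3" by (simp add: pred_def)
 then show ?thesis unfolding M3_def .
qed

lemma AE_M3_I:
 fixes P :: "real \<times> point => bool"
 assumes "Measurable.pred borel P" "AE t in lborel. AE x in N. P (t, x)"
 shows "AE p in M3. P p"
 unfolding M3_def by (rule P.AE_pair_measure[OF pred_M3]) fact+

lemma AE_M3_commute:
 fixes P :: "real => point => bool"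
 assumes "Measurable.pred borel (%p. P (fst p) (snd p))"
 shows "(AE t in lborel. AE x in N. P t x) \<longleftrightarrow> (AE x in N. AE t in lborel. P t x)"
 by (rule P.AE_commute[OF pred_M3[OF assms]])

lemma AE_M3_I2:
 fixes P :: "real \<times> point => bool"
 assumes "Measurable.pred borel P" "AE x in N. AE t in lborel. P (t, x)"
 shows "AE p in M3. P p"
 by (rule AE_M3_I[OF assms(1)]) (use AE_M3_commute[of "%t x. P (t,x)"] assms in simp)

lemma integral_M3:
 fixes f :: "real \<times> point => real"
 assumes "integrable M3 f"
 shows "(LINT p|M3. f p) = (LINT t|lborel. (LINT x|N. f (t, x)))"
  and "(LINT p|M3. f p) = (LINT x|N. (LINT t|lborel. f (t, x)))"
  and "AE t in lborel. integrable N (%x. f (t, x))"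
  and "AE x in N. integrable lborel (%t. f (t, x))"
  and "integrable lborel (%t. LINT x|N. f (t, x))"
  and "integrable N (%x. LINT t|lborel. f (t, x))"
proof -
 have f: "integrable (lborel \<Otimes>\<^sub>M N) f" "integrable (lborel \<Otimes>\<^sub>M N) (case_prod (%t x. f (t, x)))"
  using assms by (simp_all add: M3_def)
 show "(LINT p|M3. f p) = (LINT t|lborel. (LINT x|N. f (t, x)))"
  unfolding M3_def by (rule P.integral_fst'[OF f(1), symmetric])
 show "(LINT p|M3. f p) = (LINT x|N. (LINT t|lborel. f (t, x)))"
  using P.integral_snd[OF f(2)] by (simp add: M3_def)
 show "AE t in lborel. integrable N (%x. f (t, x))" by (rule P.AE_integrable_fst'[OF f(1)])
 show "AE x in N. integrable lborel (%t. f (t, x))" by (rule P.AE_integrable_snd[OF f(2)])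
 show "integrable lborel (%t. LINT x|N. f (t, x))" by (rule P.integrable_fst'[OF f(1)])
 show "integrable N (%x. LINT t|lborel. f (t, x))" by (rule P.integrable_snd[OF f(2)])
qed

lemma emeasure_M3:
 assumes A: "A \<in> sets borel"
 shows "emeasure M3 A = emeasure lborel (A \<inter> (UNIV \<times> Omega l h))"
proof -
 let ?O = "UNIV \<times> Omega l h :: (real \<times> point) set"
 have O: "?O \<in> sets borel" by (intro borel_open open_Times) auto
 have [measurable]: "A \<inter> ?O \<in> sets (lborel \<Otimes>\<^sub>M lborel)"
  unfolding lborel_prod sets_lborel using A O by (rule sets.Int)
 have "emeasure M3 A = (\<integral>\<^sup>+t. (\<integral>\<^sup>+x. indicator A (t, x) \<partial>N) \<partial>lborel)"
  using A by (subst nn_integral_M3[symmetric]) auto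
 also have "\<dots> = (\<integral>\<^sup>+t. (\<integral>\<^sup>+x. indicator (A \<inter> ?O) (t, x) \<partial>lborel) \<partial>lborel)"
 proof (rule nn_integral_cong)
  fix t :: real
  have "(%x. indicator A (t, x) :: ennreal) \<in> borel_measurable borel"
   using A by (intro measurable_compose[OF _ borel_measurable_indicator[OF A]]) auto
  then show "(\<integral>\<^sup>+x. indicator A (t, x) \<partial>N) = (\<integral>\<^sup>+x. indicator (A \<inter> ?O) (t, x) \<partial>lborel)"
   by (subst nn_integral_N) (auto intro!: nn_integral_cong simp: indicator_def)
 qed
 also have "\<dots> = (\<integral>\<^sup>+p. indicator (A \<inter> ?O) p \<partial>(lborel \<Otimes>\<^sub>M lborel))"
  by (subst lborel.nn_integral_fst) auto
 also have "\<dots> = emeasure lborel (A \<inter> ?O)" using A O by (simp add: lborel_prod)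
 finally show ?thesis .
qed

lemma wrp_id: "x \<in> Omega l h ==> wrp x = x"
 by (auto simp: wrp_def Omega_def wrap1_id)

lemma shf_eq: "x + z \<in> Omega l h ==> shf z x = x + z"
 by (simp add: shf_def wrp_id)

lemma Shf_eventually:
 assumes x: "snd p \<in> Omega l h" and z: "z \<longlonglongrightarrow> 0"
 shows "eventually (%n. Shf (z n) p = p + z n) sequentially"
proof -
 have "(%n. snd p + snd (z n)) \<longlonglongrightarrow> snd p + snd (0 :: real \<times> point)"
  by (intro tendsto_intros z)
 then have "(%n. snd p + snd (z n)) \<longlonglongrightarrow> snd p" by simp
 then have "eventually (%n. snd p + snd (z n) \<in> Omega l h) sequentially"
  using x by (rule topological_tendstoD[OF _ Omega_open])
 then show ?thesis by eventually_elim (auto simp: Shf_def shf_eq prod_eq_iff)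
qed

lemma AE_M3_Omega: "AE p in M3. snd p \<in> Omega l h"
 by (rule AE_M3_I) (auto intro: AE_N_Omega)

text \<open>A point of an open set stays in it under small shifts, so the product of the two
  indicators converges to the indicator and is dominated by it. The absolute difference is the sum
  of the two indicators minus twice their product, and the shifted one has the same
  integral.\<close>

lemma L1_shift_open:
 assumes U: "open U" "U \<subseteq> UNIV \<times> Omega l h" and fin: "emeasure M3 U < \<infinity>" and z: "z \<longlonglongrightarrow> 0"
 shows "(%n. LINT p|M3. \<bar>indicator U (Shf (z n) p) - indicator U p\<bar>) \<longlonglongrightarrow> (0::real)"
proof -
 have [measurable]: "U \<in> sets borel" using U by simp
 have iU: "integrable M3 (%p. indicator U p :: real)" using fin by (auto simp: integrable_indicator_iff)
 have iUs: "integrable M3 (%p. indicator U (Shf (z n) p) :: real)" for n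
  using iU by (subst integrable_Shf) auto
 have iP: "integrable M3 (%p. indicator U p * indicator U (Shf (z n) p) :: real)" for n
  by (rule Bochner_Integration.integrable_bound[OF iU]) (auto simp: indicator_def)
 have "(%n. LINT p|M3. indicator U p * indicator U (Shf (z n) p)) \<longlonglongrightarrow> (\<integral>p. indicator U p \<partial>M3 :: real)"
 proof (rule integral_dominated_convergence[where w="%p. indicator U p"])
  show "AE p in M3. (%n. indicator U p * indicator U (Shf (z n) p)) \<longlonglongrightarrow> (indicator U p :: real)"
  proof (rule AE_I2)
   fix p
   show "(%n. indicator U p * indicator U (Shf (z n) p)) \<longlonglongrightarrow> (indicator U p :: real)"
   proof (cases "p \<in> U")
    case True
    then have "snd p \<in> Omega l h" using U by auto
    from Shf_eventually[OF this z] have 1: "eventually (%n. Shf (z n) p = p + z n) sequentially" .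
    have "(%n. p + z n) \<longlonglongrightarrow> p + 0" by (intro tendsto_intros z)
    then have "eventually (%n. p + z n \<in> U) sequentially"
     using True U(1) by (intro topological_tendstoD) auto
    with 1 have "eventually (%n. (indicator U p * indicator U (Shf (z n) p)) = (indicator U p :: real)) sequentially"
     by eventually_elim (auto simp: True)
    then show ?thesis by (rule tendsto_eventually)
   qed simp
  qed
  show "AE p in M3. norm (indicator U p * indicator U (Shf (z n) p) :: real) \<le> indicator U p" for n
   by (auto simp: indicator_def)
 qed (use iU in auto)
 then have "(%n. 2 * (LINT p|M3. indicator U p) - 2 * (LINT p|M3. indicator U p * indicator U (Shf (z n) p))) \<longlonglongrightarrow>
  2 * (LINT p|M3. indicator U p) - 2 * (\<integral>p. indicator U p \<partial>M3 :: real)"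
  by (intro tendsto_intros)
 moreover have "(LINT p|M3. \<bar>indicator U (Shf (z n) p) - indicator U p\<bar>) =
  2 * (LINT p|M3. indicator U p) - 2 * (\<integral>p. indicator U p * indicator U (Shf (z n) p) \<partial>M3 :: real)" for n
 proof -
  have "(LINT p|M3. \<bar>indicator U (Shf (z n) p) - indicator U p\<bar>) =
   (\<integral>p. indicator U (Shf (z n) p) + indicator U p - 2 * (indicator U p * indicator U (Shf (z n) p)) \<partial>M3 :: real)"
   by (intro Bochner_Integration.integral_cong) (auto simp: indicator_def)
  also have "\<dots> = (LINT p|M3. indicator U (Shf (z n) p)) + (LINT p|M3. indicator U p) - 2 * (\<integral>p. indicator U p * indicator U (Shf (z n) p) \<partial>M3 :: real)"
   using iU iUs iP by (subst Bochner_Integration.integral_diff, simp, simp, subst Bochner_Integration.integral_add) auto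
  also have "(LINT p|M3. indicator U (Shf (z n) p)) = (\<integral>p. indicator U p \<partial>M3 :: real)"
   by (rule integral_Shf) auto
  finally show ?thesis by simp
 qed
 ultimately show ?thesis by simp
qed

text \<open>Outer regularity encloses the set in an open one with small excess. The excess enters
  twice, at a point and at its translate, with equal measure since translations preserve
  \<open>M3\<close>. The open set is cut with the cylinder over the rectangle, which carries
  \<open>M3\<close>.\<close>

lemma L1_shift_set:
 assumes A [measurable]: "A \<in> sets borel" and fin: "emeasure M3 A < \<infinity>" and z: "z \<longlonglongrightarrow> 0"
 shows "(%n. LINT p|M3. \<bar>indicator A (Shf (z n) p) - indicator A p\<bar>) \<longlonglongrightarrow> (0::real)"
proof (rule LIMSEQ_I)
 fix r :: real assume r: "r > 0"
 let ?O = "UNIV \<times> Omega l h :: (real \<times> point) set"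
 have oO: "open ?O" by (intro open_Times) auto
 then have O[measurable]: "?O \<in> sets borel" by simp
 obtain V where V: "open V" "A \<inter> ?O \<subseteq> V" "emeasure lborel (V - A \<inter> ?O) < ennreal (r/4)"
  using outer_regular_lborel[of "A \<inter> ?O" "r/4"] A O r by (metis sets.Int zero_less_divide_iff zero_less_numeral)
 define U where "U = V \<inter> ?O"
 have U: "open U" "U \<subseteq> ?O" "A \<inter> ?O \<subseteq> U" using V oO by (auto simp: U_def)
 have [measurable]: "U \<in> sets borel" using U by simp
 have UA: "emeasure M3 (U - A) < ennreal (r/4)"
 proof -
  have "emeasure M3 (U - A) = emeasure lborel ((U - A) \<inter> ?O)" by (rule emeasure_M3) auto
  also have "\<dots> \<le> emeasure lborel (V - A \<inter> ?O)"
   using V(1) A O by (intro emeasure_mono) (auto simp: U_def)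
  finally show ?thesis using V(3) by simp
 qed
 then have iD: "integrable M3 (%p. indicator (U - A) p :: real)"
  by (auto simp: integrable_indicator_iff intro: less_trans)
 have iA: "integrable M3 (%p. indicator A p :: real)" using fin by (auto simp: integrable_indicator_iff)
 have AU: "AE p in M3. (indicator U p :: real) = indicator A p + indicator (U - A) p"
  using AE_M3_Omega by eventually_elim (use U in \<open>auto simp: indicator_def\<close>)
 have iU: "integrable M3 (%p. indicator U p :: real)"
  using AU iA iD by (subst integrable_cong_AE[where g="%p. indicator A p + indicator (U - A) p"]) auto
 then have fU: "emeasure M3 U < \<infinity>" by (auto simp: integrable_indicator_iff)
 obtain n0 where n0: "\<And>n. n \<ge> n0 ==> (LINT p|M3. \<bar>indicator U (Shf (z n) p) - indicator U p\<bar>) < r/4"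
  by (rule LIMSEQ_0_less[OF L1_shift_open[OF U(1,2) fU z], of "r/4"]) (use r in auto)
 have D: "(LINT p|M3. indicator (U - A) p) < r/4"
 proof -
  have "ennreal (LINT p|M3. indicator (U - A) p) = emeasure M3 (U - A)"
   using UA by (simp add: emeasure_eq_ennreal_measure top.not_eq_extremum) (metis UA emeasure_eq_ennreal_measure ennreal_less_top order_less_trans top.not_eq_extremum)
  then have "ennreal (LINT p|M3. indicator (U - A) p) < ennreal (r/4)" using UA by (simp only:)
  then show ?thesis by (rule ennreal_less_iff[THEN iffD1, rotated]) simp
 qed
 have "(LINT p|M3. \<bar>indicator A (Shf (z n) p) - indicator A p\<bar>) < r" if "n \<ge> n0" for n
 proof -
  let ?S = "Shf (z n)"
  have s: "integrable M3 (%p. indicator B (?S p) :: real)" if "integrable M3 (%p. indicator B p :: real)" "B \<in> sets borel" for B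
   using that by (subst integrable_Shf) auto
  have "(LINT p|M3. \<bar>indicator A (?S p) - indicator A p :: real\<bar>) \<le>
   (LINT p|M3. \<bar>indicator U (?S p) - indicator U p\<bar> + indicator (U - A) (?S p) + indicator (U - A) p)"
  proof (rule integral_mono_AE)
   show "AE p in M3. \<bar>indicator A (?S p) - indicator A p\<bar> \<le>
    \<bar>indicator U (?S p) - indicator U p\<bar> + indicator (U - A) (?S p) + (indicator (U - A) p :: real)"
    using AU AE_Shf[OF AU, of "z n"]
   proof eventually_elim
    case (elim p)
    have "\<bar>a - b\<bar> \<le> \<bar>a + u - (b + v)\<bar> + u + v" if "0 \<le> u" "0 \<le> v" for a b u v :: real
     using that by linarith
    then show ?case unfolding elim by (simp add: indicator_pos_le)
   qed
   show "integrable M3 (%p. \<bar>indicator A (?S p) - indicator A p :: real\<bar>)" using s[OF iA] iA by auto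
   show "integrable M3 (%p. \<bar>indicator U (?S p) - indicator U p\<bar> + indicator (U - A) (?S p) + (indicator (U - A) p :: real))"
    using s[OF iU] iU s[OF iD] iD by (intro Bochner_Integration.integrable_add) auto
  qed
  also have "\<dots> = (LINT p|M3. \<bar>indicator U (?S p) - indicator U p\<bar>) + (LINT p|M3. indicator (U - A) (?S p)) + (LINT p|M3. indicator (U - A) p)"
   using s[OF iU] iU s[OF iD] iD by (subst Bochner_Integration.integral_add, auto)+
  also have "(LINT p|M3. indicator (U - A) (?S p)) = (\<integral>p. indicator (U - A) p \<partial>M3 :: real)"
   by (rule integral_Shf) auto
  finally show ?thesis using n0[OF that] D r by simp
 qed
 then show "\<exists>no. \<forall>n\<ge>no. norm ((LINT p|M3. \<bar>indicator A (Shf (z n) p) - indicator A p :: real\<bar>) - 0) < r"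
  by (auto intro!: exI[of _ n0])
qed

lemma L1_shift:
 fixes f :: "real \<times> point => real"
 assumes "integrable M3 f" and z: "z \<longlonglongrightarrow> 0"
 shows "(%n. LINT p|M3. \<bar>f (Shf (z n) p) - f p\<bar>) \<longlonglongrightarrow> 0"
 using assms(1)
proof (induction rule: integrable_induct)
 case (base A c)
 have "(%n. \<bar>c\<bar> * (LINT p|M3. \<bar>indicator A (Shf (z n) p) - indicator A p\<bar>)) \<longlonglongrightarrow> \<bar>c\<bar> * 0"
  using base z by (intro tendsto_intros L1_shift_set) auto
 moreover have "(LINT p|M3. \<bar>indicat_real A (Shf (z n) p) *\<^sub>R c - indicat_real A p *\<^sub>R c\<bar>) =
   \<bar>c\<bar> * (LINT p|M3. \<bar>indicator A (Shf (z n) p) - indicator A p\<bar>)" for n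
  by (subst integral_mult_right_zero[symmetric], rule Bochner_Integration.integral_cong)
   (auto simp: abs_mult[symmetric] algebra_simps)
 ultimately show ?case by simp
next
 case (add f g)
 have [measurable]: "f \<in> borel_measurable borel" "g \<in> borel_measurable borel" using add by (auto dest: borel_measurable_integrable)
 have "(%n. (LINT p|M3. \<bar>f (Shf (z n) p) - f p\<bar>) + (LINT p|M3. \<bar>g (Shf (z n) p) - g p\<bar>)) \<longlonglongrightarrow> 0 + 0"
  using add by (intro tendsto_intros) auto
 then have lim: "(%n. (LINT p|M3. \<bar>f (Shf (z n) p) - f p\<bar>) + (LINT p|M3. \<bar>g (Shf (z n) p) - g p\<bar>)) \<longlonglongrightarrow> 0" by simp
 show ?case
 proof (rule tendsto_sandwich[OF _ _ tendsto_const lim])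
  have i: "integrable M3 (%p. f (Shf (z n) p))" "integrable M3 (%p. g (Shf (z n) p))" for n
   using add by (subst integrable_Shf; auto)+
  show "\<forall>\<^sub>F n in sequentially. (LINT p|M3. \<bar>f (Shf (z n) p) + g (Shf (z n) p) - (f p + g p)\<bar>) \<le>
   (LINT p|M3. \<bar>f (Shf (z n) p) - f p\<bar>) + (LINT p|M3. \<bar>g (Shf (z n) p) - g p\<bar>)"
  proof (intro always_eventually allI)
   fix n
   have "(LINT p|M3. \<bar>f (Shf (z n) p) + g (Shf (z n) p) - (f p + g p)\<bar>) \<le>
    (LINT p|M3. \<bar>f (Shf (z n) p) - f p\<bar> + \<bar>g (Shf (z n) p) - g p\<bar>)"
    using add i by (intro integral_mono) auto
   also have "\<dots> = (LINT p|M3. \<bar>f (Shf (z n) p) - f p\<bar>) + (LINT p|M3. \<bar>g (Shf (z n) p) - g p\<bar>)"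
    using add i by (intro Bochner_Integration.integral_add) auto
   finally show "(LINT p|M3. \<bar>f (Shf (z n) p) + g (Shf (z n) p) - (f p + g p)\<bar>) \<le>
   (LINT p|M3. \<bar>f (Shf (z n) p) - f p\<bar>) + (LINT p|M3. \<bar>g (Shf (z n) p) - g p\<bar>)" .
  qed
 qed auto
next
 case (lim f s)
 have ms[measurable]: "f \<in> borel_measurable borel" "s i \<in> borel_measurable borel" for i using lim by (auto dest: borel_measurable_integrable)
 \<comment> \<open>The approximating simple functions satisfy |s i| \<le> 2 |f|, whence the
   dominating function 3 |f|.\<close>
 have L: "(%i. LINT p|M3. \<bar>s i p - f p\<bar>) \<longlonglongrightarrow> (LINT p|M3. 0)"
 proof (rule integral_dominated_convergence[where w="%p. 3 * \<bar>f p\<bar>"])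
  show "AE p in M3. (%i. \<bar>s i p - f p\<bar>) \<longlonglongrightarrow> 0"
  proof (rule AE_I2)
   fix p
   have "(%i. s i p) \<longlonglongrightarrow> f p" using lim by auto
   then show "(%i. \<bar>s i p - f p\<bar>) \<longlonglongrightarrow> 0" by (simp add: LIM_zero_iff tendsto_rabs_zero_iff)
  qed
  show "AE p in M3. norm \<bar>s i p - f p\<bar> \<le> 3 * \<bar>f p\<bar>" for i
  proof (rule AE_I2)
   fix p have "norm (s i p) \<le> 2 * norm (f p)" using lim by auto
   then show "norm \<bar>s i p - f p\<bar> \<le> 3 * \<bar>f p\<bar>" by simp
  qed
 qed (use lim in auto)
 show ?case
 proof (rule LIMSEQ_I)
  fix r :: real assume r: "r > 0"
  from L have L0: "(%i. LINT p|M3. \<bar>s i p - f p\<bar>) \<longlonglongrightarrow> 0" by simp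
  obtain i where i: "(LINT p|M3. \<bar>s i p - f p\<bar>) < r/3"
   by (rule LIMSEQ_0_less[OF L0, of "r/3"]) (use r in auto)
  obtain n0 where n0: "\<And>n. n \<ge> n0 ==> (LINT p|M3. \<bar>s i (Shf (z n) p) - s i p\<bar>) < r/3"
   by (rule LIMSEQ_0_less[OF lim.IH[of i], of "r/3"]) (use r in auto)
  have "(LINT p|M3. \<bar>f (Shf (z n) p) - f p\<bar>) < r" if "n \<ge> n0" for n
  proof -
   have ii: "integrable M3 (%p. f (Shf (z n) p))" "integrable M3 (%p. s i (Shf (z n) p))"
    using lim by (subst integrable_Shf; auto)+
   have "(LINT p|M3. \<bar>f (Shf (z n) p) - f p\<bar>) \<le> (LINT p|M3. \<bar>s i (Shf (z n) p) - f (Shf (z n) p)\<bar> + \<bar>s i (Shf (z n) p) - s i p\<bar> + \<bar>s i p - f p\<bar>)"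
    using ii lim(1,4) by (intro integral_mono) auto
   also have "\<dots> = (LINT p|M3. \<bar>s i (Shf (z n) p) - f (Shf (z n) p)\<bar>) + (LINT p|M3. \<bar>s i (Shf (z n) p) - s i p\<bar>) + (LINT p|M3. \<bar>s i p - f p\<bar>)"
    using ii lim(1,4) by (subst Bochner_Integration.integral_add, auto)+
   also have "(LINT p|M3. \<bar>s i (Shf (z n) p) - f (Shf (z n) p)\<bar>) = (LINT p|M3. \<bar>s i p - f p\<bar>)"
    by (rule integral_Shf[where f="%p. \<bar>s i p - f p\<bar>"]) auto
   finally show ?thesis using n0[OF that] i r by simp
  qed
  then show "\<exists>no. \<forall>n\<ge>no. norm ((LINT p|M3. \<bar>f (Shf (z n) p) - f p\<bar>) - 0) < r" by (auto intro!: exI[of _ n0])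
 qed
qed

lemma sqint_Shf: "sqint M3 f ==> sqint M3 (%p. f (Shf z p))"
 unfolding sqint_def by (auto simp: integrable_Shf[where f="%p. (f p)^2"])

lemma sqint_shf: "sqint N f ==> sqint N (%p. f (shf z p))"
 unfolding sqint_def by (auto simp: integrable_shf[where f="%p. (f p)^2"])

text \<open>Squaring with sign reduces the statement to the corresponding one in \<open>L\<^sup>1\<close>.\<close>
lemma sq_diff_le: "(x - y)^2 \<le> 2 * \<bar>x * \<bar>x\<bar> - y * \<bar>y\<bar>\<bar>" for x y :: real
proof -
 have *: "(x - y)^2 \<le> 2 * \<bar>x * \<bar>x\<bar> - y * \<bar>y\<bar>\<bar>" if "x \<ge> y" for x y :: real
 proof -
  consider "y \<ge> 0" | "x \<le> 0" | "x > 0" "y < 0" by linarith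
  then show ?thesis
  proof cases
   case 1
   then have "(x - y) * (x - y) \<le> (x - y) * (x + y)" using that by (intro mult_left_mono) auto
   moreover have "0 \<le> (x - y) * (x + y)" using 1 that by auto
   ultimately show ?thesis using 1 that by (simp add: power2_eq_square algebra_simps)
  next
   case 2
   then have "(x - y) * (x - y) \<le> (x - y) * (- x - y)" using that by (intro mult_left_mono) auto
   moreover have "0 \<le> (x - y) * (- x - y)" using 2 that by auto
   ultimately show ?thesis using 2 that by (simp add: power2_eq_square algebra_simps)
  next
   case 3
   have "0 \<le> (x + y)^2" by simp
   then show ?thesis using 3 by (simp add: power2_eq_square algebra_simps)
  qed
 qed
 show ?thesis
 proof (cases "x \<ge> y")
  case False
  then show ?thesis using *[of x y] by (simp add: power2_commute abs_minus_commute)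
 qed (rule *)
qed

lemma L2_shift:
 assumes f: "sqint M3 f" and z: "z \<longlonglongrightarrow> 0"
 shows "(%n. LINT p|M3. (f (Shf (z n) p) - f p)^2) \<longlonglongrightarrow> 0"
proof -
 have [measurable]: "f \<in> borel_measurable borel" using sqint_measurable[OF f] by simp
 have i: "integrable M3 (%p. f p * \<bar>f p\<bar>)"
 proof (rule Bochner_Integration.integrable_bound[of M3 "%p. (f p)^2"])
  show "integrable M3 (%p. (f p)^2)" using f by (simp only: sqint_def)
  show "(%p. f p * \<bar>f p\<bar>) \<in> borel_measurable M3" unfolding measurable_M3 by measurable
  have "norm (y * \<bar>y\<bar>) \<le> norm (y^2)" for y :: real by (simp add: power2_eq_square abs_mult)
  then show "AE p in M3. norm (f p * \<bar>f p\<bar>) \<le> norm ((f p)^2)" by blast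
 qed
 have "(%n. 2 * (LINT p|M3. \<bar>f (Shf (z n) p) * \<bar>f (Shf (z n) p)\<bar> - f p * \<bar>f p\<bar>\<bar>)) \<longlonglongrightarrow> 2 * 0"
  by (intro tendsto_intros L1_shift[OF i z])
 then have L: "(%n. 2 * (LINT p|M3. \<bar>f (Shf (z n) p) * \<bar>f (Shf (z n) p)\<bar> - f p * \<bar>f p\<bar>\<bar>)) \<longlonglongrightarrow> 0" by simp
 show ?thesis
 proof (rule tendsto_sandwich[OF _ _ tendsto_const L])
  have "(LINT p|M3. (f (Shf (z n) p) - f p)^2) \<le> (LINT p|M3. 2 * \<bar>f (Shf (z n) p) * \<bar>f (Shf (z n) p)\<bar> - f p * \<bar>f p\<bar>\<bar>)" for n
  proof (rule integral_mono)
   show "integrable M3 (%p. (f (Shf (z n) p) - f p)^2)"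
    using sqint_diff[OF sqint_Shf[OF f] f] by (auto simp: sqint_def)
   have "integrable M3 (%p. f (Shf (z n) p) * \<bar>f (Shf (z n) p)\<bar>)"
    using i by (subst integrable_Shf[where f="%p. f p * \<bar>f p\<bar>"]) auto
   then show "integrable M3 (%p. 2 * \<bar>f (Shf (z n) p) * \<bar>f (Shf (z n) p)\<bar> - f p * \<bar>f p\<bar>\<bar>)" using i by auto
  qed (rule sq_diff_le)
  then show "\<forall>\<^sub>F n in sequentially. (LINT p|M3. (f (Shf (z n) p) - f p)^2) \<le>
   2 * (LINT p|M3. \<bar>f (Shf (z n) p) * \<bar>f (Shf (z n) p)\<bar> - f p * \<bar>f p\<bar>\<bar>)"
   by simp
 qed auto
qed

lemma weak_shift:
 assumes a: "sqint M3 a" and f: "sqint M3 f" and z: "z \<longlonglongrightarrow> 0"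
 shows "(%n. LINT p|M3. a p * f (Shf (z n) p)) \<longlonglongrightarrow> (LINT p|M3. a p * f p)"
proof -
 have "(%n. LINT p|M3. a p * (f (Shf (z n) p) - f p)) \<longlonglongrightarrow> 0"
  by (rule sqint_weak_limit[OF a sqint_diff[OF sqint_Shf[OF f] f] L2_shift[OF f z]])
 moreover have "(LINT p|M3. a p * (f (Shf (z n) p) - f p)) = (LINT p|M3. a p * f (Shf (z n) p)) - (LINT p|M3. a p * f p)" for n
  using sqint_mult[OF a sqint_Shf[OF f]] sqint_mult[OF a f] by (simp add: algebra_simps)
 ultimately show ?thesis by (simp add: LIM_zero_iff)
qed

end

section \<open>Differentiable functions of compact support\<close>

text \<open>Smoothness of a concrete function is obtained from a class closed under partial
  derivatives, so that no higher derivative has to be computed. The classes used are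
  \<open>trig\<close> and \<open>bumps\<close>.\<close>

lemma Ck_on_closed_class:
 assumes "\<And>f x. f \<in> \<F> ==> x \<in> S ==> f differentiable (at x)"
  and "\<And>f b. f \<in> \<F> ==> b \<in> Basis ==> (%x. frechet_derivative f (at x) b) \<in> \<F>"
  and "f \<in> \<F>"
 shows "Ck_on k S f"
 using assms(3)
proof (induction k arbitrary: f)
 case 0
 then show ?case using assms(1)
  by (auto intro!: continuous_at_imp_continuous_on differentiable_imp_continuous_within)
qed (use assms in auto)

lemma Ck_on_shift:
 "Ck_on k UNIV f ==> Ck_on k UNIV (%x. f (x + z))"
proof (induction k arbitrary: f)
 case 0
 then show ?case by (auto intro!: continuous_on_compose2[of UNIV f] continuous_intros)
next
 case (Suc k)
 have d: "((%x. f (x + z)) has_derivative frechet_derivative f (at (x + z))) (at x)" for x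
 proof -
  have "(f has_derivative frechet_derivative f (at (x + z))) (at (x + z))"
   using Suc.prems by (auto simp: frechet_derivative_works)
  then show ?thesis
   by (rule has_derivative_compose[where g=f and f="%x. x + z" and x=x and s=UNIV, rotated, THEN has_derivative_eq_rhs])
    (auto intro!: derivative_eq_intros)
 qed
 have "frechet_derivative (%x. f (x + z)) (at x) = frechet_derivative f (at (x + z))" for x
  using frechet_derivative_at[OF d] by simp
 moreover have "Ck_on k UNIV (%x. frechet_derivative f (at (x + z)) b)" if "b \<in> Basis" for b
  using Suc.IH[of "%x. frechet_derivative f (at x) b"] Suc.prems that by simp
 ultimately show ?case using d by (auto simp: differentiable_def)
qed

lemma notin_supp: "x \<notin> supp f ==> f x = 0"
 using closure_subset[of "{x. f x \<noteq> 0}"] by (auto simp: supp_def)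

lemma Ck_compact_outside:
 assumes "Ck_compact k S f" "x \<notin> supp f"
 shows "eventually (%y. f y = 0) (nhds x)"
proof -
 have "open (- supp f)" unfolding supp_def by auto
 moreover have "f y = 0" if "y \<in> - supp f" for y
  using that notin_supp by auto
 ultimately show ?thesis using assms(2) by (auto simp: eventually_nhds)
qed

lemma Ck_compact_0_continuous:
 assumes "Ck_compact 0 S f" "open S"
 shows "continuous_on UNIV f"
proof (rule continuous_at_imp_continuous_on, rule ballI)
 fix x
 show "isCont f x"
 proof (cases "x \<in> supp f")
  case True
  then show ?thesis using assms by (auto simp: Ck_compact_def continuous_on_eq_continuous_at)
 next
  case False
  from Ck_compact_outside[OF assms(1) this] have e: "eventually (%y. f y = 0) (nhds x)" .
  then have "isCont f x \<longleftrightarrow> isCont (%_. 0 :: real) x" by (intro isCont_cong) auto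
  then show ?thesis by simp
 qed
qed

text \<open>Near a point off the support the function is identically zero, so the derivative exists
  on the whole space and not only on S. This allows compactly supported data to be integrated by
  parts over the whole space.\<close>

lemma Ck_compact_Suc:
 assumes f: "Ck_compact (Suc k) S f" and S: "open S"
 shows "(f has_derivative frechet_derivative f (at x)) (at x)"
  and "b \<in> Basis ==> Ck_compact k S (%x. frechet_derivative f (at x) b)"
  and "Ck_compact 0 S f"
proof -
 have out: "(f has_derivative (%_. 0)) (at x)" if "x \<notin> supp f" for x
 proof -
  have ev: "eventually (%y. 0 = f y) (nhds x)" using Ck_compact_outside[OF f that] by eventually_elim simp
  then have "0 = f x" by (rule eventually_nhds_x_imp_x)
  with ev show ?thesis
   by (intro has_derivative_transform_eventually[of "%_. 0" _ x UNIV f]) (auto simp: eventually_at_filter elim: eventually_mono)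
 qed
 show d: "(f has_derivative frechet_derivative f (at x)) (at x)" for x
 proof (cases "x \<in> supp f")
  case True
  then have "x \<in> S" using f by (auto simp: Ck_compact_def)
  then show ?thesis using f by (auto simp: Ck_compact_def frechet_derivative_works[symmetric])
 next
  case False
  then have "f differentiable (at x)" using out by (auto simp: differentiable_def)
  then show ?thesis by (simp add: frechet_derivative_works)
 qed
 show "Ck_compact k S (%x. frechet_derivative f (at x) b)" if b: "b \<in> Basis"
 proof -
  have "{x. frechet_derivative f (at x) b \<noteq> 0} \<subseteq> supp f"
  proof
   fix x assume "x \<in> {x. frechet_derivative f (at x) b \<noteq> 0}"
   then show "x \<in> supp f" using frechet_derivative_at[OF out, of x] by (metis mem_Collect_eq)
  qed
  then have "supp (%x. frechet_derivative f (at x) b) \<subseteq> supp f"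
   unfolding supp_def by (metis closure_closure closure_mono)
  moreover have "closed (supp (%x. frechet_derivative f (at x) b))" by (simp add: supp_def)
  ultimately show ?thesis using f b unfolding Ck_compact_def
   by (auto intro: compact_Int_closed simp: closed_Int_compact) (metis closed_Int_compact inf.absorb_iff1 inf_commute)
 qed
 show "Ck_compact 0 S f"
  using f d by (auto simp: Ck_compact_def intro!: continuous_at_imp_continuous_on has_derivative_continuous)
qed

lemma Ck_compact_bounded:
 assumes f: "Ck_compact 0 S f" "open S"
 obtains B where "B \<ge> 0" "\<And>x. \<bar>f x\<bar> \<le> B"
proof -
 have "compact (f ` supp f)"
  using f Ck_compact_0_continuous[OF f] by (intro compact_continuous_image) (auto simp: Ck_compact_def intro: continuous_on_subset)
 then obtain B where B: "\<And>x. x \<in> supp f ==> \<bar>f x\<bar> \<le> B"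
  by (auto simp: bounded_iff dest!: compact_imp_bounded) blast
 have "\<bar>f x\<bar> \<le> max B 0" for x
 proof (cases "x \<in> supp f")
  case False
  then have "f x = 0" using closure_subset[of "{x. f x \<noteq> 0}"] by (auto simp: supp_def)
  then show ?thesis by simp
 qed (use B[of x] in auto)
 then show ?thesis using that[of "max B 0"] by auto
qed

text \<open>The integral of \<open>F (x + b) - F x\<close> vanishes and equals the mean over \<open>\<sigma> \<in> [0,1]\<close>
 of the integrals of the derivative at \<open>x + \<sigma> b\<close>, which do not depend on \<open>\<sigma>\<close>.\<close>
lemma integral_derivative_compact_support:
 fixes F :: "'a::euclidean_space => real"
 assumes d: "\<And>x. (F has_derivative D x) (at x)"
  and c: "continuous_on UNIV (%x. D x b)" and s: "compact K" "\<And>x. x \<notin> K ==> F x = 0" "\<And>x. x \<notin> K ==> D x b = 0"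
 shows "(LINT x|lborel. D x b) = 0"
proof -
 have cF: "continuous_on UNIV F" using d by (intro continuous_at_imp_continuous_on ballI has_derivative_continuous)
 have [measurable]: "(%x. D x b) \<in> borel_measurable borel" "F \<in> borel_measurable borel"
  using c cF by (auto intro: borel_measurable_continuous_onI)
 have i: "integrable lborel f" if f: "continuous_on UNIV f" "\<And>x. x \<notin> K ==> f x = 0" for f :: "'a => real"
 proof -
  have "set_integrable lborel K f" unfolding set_integrable_def real_scaleR_def
   using borel_integrable_compact[OF s(1), of f] f(1) by (auto intro: continuous_on_subset)
  moreover have "(%x. indicator K x *\<^sub>R f x) = f" using f(2) by (fastforce simp: indicator_def)
  ultimately show ?thesis by (simp add: set_integrable_def)
 qed
 note iF = i[OF cF s(2)] and iD = i[OF c s(3)]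
 have tr: "(LINT x|lborel. f (x + a)) = (LINT x|lborel. f x)" if [measurable]: "f \<in> borel_measurable borel" for f :: "'a => real" and a
  by (subst (2) lborel_distr_plus[symmetric, of a], subst integral_distr) (auto simp: add.commute)
 have itr: "integrable lborel (%x. f (x + a))" if "integrable lborel f" for f :: "'a => real" and a
 proof -
  have [measurable]: "f \<in> borel_measurable borel" using that by auto
  have "integrable (distr lborel borel ((+) a)) f" using that by (simp add: lborel_distr_plus)
  then show ?thesis by (subst (asm) integrable_distr_eq) (auto simp: add.commute)
 qed
 let ?g = "%(\<sigma>, x). indicator {0..1} \<sigma> * D (x + \<sigma> *\<^sub>R b) b"
 have m: "?g \<in> borel_measurable (lborel \<Otimes>\<^sub>M lborel)"
  unfolding lborel_prod measurable_lborel1 split_beta by measurable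
 have ig: "integrable (lborel \<Otimes>\<^sub>M lborel) ?g"
 proof (rule lborel_pair.Fubini_integrable[OF m])
  have "(LINT y|lborel. norm (?g (x, y))) = indicator {0..1} x * (LINT y|lborel. \<bar>D y b\<bar>)" for x
   by (subst tr[symmetric, of "%y. \<bar>D y b\<bar>" "x *\<^sub>R b"]) (auto simp: abs_mult)
  then show "integrable lborel (%x. LINT y|lborel. norm (?g (x, y)))" by simp
  show "AE x in lborel. integrable lborel (%y. ?g (x, y))"
   using itr[OF iD] by auto
 qed
 have "0 = (LINT x|lborel. F (x + b)) - (LINT x|lborel. F x)" by (simp add: tr)
 also have "\<dots> = (LINT x|lborel. F (x + b) - F x)"
  using iF itr[OF iF, of b] by simp
 also have "\<dots> = (LINT x|lborel. (LINT \<sigma>|lborel. ?g (\<sigma>, x)))"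
 proof (rule Bochner_Integration.integral_cong[OF refl])
  fix x
  have "(LINT \<sigma>|lborel. D (x + \<sigma> *\<^sub>R b) b * indicator {0..1} \<sigma>) = F (x + 1 *\<^sub>R b) - F (x + 0 *\<^sub>R b)"
  proof (rule integral_FTC_Icc_real)
   fix \<sigma> :: real
   have "((%\<sigma>. F (x + \<sigma> *\<^sub>R b)) has_derivative (%h. D (x + \<sigma> *\<^sub>R b) (h *\<^sub>R b))) (at \<sigma>)"
    by (rule has_derivative_compose[where f="%\<sigma>. x + \<sigma> *\<^sub>R b", OF _ d]) (auto intro!: derivative_eq_intros)
   moreover have "D (x + \<sigma> *\<^sub>R b) (h *\<^sub>R b) = D (x + \<sigma> *\<^sub>R b) b * h" for h
    using linear_scale[OF has_derivative_linear[OF d]] by simp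
   ultimately show "((%\<sigma>. F (x + \<sigma> *\<^sub>R b)) has_real_derivative D (x + \<sigma> *\<^sub>R b) b) (at \<sigma>)"
    by (simp add: has_field_derivative_def)
   have "continuous_on UNIV (%\<sigma>. D (x + \<sigma> *\<^sub>R b) b)"
    by (rule continuous_on_compose2[OF c]) (auto intro!: continuous_intros)
   then show "isCont (%\<sigma>. D (x + \<sigma> *\<^sub>R b) b) \<sigma>" by (auto simp: continuous_on_eq_continuous_at)
  qed simp
  then show "F (x + b) - F x = (LINT \<sigma>|lborel. ?g (\<sigma>, x))" by (simp add: mult.commute)
 qed
 also have "\<dots> = (LINT \<sigma>|lborel. (LINT x|lborel. ?g (\<sigma>, x)))"
  by (rule lborel_pair.Fubini_integral) (use ig in simp)
 also have "\<dots> = (LINT \<sigma>|lborel. indicator {0..1::real} \<sigma> * (LINT x|lborel. D x b))"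
  by (simp add: tr[of "%x. D x b"])
 also have "\<dots> = (LINT x|lborel. D x b)" by simp
 finally show ?thesis by simp
qed

text \<open>Boxes are an intersection-stable generator of the Borel sets, so vanishing integrals
  pass to all Borel sets by Dynkin's argument. The step to complements uses the integral over the
  whole space, which is a limit over growing boxes.\<close>

lemma integrable_zero_on_boxes:
 fixes R :: "'a::euclidean_space => real"
 assumes i: "integrable lborel R" and z: "\<And>a b. (LINT x|lborel. indicator (box a b) x * R x) = 0"
 shows "AE x in lborel. R x = 0"
proof -
 have iA: "integrable lborel (%x. indicator A x * R x)" if "A \<in> sets borel" for A
  using integrable_mult_indicator[of A lborel R] i that by simp
 have "(%n. LINT x|lborel. indicator (box (- real n *\<^sub>R One) (real n *\<^sub>R One)) x * R x) \<longlonglongrightarrow> (LINT x|lborel. R x)"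
 proof (rule integral_dominated_convergence[where w="%x. norm (R x)"])
  show "AE x in lborel. (%n. indicator (box (- real n *\<^sub>R One) (real n *\<^sub>R One)) x * R x) \<longlonglongrightarrow> R x"
  proof (rule AE_I2)
   fix x :: 'a
   have "x \<in> box (- real n *\<^sub>R One) (real n *\<^sub>R One)" if "n \<ge> nat \<lceil>norm x\<rceil> + 1" for n
   proof -
    have "norm x < real n" using that by linarith
    then have "\<bar>x \<bullet> b\<bar> < real n" if "b \<in> Basis" for b using Basis_le_norm[OF that, of x] by simp
    then show ?thesis by (force simp: mem_box inner_diff_left abs_less_iff)
   qed
   then have "eventually (%n. indicator (box (- real n *\<^sub>R One) (real n *\<^sub>R One)) x * R x = R x) sequentially"
    unfolding eventually_sequentially by (intro exI[of _ "nat \<lceil>norm x\<rceil> + 1"]) simp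
   then show "(%n. indicator (box (- real n *\<^sub>R One) (real n *\<^sub>R One)) x * R x) \<longlonglongrightarrow> R x"
    by (rule tendsto_eventually)
  qed
 qed (use i in \<open>auto simp: indicator_def\<close>)
 then have R0: "(LINT x|lborel. R x) = 0" unfolding z by (simp add: LIMSEQ_const_iff)
 have "(LINT x|lborel. indicator A x * R x) = 0" if "A \<in> sets borel" for A
 proof -
  have A: "A \<in> sigma_sets UNIV (range (%(a, b). box a b))"
   using that by (simp add: borel_eq_box)
  have "Int_stable (range (%(a, b). box a b :: 'a set))"
   by (auto simp: Int_stable_def box_Int_box)
  moreover have "range (%(a, b). box a b :: 'a set) \<subseteq> Pow UNIV" by simp
  ultimately show ?thesis using A
  proof (induction rule: sigma_sets_induct_disjoint)
   case (basic A)
   then show ?case using z by auto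
  next
   case empty
   then show ?case by simp
  next
   case (compl A)
   have "A \<in> sets borel" using compl(1) by (simp add: borel_eq_box)
   have "(LINT x|lborel. indicator (UNIV - A) x * R x) = (LINT x|lborel. R x - indicator A x * R x)"
    by (intro Bochner_Integration.integral_cong) (auto simp: indicator_def)
   also have "\<dots> = 0" using i iA[OF \<open>A \<in> sets borel\<close>] compl R0 by (subst Bochner_Integration.integral_diff) auto
   finally show ?case .
  next
   case (union A)
   have [measurable]: "A j \<in> sets borel" for j using union(2) by (auto simp: borel_eq_box)
   have "(LINT x:(\<Union>i. A i)|lborel. R x) = (\<Sum>i. (LINT x:(A i)|lborel. R x))"
    using union(1) iA by (intro lebesgue_integral_countable_add) (auto simp: disjoint_family_on_def set_integrable_def)
   then show ?case using union by (simp add: set_lebesgue_integral_def)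
  qed
 qed
 then show ?thesis
  using density_unique_real[OF i, of "%_. 0"] by (simp add: set_lebesgue_integral_def)
qed

text \<open>Trigonometric polynomials. With a free phase the derivative of a cosine is a multiple of
  a cosine shifted by pi/2, so cosines alone give closure under differentiation.\<close>

inductive trig :: "real => real => (point => real) => bool" for \<alpha> \<beta> where
 trig_const: "trig \<alpha> \<beta> (%x. c)"
| trig_cos1: "trig \<alpha> \<beta> (%x. cos (\<alpha> * fst x + \<gamma>))"
| trig_cos2: "trig \<alpha> \<beta> (%x. cos (\<beta> * snd x + \<gamma>))"
| trig_add: "trig \<alpha> \<beta> f ==> trig \<alpha> \<beta> g ==> trig \<alpha> \<beta> (%x. f x + g x)"
| trig_mult: "trig \<alpha> \<beta> f ==> trig \<alpha> \<beta> g ==> trig \<alpha> \<beta> (%x. f x * g x)"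

lemma trig_derivative:
 "trig \<alpha> \<beta> f ==> \<exists>D. (\<forall>x. (f has_derivative D x) (at x)) \<and> (\<forall>v. trig \<alpha> \<beta> (%x. D x v))"
proof (induction rule: trig.induct)
 case (trig_const c)
 show ?case by (intro exI[of _ "%x v. 0"]) (auto intro: trig.trig_const)
next
 case (trig_cos1 \<gamma>)
 have "trig \<alpha> \<beta> (%x. (\<alpha> * fst v) * cos (\<alpha> * fst x + (\<gamma> + pi/2)))" for v :: point by (intro trig.intros)
 moreover have "((%x. cos (\<alpha> * fst x + \<gamma>)) has_derivative (%v. (\<alpha> * fst v) * cos (\<alpha> * fst x + (\<gamma> + pi/2)))) (at x)" for x :: point
 proof -
  have "cos (\<alpha> * fst x + (\<gamma> + pi/2)) = - sin (\<alpha> * fst x + \<gamma>)"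
   using minus_sin_cos_eq[of "\<alpha> * fst x + \<gamma>"] by (simp add: add.assoc)
  then show ?thesis by (auto intro!: derivative_eq_intros simp: algebra_simps)
 qed
 ultimately show ?case by (intro exI[of _ "%x v. (\<alpha> * fst v) * cos (\<alpha> * fst x + (\<gamma> + pi/2))"]) blast
next
 case (trig_cos2 \<gamma>)
 have "trig \<alpha> \<beta> (%x. (\<beta> * snd v) * cos (\<beta> * snd x + (\<gamma> + pi/2)))" for v :: point by (intro trig.intros)
 moreover have "((%x. cos (\<beta> * snd x + \<gamma>)) has_derivative (%v. (\<beta> * snd v) * cos (\<beta> * snd x + (\<gamma> + pi/2)))) (at x)" for x :: point
 proof -
  have "cos (\<beta> * snd x + (\<gamma> + pi/2)) = - sin (\<beta> * snd x + \<gamma>)"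
   using minus_sin_cos_eq[of "\<beta> * snd x + \<gamma>"] by (simp add: add.assoc)
  then show ?thesis by (auto intro!: derivative_eq_intros simp: algebra_simps)
 qed
 ultimately show ?case by (intro exI[of _ "%x v. (\<beta> * snd v) * cos (\<beta> * snd x + (\<gamma> + pi/2))"]) blast
next
 case (trig_add f g)
 then obtain D E where "\<forall>x. (f has_derivative D x) (at x)" "\<forall>v. trig \<alpha> \<beta> (%x. D x v)"
  "\<forall>x. (g has_derivative E x) (at x)" "\<forall>v. trig \<alpha> \<beta> (%x. E x v)" by blast
 then show ?case
  by (intro exI[of _ "%x v. D x v + E x v"]) (auto intro!: trig.intros has_derivative_add)
next
 case (trig_mult f g)
 then obtain D E where "\<forall>x. (f has_derivative D x) (at x)" "\<forall>v. trig \<alpha> \<beta> (%x. D x v)"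
  "\<forall>x. (g has_derivative E x) (at x)" "\<forall>v. trig \<alpha> \<beta> (%x. E x v)" by blast
 then show ?case using trig_mult
  by (intro exI[of _ "%x v. f x * E x v + D x v * g x"]) (auto intro!: trig.intros has_derivative_mult)
qed

lemma trig_smooth:
 assumes "trig \<alpha> \<beta> f" shows "smooth_fun_on UNIV f"
 unfolding smooth_fun_on_def
proof
 fix k
 show "Ck_on k UNIV f"
 proof (rule Ck_on_closed_class[where \<F>="Collect (trig \<alpha> \<beta>)"])
  fix f x assume "f \<in> Collect (trig \<alpha> \<beta>)"
  then show "f differentiable (at x)" using trig_derivative[of \<alpha> \<beta> f] unfolding differentiable_def by blast
 next
  fix f and b :: point assume "f \<in> Collect (trig \<alpha> \<beta>)"
  then obtain D where D: "\<forall>x. (f has_derivative D x) (at x)" "\<forall>v. trig \<alpha> \<beta> (%x. D x v)" using trig_derivative by blast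
  then have "frechet_derivative f (at x) = D x" for x using frechet_derivative_at[of f "D x" x] by metis
  then show "(%x. frechet_derivative f (at x) b) \<in> Collect (trig \<alpha> \<beta>)" using D(2) by (simp only: mem_Collect_eq)
 qed (use assms in simp)
qed

lemma trig_power: "trig \<alpha> \<beta> f ==> trig \<alpha> \<beta> (%x. f x ^ n)"
 by (induction n) (auto intro: trig.intros)

lemma measurable_pair_borel:
 fixes M :: "'a::second_countable_topology measure" and M' :: "'b::second_countable_topology measure"
 assumes "sets M = sets borel" "sets M' = sets borel"
 shows "measurable (M \<Otimes>\<^sub>M M') L = measurable borel L"
proof (rule measurable_cong_sets)
 show "sets (M \<Otimes>\<^sub>M M') = sets borel"
  unfolding borel_prod[symmetric] by (intro sets_pair_measure_cong assms)
qed simp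

lemma borel_measurable_param_integral:
 fixes f :: "'a::second_countable_topology => 'b::second_countable_topology => real"
 assumes "sigma_finite_measure M" "sets M = sets borel"
  "(%p. f (fst p) (snd p)) \<in> borel_measurable borel"
 shows "(%x. LINT y|M. f x y) \<in> borel_measurable borel"
proof -
 interpret sigma_finite_measure M by fact
 show ?thesis using assms(3)
  by (intro borel_measurable_lebesgue_integral) (simp add: measurable_pair_borel assms split_beta')
qed

section \<open>Periodic smoothing kernels and testing on the torus\<close>

context torus begin

text \<open>In each variable this is the squared cosine of half the angle; its powers divided by
  \<open>cc n\<close> are the de la Vallee-Poussin kernels. They are trigonometric polynomials,
  hence periodic test functions, and the maximum 1 is attained only on the period lattice.\<close>

definition kk :: "point => real" where
 "kk z = (1 + cos (pi / l * fst z)) / 2 * ((1 + cos (2 * pi / h * snd z)) / 2)"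

lemma torus_test_lattice:
 assumes "torus_test_function l h \<psi>"
 shows "\<psi> (x + (2 * l * of_int m, h * of_int n)) = \<psi> x"
proof -
 have p1: "\<psi> (x + (2 * l, 0)) = \<psi> x" and p2: "\<psi> (x + (0, h)) = \<psi> x" for x
  using assms unfolding torus_test_function_def by blast+
 have 1: "\<psi> (x + (2 * l * real k, 0)) = \<psi> x" for k x
 proof (induction k)
  case 0 then show ?case by (simp add: zero_prod_def[symmetric])
 next
  case (Suc k)
  then show ?case using p1[of "x + (2 * l * real k, 0)"] by (simp add: algebra_simps)
 qed
 have 2: "\<psi> (x + (0, h * real k)) = \<psi> x" for k x
 proof (induction k)
  case 0 then show ?case by (simp add: zero_prod_def[symmetric])
 next
  case (Suc k)
  then show ?case using p2[of "x + (0, h * real k)"] by (simp add: algebra_simps)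
 qed
 have p1': "\<psi> (x + (2 * l * of_int m, 0)) = \<psi> x" for m x
 proof (cases m)
  case (neg k)
  then have "(2 * l * of_int m, 0) + (2 * l * real (Suc k), 0) = (0 :: point)"
   by (simp add: zero_prod_def flip: distrib_left)
  then show ?thesis using 1[of "x + (2 * l * of_int m, 0)" "Suc k"] by (simp only: add.assoc add_0_right)
 qed (use 1 in auto)
 have p2': "\<psi> (x + (0, h * of_int m)) = \<psi> x" for m x
 proof (cases m)
  case (neg k)
  then have "(0, h * of_int m) + (0, h * real (Suc k)) = (0 :: point)"
   by (simp add: zero_prod_def flip: distrib_left)
  then show ?thesis using 2[of "x + (0, h * of_int m)" "Suc k"] by (simp only: add.assoc add_0_right)
 qed (use 2 in auto)
 show ?thesis using p1'[of "x + (0, h * of_int n)" m] p2'[of x n] by (simp add: add.assoc)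
qed

lemma wrp_lattice: "\<exists>m n. wrp x = x + (2 * l * of_int m, h * of_int n)"
 by (rule exI[of _ "- \<lfloor>(fst x + l) / (2 * l)\<rfloor>"], rule exI[of _ "- \<lfloor>snd x / h\<rfloor>"])
  (simp add: wrp_def wrap1_def prod_eq_iff)

lemma torus_test_wrp: "torus_test_function l h \<psi> ==> \<psi> (wrp x) = \<psi> x"
 using wrp_lattice[of x] torus_test_lattice by metis

lemma torus_test_shf: "torus_test_function l h \<psi> ==> \<psi> (shf z x) = \<psi> (x + z)"
 by (simp add: shf_def torus_test_wrp)

lemma wrp_wrp: "wrp (wrp x + z) = wrp (x + z)"
 using l_pos h_pos by (simp add: wrp_def wrap1_wrap1)

lemma shf_shf: "shf z (shf w x) = shf (w + z) x"
 by (simp add: shf_def wrp_wrp add.assoc)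

lemma shf_inverse: "x \<in> Omega l h ==> shf z (shf (-z) x) = x" "x \<in> Omega l h ==> shf (-z) (shf z x) = x"
 by (simp_all add: shf_shf) (simp_all add: shf_def wrp_id)

lemma torus_test_shift:
 assumes "torus_test_function l h \<psi>" shows "torus_test_function l h (%x. \<psi> (x + z))"
proof -
 have "\<psi> (x + (2 * l, 0) + z) = \<psi> (x + z)" "\<psi> (x + (0, h) + z) = \<psi> (x + z)" for x
  using assms unfolding torus_test_function_def by (metis add.commute add.left_commute)+
 then show ?thesis using assms by (auto simp: torus_test_function_def smooth_fun_on_def Ck_on_shift)
qed

lemma torus_test_deriv:
 assumes "torus_test_function l h \<psi>"
 shows "(\<psi> has_derivative frechet_derivative \<psi> (at x)) (at x)"
  and "b \<in> Basis ==> continuous_on UNIV (%x. frechet_derivative \<psi> (at x) b)"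
  and "continuous_on UNIV \<psi>"
proof -
 have "Ck_on (Suc 0) UNIV \<psi>" using assms unfolding torus_test_function_def smooth_fun_on_def by blast
 then show d: "(\<psi> has_derivative frechet_derivative \<psi> (at x)) (at x)"
  and "b \<in> Basis ==> continuous_on UNIV (%x. frechet_derivative \<psi> (at x) b)" for x
  unfolding frechet_derivative_works[symmetric] Ck_on.simps by blast+
 then show "continuous_on UNIV \<psi>"
  by (intro continuous_at_imp_continuous_on ballI has_derivative_continuous)
qed

lemma bounded_on_Omega:
 fixes f :: "point => real"
 assumes "continuous_on UNIV f"
 obtains B where "B \<ge> 0" "\<And>x. x \<in> Omega l h ==> \<bar>f x\<bar> \<le> B"
proof -
 have "compact (f ` closure (Omega l h))"
  using assms by (intro compact_continuous_image) (auto intro: continuous_on_subset)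
 then obtain B where "\<forall>y\<in>f ` closure (Omega l h). \<bar>y\<bar> \<le> B" by (auto simp: bounded_iff dest!: compact_imp_bounded)
 then have "\<bar>f x\<bar> \<le> max B 0" if "x \<in> Omega l h" for x using that closure_subset[of "Omega l h"] by fastforce
 then show ?thesis using that[of "max B 0"] by auto
qed

lemma integrable_mult_cont:
 assumes f: "integrable N f" and g: "continuous_on UNIV g"
 shows "integrable N (%x. f x * g x :: real)"
proof -
 obtain B where B: "B \<ge> 0" "\<And>x. x \<in> Omega l h ==> \<bar>g x\<bar> \<le> B" using bounded_on_Omega[OF g] by metis
 have [measurable]: "f \<in> borel_measurable borel" using f by (auto dest: borel_measurable_integrable)
 have [measurable]: "g \<in> borel_measurable borel" using g by (rule borel_measurable_continuous_onI)
 show ?thesis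
 proof (rule Bochner_Integration.integrable_bound[of N "%x. B * f x"])
  show "AE x in N. norm (f x * g x) \<le> norm (B * f x)"
   using AE_N_Omega
  proof eventually_elim
   case (elim x)
   show ?case unfolding real_norm_def abs_mult abs_of_nonneg[OF B(1)] mult.commute[of B] by (intro mult_left_mono B elim) simp
  qed
 qed (use f in auto)
qed

lemma kk_trig: "trig (pi / l) (2 * pi / h) (%x. kk (x - y))"
proof -
 have "trig (pi / l) (2 * pi / h) (%x. ((1/2) * (1 + cos (pi / l * fst x + (- pi / l * fst y)))) * ((1/2) * (1 + cos (2 * pi / h * snd x + (- 2 * pi / h * snd y)))))"
  by (intro trig.intros)
 moreover have "(%x. ((1/2) * (1 + cos (pi / l * fst x + (- pi / l * fst y)))) * ((1/2) * (1 + cos (2 * pi / h * snd x + (- 2 * pi / h * snd y))))) = (%x. kk (x - y))"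
  by (auto simp: kk_def algebra_simps diff_divide_distrib)
 ultimately show ?thesis by simp
qed

lemma kk_periodic: "kk (z + (2 * l, 0)) = kk z" "kk (z + (0, h)) = kk z"
proof -
 have "pi / l * (fst z + 2 * l) = pi / l * fst z + 2 * pi" "2 * pi / h * (snd z + h) = 2 * pi / h * snd z + 2 * pi"
  using l_pos h_pos by (simp_all add: field_simps)
 then show "kk (z + (2 * l, 0)) = kk z" "kk (z + (0, h)) = kk z" by (simp_all only: kk_def fst_add snd_add fst_conv snd_conv cos_periodic add_0_right)
qed

lemma kk_test: "torus_test_function l h (%x. kk (x - y) ^ n)"
 unfolding torus_test_function_def
proof
 show "smooth_fun_on UNIV (%x. kk (x - y) ^ n)" by (rule trig_smooth[OF trig_power[OF kk_trig]])
 have "x + v - y = x - y + v" for x v :: point by simp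
 then show "\<forall>x. kk (x + (2 * l, 0) - y) ^ n = kk (x - y) ^ n \<and> kk (x + (0, h) - y) ^ n = kk (x - y) ^ n"
  by (simp only: kk_periodic) simp
qed

lemma kk_range: "0 \<le> kk z" "kk z \<le> 1"
proof -
 have "-1 \<le> u ==> 0 \<le> (1 + u) / 2" "u \<le> 1 ==> (1 + u) / 2 \<le> 1" for u :: real by auto
 note c = this(1)[OF cos_ge_minus_one] and c1 = this(2)[OF cos_le_one]
 show "0 \<le> kk z" unfolding kk_def by (intro mult_nonneg_nonneg c)
 show "kk z \<le> 1" unfolding kk_def by (intro mult_le_one c c1)
qed

lemma kk_continuous [continuous_intros]: "continuous_on UNIV kk"
 unfolding kk_def by (intro continuous_intros) auto

lemma kk_measurable [measurable]: "kk \<in> borel_measurable borel"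
 by (rule borel_measurable_continuous_onI) (rule kk_continuous)

lemma kk_even: "kk (x - y) = kk (y - x)"
proof -
 have "pi / l * fst (x - y) = - (pi / l * fst (y - x))" "2 * pi / h * snd (x - y) = - (2 * pi / h * snd (y - x))"
  unfolding mult_minus_right[symmetric] by simp_all
 then show ?thesis by (simp only: kk_def cos_minus)
qed

lemma cos_eq_1_imp: "cos t = 1 ==> \<bar>t\<bar> < 2 * pi ==> t = 0"
proof -
 assume "cos t = 1" "\<bar>t\<bar> < 2 * pi"
 then obtain n :: int where n: "t = real_of_int n * 2 * pi" using cos_one_2pi_int by auto
 then have "\<bar>real_of_int n\<bar> * (2 * pi) < 1 * (2 * pi)" using \<open>\<bar>t\<bar> < 2 * pi\<close> by (simp add: abs_mult)
 then have "\<bar>real_of_int n\<bar> < 1" by (subst (asm) mult_less_cancel_right) auto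
 then have "n = 0" by linarith
 then show ?thesis using n by simp
qed

text \<open>One point is interior, so each coordinate difference stays strictly below a full period
  and zero is the only lattice point that could give the maximum. The other point ranges over the
  closure, as the compactness argument in \<open>Laplace_kernel\<close> requires.\<close>

lemma kk_less_1:
 assumes x: "x \<in> Omega l h" and y: "y \<in> closure (Omega l h)" and "x \<noteq> y"
 shows "kk (x - y) < 1"
proof (rule ccontr)
 assume "\<not> kk (x - y) < 1"
 then have k: "kk (x - y) = 1" using kk_range[of "x - y"] by simp
 have y': "\<bar>fst y\<bar> \<le> l" "0 \<le> snd y" "snd y \<le> h"
  using y l_pos h_pos by (auto simp: Omega_def closure_Times)
 have x': "\<bar>fst x\<bar> < l" "0 < snd x" "snd x < h" using x by (auto simp: Omega_def)
 define a where "a = (1 + cos (pi / l * fst (x - y))) / 2"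
 define b where "b = (1 + cos (2 * pi / h * snd (x - y))) / 2"
 have "-1 \<le> u ==> 0 \<le> (1 + u) / 2" "u \<le> 1 ==> (1 + u) / 2 \<le> 1" for u :: real by auto
 note c = this(1)[OF cos_ge_minus_one] this(2)[OF cos_le_one]
 have ab: "0 \<le> a" "a \<le> 1" "0 \<le> b" "b \<le> 1" unfolding a_def b_def by (rule c)+
 have "a * b = 1" using k by (simp add: kk_def a_def b_def)
 then have "a = 1" "b = 1" using ab mult_left_le[of b a] mult_left_le_one_le[of b a] by linarith+
 then have c: "cos (pi / l * fst (x - y)) = 1" "cos (2 * pi / h * snd (x - y)) = 1" by (simp_all add: a_def b_def)
 have "\<bar>pi / l * fst (x - y)\<bar> < 2 * pi"
 proof -
  have "\<bar>fst (x - y)\<bar> < 2 * l" using x' y' by auto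
  then have "pi / l * \<bar>fst (x - y)\<bar> < pi / l * (2 * l)" using l_pos by (intro mult_strict_left_mono) auto
  then show ?thesis using l_pos by (simp add: abs_mult)
 qed
 then have 1: "fst (x - y) = 0" using cos_eq_1_imp[OF c(1)] l_pos by simp
 have "\<bar>2 * pi / h * snd (x - y)\<bar> < 2 * pi"
 proof -
  have "\<bar>snd (x - y)\<bar> < h" using x' y' by auto
  then have "2 * pi / h * \<bar>snd (x - y)\<bar> < 2 * pi / h * h" using h_pos by (intro mult_strict_left_mono) auto
  then show ?thesis using h_pos by (simp add: abs_mult)
 qed
 then have "snd (x - y) = 0" using cos_eq_1_imp[OF c(2)] h_pos by simp
 with 1 \<open>x \<noteq> y\<close> show False by (simp add: prod_eq_iff)
qed

definition cc :: "nat => real" where "cc n = (LINT y|N. kk y ^ n)"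

lemma integrable_N_bounded:
 assumes [measurable]: "f \<in> borel_measurable borel" and "\<And>x. \<bar>f x\<bar> \<le> B"
 shows "integrable N (f :: point => real)"
 by (rule N.integrable_const_bound[of _ B]) (use assms in auto)

lemma kk_integrable: "integrable N (%y. kk (x - y) ^ n)"
 by (rule integrable_N_bounded[of _ 1]) (auto simp: kk_range power_le_one abs_of_nonneg)

lemma cc_eq: "(LINT y|N. kk (x - y) ^ n) = cc n"
proof -
 have "cc n = (LINT y|N. kk (shf (-x) y) ^ n)" unfolding cc_def by (subst integral_shf[symmetric, of _ "-x"]) auto
 also have "\<dots> = (LINT y|N. kk (x - y) ^ n)"
  using torus_test_shf[OF kk_test[of 0 n]] kk_even by simp
 finally show ?thesis by simp
qed

text \<open>Laplace's method. Away from x the kernel is at most \<open>q ^ n\<close>, while a small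
  ball around x makes the normalisation \<open>cc n\<close> at least \<open>r ^ n * m\<close> with q
  < r < 1; the far part is therefore of order (q/r)^n. Near x the values of g are close to g
  x.\<close>

lemma Laplace_kernel:
 assumes x: "x \<in> Omega l h" and g[measurable]: "g \<in> borel_measurable borel" and M: "\<And>y. \<bar>g y\<bar> \<le> M"
  and c: "isCont g x"
 shows "(%n. (LINT y|N. g y * kk (x - y) ^ n) / cc n) \<longlonglongrightarrow> g x"
proof (rule LIMSEQ_I)
 fix e :: real assume e: "e > 0"
 have M0: "M \<ge> 0" using M[of x] by linarith
 obtain d where d: "d > 0" "\<And>y. dist y x < d ==> \<bar>g y - g x\<bar> < e/2"
  using c e unfolding continuous_at_eps_delta by (metis dist_real_def half_gt_zero)
 let ?K = "closure (Omega l h) - ball x d"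
 obtain q where q: "0 \<le> q" "q < 1" "\<And>y. y \<in> ?K ==> kk (x - y) \<le> q"
 proof (cases "?K = {}")
  case True show ?thesis by (rule that[of 0]) (use True in auto)
 next
  case False
  have "compact ?K" by (intro compact_diff) auto
  moreover have "continuous_on ?K (%y. kk (x - y))"
   by (intro continuous_on_compose2[OF kk_continuous] continuous_intros) auto
  ultimately obtain y0 where y0: "y0 \<in> ?K" "\<And>y. y \<in> ?K ==> kk (x - y) \<le> kk (x - y0)"
   using continuous_attains_sup[of ?K] False by metis
  then have "x \<noteq> y0" using d by auto
  then show ?thesis using that[of "kk (x - y0)"] y0 kk_range kk_less_1[OF x] by auto
 qed
 \<comment> \<open>Any value strictly between q and 1 serves: the kernel is at least r on some ball,
   and this bounds the total mass from below.\<close>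
 define r where "r = (1 + q) / 2"
 have r: "q < r" "r < 1" "r > 0" using q by (auto simp: r_def)
 have "isCont kk 0" using kk_continuous by (simp add: continuous_on_eq_continuous_at del: split_paired_All)
 moreover have "kk 0 = 1" by (simp add: kk_def)
 ultimately obtain d1 where d1: "d1 > 0" "\<And>z. dist z 0 < d1 ==> \<bar>kk z - 1\<bar> < 1 - r"
  using r unfolding continuous_at_eps_delta by (metis dist_real_def diff_gt_0_iff_gt)
 obtain d2 where d2: "d2 > 0" "ball x d2 \<subseteq> Omega l h" using x by (meson Omega_open open_contains_ball)
 define B where "B = ball x (min d1 d2)"
 have B: "B \<subseteq> Omega l h" "\<And>y. y \<in> B ==> r \<le> kk (x - y)"
 proof -
  show "B \<subseteq> Omega l h" using d2 by (auto simp: B_def)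
  fix y assume "y \<in> B"
  then have "dist (x - y) 0 < d1" by (auto simp: B_def dist_norm)
  then show "r \<le> kk (x - y)" using d1(2)[of "x - y"] by linarith
 qed
 have Bs[measurable]: "B \<in> sets borel" by (simp add: B_def)
 define m where "m = measure N B"
 have m: "m > 0"
 proof -
  have "emeasure N B = emeasure lborel B" using B by (simp add: emeasure_N Int_absorb2)
  then have "m = measure lborel B" by (simp add: m_def measure_def)
  then show ?thesis using content_ball_pos[of "min d1 d2" x] d1 d2 by (simp add: B_def)
 qed
 have cn: "r ^ n * m \<le> cc n" for n
 proof -
  have "r ^ n * m = (LINT y|N. indicator B y * r ^ n)" by (simp add: m_def)
  also have "\<dots> \<le> (LINT y|N. kk (x - y) ^ n)"
  proof (rule integral_mono[OF _ kk_integrable])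
   show "integrable N (%y. indicator B y * r ^ n)" by (intro integrable_mult_left) (simp add: integrable_indicator_iff N.emeasure_eq_measure)
   fix y show "indicator B y * r ^ n \<le> kk (x - y) ^ n"
    using B(2)[of y] r kk_range[of "x - y"] by (auto simp: indicator_def intro: power_mono)
  qed
  finally show ?thesis by (simp add: cc_eq)
 qed
 have cpos: "cc n > 0" for n using cn[of n] r m by (smt (verit) mult_pos_pos zero_less_power)
 define V where "V = measure N UNIV"
 have V: "V \<ge> 0" by (simp add: V_def)
 have main: "\<bar>(LINT y|N. g y * kk (x - y) ^ n) / cc n - g x\<bar> \<le> e/2 + (2 * M * V / m) * (q / r) ^ n" for n
 proof -
  have ig: "integrable N (%y. g y * kk (x - y) ^ n)"
  proof (rule integrable_N_bounded[of _ M])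
   fix y show "\<bar>g y * kk (x - y) ^ n\<bar> \<le> M"
    using M[of y] kk_range[of "x - y"] power_le_one[of "kk (x - y)" n] mult_mono[of "\<bar>g y\<bar>" M "kk (x - y) ^ n" 1] M0
    by (simp add: abs_mult)
  qed measurable
  have "(LINT y|N. g y * kk (x - y) ^ n) - g x * cc n = (LINT y|N. (g y - g x) * kk (x - y) ^ n)"
   using ig kk_integrable by (simp add: left_diff_distrib cc_eq)
  then have "\<bar>(LINT y|N. g y * kk (x - y) ^ n) - g x * cc n\<bar> \<le> (LINT y|N. \<bar>(g y - g x) * kk (x - y) ^ n\<bar>)"
   using integral_abs_bound[of N "%y. (g y - g x) * kk (x - y) ^ n"] by simp
  also have "\<dots> \<le> (LINT y|N. e/2 * kk (x - y) ^ n + 2 * M * q ^ n)"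
  proof (rule integral_mono_AE)
   show "integrable N (%y. \<bar>(g y - g x) * kk (x - y) ^ n\<bar>)"
    using ig kk_integrable[of x n] by (simp add: left_diff_distrib)
   show "integrable N (%y. e/2 * kk (x - y) ^ n + 2 * M * q ^ n)" using kk_integrable[of x n] by simp
   show "AE y in N. \<bar>(g y - g x) * kk (x - y) ^ n\<bar> \<le> e/2 * kk (x - y) ^ n + 2 * M * q ^ n"
    using AE_N_Omega
   proof eventually_elim
    case (elim y)
    have k0: "0 \<le> kk (x - y) ^ n" using kk_range by simp
    show ?case
    proof (cases "dist y x < d")
     case True
     then have "\<bar>g y - g x\<bar> * kk (x - y) ^ n \<le> e/2 * kk (x - y) ^ n"
      using d(2)[of y] k0 by (intro mult_right_mono) auto
     moreover have "0 \<le> 2 * M * q ^ n" using M0 q by simp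
     ultimately show ?thesis using k0 kk_range[of "x - y"] by (simp add: abs_mult)
    next
     case False
     then have "y \<in> ?K" using elim closure_subset by (auto simp: dist_commute)
     then have "kk (x - y) ^ n \<le> q ^ n" using q kk_range by (intro power_mono) auto
     moreover have "\<bar>g y - g x\<bar> \<le> 2 * M" using M[of y] M[of x] by linarith
     ultimately have "\<bar>g y - g x\<bar> * kk (x - y) ^ n \<le> 2 * M * q ^ n" using k0 M0 by (intro mult_mono) auto
     moreover have "0 \<le> e/2 * kk (x - y) ^ n" using e k0 by simp
     ultimately show ?thesis using kk_range[of "x - y"] by (simp add: abs_mult)
    qed
   qed
  qed
  also have "\<dots> = e/2 * cc n + 2 * M * q ^ n * V"
   using kk_integrable[of x n] by (simp add: cc_eq V_def)
  finally have a: "\<bar>(LINT y|N. g y * kk (x - y) ^ n) - g x * cc n\<bar> \<le> e/2 * cc n + 2 * M * V * q ^ n" by (simp add: mult_ac)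
  have "\<bar>(LINT y|N. g y * kk (x - y) ^ n) / cc n - g x\<bar> = \<bar>(LINT y|N. g y * kk (x - y) ^ n) - g x * cc n\<bar> / cc n"
  proof -
   have "(LINT y|N. g y * kk (x - y) ^ n) / cc n - g x = ((LINT y|N. g y * kk (x - y) ^ n) - g x * cc n) / cc n"
    using cpos[of n] by (simp add: field_simps)
   then show ?thesis using cpos[of n] by (simp add: abs_divide)
  qed
  also have "\<dots> \<le> (e/2 * cc n + 2 * M * V * q ^ n) / cc n" using a cpos[of n] by (intro divide_right_mono) auto
  also have "\<dots> = e/2 + 2 * M * V * q ^ n / cc n" using cpos[of n] by (simp add: add_divide_distrib)
  also have "2 * M * V * q ^ n / cc n \<le> 2 * M * V * q ^ n / (r ^ n * m)"
   using cn[of n] cpos[of n] r m M0 V q by (intro divide_left_mono) auto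
  also have "2 * M * V * q ^ n / (r ^ n * m) = (2 * M * V / m) * (q / r) ^ n" by (simp add: power_divide field_simps)
  finally show ?thesis by simp
 qed
 have "(%n. (2 * M * V / m) * (q / r) ^ n) \<longlonglongrightarrow> (2 * M * V / m) * 0"
  using q r by (intro tendsto_intros LIMSEQ_realpow_zero) auto
 then have "(%n. (2 * M * V / m) * (q / r) ^ n) \<longlonglongrightarrow> 0" by simp
 then obtain n0 where n0: "\<And>n. n \<ge> n0 ==> (2 * M * V / m) * (q / r) ^ n < e/2"
  using LIMSEQ_0_less[of _ "e/2"] e half_gt_zero by blast
 have "norm ((LINT y|N. g y * kk (x - y) ^ n) / cc n - g x) < e" if "n \<ge> n0" for n
  unfolding real_norm_def using main[of n] n0[OF that] by linarith
 then show "\<exists>no. \<forall>n\<ge>no. norm ((LINT y|N. g y * kk (x - y) ^ n) / cc n - g x) < e" by blast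
qed

lemma kernel_bound:
 assumes [measurable]: "g \<in> borel_measurable borel" and M: "\<And>y. \<bar>g y\<bar> \<le> M"
 shows "\<bar>(LINT y|N. g y * kk (x - y) ^ n) / cc n\<bar> \<le> M"
proof -
 have M0: "M \<ge> 0" using M[of 0] by linarith
 have c0: "cc n \<ge> 0" unfolding cc_def by (intro integral_nonneg_AE) (auto simp: kk_range)
 have ig: "integrable N (%y. g y * kk (x - y) ^ n)"
 proof (rule integrable_N_bounded[of _ M])
  fix y show "\<bar>g y * kk (x - y) ^ n\<bar> \<le> M"
   using M[of y] kk_range[of "x - y"] power_le_one[of "kk (x - y)" n] mult_mono[of "\<bar>g y\<bar>" M "kk (x - y) ^ n" 1] M0
   by (simp add: abs_mult)
 qed measurable
 have "\<bar>LINT y|N. g y * kk (x - y) ^ n\<bar> \<le> (LINT y|N. \<bar>g y * kk (x - y) ^ n\<bar>)" by (rule integral_abs_bound)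
 also have "\<dots> \<le> (LINT y|N. M * kk (x - y) ^ n)"
 proof (rule integral_mono)
  show "integrable N (%y. \<bar>g y * kk (x - y) ^ n\<bar>)" using ig by (rule integrable_abs)
  show "integrable N (%y. M * kk (x - y) ^ n)" using kk_integrable[of x n] by simp
  fix y
  have "0 \<le> kk (x - y) ^ n" using kk_range by simp
  then show "\<bar>g y * kk (x - y) ^ n\<bar> \<le> M * kk (x - y) ^ n"
   using M[of y] by (simp add: abs_mult mult_right_mono)
 qed
 also have "\<dots> = M * cc n" by (simp add: cc_eq)
 finally have "\<bar>LINT y|N. g y * kk (x - y) ^ n\<bar> \<le> M * cc n" .
 then show ?thesis
  using c0 M0 by (cases "cc n = 0") (auto simp: abs_div_pos[symmetric] pos_divide_le_eq)
qed

text \<open>Continuity almost everywhere is the right assumption, since g will be the indicator of a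
  box as well as a compactly supported function. The bound of g is inherited by its smoothed
  versions and yields the dominating function.\<close>

lemma kernel_limit:
 assumes R: "integrable N R" and [measurable]: "g \<in> borel_measurable borel" and M: "\<And>y. \<bar>g y\<bar> \<le> M"
  and c: "AE x in N. isCont g x"
 shows "(%n. (LINT x|N. R x * (LINT y|N. g y * kk (x - y) ^ n)) / cc n) \<longlonglongrightarrow> (LINT x|N. R x * g x)"
proof -
 have [measurable]: "R \<in> borel_measurable borel" using R by (auto dest: borel_measurable_integrable)
 have [measurable]: "(%x. LINT y|N. g y * kk (x - y) ^ n) \<in> borel_measurable borel" for n
  by (intro borel_measurable_param_integral N.sigma_finite_measure_axioms) auto
 have "(%n. (LINT x|N. R x * ((LINT y|N. g y * kk (x - y) ^ n) / cc n))) \<longlonglongrightarrow> (LINT x|N. R x * g x)"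
 proof (rule integral_dominated_convergence[where w="%x. M * \<bar>R x\<bar>"])
  show "AE x in N. (%n. R x * ((LINT y|N. g y * kk (x - y) ^ n) / cc n)) \<longlonglongrightarrow> R x * g x"
   using AE_N_Omega c
  proof eventually_elim
   case (elim x)
   show ?case by (intro tendsto_intros Laplace_kernel[where M=M] elim M) simp
  qed
  show "AE x in N. norm (R x * ((LINT y|N. g y * kk (x - y) ^ n) / cc n)) \<le> M * \<bar>R x\<bar>" for n
  proof (rule AE_I2)
   fix x
   have "\<bar>(LINT y|N. g y * kk (x - y) ^ n) / cc n\<bar> \<le> M" by (rule kernel_bound) (simp_all add: M)
   then have "\<bar>R x\<bar> * \<bar>(LINT y|N. g y * kk (x - y) ^ n) / cc n\<bar> \<le> \<bar>R x\<bar> * M" by (rule mult_left_mono) simp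
   then show "norm (R x * ((LINT y|N. g y * kk (x - y) ^ n) / cc n)) \<le> M * \<bar>R x\<bar>"
    by (simp only: real_norm_def abs_mult mult.commute[of M])
  qed
 qed (use R in auto)
 then show ?thesis by simp
qed

end

lemma integrable_pair_dominated:
 fixes f :: "'a::second_countable_topology => 'b::second_countable_topology => real"
 assumes "sigma_finite_measure M1" "finite_measure M2" and s: "sets M1 = sets borel" "sets M2 = sets borel"
  and R: "integrable M1 R" and f: "(%p. f (fst p) (snd p)) \<in> borel_measurable borel"
  and b: "AE x in M1. AE y in M2. \<bar>f x y\<bar> \<le> B * \<bar>R x\<bar>"
 shows "integrable (M1 \<Otimes>\<^sub>M M2) (%(x, y). f x y)"
proof -
 interpret M1: sigma_finite_measure M1 by fact
 interpret M2: finite_measure M2 by fact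
 interpret P: pair_sigma_finite M1 M2 ..
 have m: "(%(x, y). f x y) \<in> borel_measurable (M1 \<Otimes>\<^sub>M M2)"
  using f by (simp add: measurable_pair_borel[OF s] split_beta')
 have ms: "(%y. f x y) \<in> borel_measurable M2" for x
  using measurable_Pair2[OF m, of x] sets_eq_imp_space_eq[OF s(1)] by simp
 show ?thesis
 proof (rule P.Fubini_integrable[OF m])
  have ae: "AE x in M1. integrable M2 (%y. f x y)"
   using b
  proof eventually_elim
   case (elim x)
   show ?case by (rule M2.integrable_const_bound[of _ "B * \<bar>R x\<bar>"]) (use elim ms in auto)
  qed
  then show "AE x in M1. integrable M2 (%y. case (x, y) of (x, y) => f x y)" by simp
  have mi: "(%x. LINT y|M2. norm (case (x, y) of (x, y) => f x y)) \<in> borel_measurable M1"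
  proof -
   have "(%p. norm (case p of (x, y) => f x y)) \<in> borel_measurable (M1 \<Otimes>\<^sub>M M2)" using m by measurable
   then show ?thesis using M2.borel_measurable_lebesgue_integral[of "%x y. norm (f x y)" M1] by (simp add: split_beta')
  qed
  show "integrable M1 (%x. LINT y|M2. norm (case (x, y) of (x, y) => f x y))"
  proof (rule Bochner_Integration.integrable_bound[OF _ mi])
   show "integrable M1 (%x. (B * measure M2 (space M2)) * R x)" using R by simp
   show "AE x in M1. norm (LINT y|M2. norm (case (x, y) of (x, y) => f x y)) \<le> norm ((B * measure M2 (space M2)) * R x)"
    using b ae
   proof eventually_elim
    case (elim x)
    have "(LINT y|M2. \<bar>f x y\<bar>) \<le> (LINT y|M2. B * \<bar>R x\<bar>)"
     using elim by (intro integral_mono_AE) auto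
    also have "\<dots> = (B * measure M2 (space M2)) * \<bar>R x\<bar>" by simp
    also have "\<dots> \<le> norm ((B * measure M2 (space M2)) * R x)"
     unfolding real_norm_def abs_mult by (intro mult_right_mono mult_mono) auto
    finally show ?case by simp
   qed
  qed
 qed
qed

lemma compact_abs_bounded:
 fixes f :: "'a::topological_space => real"
 assumes "compact K" "continuous_on K f"
 obtains B where "B \<ge> 0" "\<And>x. x \<in> K ==> \<bar>f x\<bar> \<le> B"
proof -
 have "bounded (f ` K)" using compact_continuous_image[OF assms(2,1)] by (rule compact_imp_bounded)
 then obtain C where C: "\<forall>y\<in>f ` K. norm y \<le> C" by (auto simp: bounded_iff)
 have "\<bar>f x\<bar> \<le> max C 0" if "x \<in> K" for x using bspec[OF C imageI[OF that]] by simp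
 then show ?thesis using that[of "max C 0"] by simp
qed

context torus begin

lemma Fubini_NN:
 fixes f :: "point => point => real"
 assumes R: "integrable N R" and f: "(%p. f (fst p) (snd p)) \<in> borel_measurable borel"
  and b: "\<And>x y. x \<in> Omega l h ==> y \<in> Omega l h ==> \<bar>f x y\<bar> \<le> B * \<bar>R x\<bar>"
 shows "(LINT x|N. (LINT y|N. f x y)) = (LINT y|N. (LINT x|N. f x y))"
proof -
 interpret NN: pair_sigma_finite N N ..
 have "AE x in N. AE y in N. \<bar>f x y\<bar> \<le> B * \<bar>R x\<bar>"
  using AE_N_Omega
 proof eventually_elim
  case (elim x)
  show ?case using AE_N_Omega by eventually_elim (rule b[OF elim])
 qed
 then have "integrable (N \<Otimes>\<^sub>M N) (%(x, y). f x y)"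
  by (intro integrable_pair_dominated[OF N.sigma_finite_measure_axioms finite_N _ _ R f]) auto
 then show ?thesis by (rule NN.Fubini_integral[symmetric])
qed

lemma AE_box_isCont: "AE x in N. isCont (indicat_real (box a b)) x"
proof -
 have "negligible (frontier (box a b :: point set))" by (rule negligible_convex_frontier) simp
 then have "frontier (box a b :: point set) \<in> null_sets lborel"
  by (simp add: negligible_iff_null_sets null_sets_completion_iff)
 then have "AE x in lborel. x \<notin> frontier (box a b :: point set)" by (rule AE_not_in)
 then have "AE x in N. x \<notin> frontier (box a b)" unfolding AE_N by eventually_elim blast
 then show ?thesis unfolding isCont_indicator .
qed

lemma kk_joint [measurable]: "(%p. kk (fst p - snd p)) \<in> borel_measurable borel"
 by measurable

text \<open>Fubini turns the pairing of R with a smoothed box indicator into pairings with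
  translated kernels, which are test functions. In the limit R has zero integral over every
  box.\<close>

lemma test_orthogonal_AE_0:
 assumes R: "integrable N R" and t: "\<And>\<psi>. torus_test_function l h \<psi> ==> (LINT x|N. R x * \<psi> x) = 0"
 shows "AE x in N. R x = 0"
proof -
 have [measurable]: "R \<in> borel_measurable borel" using R by (auto dest: borel_measurable_integrable)
 have z: "(LINT x|N. R x * indicator (box a b) x) = 0" for a b
 proof -
  let ?g = "indicat_real (box a b)"
  have "(%n. (LINT x|N. R x * (LINT y|N. ?g y * kk (x - y) ^ n)) / cc n) \<longlonglongrightarrow> (LINT x|N. R x * ?g x)"
   by (rule kernel_limit[OF R _ _ AE_box_isCont, of _ _ 1]) (simp, simp add: indicator_def)
  moreover have "(LINT x|N. R x * (LINT y|N. ?g y * kk (x - y) ^ n)) = 0" for n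
  proof -
   have "(LINT x|N. R x * (LINT y|N. ?g y * kk (x - y) ^ n)) = (LINT x|N. (LINT y|N. R x * (?g y * kk (x - y) ^ n)))"
    by simp
   also have "\<dots> = (LINT y|N. (LINT x|N. R x * (?g y * kk (x - y) ^ n)))"
   proof (rule Fubini_NN[OF R, of _ 1])
    fix x y
    have "\<bar>?g y * kk (x - y) ^ n\<bar> \<le> 1" using kk_range[of "x - y"] by (auto simp: indicator_def power_le_one)
    then have "\<bar>R x\<bar> * \<bar>?g y * kk (x - y) ^ n\<bar> \<le> \<bar>R x\<bar> * 1" by (rule mult_left_mono) simp
    then show "\<bar>R x * (?g y * kk (x - y) ^ n)\<bar> \<le> 1 * \<bar>R x\<bar>" by (simp only: abs_mult[of "R x"] mult_1_right mult_1_left)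
   qed measurable
   also have "\<dots> = (LINT y|N. ?g y * (LINT x|N. R x * kk (x - y) ^ n))"
    unfolding mult.left_commute[of "R _"] integral_mult_right_zero ..
   also have "\<dots> = 0" using t[OF kk_test] by simp
   finally show ?thesis .
  qed
  ultimately show ?thesis by (simp add: LIMSEQ_const_iff)
 qed
 have "AE x in lborel. indicator (Omega l h) x * R x = 0"
 proof (rule integrable_zero_on_boxes)
  show "integrable lborel (%x. indicator (Omega l h) x * R x)"
   using R by (simp add: integrable_N set_integrable_def)
  show "(LINT x|lborel. indicator (box a b) x * (indicator (Omega l h) x * R x)) = 0" for a b
   using z[of a b] by (subst (asm) integral_N) (auto simp: set_lebesgue_integral_def mult_ac)
 qed
 then show ?thesis unfolding AE_N by eventually_elim auto
qed

section \<open>Weak derivatives on the torus\<close>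

text \<open>One component of \<open>torus_weak_gradient\<close>, written with the measure N so that
  its translation invariance can be used; \<open>torus_weak_gradient_iff\<close> links the
  two.\<close>

definition wgrad :: "(point => real) => (point => real) => point => bool" where
 "wgrad f g b \<longleftrightarrow> (\<forall>\<psi>. torus_test_function l h \<psi> -->
  (LINT x|N. f x * frechet_derivative \<psi> (at x) b) = - (LINT x|N. g x * \<psi> x))"

text \<open>The support of v is a compact subset of the open rectangle, so the product with \<kappa>
  continues by zero to the plane, where its derivative integrates to zero. Below \<kappa> is a
  periodic test function or a translated kernel.\<close>

lemma integral_by_parts_compact:
 assumes v: "Ck_compact 1 (Omega l h) v" and b: "b \<in> Basis"
  and k: "\<And>x. (\<kappa> has_derivative D x) (at x)" "continuous_on UNIV (%x. D x b)"
 shows "(LINT x|N. v x * D x b) = - (LINT x|N. frechet_derivative v (at x) b * \<kappa> x)"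
proof -
 let ?v' = "%x. frechet_derivative v (at x)"
 note v' = Ck_compact_Suc[OF v[unfolded One_nat_def] Omega_open]
 have cv: "continuous_on UNIV v" "continuous_on UNIV (%x. ?v' x b)"
  using Ck_compact_0_continuous[OF v'(3)] Ck_compact_0_continuous[OF v'(2)[OF b]] by auto
 have ck: "continuous_on UNIV \<kappa>" using k(1) by (intro continuous_at_imp_continuous_on ballI has_derivative_continuous)
 have s: "supp v \<subseteq> Omega l h" "compact (supp v)" using v by (auto simp: Ck_compact_def)
 have v0: "v x = 0" "?v' x b = 0" if "x \<notin> supp v" for x
 proof -
  show "v x = 0" using that by (rule notin_supp)
  have "eventually (%y. v y = 0) (nhds x)" using Ck_compact_outside[OF v that] .
  then have "(v has_derivative (%_. 0)) (at x)"
   using \<open>v x = 0\<close> by (intro has_derivative_transform_eventually[of "%_. 0" "%_. 0" x UNIV v]) (auto simp: eventually_at_filter elim: eventually_mono)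
  then show "?v' x b = 0" using frechet_derivative_at by metis
 qed
 have v00: "v x = 0" "?v' x b = 0" if "x \<notin> Omega l h" for x using v0[of x] s(1) that by blast+
 have "(LINT x|lborel. v x * D x b + ?v' x b * \<kappa> x) = 0"
 proof (rule integral_derivative_compact_support[where F="%x. v x * \<kappa> x" and K="supp v" and D="%x w. v x * D x w + ?v' x w * \<kappa> x"])
  show "((%x. v x * \<kappa> x) has_derivative (%w. v x * D x w + ?v' x w * \<kappa> x)) (at x)" for x
   by (rule has_derivative_mult[OF v'(1) k(1)])
  show "continuous_on UNIV (%x. v x * D x b + ?v' x b * \<kappa> x)" by (intro continuous_intros cv ck k)
 qed (use s v0 in auto)
 moreover have [measurable]: "v \<in> borel_measurable borel" "\<kappa> \<in> borel_measurable borel" "(%x. D x b) \<in> borel_measurable borel"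
  "(%x. ?v' x b) \<in> borel_measurable borel" using cv ck k by (auto intro: borel_measurable_continuous_onI)
 moreover have "(LINT x|N. v x * D x b + ?v' x b * \<kappa> x) = (LINT x|lborel. v x * D x b + ?v' x b * \<kappa> x)"
 proof -
  have "indicator (Omega l h) x *\<^sub>R (v x * D x b + ?v' x b * \<kappa> x) = v x * D x b + ?v' x b * \<kappa> x" for x
   by (cases "x \<in> Omega l h") (simp_all add: v00)
  then show ?thesis by (subst integral_N) (simp_all only: set_lebesgue_integral_def, measurable)
 qed
 moreover have "(LINT x|N. v x * D x b + ?v' x b * \<kappa> x) = (LINT x|N. v x * D x b) + (LINT x|N. ?v' x b * \<kappa> x)"
 proof (rule Bochner_Integration.integral_add)
  have one: "integrable N (%x. 1::real)" by simp
  show "integrable N (%x. v x * D x b)" "integrable N (%x. ?v' x b * \<kappa> x)"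
   using integrable_mult_cont[OF one continuous_on_mult[OF cv(1) k(2)]] integrable_mult_cont[OF one continuous_on_mult[OF cv(2) ck]]
   by simp_all
 qed
 ultimately show ?thesis by simp
qed

lemma wgrad_C1_compact:
 assumes v: "Ck_compact 1 (Omega l h) v" and b: "b \<in> Basis"
 shows "wgrad v (%x. frechet_derivative v (at x) b) b"
 unfolding wgrad_def by (intro allI impI integral_by_parts_compact[OF v b] torus_test_deriv[OF _] b)

lemma frechet_derivative_shift:
 assumes "\<And>x. (f has_derivative D x) (at x)"
 shows "frechet_derivative (%x. f (x + z)) (at x) = D (x + z)"
proof -
 have "((%x. f (x + z)) has_derivative D (x + z)) (at x)"
  by (rule has_derivative_compose[where f="%x. x + z", OF _ assms, THEN has_derivative_eq_rhs]) (auto intro!: derivative_eq_intros)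
 then show ?thesis using frechet_derivative_at by metis
qed

text \<open>Being merely C^1, v is not a test function itself. It is averaged against translated
  kernels, which are; \<open>p\<close> moves the derivative from the kernel to v, and the limit
  restores v. The result is applied with v a first derivative of the initial value.\<close>

lemma wgrad_against_C1_compact:
 assumes f: "integrable N f" and g: "integrable N g" and w: "wgrad f g b" and b: "b \<in> Basis"
  and v: "Ck_compact 1 (Omega l h) v"
 shows "(LINT x|N. f x * frechet_derivative v (at x) b) = - (LINT x|N. g x * v x)"
proof -
 have [measurable]: "f \<in> borel_measurable borel" "g \<in> borel_measurable borel" using f g by (auto dest: borel_measurable_integrable)
 let ?v' = "%x. frechet_derivative v (at x) b"
 note v' = Ck_compact_Suc[OF v[unfolded One_nat_def] Omega_open]
 have cv: "continuous_on UNIV v" "continuous_on UNIV ?v'"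
  using Ck_compact_0_continuous[OF v'(3)] Ck_compact_0_continuous[OF v'(2)[OF b]] by auto
 have [measurable]: "v \<in> borel_measurable borel" "?v' \<in> borel_measurable borel"
  using cv by (auto intro: borel_measurable_continuous_onI)
 obtain V where V: "V \<ge> 0" "\<And>x. \<bar>v x\<bar> \<le> V" using Ck_compact_bounded[OF v'(3)] by auto
 obtain V' where V': "V' \<ge> 0" "\<And>x. \<bar>?v' x\<bar> \<le> V'" using Ck_compact_bounded[OF v'(2)[OF b]] by auto
 have eq: "(LINT x|N. f x * (LINT y|N. ?v' y * kk (x - y) ^ n)) = - (LINT x|N. g x * (LINT y|N. v y * kk (x - y) ^ n))" for n
 proof -
  let ?k = "%x. kk x ^ n"
  have tk: "torus_test_function l h ?k" using kk_test[of 0 n] by simp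
  let ?D = "%x. frechet_derivative ?k (at x)"
  note dk = torus_test_deriv[OF tk]
  have [measurable]: "(%x. ?D x b) \<in> borel_measurable borel" using dk(2)[OF b] by (rule borel_measurable_continuous_onI)
  have "compact {x - y |x y. x \<in> closure (Omega l h) \<and> y \<in> closure (Omega l h)}"
   by (intro compact_differences) auto
  moreover have "continuous_on {x - y |x y. x \<in> closure (Omega l h) \<and> y \<in> closure (Omega l h)} (%z. ?D z b)"
   by (rule continuous_on_subset[OF dk(2)[OF b]]) simp
  ultimately obtain B where "B \<ge> 0" "\<And>z. z \<in> {x - y |x y. x \<in> closure (Omega l h) \<and> y \<in> closure (Omega l h)} ==> \<bar>?D z b\<bar> \<le> B"
   by (rule compact_abs_bounded) blast
  then have B: "\<bar>?D (x - y) b\<bar> \<le> B" if "x \<in> Omega l h" "y \<in> Omega l h" for x y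
   using that closure_subset[of "Omega l h"] by blast
  have fd: "frechet_derivative (%x. kk (x - y) ^ n) (at x) = ?D (x - y)" for x y
   using frechet_derivative_shift[OF dk(1), of "-y" x] by simp
  have p: "(LINT y|N. v y * ?D (x - y) b) = (LINT y|N. ?v' y * kk (x - y) ^ n)" for x
  proof -
   have "(LINT y|N. v y * (- ?D (x - y) b)) = - (LINT y|N. ?v' y * kk (x - y) ^ n)"
   proof (rule integral_by_parts_compact[OF v b, where D="%y w. - ?D (x - y) w"])
    show "((%y. kk (x - y) ^ n) has_derivative (%w. - ?D (x - y) w)) (at y)" for y
    proof (rule has_derivative_compose[where f="%y. x - y" and g="?k", OF _ dk(1), THEN has_derivative_eq_rhs])
     show "((-) x has_derivative (%w. - w)) (at y)" by (auto intro!: derivative_eq_intros)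
     show "(%w. ?D (x - y) (- w)) = (%w. - ?D (x - y) w)"
      using linear_neg[OF has_derivative_linear[OF dk(1)]] by (auto simp: fun_eq_iff)
    qed
    show "continuous_on UNIV (%y. - ?D (x - y) b)"
     by (intro continuous_intros continuous_on_compose2[OF dk(2)[OF b]]) auto
   qed
   then show ?thesis by simp
  qed
  have "(LINT x|N. f x * (LINT y|N. ?v' y * kk (x - y) ^ n)) = (LINT x|N. (LINT y|N. f x * (v y * ?D (x - y) b)))"
   by (simp add: p)
  also have "\<dots> = (LINT y|N. (LINT x|N. f x * (v y * ?D (x - y) b)))"
  proof (rule Fubini_NN[OF f, of _ "V * B"])
   fix x y assume xy: "x \<in> Omega l h" "y \<in> Omega l h"
   have "\<bar>v y\<bar> * \<bar>?D (x - y) b\<bar> \<le> V * B" using V B[OF xy] by (intro mult_mono) auto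
   then have "\<bar>f x\<bar> * \<bar>v y * ?D (x - y) b\<bar> \<le> \<bar>f x\<bar> * (V * B)" unfolding abs_mult[of "v y"] by (rule mult_left_mono) simp
   then show "\<bar>f x * (v y * ?D (x - y) b)\<bar> \<le> V * B * \<bar>f x\<bar>" by (simp only: abs_mult[of "f x"] mult.commute)
  qed measurable
  also have "\<dots> = (LINT y|N. v y * (LINT x|N. f x * ?D (x - y) b))"
   unfolding mult.left_commute[of "f _"] integral_mult_right_zero ..
  also have "\<dots> = (LINT y|N. v y * (- (LINT x|N. g x * kk (x - y) ^ n)))"
   using w kk_test unfolding wgrad_def fd[symmetric] by simp
  also have "\<dots> = - (LINT y|N. (LINT x|N. g x * (v y * kk (x - y) ^ n)))"
   unfolding mult.left_commute[of "g _"] integral_mult_right_zero by simp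
  also have "(LINT y|N. (LINT x|N. g x * (v y * kk (x - y) ^ n))) = (LINT x|N. (LINT y|N. g x * (v y * kk (x - y) ^ n)))"
  proof (rule Fubini_NN[OF g, of _ V, symmetric])
   fix x y
   have "\<bar>v y\<bar> * \<bar>kk (x - y) ^ n\<bar> \<le> V * 1" using V kk_range[of "x - y"] by (intro mult_mono) (auto simp: power_le_one)
   then have "\<bar>g x\<bar> * \<bar>v y * kk (x - y) ^ n\<bar> \<le> \<bar>g x\<bar> * (V * 1)" unfolding abs_mult[of "v y"] by (rule mult_left_mono) simp
   then show "\<bar>g x * (v y * kk (x - y) ^ n)\<bar> \<le> V * \<bar>g x\<bar>" by (simp only: abs_mult[of "g x"] mult.commute mult_1_left)
  qed measurable
  finally show ?thesis by simp
 qed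
 have c: "AE x in N. isCont v x" "AE x in N. isCont ?v' x" using cv by (auto simp: continuous_on_eq_continuous_at)
 have "(%n. (LINT x|N. f x * (LINT y|N. ?v' y * kk (x - y) ^ n)) / cc n) \<longlonglongrightarrow> (LINT x|N. f x * ?v' x)"
  by (rule kernel_limit[OF f _ V'(2) c(2)]) measurable
 moreover have "(%n. - ((LINT x|N. g x * (LINT y|N. v y * kk (x - y) ^ n)) / cc n)) \<longlonglongrightarrow> - (LINT x|N. g x * v x)"
  by (intro tendsto_intros kernel_limit[OF g _ V(2) c(1)]) measurable
 ultimately show ?thesis unfolding eq by (simp add: LIMSEQ_unique)
qed

lemma wgrad_shift:
 assumes w: "wgrad f g b" and [measurable]: "f \<in> borel_measurable borel" "g \<in> borel_measurable borel" and b: "b \<in> Basis"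
 shows "wgrad (%x. f (shf z x)) (%x. g (shf z x)) b"
 unfolding wgrad_def
proof (intro allI impI)
 fix \<psi> assume t: "torus_test_function l h \<psi>"
 note d = torus_test_deriv[OF t]
 have ts: "torus_test_function l h (%x. \<psi> (x + (-z)))" by (rule torus_test_shift[OF t])
 have [measurable]: "\<psi> \<in> borel_measurable borel" "(%x. frechet_derivative \<psi> (at x) b) \<in> borel_measurable borel"
  by (intro borel_measurable_continuous_onI d b)+
 have fd: "frechet_derivative (%x. \<psi> (x + (-z))) (at x) = frechet_derivative \<psi> (at (x + (-z)))" for x
  by (rule frechet_derivative_shift[OF d(1)])
 have [measurable]: "(%x. frechet_derivative \<psi> (at (x + (-z))) b) \<in> borel_measurable borel"
  by (rule measurable_compose[of "%x. x + (-z)" borel borel "%x. frechet_derivative \<psi> (at x) b"]) measurable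
 have [measurable]: "(%x. frechet_derivative \<psi> (at (shf (-z) x)) b) \<in> borel_measurable borel"
  by (rule measurable_compose[of "shf (-z)" borel borel "%x. frechet_derivative \<psi> (at x) b"]) measurable
 \<comment> \<open>Wrapping moves the point by a lattice vector; the test function, and with it its
   derivative, is invariant under such a move.\<close>
 have fds: "frechet_derivative \<psi> (at (shf (-z) x)) b = frechet_derivative \<psi> (at (x + (-z))) b" for x
 proof -
  obtain m n where "shf (-z) x = x + (-z) + (2 * l * of_int m, h * of_int n)" using wrp_lattice[of "x + (-z)"] by (auto simp: shf_def)
  moreover have "(%x. \<psi> (x + (2 * l * of_int m, h * of_int n))) = \<psi>" using torus_test_lattice[OF t] by auto
  ultimately show ?thesis using frechet_derivative_shift[OF d(1), of "(2 * l * of_int m, h * of_int n)" "x + (-z)"] by simp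
 qed
 have "(LINT x|N. f (shf z x) * frechet_derivative \<psi> (at x) b) = (LINT x|N. f (shf z (shf (-z) x)) * frechet_derivative \<psi> (at (shf (-z) x)) b)"
  by (rule integral_shf[symmetric, where f="%x. f (shf z x) * frechet_derivative \<psi> (at x) b"]) measurable
 also have "\<dots> = (LINT x|N. f x * frechet_derivative (%x. \<psi> (x + (-z))) (at x) b)"
  unfolding fd by (rule integral_cong_AE, simp, simp, use AE_N_Omega in eventually_elim) (simp_all only: shf_inverse fds)
 also have "\<dots> = - (LINT x|N. g x * \<psi> (x + (-z)))" using w ts by (auto simp: wgrad_def)
 also have "(LINT x|N. g x * \<psi> (x + (-z))) = (LINT x|N. g (shf z (shf (-z) x)) * \<psi> (shf (-z) x))"
  by (rule integral_cong_AE, measurable, use AE_N_Omega in eventually_elim) (simp_all add: shf_inverse torus_test_shf[OF t])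
 also have "\<dots> = (LINT x|N. g (shf z x) * \<psi> x)"
  by (rule integral_shf[where f="%x. g (shf z x) * \<psi> x"]) measurable
 finally show "(LINT x|N. f (shf z x) * frechet_derivative \<psi> (at x) b) = - (LINT x|N. g (shf z x) * \<psi> x)" .
qed

lemma wgrad_linear:
 assumes "wgrad f g b" "wgrad f' g' b" and i: "integrable N f" "integrable N g" "integrable N f'" "integrable N g'" and b: "b \<in> Basis"
 shows "wgrad (%x. c * f x + d * f' x) (%x. c * g x + d * g' x) b"
 unfolding wgrad_def
proof (intro allI impI)
 fix \<psi> assume t: "torus_test_function l h \<psi>"
 note dd = torus_test_deriv[OF t]
 have j: "integrable N (%x. f x * frechet_derivative \<psi> (at x) b)" "integrable N (%x. f' x * frechet_derivative \<psi> (at x) b)"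
  "integrable N (%x. g x * \<psi> x)" "integrable N (%x. g' x * \<psi> x)"
  by (intro integrable_mult_cont i dd b)+
 have "(LINT x|N. (c * f x + d * f' x) * frechet_derivative \<psi> (at x) b) =
  (LINT x|N. c * (f x * frechet_derivative \<psi> (at x) b) + d * (f' x * frechet_derivative \<psi> (at x) b))"
  by (simp add: algebra_simps)
 also have "\<dots> = c * (LINT x|N. f x * frechet_derivative \<psi> (at x) b) + d * (LINT x|N. f' x * frechet_derivative \<psi> (at x) b)"
  using j by simp
 also have "\<dots> = - (c * (LINT x|N. g x * \<psi> x) + d * (LINT x|N. g' x * \<psi> x))"
  using assms(1,2) t by (simp add: wgrad_def)
 also have "\<dots> = - (LINT x|N. c * (g x * \<psi> x) + d * (g' x * \<psi> x))" using j by simp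
 also have "(LINT x|N. c * (g x * \<psi> x) + d * (g' x * \<psi> x)) = (LINT x|N. (c * g x + d * g' x) * \<psi> x)"
  by (simp add: algebra_simps)
 finally show "(LINT x|N. (c * f x + d * f' x) * frechet_derivative \<psi> (at x) b) = - (LINT x|N. (c * g x + d * g' x) * \<psi> x)" .
qed

text \<open>A mean value formula for weakly differentiable functions. After pairing with a test
  function the translation sits on the test function, where the classical fundamental theorem
  applies; the weak derivative and Fubini carry everything back, and
  \<open>test_orthogonal_AE_0\<close> removes the test function.\<close>

lemma wgrad_shift_repr:
 assumes f: "integrable N f" and g: "integrable N g" and w: "wgrad f g b" and b: "b \<in> Basis"
 shows "AE x in N. f (shf (s *\<^sub>R b) x) - f x = s * (LINT \<sigma>|lborel. indicator {0..1} \<sigma> * g (shf ((\<sigma> * s) *\<^sub>R b) x))"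
proof -
 have [measurable]: "f \<in> borel_measurable borel" "g \<in> borel_measurable borel" using f g by (auto dest: borel_measurable_integrable)
 define J where "J x = (LINT \<sigma>|lborel. indicator {0..1} \<sigma> * g (shf ((\<sigma> * s) *\<^sub>R b) x))" for x
 let ?H = "%(\<sigma>, x). indicator {0..1} \<sigma> * g (shf ((\<sigma> * s) *\<^sub>R b) x)"
 have mH: "(%p. ?H p) \<in> borel_measurable borel"
  unfolding split_beta shf_def by measurable
 have igs: "integrable N (%x. g (shf z x))" "integrable N (%x. f (shf z x))" for z
  using f g by (simp_all add: integrable_shf)
 have iH: "integrable M3 ?H"
  unfolding M3_def
 proof (rule P.Fubini_integrable)
  show "?H \<in> borel_measurable (lborel \<Otimes>\<^sub>M N)" using mH by (simp only: M3_def[symmetric] measurable_M3)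
  have "(LINT y|N. norm (?H (x, y))) = indicator {0..1} x * (LINT y|N. \<bar>g y\<bar>)" for x
   using integral_shf[of "%y. \<bar>g y\<bar>" "(x * s) *\<^sub>R b"] by (simp add: abs_mult)
  then show "integrable lborel (%x. LINT y|N. norm (?H (x, y)))" by simp
  show "AE x in lborel. integrable N (%y. ?H (x, y))" using igs by simp
 qed
 have iJ: "integrable N J" using integral_M3(6)[OF iH] by (simp add: J_def[abs_def])
 have "AE x in N. f (shf (s *\<^sub>R b) x) - f x - s * J x = 0"
 proof (rule test_orthogonal_AE_0)
  show "integrable N (%x. f (shf (s *\<^sub>R b) x) - f x - s * J x)" using igs f iJ by simp
  fix \<psi> assume t: "torus_test_function l h \<psi>"
  note d = torus_test_deriv[OF t]
  have [measurable]: "\<psi> \<in> borel_measurable borel" using d(3) by (rule borel_measurable_continuous_onI)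
  have sh: "(LINT x|N. q (shf z x) * \<psi> x) = (LINT x|N. q x * \<psi> (x + (-z)))" if [measurable]: "q \<in> borel_measurable borel" for q z
  proof -
   have "(LINT x|N. q (shf z x) * \<psi> x) = (LINT x|N. q (shf z (shf (-z) x)) * \<psi> (shf (-z) x))"
    by (rule integral_shf[symmetric, where f="%x. q (shf z x) * \<psi> x"]) measurable
   also have "\<dots> = (LINT x|N. q x * \<psi> (x + (-z)))"
    by (rule integral_cong_AE, measurable, use AE_N_Omega in eventually_elim) (simp_all add: shf_inverse torus_test_shf[OF t])
   finally show ?thesis .
  qed
  let ?D = "%x. frechet_derivative \<psi> (at x) b"
  have [measurable]: "?D \<in> borel_measurable borel" using d(2)[OF b] by (rule borel_measurable_continuous_onI)
  obtain B where "B \<ge> 0" "\<And>x. x \<in> Omega l h ==> \<bar>\<psi> x\<bar> \<le> B" using bounded_on_Omega[OF d(3)] by metis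
  \<comment> \<open>The minus signs arise because the test function is translated by the opposite
    vector.\<close>
  have ftc: "\<psi> (x + (- (s *\<^sub>R b))) - \<psi> x = - s * (LINT \<sigma>|lborel. indicator {0..1} \<sigma> * ?D (x + (- ((\<sigma> * s) *\<^sub>R b))))" for x
  proof -
   have "(LINT \<sigma>|lborel. (- s * ?D (x + (- ((\<sigma> * s) *\<^sub>R b)))) * indicator {0..1} \<sigma>) = \<psi> (x + (- ((1 * s) *\<^sub>R b))) - \<psi> (x + (- ((0 * s) *\<^sub>R b)))"
   proof (rule integral_FTC_Icc_real)
    fix \<sigma> :: real
    have "((%\<sigma>. \<psi> (x + (- ((\<sigma> * s) *\<^sub>R b)))) has_derivative (%h. frechet_derivative \<psi> (at (x + (- ((\<sigma> * s) *\<^sub>R b)))) ((-h * s) *\<^sub>R b))) (at \<sigma>)"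
     by (rule has_derivative_compose[where f="%\<sigma>. x + (- ((\<sigma> * s) *\<^sub>R b))", OF _ d(1)]) (auto intro!: derivative_eq_intros)
    moreover have "frechet_derivative \<psi> (at y) ((-h * s) *\<^sub>R b) = (- s * ?D y) * h" for h y
     using linear_scale[OF has_derivative_linear[OF d(1)], of y "- h * s" b] by simp
    ultimately show "((%\<sigma>. \<psi> (x + (- ((\<sigma> * s) *\<^sub>R b)))) has_real_derivative (- s * ?D (x + (- ((\<sigma> * s) *\<^sub>R b))))) (at \<sigma>)"
     by (simp only: has_field_derivative_def)
    have "continuous_on UNIV (%\<sigma>. - s * ?D (x + (- ((\<sigma> * s) *\<^sub>R b))))"
     by (intro continuous_intros continuous_on_compose2[OF d(2)[OF b]]) auto
    then show "isCont (%\<sigma>. - s * ?D (x + (- ((\<sigma> * s) *\<^sub>R b)))) \<sigma>" by (auto simp: continuous_on_eq_continuous_at)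
   qed simp
   then have "\<psi> (x + (- (s *\<^sub>R b))) - \<psi> x = (LINT \<sigma>|lborel. - s * (indicator {0..1} \<sigma> * ?D (x + (- ((\<sigma> * s) *\<^sub>R b)))))"
    by (simp add: mult_ac)
   then show ?thesis by simp
  qed
  obtain BD where BD: "BD \<ge> 0" "\<And>\<sigma> x. \<sigma> \<in> {0..1} ==> x \<in> Omega l h ==> \<bar>?D (x + (- ((\<sigma> * s) *\<^sub>R b)))\<bar> \<le> BD"
  proof -
   have "compact ({0..1::real} \<times> closure (Omega l h))" by (intro compact_Times) auto
   moreover have "continuous_on ({0..1::real} \<times> closure (Omega l h)) (%p. ?D (snd p + (- ((fst p * s) *\<^sub>R b))))"
    by (intro continuous_on_compose2[OF d(2)[OF b]] continuous_intros) auto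
   ultimately obtain C where C: "C \<ge> 0" "\<And>p. p \<in> {0..1} \<times> closure (Omega l h) ==> \<bar>?D (snd p + (- ((fst p * s) *\<^sub>R b)))\<bar> \<le> C"
    by (rule compact_abs_bounded) blast
   have "\<bar>?D (x + (- ((\<sigma> * s) *\<^sub>R b)))\<bar> \<le> C" if "\<sigma> \<in> {0..1}" "x \<in> Omega l h" for \<sigma> x
    using C(2)[of "(\<sigma>, x)"] that closure_subset[of "Omega l h"] by auto
   then show ?thesis using that C(1) by blast
  qed
  let ?K = "%(\<sigma>, x). indicator {0..1} \<sigma> * (f x * ?D (x + (- ((\<sigma> * s) *\<^sub>R b))))"
  have mK: "?K \<in> borel_measurable borel" unfolding split_beta by measurable
  have iK: "integrable M3 ?K"
   unfolding M3_def
  proof (rule P.Fubini_integrable)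
   show mK': "?K \<in> borel_measurable (lborel \<Otimes>\<^sub>M N)" using mK by (simp only: M3_def[symmetric] measurable_M3)
   show ae: "AE x in lborel. integrable N (%y. ?K (x, y))"
   proof (rule AE_I2)
    fix \<sigma> :: real
    have "continuous_on UNIV (%x. indicator {0..1} \<sigma> * ?D (x + (- ((\<sigma> * s) *\<^sub>R b))))"
     by (intro continuous_intros continuous_on_compose2[OF d(2)[OF b]]) auto
    from integrable_mult_cont[OF f this] show "integrable N (%y. ?K (\<sigma>, y))" by (simp add: mult_ac)
   qed
   have "(%x. LINT y|N. norm (?K (x, y))) \<in> borel_measurable borel"
    unfolding split_beta fst_conv snd_conv by (intro borel_measurable_param_integral N.sigma_finite_measure_axioms) auto
   then have m: "(%x. LINT y|N. norm (?K (x, y))) \<in> borel_measurable lborel" by simp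
   show "integrable lborel (%x. LINT y|N. norm (?K (x, y)))"
   proof (rule Bochner_Integration.integrable_bound[OF _ m])
    show "integrable lborel (%\<sigma>. indicator {0..1::real} \<sigma> * (BD * (LINT x|N. \<bar>f x\<bar>)))" by simp
    show "AE \<sigma> in lborel. norm (LINT y|N. norm (?K (\<sigma>, y))) \<le> norm (indicator {0..1::real} \<sigma> * (BD * (LINT x|N. \<bar>f x\<bar>)))"
     using ae
    proof eventually_elim
     case (elim \<sigma>)
     have "(LINT y|N. norm (?K (\<sigma>, y))) \<le> (LINT y|N. indicator {0..1::real} \<sigma> * (BD * \<bar>f y\<bar>))"
     proof (rule integral_mono_AE)
      show "AE y in N. norm (?K (\<sigma>, y)) \<le> indicator {0..1::real} \<sigma> * (BD * \<bar>f y\<bar>)"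
       using AE_N_Omega
      proof eventually_elim
       case (elim y)
       show ?case
       proof (cases "\<sigma> \<in> {0..1}")
        case True
        then show ?thesis using mult_left_mono[OF BD(2)[OF True elim], of "\<bar>f y\<bar>"] by (simp add: abs_mult mult.commute)
       qed simp
      qed
     qed (use elim f in auto)
     also have "\<dots> = indicator {0..1::real} \<sigma> * (BD * (LINT x|N. \<bar>f x\<bar>))" by simp
     finally have "(LINT y|N. norm (?K (\<sigma>, y))) \<le> indicator {0..1::real} \<sigma> * (BD * (LINT x|N. \<bar>f x\<bar>))" .
     moreover have "0 \<le> (LINT y|N. norm (?K (\<sigma>, y)))" by (intro integral_nonneg_AE) auto
     ultimately show ?case unfolding real_norm_def by linarith
    qed
   qed
  qed
  have iHp: "integrable M3 (%p. ?H p * \<psi> (snd p))"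
  proof (rule Bochner_Integration.integrable_bound[of M3 "%p. B * ?H p"])
   show "integrable M3 (%p. B * ?H p)" using iH by simp
   show "(%p. ?H p * \<psi> (snd p)) \<in> borel_measurable M3" unfolding measurable_M3 by (rule borel_measurable_times[OF mH]) measurable
   show "AE p in M3. norm (?H p * \<psi> (snd p)) \<le> norm (B * ?H p)"
    using AE_M3_Omega
   proof eventually_elim
    case (elim p)
    have "\<bar>?H p\<bar> * \<bar>\<psi> (snd p)\<bar> \<le> \<bar>?H p\<bar> * B" by (intro mult_left_mono \<open>\<And>x. x \<in> Omega l h ==> \<bar>\<psi> x\<bar> \<le> B\<close> elim) simp
    then show ?case using \<open>B \<ge> 0\<close> unfolding real_norm_def abs_mult by (simp add: mult.commute)
   qed
  qed
  have "(LINT x|N. f (shf (s *\<^sub>R b) x) * \<psi> x) - (LINT x|N. f x * \<psi> x) = (LINT x|N. f x * \<psi> (x + (-(s *\<^sub>R b)))) - (LINT x|N. f x * \<psi> x)"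
   by (subst sh) auto
  also have "\<dots> = (LINT x|N. f x * \<psi> (x + (-(s *\<^sub>R b))) - f x * \<psi> x)"
  proof (rule Bochner_Integration.integral_diff[symmetric])
   have "continuous_on UNIV (%x. \<psi> (x + (-(s *\<^sub>R b))))"
    by (rule continuous_on_compose2[OF d(3)]) (intro continuous_intros, simp)
   then show "integrable N (%x. f x * \<psi> (x + (-(s *\<^sub>R b))))" by (rule integrable_mult_cont[OF f])
  qed (rule integrable_mult_cont[OF f d(3)])
  also have "\<dots> = (LINT x|N. - s * (LINT \<sigma>|lborel. ?K (\<sigma>, x)))"
  proof (rule Bochner_Integration.integral_cong[OF refl])
   fix x
   have "f x * \<psi> (x + (-(s *\<^sub>R b))) - f x * \<psi> x = f x * (\<psi> (x + (-(s *\<^sub>R b))) - \<psi> x)" by (simp add: right_diff_distrib)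
   also have "\<dots> = - s * (f x * (LINT \<sigma>|lborel. indicator {0..1} \<sigma> * ?D (x + (- ((\<sigma> * s) *\<^sub>R b)))))"
    unfolding ftc by simp
   also have "\<dots> = - s * (LINT \<sigma>|lborel. ?K (\<sigma>, x))" by (simp add: mult.left_commute)
   finally show "f x * \<psi> (x + (-(s *\<^sub>R b))) - f x * \<psi> x = - s * (LINT \<sigma>|lborel. ?K (\<sigma>, x))" .
  qed
  also have "\<dots> = - s * (LINT \<sigma>|lborel. (LINT x|N. ?K (\<sigma>, x)))"
   using integral_M3(1,2)[OF iK] by simp
  also have "(LINT \<sigma>|lborel. (LINT x|N. ?K (\<sigma>, x))) = (LINT \<sigma>|lborel. indicator {0..1} \<sigma> * (- (LINT x|N. g (shf ((\<sigma> * s) *\<^sub>R b) x) * \<psi> x)))"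
  proof (rule Bochner_Integration.integral_cong[OF refl])
   fix \<sigma> :: real
   let ?z = "(\<sigma> * s) *\<^sub>R b"
   have "(LINT x|N. f x * ?D (x + (- ?z))) = (LINT x|N. f x * frechet_derivative (%x. \<psi> (x + (- ?z))) (at x) b)"
    by (simp only: frechet_derivative_shift[OF d(1)])
   also have "\<dots> = - (LINT x|N. g x * \<psi> (x + (- ?z)))"
    using w torus_test_shift[OF t, of "- ?z"] unfolding wgrad_def by blast
   also have "(LINT x|N. g x * \<psi> (x + (- ?z))) = (LINT x|N. g (shf ?z x) * \<psi> x)" by (subst sh) auto
   finally show "(LINT x|N. ?K (\<sigma>, x)) = indicator {0..1} \<sigma> * (- (LINT x|N. g (shf ?z x) * \<psi> x))" by simp
  qed
  also have "\<dots> = - (LINT \<sigma>|lborel. (LINT x|N. ?H (\<sigma>, x) * \<psi> x))"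
   by (simp add: mult.assoc)
  also have "(LINT \<sigma>|lborel. (LINT x|N. ?H (\<sigma>, x) * \<psi> x)) = (LINT x|N. (LINT \<sigma>|lborel. ?H (\<sigma>, x) * \<psi> x))"
   using integral_M3(1,2)[OF iHp] by simp
  also have "\<dots> = (LINT x|N. J x * \<psi> x)" by (simp add: J_def)
  finally have fin: "(LINT x|N. f (shf (s *\<^sub>R b) x) * \<psi> x) - (LINT x|N. f x * \<psi> x) = s * (LINT x|N. J x * \<psi> x)" by simp
  have "(LINT x|N. (f (shf (s *\<^sub>R b) x) - f x - s * J x) * \<psi> x) =
   (LINT x|N. f (shf (s *\<^sub>R b) x) * \<psi> x - f x * \<psi> x - s * (J x * \<psi> x))" by (simp add: algebra_simps)
  also have "\<dots> = (LINT x|N. f (shf (s *\<^sub>R b) x) * \<psi> x) - (LINT x|N. f x * \<psi> x) - s * (LINT x|N. J x * \<psi> x)"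
   using integrable_mult_cont[OF f d(3)] integrable_mult_cont[OF iJ d(3)] integrable_mult_cont[OF igs(2) d(3)] by simp
  finally show "(LINT x|N. (f (shf (s *\<^sub>R b) x) - f x - s * J x) * \<psi> x) = 0" using fin by simp
 qed
 then show ?thesis by eventually_elim (simp add: J_def)
qed

end

section \<open>Smooth bumps on the line\<close>

text \<open>For positive t this is t^(-m) exp(-1/t), so \<open>beta 0\<close> is the usual smooth
  cutoff. The powers are included because the derivative of a member is a combination of two further
  members.\<close>

definition beta :: "nat => real => real" where
 "beta m t = (if t > 0 then inverse t ^ m / exp (inverse t) else 0)"

lemma beta_tendsto_0: "((%t. inverse t ^ m / exp (inverse t)) \<longlongrightarrow> (0::real)) (at_right 0)"
 by (rule filterlim_compose[OF tendsto_power_div_exp_0 filterlim_inverse_at_top_right])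

lemma beta_DERIV: "(beta m has_real_derivative (beta (m + 2) t - real m * beta (m + 1) t)) (at t)"
proof -
 consider "t > 0" | "t < 0" | "t = 0" by linarith
 then show ?thesis
 proof cases
  case 1
  have "((%t. inverse t ^ m / exp (inverse t)) has_real_derivative (inverse t ^ (m + 2) / exp (inverse t) - real m * (inverse t ^ (m + 1) / exp (inverse t)))) (at t)"
  proof -
   let ?y = "inverse t"
   have 1: "((%y. y ^ m / exp y) has_real_derivative ((real m * ?y ^ (m - 1) - ?y ^ m) / exp ?y)) (at ?y)"
   proof -
    have "((%y. y ^ m / exp y) has_real_derivative ((real m * ?y ^ (m - 1)) * exp ?y - ?y ^ m * exp ?y) / (exp ?y * exp ?y)) (at ?y)"
     using DERIV_divide[OF DERIV_pow[of m ?y UNIV] DERIV_exp[of ?y]] by simp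
    then show ?thesis by (simp flip: left_diff_distrib)
   qed
   have 2: "(inverse has_real_derivative - (?y ^ Suc (Suc 0))) (at t)" using \<open>t > 0\<close> by (intro DERIV_inverse) auto
   have A: "real m * ?y ^ (m - 1) * ?y ^ Suc (Suc 0) = real m * ?y ^ (m + 1)" by (cases m) auto
   have B: "?y ^ m * ?y ^ Suc (Suc 0) = ?y ^ (m + 2)" by (simp only: power_add[symmetric]) simp
   have "(P - Q) / R * - S = Q * S / R - P * S / R" for P Q R S :: real by (simp add: diff_divide_distrib algebra_simps)
   from this[of "real m * ?y ^ (m - 1)" "?y ^ m" "exp ?y" "?y ^ Suc (Suc 0)"]
   have 3: "(real m * ?y ^ (m - 1) - ?y ^ m) / exp ?y * - (?y ^ Suc (Suc 0)) = ?y ^ (m + 2) / exp ?y - real m * (?y ^ (m + 1) / exp ?y)"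
    unfolding A B by simp
   show ?thesis using DERIV_chain2[OF 1 2] unfolding 3 .
  qed
  moreover have "eventually (%s. inverse s ^ m / exp (inverse s) = beta m s) (nhds t)"
   using eventually_nhds_in_open[of "{0<..}" t] 1 by (auto simp: beta_def elim: eventually_mono)
  ultimately show ?thesis using 1
   by (subst DERIV_cong_ev[OF refl _ refl, of _ "%t. inverse t ^ m / exp (inverse t)"]) (auto simp: beta_def elim: eventually_mono)
 next
  case 2
  have "eventually (%s. beta m s = 0) (nhds t)"
   using eventually_nhds_in_open[of "{..<0}" t] 2 by (auto simp: beta_def elim: eventually_mono)
  then have "(beta m has_real_derivative 0) (at t) \<longleftrightarrow> ((%_. 0) has_real_derivative 0) (at t)"
   by (intro DERIV_cong_ev) auto
  then show ?thesis using 2 by (simp add: beta_def)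
 next
  case 3
  \<comment> \<open>From the right the difference quotient at zero is the next member
    \<open>beta (m + 1) h\<close>, which tends to zero.\<close>
  have "((%h. beta m h / h) \<longlongrightarrow> 0) (at_right 0)"
  proof (rule tendsto_cong[THEN iffD1, OF _ beta_tendsto_0[of "Suc m"]])
   show "\<forall>\<^sub>F h in at_right 0. inverse h ^ Suc m / exp (inverse h) = beta m h / h"
    using eventually_at_right_less[of 0] by eventually_elim (simp add: beta_def field_simps)
  qed
  moreover have "((%h. beta m h / h) \<longlongrightarrow> 0) (at_left 0)"
   by (rule tendsto_eventually) (use eventually_at_left_real[of "-1" 0] in \<open>auto simp: beta_def elim: eventually_mono\<close>)
  ultimately have "((%h. beta m h / h) \<longlongrightarrow> 0) (at 0)" by (simp add: filterlim_split_at)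
  then show ?thesis using 3 by (simp add: DERIV_def beta_def)
 qed
qed

inductive bumps :: "(real => real) => bool" where
 bumps_const: "bumps (%x. c)"
| bumps_beta: "bumps (%x. beta m (a * x + b))"
| bumps_add: "bumps f ==> bumps g ==> bumps (%x. f x + g x)"
| bumps_mult: "bumps f ==> bumps g ==> bumps (%x. f x * g x)"

lemma bumps_derivative: "bumps f ==> \<exists>f'. (\<forall>x. (f has_real_derivative f' x) (at x)) \<and> bumps f'"
proof (induction rule: bumps.induct)
 case (bumps_const c)
 show ?case by (intro exI[of _ "%_. 0"]) (auto intro: bumps.bumps_const)
next
 case (bumps_beta m a b)
 have "bumps (%x. a * (beta (m + 2) (a * x + b) + (- real m) * beta (m + 1) (a * x + b)))" by (intro bumps.intros)
 moreover have "((%x. beta m (a * x + b)) has_real_derivative a * (beta (m + 2) (a * x + b) + (- real m) * beta (m + 1) (a * x + b))) (at x)" for x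
  by (rule DERIV_chain2[OF beta_DERIV, THEN DERIV_cong, of _ a]) (auto intro!: derivative_eq_intros)
 ultimately show ?case by (intro exI[of _ "%x. a * (beta (m + 2) (a * x + b) + (- real m) * beta (m + 1) (a * x + b))"]) blast
next
 case (bumps_add f g)
 then obtain f' g' where "\<forall>x. (f has_real_derivative f' x) (at x)" "bumps f'" "\<forall>x. (g has_real_derivative g' x) (at x)" "bumps g'" by blast
 then show ?case by (intro exI[of _ "%x. f' x + g' x"]) (auto intro!: bumps.intros DERIV_add)
next
 case (bumps_mult f g)
 then obtain f' g' where "\<forall>x. (f has_real_derivative f' x) (at x)" "bumps f'" "\<forall>x. (g has_real_derivative g' x) (at x)" "bumps g'" by blast
 then show ?case using bumps_mult by (intro exI[of _ "%x. f' x * g x + g' x * f x"]) (auto intro!: bumps.intros DERIV_mult)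
qed

lemma real_frechet_derivative: "(f has_real_derivative d) (at x) ==> frechet_derivative f (at x) = (%b. d * b)"
 by (metis frechet_derivative_at has_field_derivative_def)

lemma bumps_smooth: "bumps f ==> Ck_on k S f"
proof (rule Ck_on_closed_class[where \<F>="Collect bumps"])
 fix f :: "real => real" and x assume "f \<in> Collect bumps"
 then show "f differentiable (at x)" using bumps_derivative[of f] by (auto simp: real_differentiable_def)
next
 fix f :: "real => real" and b :: real assume "f \<in> Collect bumps" and b: "b \<in> Basis"
 then obtain f' where f': "\<forall>x. (f has_real_derivative f' x) (at x)" "bumps f'" using bumps_derivative[of f] by auto
 have "(%x. frechet_derivative f (at x) b) = f'" using f' b by (intro ext) (simp add: real_frechet_derivative[OF spec[OF f'(1)]])
 then show "(%x. frechet_derivative f (at x) b) \<in> Collect bumps" using f' by simp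
qed simp

lemma bumps_continuous: "bumps f ==> continuous_on S f"
 using bumps_smooth[of f 0 S] by simp

text \<open>For positive n this is positive exactly on (a,b) and at most 1. The scale n steepens
  both flanks, so that the bumps tend to the indicator of (a,b).\<close>

definition bump :: "real => real => real => real => real" where
 "bump n a b t = beta 0 (n * (t - a)) * beta 0 (n * (b - t))"

lemma bumps_bump: "bumps (bump n a b)"
proof -
 have "bumps (%t. beta 0 (n * t + (- n * a)) * beta 0 ((- n) * t + n * b))" by (intro bumps.intros)
 moreover have "(%t. beta 0 (n * t + (- n * a)) * beta 0 ((- n) * t + n * b)) = bump n a b"
  by (auto simp: bump_def algebra_simps)
 ultimately show ?thesis by simp
qed

lemma bump_measurable [measurable, simp]: "bump n a b \<in> borel_measurable borel"
 using bumps_continuous[OF bumps_bump] by (rule borel_measurable_continuous_onI)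

lemma beta0_range: "0 \<le> beta 0 t" "beta 0 t \<le> 1"
 by (auto simp: beta_def)

lemma bump_range: "0 \<le> bump n a b t" "bump n a b t \<le> 1"
 using beta0_range by (auto simp: bump_def intro: mult_le_one)

lemma bump_0: "n > 0 ==> t \<le> a \<or> b \<le> t ==> bump n a b t = 0"
 by (auto simp: bump_def beta_def zero_less_mult_iff)

lemma bump_pos: "n > 0 ==> a < t ==> t < b ==> bump n a b t > 0"
 by (auto simp: bump_def beta_def)

lemma beta0_limit:
 assumes "filterlim f at_top F"
 shows "((%n. beta 0 (f n)) \<longlongrightarrow> 1) F"
proof -
 have "((%n. 1 / exp (inverse (f n))) \<longlongrightarrow> 1 / exp 0) F"
  by (intro tendsto_intros filterlim_compose[OF tendsto_inverse_0_at_top assms] tendsto_inverse_0_at_top assms) auto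
 moreover have "eventually (%n. 1 / exp (inverse (f n)) = beta 0 (f n)) F"
  using filterlim_at_top_dense[THEN iffD1, OF assms, rule_format, of 0] by eventually_elim (simp add: beta_def)
 ultimately show ?thesis using tendsto_cong by force
qed

text \<open>Mean value zero brings the primitive back to zero at b, which gives it compact support.
  Its smoothness is read off from its derivative, which lies in \<open>bumps\<close>.\<close>

lemma bumps_primitive:
 assumes e: "bumps e" and ab: "0 < a" "a < b" "b < T" and s: "\<And>t. t \<notin> {a..b} ==> e t = 0"
  and i: "(LINT t|lborel. e t * indicator {a..b} t) = 0"
 obtains \<psi> where "test_function {0<..<T} \<psi>" "\<And>t. (\<psi> has_real_derivative e t) (at t)" "\<psi> 0 = 0" "\<psi> T = 0"
proof -
 have ce: "isCont e t" for t using bumps_continuous[OF e, of UNIV] by (simp add: continuous_on_eq_continuous_at)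
 have "\<exists>F. \<forall>x. -\<infinity> < ereal x --> ereal x < \<infinity> --> (F has_vector_derivative e x) (at x)"
  by (rule einterval_antiderivative) (use ce in auto)
 then obtain F where "\<And>x. (F has_vector_derivative e x) (at x)" by auto
 then have F: "(F has_real_derivative e x) (at x)" for x by (simp add: has_real_derivative_iff_has_vector_derivative)
 define \<psi> where "\<psi> t = F t - F a" for t
 have D: "(\<psi> has_real_derivative e t) (at t)" for t unfolding \<psi>_def using F by (auto intro!: derivative_eq_intros)
 have const: "\<psi> t = \<psi> s" if "\<And>r. min s t \<le> r ==> r \<le> max s t ==> e r = 0" for s t
 proof -
  have "\<exists>c. \<forall>r\<in>{min s t..max s t}. \<psi> r = c"
  proof (rule has_field_derivative_zero_constant)
   fix r assume "r \<in> {min s t..max s t}"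
   then have "e r = 0" using that[of r] by simp
   then show "(\<psi> has_real_derivative 0) (at r within {min s t..max s t})"
    using has_field_derivative_at_within[OF D[of r]] by simp
  qed simp
  then obtain c where c: "\<And>r. r \<in> {min s t..max s t} ==> \<psi> r = c" by auto
  have "s \<in> {min s t..max s t}" "t \<in> {min s t..max s t}" by auto
  then show ?thesis using c[of s] c[of t] by simp
 qed
 have ea: "e a = 0"
 proof (rule tendsto_unique[of "at_left a"])
  show "(e \<longlongrightarrow> e a) (at_left a)" using ce[of a] by (simp add: isCont_def filterlim_at_split)
  show "(e \<longlongrightarrow> 0) (at_left a)"
   by (rule tendsto_eventually) (use eventually_at_left_real[of "a - 1" a] s in \<open>auto elim: eventually_mono\<close>)
 qed simp
 have eb: "e b = 0"
 proof (rule tendsto_unique[of "at_right b"])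
  show "(e \<longlongrightarrow> e b) (at_right b)" using ce[of b] by (simp add: isCont_def filterlim_at_split)
  show "(e \<longlongrightarrow> 0) (at_right b)"
   by (rule tendsto_eventually) (use eventually_at_right_less[of b] s in \<open>auto elim: eventually_mono\<close>)
 qed simp
 have "\<psi> a = 0" by (simp add: \<psi>_def)
 have "(LINT t|lborel. e t * indicator {a..b} t) = \<psi> b - \<psi> a"
  by (rule integral_FTC_Icc_real) (use ab D ce in auto)
 then have "\<psi> b = 0" using i \<open>\<psi> a = 0\<close> by simp
 have z: "\<psi> t = 0" if "t \<notin> {a<..<b}" for t
 proof (cases "t \<le> a")
  case True
  have "\<psi> t = \<psi> a"
  proof (rule const)
   fix r assume "min a t \<le> r" "r \<le> max a t"
   then have "r < a \<or> r = a" using True by auto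
   then show "e r = 0" using ea s[of r] by auto
  qed
  then show ?thesis using \<open>\<psi> a = 0\<close> by simp
 next
  case False
  then have "t \<ge> b" using that by auto
  have "\<psi> t = \<psi> b"
  proof (rule const)
   fix r assume "min b t \<le> r" "r \<le> max b t"
   then have "b < r \<or> r = b" using \<open>t \<ge> b\<close> by auto
   then show "e r = 0" using eb s[of r] by auto
  qed
  then show ?thesis using \<open>\<psi> b = 0\<close> by simp
 qed
 have "Ck_on k {0<..<T} \<psi>" for k
 proof (cases k)
  case 0
  then show ?thesis using D by (auto intro!: continuous_at_imp_continuous_on DERIV_isCont)
 next
  case (Suc j)
  have "(%x. frechet_derivative \<psi> (at x) 1) = e" by (intro ext) (simp add: real_frechet_derivative[OF D])
  then show ?thesis using Suc D bumps_smooth[OF e] by (auto simp: real_differentiable_def)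
 qed
 moreover have "supp \<psi> \<subseteq> {a..b}" unfolding supp_def
 proof (rule closure_minimal)
  show "{x. \<psi> x \<noteq> 0} \<subseteq> {a..b}"
  proof
   fix x assume "x \<in> {x. \<psi> x \<noteq> 0}"
   then have "x \<in> {a<..<b}" using z[of x] by blast
   then show "x \<in> {a..b}" by simp
  qed
 qed simp
 then have "compact (supp \<psi>)" "supp \<psi> \<subseteq> {0<..<T}" using ab
  using bounded_subset[OF bounded_closed_interval, of "supp \<psi>" a b] by (auto simp: compact_eq_bounded_closed supp_def)
 ultimately have "test_function {0<..<T} \<psi>" by (simp add: test_function_def smooth_fun_on_def)
 then show ?thesis using that D z ab by auto
qed

section \<open>Absolutely continuous functions of time\<close>

lemma integrable_indicator_interval [simp]:
 fixes a b :: real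
 shows   "integrable lborel (indicat_real {a..b})" "integrable lborel (indicat_real {a<..<b})"
 using emeasure_bounded_finite[of "{a..b}"] emeasure_bounded_finite[of "{a<..<b}"]
 by (auto intro!: integrable_real_indicator)

lemma integrable_product_lborel:
 fixes f :: "real => real" and g :: "real => real"
 assumes f: "integrable lborel f" and g: "integrable lborel g"
 shows "integrable (lborel \<Otimes>\<^sub>M lborel) (%(x, y). f x * g y)"
proof (rule lborel_pair.Fubini_integrable)
 show "(%(x, y). f x * g y) \<in> borel_measurable (lborel \<Otimes>\<^sub>M lborel)"
  using f g by (auto simp: measurable_pair_borel split_beta' dest!: borel_measurable_integrable)
qed (use f g in \<open>auto simp: abs_mult\<close>)

text \<open>The product rule for a primitive of an integrable function: Fubini on the triangle r
  \<le> s \<le> t, where the inner integral of \<xi>' is a difference of values of \<xi>.\<close>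

lemma AC_product:
 fixes b :: "real => real"
 assumes b: "integrable lborel b" and A: "\<And>s. s \<in> {0..t} ==> A s = A0 + (LINT r|lborel. indicator {0..s} r * b r)"
  and c: "\<And>s. (\<xi> has_real_derivative \<xi>' s) (at s)" "continuous_on UNIV \<xi>'" and t: "0 \<le> t"
  and Am: "A \<in> borel_measurable borel"
 shows "\<xi> t * A t = \<xi> 0 * A0 + (LINT s|lborel. indicator {0..t} s * (\<xi>' s * A s + \<xi> s * b s))"
  and "integrable lborel (%s. indicator {0..t} s * (\<xi>' s * A s + \<xi> s * b s))"
  and "integrable lborel (%s. indicator {0..t} s * (\<xi>' s * A s))" "integrable lborel (%s. indicator {0..t} s * (\<xi> s * b s))"
proof -
 note [measurable] = Am borel_measurable_integrable[OF b, unfolded measurable_lborel1]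
 have cc: "continuous_on UNIV \<xi>" using c by (auto intro!: continuous_at_imp_continuous_on DERIV_isCont)
 have [measurable]: "\<xi> \<in> borel_measurable borel" "\<xi>' \<in> borel_measurable borel" using cc c(2) by (auto intro: borel_measurable_continuous_onI)
 obtain C where C: "C \<ge> 0" "\<And>s. s \<in> {0..t} ==> \<bar>\<xi>' s\<bar> \<le> C"
  by (rule compact_abs_bounded[of "{0..t}" \<xi>']) (use c in \<open>auto intro: continuous_on_subset\<close>)
 obtain E where E: "E \<ge> 0" "\<And>s. s \<in> {0..t} ==> \<bar>\<xi> s\<bar> \<le> E"
  by (rule compact_abs_bounded[of "{0..t}" \<xi>]) (use cc in \<open>auto intro: continuous_on_subset\<close>)
 have ic: "integrable lborel (%s. indicator {0..t} s * \<xi>' s)"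
 proof (rule Bochner_Integration.integrable_bound)
  show "integrable lborel (%s. indicator {0..t} s * C)" by simp
 qed (use C in \<open>auto simp: indicator_def\<close>)
 have FTC: "(LINT s|lborel. indicator {r..t} s * \<xi>' s) = \<xi> t - \<xi> r" if "r \<le> t" for r
  using integral_FTC_Icc_real[OF that, of \<xi> \<xi>'] c by (simp add: mult.commute continuous_on_eq_continuous_at)
 let ?K = "%(s, r). indicator {0..t} s * \<xi>' s * (indicator {0..s} r * b r)"
 have iK: "integrable (lborel \<Otimes>\<^sub>M lborel) ?K"
 proof (rule Bochner_Integration.integrable_bound[OF integrable_product_lborel[OF ic b]])
  show "?K \<in> borel_measurable (lborel \<Otimes>\<^sub>M lborel)"
   by (simp add: measurable_pair_borel split_beta' indicator_def)
 qed (auto simp: indicator_def abs_mult)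
 have K1: "(LINT r|lborel. ?K (s, r)) = indicator {0..t} s * (\<xi>' s * (A s - A0))" for s
  using A[of s] by (auto simp: indicator_def)
 have K2: "(LINT s|lborel. ?K (s, r)) = indicator {0..t} r * ((\<xi> t - \<xi> r) * b r)" for r
 proof -
  have "(LINT s|lborel. ?K (s, r)) = (LINT s|lborel. (indicator {0..t} r * b r) * (indicator {r..t} s * \<xi>' s))"
   by (intro Bochner_Integration.integral_cong) (auto simp: indicator_def)
  also have "\<dots> = indicator {0..t} r * ((\<xi> t - \<xi> r) * b r)" using FTC[of r] by (auto simp: indicator_def)
  finally show ?thesis .
 qed
 have i1: "integrable lborel (%s. indicator {0..t} s * (\<xi>' s * (A s - A0)))"
  using lborel_pair.integrable_fst'[OF iK] unfolding K1 .
 have i2: "integrable lborel (%r. indicator {0..t} r * ((\<xi> t - \<xi> r) * b r))"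
  using lborel_pair.integrable_snd[of "%s r. ?K (s, r)"] iK unfolding K2 by simp
 have eq: "(LINT s|lborel. indicator {0..t} s * (\<xi>' s * (A s - A0))) = (LINT r|lborel. indicator {0..t} r * ((\<xi> t - \<xi> r) * b r))"
  using lborel_pair.Fubini_integral[of "%s r. ?K (s, r)"] iK unfolding K1 K2 by simp
 have ib: "integrable lborel (%s. indicator {0..t} s * b s)" using integrable_mult_indicator[of "{0..t}" lborel b] b by simp
 have "(%s. indicator {0..t} s * (\<xi>' s * A s)) = (%s. indicator {0..t} s * (\<xi>' s * (A s - A0)) + A0 * (indicator {0..t} s * \<xi>' s))"
  by (auto simp: algebra_simps)
 then show j1: "integrable lborel (%s. indicator {0..t} s * (\<xi>' s * A s))" using i1 ic by simp
 have "(%s. indicator {0..t} s * (\<xi> s * b s)) = (%s. \<xi> t * (indicator {0..t} s * b s) - indicator {0..t} s * ((\<xi> t - \<xi> s) * b s))"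
  by (auto simp: algebra_simps)
 then show j2: "integrable lborel (%s. indicator {0..t} s * (\<xi> s * b s))" using i2 ib by simp
 have sp: "(%s. indicator {0..t} s * (\<xi>' s * A s + \<xi> s * b s)) = (%s. indicator {0..t} s * (\<xi>' s * A s) + indicator {0..t} s * (\<xi> s * b s))"
  by (auto simp: algebra_simps)
 then show "integrable lborel (%s. indicator {0..t} s * (\<xi>' s * A s + \<xi> s * b s))" using j1 j2 by simp
 have "(LINT s|lborel. indicator {0..t} s * (\<xi>' s * A s + \<xi> s * b s)) =
  (LINT s|lborel. indicator {0..t} s * (\<xi>' s * (A s - A0)) + A0 * (indicator {0..t} s * \<xi>' s)
    + (\<xi> t * (indicator {0..t} s * b s) - indicator {0..t} s * ((\<xi> t - \<xi> s) * b s)))"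
  by (intro Bochner_Integration.integral_cong) (auto simp: algebra_simps)
 also have "\<dots> = A0 * (\<xi> t - \<xi> 0) + \<xi> t * (A t - A0)"
  using i1 ic ib i2 eq FTC[OF t] A[of t] t by simp
 finally show "\<xi> t * A t = \<xi> 0 * A0 + (LINT s|lborel. indicator {0..t} s * (\<xi>' s * A s + \<xi> s * b s))"
  by (simp add: algebra_simps)
qed

lemma primitive_measurable:
 fixes b :: "real => real"
 assumes [measurable]: "b \<in> borel_measurable borel"
 shows "(%s. LINT r|lborel. indicator {0..s} r * b r) \<in> borel_measurable borel"
proof (rule borel_measurable_param_integral)
 show "(%p. indicator {0..fst p} (snd p) * b (snd p)) \<in> borel_measurable borel"
  unfolding indicator_def atLeastAtMost_iff by measurable
qed (auto intro: lborel.sigma_finite_measure_axioms)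

text \<open>The du Bois-Reymond lemma: with \<open>M t = m t - \<integral>\<^sub>0\<^sup>t d\<close>, the integral of \<open>M\<close> against a bump
  depends only on the mass of the bump, and bumps close to \<open>0\<close> yield the initial value.\<close>
lemma du_Bois_Reymond_initial:
 fixes m d :: "real => real"
 assumes T: "T > 0" and im: "integrable lborel m" and id: "integrable lborel d"
  and H: "\<And>\<psi> \<psi>'. test_function {0<..<T} \<psi> ==> (\<And>t. (\<psi> has_real_derivative \<psi>' t) (at t)) ==>
    (LINT t|lborel. indicator {0<..<T} t * (\<psi>' t * m t)) = - (LINT t|lborel. indicator {0<..<T} t * (\<psi> t * d t))"
  and lim: "\<And>e. e > 0 ==> \<exists>\<delta>>0. AE t in lborel. 0 < t --> t < \<delta> --> \<bar>m t - (LINT r|lborel. indicator {0..t} r * d r) - m0\<bar> \<le> e"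
 shows "AE t in lborel. t \<in> {0<..<T} --> m t = m0 + (LINT r|lborel. indicator {0..t} r * d r)"
proof -
 have [measurable]: "m \<in> borel_measurable borel" "d \<in> borel_measurable borel" using im id by (auto dest: borel_measurable_integrable)
 define D where "D t = (LINT r|lborel. indicator {0..t} r * d r)" for t
 have [measurable]: "D \<in> borel_measurable borel" unfolding D_def[abs_def] by (rule primitive_measurable) simp
 have D_bound: "\<bar>D t\<bar> \<le> (LINT r|lborel. \<bar>d r\<bar>)" for t
 proof -
  have "\<bar>D t\<bar> \<le> (LINT r|lborel. \<bar>indicator {0..t} r * d r\<bar>)" unfolding D_def by (rule integral_abs_bound)
  also have "\<dots> \<le> (LINT r|lborel. \<bar>d r\<bar>)"
   using id integrable_mult_indicator[of "{0..t}" lborel d] by (intro integral_mono) (auto simp: indicator_def)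
  finally show ?thesis .
 qed
 define M where "M t = indicator {0<..<T} t * (m t - D t)" for t
 have [measurable]: "M \<in> borel_measurable borel" unfolding M_def by measurable
 have iD: "integrable lborel (%t. indicator {0<..<T} t * D t)"
 proof (rule Bochner_Integration.integrable_bound)
  show "integrable lborel (%t. indicator {0<..<T} t * (LINT r|lborel. \<bar>d r\<bar>))" by simp
 qed (use D_bound in \<open>auto simp: indicator_def intro: order_trans[OF _ abs_ge_self]\<close>)
 have iM: "integrable lborel M"
  unfolding M_def right_diff_distrib using iD integrable_mult_indicator[of "{0<..<T}" lborel m] im by simp
 have iMb: "integrable lborel (%t. f t * M t)" if "\<And>t. \<bar>f t\<bar> \<le> B" "f \<in> borel_measurable borel" for f B
 proof (rule Bochner_Integration.integrable_bound[of lborel "%t. B * M t"])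
  show "AE t in lborel. norm (f t * M t) \<le> norm (B * M t)"
   using order_trans[OF that(1) abs_ge_self] by (intro AE_I2) (auto simp: abs_mult intro: mult_right_mono)
 qed (use iM that in auto)
 have orth: "(LINT t|lborel. \<psi>' t * M t) = 0" if t: "test_function {0<..<T} \<psi>" and d\<psi>: "\<And>t. (\<psi> has_real_derivative \<psi>' t) (at t)"
  and c: "continuous_on UNIV \<psi>'" and z: "\<psi> 0 = 0" "\<psi> T = 0" for \<psi> \<psi>'
 proof -
  have [measurable]: "\<psi>' \<in> borel_measurable borel" using c by (rule borel_measurable_continuous_onI)
  obtain C where C: "C \<ge> 0" "\<And>s. s \<in> {0..T} ==> \<bar>\<psi>' s\<bar> \<le> C"
   by (rule compact_abs_bounded[of "{0..T}" \<psi>']) (use c in \<open>auto intro: continuous_on_subset\<close>)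
  have D0: "\<And>s. s \<in> {0..T} ==> D s = 0 + (LINT r|lborel. indicator {0..s} r * d r)" by (simp add: D_def)
  have A: "\<psi> T * D T = \<psi> 0 * 0 + (LINT s|lborel. indicator {0..T} s * (\<psi>' s * D s + \<psi> s * d s))"
   "integrable lborel (%s. indicator {0..T} s * (\<psi>' s * D s))" "integrable lborel (%s. indicator {0..T} s * (\<psi> s * d s))"
   by (rule AC_product[OF id D0 d\<psi> c less_imp_le[OF T]]; simp)+
  have "(LINT s|lborel. indicator {0..T} s * (\<psi>' s * D s + \<psi> s * d s)) =
    (LINT s|lborel. indicator {0..T} s * (\<psi>' s * D s) + indicator {0..T} s * (\<psi> s * d s))" by (simp add: algebra_simps)
  then have e1: "(LINT s|lborel. indicator {0..T} s * (\<psi>' s * D s)) = - (LINT s|lborel. indicator {0..T} s * (\<psi> s * d s))"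
   using A z by simp
  have oc: "(LINT s|lborel. indicator {0..T} s * f s) = (LINT s|lborel. indicator {0<..<T} s * f s)" if [measurable]: "f \<in> borel_measurable borel" for f :: "real => real"
   by (rule integral_cong_AE, measurable, use AE_lborel_singleton[of 0] AE_lborel_singleton[of T] in eventually_elim) (auto simp: indicator_def)
  have [measurable]: "\<psi> \<in> borel_measurable borel" using d\<psi> by (intro borel_measurable_continuous_onI continuous_at_imp_continuous_on) (auto intro: DERIV_isCont)
  have i1: "integrable lborel (%t. indicator {0<..<T} t * (\<psi>' t * m t))"
  proof (rule Bochner_Integration.integrable_bound[of lborel "%t. C * m t"])
   have "norm (indicator {0<..<T} t * (\<psi>' t * m t)) \<le> norm (C * m t)" for t
    using mult_right_mono[OF C(2)[of t], of "\<bar>m t\<bar>"] C(1) by (auto simp: indicator_def abs_mult)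
   then show "AE t in lborel. norm (indicator {0<..<T} t * (\<psi>' t * m t)) \<le> norm (C * m t)" by simp
  qed (use im in auto)
  have i2: "integrable lborel (%t. indicator {0<..<T} t * (\<psi>' t * D t))"
   by (rule Bochner_Integration.integrable_bound[OF A(2)]) (auto simp: indicator_def)
  have "(LINT t|lborel. \<psi>' t * M t) = (LINT t|lborel. indicator {0<..<T} t * (\<psi>' t * m t) - indicator {0<..<T} t * (\<psi>' t * D t))"
   by (intro Bochner_Integration.integral_cong) (auto simp: M_def algebra_simps)
  also have "\<dots> = (LINT t|lborel. indicator {0<..<T} t * (\<psi>' t * m t)) - (LINT t|lborel. indicator {0<..<T} t * (\<psi>' t * D t))"
   by (rule Bochner_Integration.integral_diff[OF i1 i2])
  also have "\<dots> = 0" using H[OF t d\<psi>] e1 by (simp add: oc)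
  finally show ?thesis .
 qed
 have bump: "(LINT t|lborel. bump n a b t * M t) = m0 * (LINT t|lborel. bump n a b t)" if ab: "0 < a" "b < T" and n: "n > 0" for n a b
 proof (cases "a < b")
  case False
  then have "bump n a b t = 0" for t using n bump_0[of n t a b] by linarith
  then show ?thesis by simp
 next
  case True
  define B where "B = (LINT t|lborel. bump n a b t)"
  have ib: "integrable lborel (bump n a b)" if "n > 0" for n a b
  proof (rule Bochner_Integration.integrable_bound)
   show "integrable lborel (indicat_real {a..b})" by simp
  qed (use bump_range[of n a b] bump_0[OF that, of _ a b] in \<open>auto simp: indicator_def not_le[symmetric]\<close>)
  have B0: "B \<ge> 0" unfolding B_def by (intro integral_nonneg_AE) (simp add: bump_range)
  have close: "\<bar>(LINT t|lborel. bump n a b t * M t) - m0 * B\<bar> \<le> B * e" if e: "e > 0" for e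
  proof -
   obtain \<delta> where d: "\<delta> > 0" "AE t in lborel. 0 < t --> t < \<delta> --> \<bar>m t - D t - m0\<bar> \<le> e"
    using lim[OF e] unfolding D_def by auto
   \<comment> \<open>The reference bump lives on (r, 2r), inside (0,T) and inside the range of times
     where M is within e of m0.\<close>
   define r where "r = min (\<delta> / 3) (T / 3)"
   have r: "0 < r" "2 * r < \<delta>" "2 * r < T" using d T by (auto simp: r_def)
   define c where "c = (LINT t|lborel. bump 1 r (2 * r) t)"
   have c: "c > 0"
   proof -
    have "c \<ge> 0" unfolding c_def by (intro integral_nonneg_AE) (simp add: bump_range)
    moreover have "c \<noteq> 0"
    proof
     assume "c = 0"
     then have "AE t in lborel. bump 1 r (2 * r) t = 0"
      unfolding c_def by (subst (asm) integral_nonneg_eq_0_iff_AE) (auto simp: ib bump_range)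
     then have "AE t in lborel. t \<notin> {r<..<2*r}" by eventually_elim (use bump_pos[of 1 r _ "2*r"] in force)
     then have "{r<..<2*r} \<in> null_sets lborel" by (subst (asm) AE_iff_null_sets[symmetric]) auto
     then show False using r by (simp add: null_sets_def)
    qed
    ultimately show ?thesis by simp
   qed
   \<comment> \<open>Each bump is weighted by the mass of the other, so the combination has mean
     zero; it is the derivative of a test function and hence orthogonal to M.\<close>
   define e' where "e' t = c * bump n a b t + (- B) * bump 1 r (2 * r) t" for t
   have be: "bumps e'" unfolding e'_def[abs_def] by (intro bumps.intros bumps_bump)
   have supp: "e' t = 0" if "t \<notin> {min a r..max b (2*r)}" for t
   proof -
    have "t \<le> a \<or> b \<le> t" "t \<le> r \<or> 2 * r \<le> t" using that by auto
    then show ?thesis using n bump_0[of n t a b] bump_0[of 1 t r "2*r"] by (simp add: e'_def)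
   qed
   have int0: "(LINT t|lborel. e' t * indicator {min a r..max b (2*r)} t) = 0"
   proof -
    have "(LINT t|lborel. e' t * indicator {min a r..max b (2*r)} t) = (LINT t|lborel. e' t)"
     using supp by (intro Bochner_Integration.integral_cong) (auto simp: indicator_def)
    also have "\<dots> = 0" unfolding e'_def using ib[OF n, of a b] ib[of 1 r "2*r"]
     by (simp add: B_def[symmetric] c_def[symmetric])
    finally show ?thesis .
   qed
   obtain \<psi> where \<psi>: "test_function {0<..<T} \<psi>" "\<And>t. (\<psi> has_real_derivative e' t) (at t)" "\<psi> 0 = 0" "\<psi> T = 0"
    by (rule bumps_primitive[OF be _ _ _ supp int0, of T]) (use ab r True in auto)
   have "(LINT t|lborel. e' t * M t) = 0" by (rule orth[OF \<psi>(1,2) _ \<psi>(3,4)]) (rule bumps_continuous[OF be])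
   moreover have i1: "integrable lborel (%t. bump n a b t * M t)" "integrable lborel (%t. bump 1 r (2*r) t * M t)"
    using iMb[of "bump n a b" 1] iMb[of "bump 1 r (2*r)" 1] bump_range by auto
   have "(LINT t|lborel. e' t * M t) = (LINT t|lborel. c * (bump n a b t * M t) - B * (bump 1 r (2*r) t * M t))"
    by (simp add: e'_def algebra_simps)
   ultimately have eq: "c * (LINT t|lborel. bump n a b t * M t) = B * (LINT t|lborel. bump 1 r (2*r) t * M t)"
    using i1 by simp
   have "\<bar>(LINT t|lborel. bump 1 r (2*r) t * M t) - m0 * c\<bar> \<le> e * c"
   proof -
    have "(LINT t|lborel. bump 1 r (2*r) t * M t) - m0 * c = (LINT t|lborel. bump 1 r (2*r) t * M t - m0 * bump 1 r (2*r) t)"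
     using i1 ib[of 1 r "2*r"] by (simp add: c_def)
    then have "\<bar>(LINT t|lborel. bump 1 r (2*r) t * M t) - m0 * c\<bar> = \<bar>LINT t|lborel. bump 1 r (2*r) t * M t - m0 * bump 1 r (2*r) t\<bar>" by (rule arg_cong)
    also have "\<dots> \<le> (LINT t|lborel. \<bar>bump 1 r (2*r) t * M t - m0 * bump 1 r (2*r) t\<bar>)" by (rule integral_abs_bound)
    also have "\<dots> \<le> (LINT t|lborel. e * bump 1 r (2*r) t)"
    proof (rule integral_mono_AE)
     show "AE t in lborel. \<bar>bump 1 r (2*r) t * M t - m0 * bump 1 r (2*r) t\<bar> \<le> e * bump 1 r (2*r) t"
      using d(2)
     proof eventually_elim
      case (elim t)
      show ?case
      proof (cases "r < t \<and> t < 2 * r")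
       case True
       then have "\<bar>M t - m0\<bar> \<le> e" using elim r by (auto simp: M_def)
       then have "\<bar>bump 1 r (2*r) t\<bar> * \<bar>M t - m0\<bar> \<le> bump 1 r (2*r) t * e" using bump_range by (intro mult_mono) auto
       then show ?thesis unfolding abs_mult[symmetric] by (simp add: algebra_simps)
      next
       case False
       then have "bump 1 r (2*r) t = 0" by (intro bump_0) auto
       then show ?thesis by simp
      qed
     qed
    qed (use i1 ib[of 1 r "2*r"] in auto)
    also have "\<dots> = e * c" by (simp add: c_def)
    finally show ?thesis .
   qed
   then have le: "B * \<bar>(LINT t|lborel. bump 1 r (2*r) t * M t) - m0 * c\<bar> \<le> B * (e * c)" using B0 by (rule mult_left_mono)
   have "c * ((LINT t|lborel. bump n a b t * M t) - m0 * B) = B * ((LINT t|lborel. bump 1 r (2*r) t * M t) - m0 * c)"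
    unfolding right_diff_distrib eq by (simp add: mult_ac)
   then have "c * \<bar>(LINT t|lborel. bump n a b t * M t) - m0 * B\<bar> = B * \<bar>(LINT t|lborel. bump 1 r (2*r) t * M t) - m0 * c\<bar>"
    using c B0 by (metis abs_mult abs_of_nonneg less_imp_le)
   also have "\<dots> \<le> c * (B * e)" using le by (simp add: mult_ac)
   finally show ?thesis using c by simp
  qed
  have "\<bar>(LINT t|lborel. bump n a b t * M t) - m0 * B\<bar> \<le> 0"
  proof (rule field_le_epsilon)
   fix e :: real assume "e > 0"
   then have "\<bar>(LINT t|lborel. bump n a b t * M t) - m0 * B\<bar> \<le> B * (e / (B + 1))" using B0 by (intro close) auto
   also have "\<dots> \<le> e" using B0 \<open>e > 0\<close> by (simp add: field_simps)
   finally show "\<bar>(LINT t|lborel. bump n a b t * M t) - m0 * B\<bar> \<le> 0 + e" by simp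
  qed
  then show ?thesis by (simp add: B_def)
 qed
 let ?R = "%t. M t - indicator {0<..<T} t * m0"
 have "AE t in lborel. ?R t = 0"
 proof (rule integrable_zero_on_boxes)
  show iR: "integrable lborel ?R" using iM by simp
  fix a b :: real
  \<comment> \<open>Cutting at distance T/(n+3) from both ends keeps the bumps inside (0,T). In the
    limit the cut disappears and the bumps tend to the indicator of the interval.\<close>
  define an where "an n = max a (T / real (n + 3))" for n
  define bn where "bn n = min b (T - T / real (n + 3))" for n
  have lim0: "(%n. T / real (n + 3)) \<longlonglongrightarrow> 0"
   by (rule LIMSEQ_ignore_initial_segment[OF lim_const_over_n])
  have an: "an \<longlonglongrightarrow> max a 0" unfolding an_def[abs_def] by (intro tendsto_intros lim0)
  have bn: "bn \<longlonglongrightarrow> min b (T - 0)" unfolding bn_def[abs_def] by (intro tendsto_intros lim0)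
  have "(%n. LINT t|lborel. bump (real (Suc n)) (an n) (bn n) t * ?R t) \<longlonglongrightarrow> (LINT t|lborel. indicator (box a b) t * ?R t)"
  proof (rule integral_dominated_convergence[where w="%t. \<bar>?R t\<bar>"])
   show "AE t in lborel. (%n. bump (real (Suc n)) (an n) (bn n) t * ?R t) \<longlonglongrightarrow> indicator (box a b) t * ?R t"
   proof (rule AE_I2)
    fix t
    consider "t \<le> a \<or> b \<le> t" | "t \<notin> {0<..<T}" | "a < t" "t < b" "t \<in> {0<..<T}" by fastforce
    then show "(%n. bump (real (Suc n)) (an n) (bn n) t * ?R t) \<longlonglongrightarrow> indicator (box a b) t * ?R t"
    proof cases
     case 1
     then have "bump (real (Suc n)) (an n) (bn n) t = 0" for n by (intro bump_0) (auto simp: an_def bn_def)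
     then show ?thesis using 1 by auto
    next
     case 2
     then show ?thesis by (simp add: M_def)
    next
     case 3
     have f1: "filterlim (%n. real (Suc n) * (t - an n)) at_top sequentially"
     proof (rule filterlim_at_top_mult_tendsto_pos)
      show "(%n. t - an n) \<longlonglongrightarrow> t - max a 0" by (intro tendsto_intros an)
      show "filterlim (%x. real (Suc x)) at_top sequentially"
       using filterlim_real_sequentially filterlim_sequentially_Suc[of real at_top] by simp
     qed (use 3 in auto)
     have f2: "filterlim (%n. real (Suc n) * (bn n - t)) at_top sequentially"
     proof (rule filterlim_at_top_mult_tendsto_pos)
      show "(%n. bn n - t) \<longlonglongrightarrow> min b (T - 0) - t" by (intro tendsto_intros bn)
      show "filterlim (%x. real (Suc x)) at_top sequentially"
       using filterlim_real_sequentially filterlim_sequentially_Suc[of real at_top] by simp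
     qed (use 3 in auto)
     have "(%n. bump (real (Suc n)) (an n) (bn n) t) \<longlonglongrightarrow> 1 * 1"
      unfolding bump_def by (intro tendsto_mult beta0_limit f1 f2)
     then have "(%n. bump (real (Suc n)) (an n) (bn n) t * ?R t) \<longlonglongrightarrow> (1 * 1) * ?R t" by (intro tendsto_intros)
     then show ?thesis using 3 by simp
    qed
   qed
   show "AE t in lborel. norm (bump (real (Suc n)) (an n) (bn n) t * ?R t) \<le> \<bar>?R t\<bar>" for n
    using bump_range[of "real (Suc n)" "an n" "bn n"] by (intro AE_I2) (auto simp: abs_mult intro!: mult_left_le_one_le)
   show "(%t. bump (real (Suc n)) (an n) (bn n) t * ?R t) \<in> borel_measurable lborel" for n
   proof -
    show ?thesis by measurable
   qed
  qed (use iR in auto)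
  moreover have "(LINT t|lborel. bump (real (Suc n)) (an n) (bn n) t * ?R t) = 0" for n
  proof -
   let ?b = "bump (real (Suc n)) (an n) (bn n)"
   have an0: "0 < an n" "bn n < T" using T by (auto simp: an_def bn_def less_max_iff_disj min_less_iff_disj)
   have b: "(LINT t|lborel. ?b t * M t) = m0 * (LINT t|lborel. ?b t)" by (rule bump) (use an0 in auto)
   have "indicator {0<..<T} t * ?b t = ?b t" for t
    using bump_0[of "real (Suc n)" t "an n" "bn n"] an0 by (cases "t \<in> {0<..<T}") auto
   then have "(LINT t|lborel. ?b t * ?R t) = (LINT t|lborel. ?b t * M t - m0 * ?b t)"
    by (intro Bochner_Integration.integral_cong) (auto simp: algebra_simps)
   also have "\<dots> = 0"
   proof -
    have "integrable lborel ?b"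
    proof (rule Bochner_Integration.integrable_bound)
     show "integrable lborel (indicat_real {an n..bn n})" by simp
    qed (use bump_range[of "real (Suc n)" "an n" "bn n"] bump_0[of "real (Suc n)" _ "an n" "bn n"] in \<open>auto simp: indicator_def not_le[symmetric]\<close>)
    then show ?thesis using b iMb[of ?b 1] bump_range[of "real (Suc n)" "an n" "bn n"] by simp
   qed
   finally show ?thesis .
  qed
  ultimately show "(LINT t|lborel. indicator (box a b) t * ?R t) = 0" by (simp add: LIMSEQ_const_iff)
 qed
 then show ?thesis by eventually_elim (auto simp: M_def D_def)
qed

lemma eL2norm_sq: "(eL2norm S f)^2 = (\<integral>\<^sup>+x\<in>S. ennreal ((norm (f x))^2) \<partial>lborel)"
proof -
 define I where "I = (\<integral>\<^sup>+x\<in>S. ennreal ((norm (f x))^2) \<partial>lborel)"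
 have "eL2norm S f = (if I = \<infinity> then \<infinity> else ennreal (sqrt (enn2real I)))"
  by (simp add: eL2norm_def I_def Let_def)
 then have "(eL2norm S f)^2 = I"
  by (cases I) (auto simp: ennreal_power power2_eq_square ennreal_top_mult ennreal_mult[symmetric])
 then show ?thesis by (simp add: I_def)
qed

lemma eL2norm_le:
 assumes "(\<integral>\<^sup>+x\<in>S. ennreal ((norm (f x))^2) \<partial>lborel) \<le> ennreal (C^2)" "C \<ge> 0"
 shows "eL2norm S f \<le> ennreal C"
proof -
 define I where "I = (\<integral>\<^sup>+x\<in>S. ennreal ((norm (f x))^2) \<partial>lborel)"
 have I: "I < \<infinity>" "enn2real I \<le> C^2" using assms
  by (auto simp: I_def intro: le_less_trans enn2real_leI)
 then have "sqrt (enn2real I) \<le> C" using assms(2) by (simp add: real_le_lsqrt)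
 moreover have "I \<noteq> \<infinity>" using I(1) by auto
 ultimately show ?thesis by (simp add: eL2norm_def I_def[symmetric] Let_def ennreal_leI)
qed

lemma emeasure_Icc_finite [simp]: "emeasure lborel {a..b::real} < top"
 using emeasure_bounded_finite[of "{a..b}"] by simp

text \<open>Cauchy-Schwarz against an indicator, from integrating the square of
  \<open>k * b s - P\<close> over the interval, with k its length and P the integral of b. The final
  division by k is why the degenerate interval is treated apart.\<close>

lemma integral_interval_sq_le:
 fixes b :: "real => real"
 assumes b: "sqint lborel b" and t: "r \<le> t"
 shows "(LINT s|lborel. indicator {r..t} s * b s)^2 \<le> (t - r) * (LINT s|lborel. (b s)^2)"
proof -
 have [measurable]: "b \<in> borel_measurable borel" using sqint_measurable[OF b] by simp
 have s1: "sqint lborel (indicat_real {r..t})"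
  by (simp add: sqint_def power2_eq_square flip: indicator_inter_arith)
 define P where "P = (LINT s|lborel. indicator {r..t} s * b s)"
 define Q where "Q = (LINT s|lborel. (b s)^2)"
 define k where "k = t - r"
 have int: "integrable lborel (%s. indicat_real {r..t} s * b s)" by (rule sqint_mult[OF s1 b])
 have ib: "integrable lborel (%s. (b s)^2)" using b by (simp add: sqint_def)
 have "0 \<le> (LINT s|lborel. (indicat_real {r..t} s * (k * b s - P))^2)" by simp
 also have "\<dots> \<le> (LINT s|lborel. k^2 * (b s)^2 - 2 * k * P * (indicat_real {r..t} s * b s) + P^2 * indicat_real {r..t} s)"
 proof (rule integral_mono)
  show i2: "integrable lborel (%s. k^2 * (b s)^2 - 2 * k * P * (indicat_real {r..t} s * b s) + P^2 * indicat_real {r..t} s)"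
   using ib int by simp
  show le: "(indicat_real {r..t} s * (k * b s - P))^2 \<le> k^2 * (b s)^2 - 2 * k * P * (indicat_real {r..t} s * b s) + P^2 * indicat_real {r..t} s" for s
  proof (cases "s \<in> {r..t}")
   case True
   then show ?thesis by (simp add: power2_diff power_mult_distrib)
  qed simp
  show "integrable lborel (%s. (indicat_real {r..t} s * (k * b s - P))^2)"
   by (rule Bochner_Integration.integrable_bound[OF i2]) (use le in \<open>auto intro: order_trans[OF _ abs_ge_self]\<close>)
 qed
 also have "\<dots> = k^2 * Q - 2 * k * P * P + P^2 * k"
  using ib int t by (simp add: Q_def P_def k_def)
 finally have le: "k * P^2 \<le> k * (k * Q)" by (simp add: power2_eq_square algebra_simps)
 show ?thesis
 proof (cases "k = 0")
  case True
  then have "P = (LINT s|lborel. indicat_real {r} s * b s)" by (simp add: P_def k_def)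
  also have "\<dots> = 0" by (rule integral_eq_zero_AE, use AE_lborel_singleton[of r] in eventually_elim) auto
  finally show ?thesis using True by (simp add: P_def k_def)
 next
  case False
  then show ?thesis using le t by (simp add: P_def Q_def k_def)
 qed
qed

lemma LINT_cong_param:
 fixes K :: "'a => real"
 assumes "\<And>x. indicator S x * f x = K x"
 shows "(LINT x:S|M. f x) = (LINT x|M. K x)"
 using assms by (simp add: set_lebesgue_integral_def)

section \<open>The solution as a primitive in time\<close>

context torus begin

text \<open>A function that matters on the cylinder only becomes a total Borel function on
  space-time. Solutions and coefficients are both passed through this extension.\<close>

definition ext :: "real => (real => point => 'b::real_vector) => real \<times> point => 'b" where
 "ext T u p = (if fst p \<in> {0<..<T} \<and> snd p \<in> Omega l h then u (fst p) (snd p) else 0)"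

lemma ext_measurable:
 fixes u :: "real => point => 'b::euclidean_space"
 assumes "(%(t, x). u t x) \<in> borel_measurable (restrict_space lborel ({0<..<T} \<times> Omega l h))"
 shows "ext T u \<in> borel_measurable borel"
proof -
 have S: "{0<..<T} \<times> Omega l h \<in> sets borel" by (intro borel_open open_Times) auto
 have "(%p. indicator ({0<..<T} \<times> Omega l h) p *\<^sub>R (case p of (t, x) => u t x)) \<in> borel_measurable lborel"
  using assms S by (subst (asm) borel_measurable_restrict_space_iff) auto
 moreover have "(%p. indicator ({0<..<T} \<times> Omega l h) p *\<^sub>R (case p of (t, x) => u t x)) = ext T u"
  by (auto simp: ext_def indicator_def split: prod.splits)
 ultimately show ?thesis by simp
qed

lemma in_L2_L2_ext:
 fixes u :: "real => point => 'b::euclidean_space"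
 assumes "in_L2_L2 T (Omega l h) u"
 shows "ext T u \<in> borel_measurable borel" "integrable M3 (%p. (norm (ext T u p))^2)"
proof -
 show m[measurable]: "ext T u \<in> borel_measurable borel" using assms by (intro ext_measurable) (simp add: in_L2_L2_def)
 have "(\<integral>\<^sup>+p. ennreal (norm ((norm (ext T u p))^2)) \<partial>M3) = (\<integral>\<^sup>+t. (\<integral>\<^sup>+x. ennreal ((norm (ext T u (t, x)))^2) \<partial>N) \<partial>lborel)"
  by (subst nn_integral_M3) auto
 also have "\<dots> = (\<integral>\<^sup>+t\<in>{0<..<T}. (eL2norm (Omega l h) (u t))^2 \<partial>lborel)"
 proof (rule nn_integral_cong)
  fix t
  have "(\<integral>\<^sup>+x. ennreal ((norm (ext T u (t, x)))^2) \<partial>N) = (\<integral>\<^sup>+x\<in>Omega l h. ennreal ((norm (ext T u (t, x)))^2) \<partial>lborel)"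
   by (rule nn_integral_N) measurable
  also have "\<dots> = (\<integral>\<^sup>+x\<in>Omega l h. ennreal ((norm (u t x))^2) \<partial>lborel) * indicator {0<..<T} t"
   by (cases "t \<in> {0<..<T}") (auto simp: ext_def intro!: nn_integral_cong split: split_indicator)
  finally show "(\<integral>\<^sup>+x. ennreal ((norm (ext T u (t, x)))^2) \<partial>N) = (eL2norm (Omega l h) (u t))^2 * indicator {0<..<T} t"
   by (simp add: eL2norm_sq)
 qed
 also have "\<dots> < \<infinity>" using assms by (simp add: in_L2_L2_def)
 finally show "integrable M3 (%p. (norm (ext T u p))^2)" by (intro integrableI_bounded) auto
qed

lemma in_L2_L2I:
 fixes u :: "real => point => 'b::euclidean_space"
 assumes m: "(%p. u (fst p) (snd p)) \<in> borel_measurable borel"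
  and i: "integrable M3 (%p. indicator {0<..<T} (fst p) * (norm (u (fst p) (snd p)))^2)"
 shows "in_L2_L2 T (Omega l h) u"
 unfolding in_L2_L2_def
proof
 have [measurable]: "(%x. u t x) \<in> borel_measurable borel" for t
  using measurable_compose[OF _ m, of "%x. (t, x)" borel] by simp
 show "(%(t, x). u t x) \<in> borel_measurable (restrict_space lborel ({0<..<T} \<times> Omega l h))"
  using m by (intro measurable_restrict_space1) (simp add: split_beta')
 have "(\<integral>\<^sup>+t\<in>{0<..<T}. (eL2norm (Omega l h) (u t))^2 \<partial>lborel) = (\<integral>\<^sup>+t. (\<integral>\<^sup>+x. ennreal (indicator {0<..<T} t * (norm (u t x))^2) \<partial>N) \<partial>lborel)"
 proof (rule nn_integral_cong)
  fix t
  show "(eL2norm (Omega l h) (u t))^2 * indicator {0<..<T} t = (\<integral>\<^sup>+x. ennreal (indicator {0<..<T} t * (norm (u t x))^2) \<partial>N)"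
   by (cases "t \<in> {0<..<T}") (simp_all add: eL2norm_sq nn_integral_N)
 qed
 also have "\<dots> = (\<integral>\<^sup>+p. ennreal (indicator {0<..<T} (fst p) * (norm (u (fst p) (snd p)))^2) \<partial>M3)"
  using m by (subst nn_integral_M3) auto
 also have "\<dots> < \<infinity>" using i by (auto simp: integrable_iff_bounded)
 finally show "(\<integral>\<^sup>+t\<in>{0<..<T}. (eL2norm (Omega l h) (u t))^2 \<partial>lborel) < \<infinity>" .
qed

lemma LINT_Omega:
 assumes [measurable]: "K \<in> borel_measurable borel" and "\<And>x. x \<in> Omega l h ==> F x = K x"
 shows "(LINT x:Omega l h|lborel. F x) = (\<integral>x. K x \<partial>N :: real)"
proof -
 have "(LINT x:Omega l h|lborel. F x) = (LINT x:Omega l h|lborel. K x)"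
  unfolding set_lebesgue_integral_def using assms(2) by (intro Bochner_Integration.integral_cong) (auto simp: indicator_def)
 then show ?thesis by (simp add: integral_N)
qed

lemma LINT_cylinder:
 fixes K :: "real \<times> point => real"
 assumes i: "integrable M3 K" and eq: "\<And>t x. t \<in> {0<..<T} ==> x \<in> Omega l h ==> F t x = K (t, x)"
  and z: "\<And>t x. t \<notin> {0<..<T} ==> K (t, x) = 0"
 shows "(LINT t:{0<..<T}|lborel. LINT x:Omega l h|lborel. F t x) = (LINT p|M3. K p)"
proof -
 have m: "K \<in> borel_measurable borel" using i by (auto dest: borel_measurable_integrable)
 have [measurable]: "(%x. K (t, x)) \<in> borel_measurable borel" for t
  using measurable_compose[OF _ m, of "%x. (t, x)" borel] by simp
 have "(LINT t:{0<..<T}|lborel. LINT x:Omega l h|lborel. F t x) = (LINT t|lborel. (LINT x|N. K (t, x)))"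
 proof (rule LINT_cong_param)
  fix t
  show "indicator {0<..<T} t * (LINT x:Omega l h|lborel. F t x) = (LINT x|N. K (t, x))"
   using LINT_Omega[of "%x. K (t, x)" "F t"] eq z by (cases "t \<in> {0<..<T}") auto
 qed
 then show ?thesis using integral_M3(1)[OF i] by simp
qed

text \<open>For negative times the interval is empty and the value is 0.\<close>

definition prim :: "(real \<times> point => real) => real \<times> point => real" where
 "prim F p = (LINT s|lborel. indicator {0..fst p} s * F (s, snd p))"

lemma prim_measurable [measurable]:
 assumes m: "F \<in> borel_measurable borel"
 shows "prim F \<in> borel_measurable borel"
 unfolding prim_def
proof (rule borel_measurable_param_integral)
 have [measurable]: "(%p. F (snd p, snd (fst p))) \<in> borel_measurable (borel :: ((real \<times> point) \<times> real) measure)"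
  by (rule measurable_compose[OF _ m]) measurable
 show "(%p. indicator {0..fst (fst p)} (snd p) * F (snd p, snd (fst p))) \<in> borel_measurable (borel :: ((real \<times> point) \<times> real) measure)"
  unfolding indicator_def atLeastAtMost_iff by measurable
qed (auto intro: lborel.sigma_finite_measure_axioms)

lemma sqint_time_indicator:
 assumes "A \<in> sets borel" "emeasure lborel A < \<infinity>"
 shows "sqint M3 (%p. indicator A (fst p))" "(LINT p|M3. indicator A (fst p)) = measure lborel A * measure N UNIV"
proof -
 have [measurable]: "A \<in> sets borel" by fact
 have e: "emeasure M3 (A \<times> UNIV) = emeasure lborel A * emeasure N UNIV"
  unfolding M3_def using N.emeasure_pair_measure_Times[of A lborel UNIV] by simp
 have f: "emeasure M3 (A \<times> UNIV) < \<infinity>"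
  unfolding e using assms(2) by (simp add: ennreal_mult_less_top N.emeasure_eq_measure)
 have [measurable]: "A \<times> UNIV \<in> sets (borel :: (real \<times> point) measure)" by (subst borel_prod[symmetric]) simp
 have ind: "(%p::real \<times> point. indicat_real A (fst p)) = indicator (A \<times> UNIV)" by (auto simp: indicator_def)
 have i: "integrable M3 (%p. indicat_real A (fst p))" using f unfolding ind by (simp add: integrable_indicator_iff)
 moreover have "(%p. (indicat_real A (fst p))^2) = (%p::real \<times> point. indicat_real A (fst p))" by (auto simp: indicator_def)
 ultimately show "sqint M3 (%p. indicator A (fst p))" by (simp add: sqint_def)
 have "(LINT p|M3. indicator A (fst p)) = measure M3 (A \<times> UNIV)" unfolding ind by simp
 also have "\<dots> = measure lborel A * measure N UNIV" by (simp add: measure_def e enn2real_mult)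
 finally show "(LINT p|M3. indicator A (fst p)) = measure lborel A * measure N UNIV" .
qed

lemma sqint_integrable_slab:
 assumes "sqint M3 F" shows "integrable M3 (%p. indicator {a..b} (fst p) * F p)"
 by (rule sqint_mult[OF sqint_time_indicator(1) assms]) (auto intro: emeasure_bounded_finite)

lemma prim_bound:
 assumes F: "sqint M3 F" and t: "t \<in> {0..T}"
 shows "AE x in N. (prim F (t, x))^2 \<le> t * (LINT s|lborel. (F (s, x))^2)"
  and "AE x in N. integrable lborel (%s. (F (s, x))^2)"
proof -
 have [measurable]: "F \<in> borel_measurable borel" using sqint_measurable[OF F] by simp
 have m: "(%s. F (s, x)) \<in> borel_measurable borel" for x
  by (rule measurable_compose[of "%s. (s, x)" borel borel F]) measurable
 show 1: "AE x in N. integrable lborel (%s. (F (s, x))^2)"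
  using integral_M3(4)[of "%p. (F p)^2"] F by (simp add: sqint_def)
 show "AE x in N. (prim F (t, x))^2 \<le> t * (LINT s|lborel. (F (s, x))^2)"
  using 1
 proof eventually_elim
  case (elim x)
  have s: "sqint lborel (%s. F (s, x))" using elim m by (simp add: sqint_def)
  show ?case using integral_interval_sq_le[OF s, of 0 t] t by (simp add: prim_def)
 qed
qed

lemma prim_L2:
 assumes F: "sqint M3 F" and t: "t \<in> {0..T}"
 shows "sqint N (%x. prim F (t, x))" "(LINT x|N. (prim F (t, x))^2) \<le> t * (LINT p|M3. (F p)^2)"
proof -
 have [measurable]: "F \<in> borel_measurable borel" using sqint_measurable[OF F] by simp
 have [measurable]: "(%x. prim F (t, x)) \<in> borel_measurable borel"
  by (rule measurable_compose[of "%x. (t, x)" borel borel "prim F"]) measurable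
 have i: "integrable M3 (%p. (F p)^2)" using F by (simp add: sqint_def)
 have j: "integrable N (%x. t * (LINT s|lborel. (F (s, x))^2))" using integral_M3(6)[OF i] by simp
 have k: "integrable N (%x. (prim F (t, x))^2)"
  by (rule Bochner_Integration.integrable_bound[OF j], simp, use prim_bound(1)[OF F t] in eventually_elim) (auto intro: order_trans[OF _ abs_ge_self])
 then show "sqint N (%x. prim F (t, x))" by (simp add: sqint_def)
 have "(LINT x|N. (prim F (t, x))^2) \<le> (LINT x|N. t * (LINT s|lborel. (F (s, x))^2))"
  by (rule integral_mono_AE[OF k j prim_bound(1)[OF F t]])
 also have "\<dots> = t * (LINT p|M3. (F p)^2)" using integral_M3(2)[OF i] by simp
 finally show "(LINT x|N. (prim F (t, x))^2) \<le> t * (LINT p|M3. (F p)^2)" .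
qed

lemma prim_slab:
 assumes V: "sqint M3 V"
 shows "sqint M3 (%p. indicator {a..b} (fst p) * prim V p)"
proof -
 have [measurable]: "V \<in> borel_measurable borel" using sqint_measurable[OF V] by simp
 \<comment> \<open>Since negative times contribute nothing, the slab can be replaced by the one from
   0 to |b|.\<close>
 define q where "q = \<bar>b\<bar>"
 let ?g = "%p. indicator {0..q} (fst p) * (prim V p)^2"
 have q: "q \<ge> 0" by (simp add: q_def)
 have gm: "?g \<in> borel_measurable M3" by simp
 have "integrable M3 ?g"
  unfolding M3_def
 proof (rule P.Fubini_integrable)
  show "?g \<in> borel_measurable (lborel \<Otimes>\<^sub>M N)" using gm by (simp only: M3_def)
  show "AE t in lborel. integrable N (%x. ?g (t, x))"
  proof (rule AE_I2)
   fix t show "integrable N (%x. ?g (t, x))"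
    using prim_L2(1)[OF V, of t q] by (cases "t \<in> {0..q}") (auto simp: sqint_def)
  qed
  have mm: "(%t. LINT x|N. norm (?g (t, x))) \<in> borel_measurable borel"
  proof (rule borel_measurable_param_integral)
   have "(%p. norm (?g p)) \<in> borel_measurable borel" by simp
   then show "(%p. norm (?g (fst p, snd p))) \<in> borel_measurable borel" by simp
  qed (auto intro: N.sigma_finite_measure_axioms)
  show "integrable lborel (%t. LINT x|N. norm (?g (t, x)))"
  proof (rule Bochner_Integration.integrable_bound)
   show "integrable lborel (%t. indicator {0..q} t * (q * (LINT p|M3. (V p)^2)))" by simp
   show "AE t in lborel. norm (LINT x|N. norm (?g (t, x))) \<le> norm (indicator {0..q} t * (q * (LINT p|M3. (V p)^2)))"
   proof (rule AE_I2)
    fix t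
    show "norm (LINT x|N. norm (?g (t, x))) \<le> norm (indicator {0..q} t * (q * (LINT p|M3. (V p)^2)))"
    proof (cases "t \<in> {0..q}")
     case True
     have "(LINT x|N. (prim V (t, x))^2) \<le> t * (LINT p|M3. (V p)^2)" using prim_L2(2)[OF V, of t q] True by auto
     also have "\<dots> \<le> q * (LINT p|M3. (V p)^2)" using True by (intro mult_right_mono) auto
     finally show ?thesis using True q by (simp add: abs_mult)
    qed simp
   qed
  qed (use mm in simp)
 qed
 moreover have "(%p. (indicator {0..q} (fst p) * prim V p)^2) = ?g" by (auto simp: indicator_def)
 ultimately have "sqint M3 (%p. indicator {0..q} (fst p) * prim V p)" by (simp add: sqint_def)
 then show ?thesis
 proof (rule sqint_bound[where C=1])
  have z: "prim V p = 0" if "fst p < 0" for p using that by (simp add: prim_def)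
  have "\<bar>indicator {a..b} (fst p) * prim V p\<bar> \<le> 1 * \<bar>indicator {0..q} (fst p) * prim V p\<bar>" for p
   by (cases "fst p < 0") (auto simp: z indicator_def q_def)
  then show "AE p in M3. \<bar>indicator {a..b} (fst p) * prim V p\<bar> \<le> 1 * \<bar>indicator {0..q} (fst p) * prim V p\<bar>" by simp
 qed simp
qed

text \<open>For each test function in time the weak derivative gives an identity outside a null set
  of points that depends on the test function, so the scalar lemma cannot be applied at a fixed
  point. It is applied to integrals over a Borel set B of points instead, and the difference R is
  then seen to have zero integral over all boxes of space-time. The initial value comes from the
  representative that is continuous in time with values in L2.\<close>

lemma solution_is_primitive:
 fixes u du :: "real => point => real"
 assumes T: "T > 0" and u: "in_L2_L2 T (Omega l h) u" and du: "in_L2_L2 T (Omega l h) du"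
  and wd: "weak_time_derivative T (Omega l h) u du" and tr: "time_trace T (Omega l h) u 0 v"
  and v: "sqint N v"
 shows "AE p in M3. fst p \<in> {0<..<T} --> ext T u p = v (snd p) + prim (ext T du) p"
proof -
 define U where "U = ext T u"
 define V where "V = ext T du"
 have sU: "sqint M3 U" and sV: "sqint M3 V"
  using in_L2_L2_ext[OF u] in_L2_L2_ext[OF du] by (simp_all add: sqint_def U_def V_def)
 have [measurable]: "U \<in> borel_measurable borel" "V \<in> borel_measurable borel" "v \<in> borel_measurable borel"
  using sqint_measurable[OF sU] sqint_measurable[OF sV] sqint_measurable[OF v] by simp_all
 have slab: "indicator {0..T} (fst p) * U p = U p" "indicator {0..T} (fst p) * V p = V p" for p
  by (auto simp: U_def V_def ext_def)
 have z: "U (t, x) = 0" "V (t, x) = 0" if "t \<notin> {0<..<T}" for t x using that by (auto simp: U_def V_def ext_def)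
 have iU: "integrable M3 U" and iV: "integrable M3 V"
  using sqint_integrable_slab[OF sU, of 0 T] sqint_integrable_slab[OF sV, of 0 T] by (simp_all add: slab)
 define R where "R p = indicator {0<..<T} (fst p) * (U p - v (snd p) - prim V p)" for p
 have [measurable]: "R \<in> borel_measurable borel" unfolding R_def[abs_def] by measurable
 have main: "AE t in lborel. t \<in> {0<..<T} --> (LINT x|N. indicator B x * R (t, x)) = 0" if B[measurable]: "B \<in> sets borel" for B :: "point set"
 proof -
  define m where "m t = (LINT x|N. indicator B x * U (t, x))" for t
  define d where "d t = (LINT x|N. indicator B x * V (t, x))" for t
  define m0 where "m0 = (LINT x|N. indicator B x * v x)"
  have iB: "integrable M3 (%p. indicator B (snd p) * F p)" if "integrable M3 F" for F :: "real \<times> point => real"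
   using that by (intro Bochner_Integration.integrable_bound[OF that]) (auto simp: indicator_def dest!: borel_measurable_integrable)
  have im: "integrable lborel m" "integrable lborel d"
   unfolding m_def d_def using integral_M3(5)[OF iB[OF iU]] integral_M3(5)[OF iB[OF iV]] by simp_all
  have D: "(LINT r|lborel. indicator {0..t} r * d r) = (LINT p|M3. (indicator {0..t} (fst p) * indicator B (snd p)) * V p)"
   "(LINT r|lborel. indicator {0..t} r * d r) = (LINT x|N. indicator B x * prim V (t, x))" for t
  proof -
   have i: "integrable M3 (%p. (indicator {0..t} (fst p) * indicator B (snd p)) * V p)"
    using iB[OF iV] by (intro Bochner_Integration.integrable_bound[OF iV]) (auto simp: indicator_def)
   show "(LINT r|lborel. indicator {0..t} r * d r) = (LINT p|M3. (indicator {0..t} (fst p) * indicator B (snd p)) * V p)"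
    using integral_M3(1)[OF i] by (simp add: d_def mult.assoc)
   also have "\<dots> = (LINT x|N. (LINT s|lborel. (indicator {0..t} s * indicator B x) * V (s, x)))"
    using integral_M3(2)[OF i] by simp
   also have "\<dots> = (LINT x|N. indicator B x * prim V (t, x))"
    by (simp add: prim_def mult_ac flip: integral_mult_right_zero)
   finally show "(LINT r|lborel. indicator {0..t} r * d r) = (LINT x|N. indicator B x * prim V (t, x))" .
  qed
  have "AE t in lborel. t \<in> {0<..<T} --> m t = m0 + (LINT r|lborel. indicator {0..t} r * d r)"
  proof (rule du_Bois_Reymond_initial[OF T im])
   fix \<psi> \<psi>' assume t: "test_function {0<..<T} \<psi>" and D\<psi>: "\<And>t. (\<psi> has_real_derivative \<psi>' t) (at t)"
   have der: "deriv \<psi> = \<psi>'" using D\<psi> by (auto intro: DERIV_imp_deriv)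
   have tc: "Ck_compact k {0<..<T} \<psi>" for k using t by (auto simp: test_function_def smooth_fun_on_def Ck_compact_def)
   have fd: "frechet_derivative \<psi> (at x) 1 = \<psi>' x" for x by (simp add: real_frechet_derivative[OF D\<psi>])
   note op = open_greaterThanLessThan[of 0 T]
   have c1: "Ck_compact 0 {0<..<T} \<psi>'" using Ck_compact_Suc(2)[OF tc[of "Suc 0"] op, of 1] by (simp add: fd)
   obtain C where C: "\<And>x. \<bar>\<psi> x\<bar> \<le> C" using Ck_compact_bounded[OF tc[of 0] op] by auto
   obtain C' where C': "\<And>x. \<bar>\<psi>' x\<bar> \<le> C'" using Ck_compact_bounded[OF c1 op] by auto
   have [measurable]: "\<psi> \<in> borel_measurable borel" "\<psi>' \<in> borel_measurable borel"
    using Ck_compact_0_continuous[OF tc[of 0] op] Ck_compact_0_continuous[OF c1 op]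
    by (auto intro: borel_measurable_continuous_onI)
   have i: "integrable M3 (%p. q (fst p) * (indicator B (snd p) * F p))" if F: "integrable M3 F" and q: "\<And>x. \<bar>q x\<bar> \<le> K" and [measurable]: "q \<in> borel_measurable borel" for q :: "real => real" and F K
   proof (rule Bochner_Integration.integrable_bound[of M3 "%p. K * F p"])
    have [measurable]: "F \<in> borel_measurable borel" using F by (auto dest: borel_measurable_integrable)
    show "(%p. q (fst p) * (indicator B (snd p) * F p)) \<in> borel_measurable M3" by simp
    have "norm (q (fst p) * (indicator B (snd p) * F p)) \<le> norm (K * F p)" for p
     using mult_right_mono[OF order_trans[OF q abs_ge_self], of "\<bar>F p\<bar>" "fst p"] by (auto simp: abs_mult indicator_def)
    then show "AE p in M3. norm (q (fst p) * (indicator B (snd p) * F p)) \<le> norm (K * F p)" by simp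
   qed (use F in simp)
   note i1 = i[OF iU C'] and i2 = i[OF iV C]
   have "(LINT t|lborel. indicator {0<..<T} t * (\<psi>' t * m t)) = (LINT t|lborel. (LINT x|N. \<psi>' t * (indicator B x * U (t, x))))"
   proof (rule Bochner_Integration.integral_cong[OF refl])
    fix t show "indicator {0<..<T} t * (\<psi>' t * m t) = (LINT x|N. \<psi>' t * (indicator B x * U (t, x)))"
     by (cases "t \<in> {0<..<T}") (simp_all add: m_def z)
   qed
   also have "\<dots> = (LINT x|N. (LINT t|lborel. \<psi>' t * (indicator B x * U (t, x))))"
    using integral_M3(1,2)[OF i1] by simp
   also have "\<dots> = (LINT x|N. - (LINT t|lborel. \<psi> t * (indicator B x * V (t, x))))"
   proof (rule integral_cong_AE)
    have "AE x in N. (LINT t:{0<..<T}|lborel. deriv \<psi> t * u t x) = - (LINT t:{0<..<T}|lborel. \<psi> t * du t x)"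
     using wd t unfolding weak_time_derivative_def AE_N by blast
    then show "AE x in N. (LINT t|lborel. \<psi>' t * (indicator B x * U (t, x))) = - (LINT t|lborel. \<psi> t * (indicator B x * V (t, x)))"
     using AE_N_Omega
    proof eventually_elim
     case (elim x)
     have 1: "(LINT t:{0<..<T}|lborel. deriv \<psi> t * u t x) = (LINT t|lborel. \<psi>' t * U (t, x))"
      unfolding set_lebesgue_integral_def
      by (intro Bochner_Integration.integral_cong) (use elim in \<open>auto simp: U_def ext_def der indicator_def\<close>)
     have 2: "(LINT t:{0<..<T}|lborel. \<psi> t * du t x) = (LINT t|lborel. \<psi> t * V (t, x))"
      unfolding set_lebesgue_integral_def
      by (intro Bochner_Integration.integral_cong) (use elim in \<open>auto simp: V_def ext_def indicator_def\<close>)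
     show ?case using elim(1) unfolding 1 2 by (simp add: indicator_def)
    qed
    show "(%x. LINT t|lborel. \<psi>' t * (indicator B x * U (t, x))) \<in> borel_measurable N"
     "(%x. - (LINT t|lborel. \<psi> t * (indicator B x * V (t, x)))) \<in> borel_measurable N"
     using integral_M3(6)[OF i1] integral_M3(6)[OF i2] by auto
   qed
   also have "\<dots> = - (LINT t|lborel. (LINT x|N. \<psi> t * (indicator B x * V (t, x))))"
    using integral_M3(1,2)[OF i2] by simp
   also have "(LINT t|lborel. (LINT x|N. \<psi> t * (indicator B x * V (t, x)))) = (LINT t|lborel. indicator {0<..<T} t * (\<psi> t * d t))"
   proof (rule Bochner_Integration.integral_cong[OF refl])
    fix t show "(LINT x|N. \<psi> t * (indicator B x * V (t, x))) = indicator {0<..<T} t * (\<psi> t * d t)"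
     by (cases "t \<in> {0<..<T}") (simp_all add: d_def z)
   qed
   finally show "(LINT t|lborel. indicator {0<..<T} t * (\<psi>' t * m t)) = - (LINT t|lborel. indicator {0<..<T} t * (\<psi> t * d t))" .
  next
   fix e :: real assume e: "e > 0"
   obtain w where w: "\<forall>t\<in>{0..T}. in_L2 (Omega l h) (w t)"
    "\<forall>r\<in>{0..T}. ((%t. eL2norm (Omega l h) (%x. w t x - w r x)) \<longlongrightarrow> 0) (at r within {0..T})"
    "AE t\<in>{0<..<T} in lborel. AE x\<in>Omega l h in lborel. w t x = u t x" "w 0 = v"
    using tr unfolding time_trace_def by blast
   define nB where "nB = measure N UNIV + 1"
   have nB: "nB > 0" by (simp add: nB_def add_nonneg_pos)
   \<comment> \<open>The Young weight a1 and the radius \<eta> are tuned so that both shares in the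
     bound for \<open>m t - m0\<close> are e/4.\<close>
   define a1 where "a1 = e / (4 * nB)"
   have a1: "a1 > 0" "a1 * nB = e / 4" using e nB by (auto simp: a1_def)
   define \<eta> where "\<eta> = sqrt (a1 * (e / 4))"
   have \<eta>: "\<eta> > 0" "\<eta>^2 = a1 * (e / 4)" using a1 e by (auto simp: \<eta>_def)
   have "((%t. eL2norm (Omega l h) (%x. w t x - v x)) \<longlongrightarrow> 0) (at 0 within {0..T})"
    using w(2) T w(4) by auto
   then have "eventually (%t. eL2norm (Omega l h) (%x. w t x - v x) < ennreal \<eta>) (at 0 within {0..T})"
    by (rule order_tendstoD) (use \<eta> in simp)
   then obtain \<delta>1 where d1: "\<delta>1 > 0" "\<And>t. t \<in> {0..T} ==> t \<noteq> 0 ==> \<bar>t\<bar> < \<delta>1 ==> eL2norm (Omega l h) (%x. w t x - v x) < ennreal \<eta>"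
    unfolding eventually_at by (auto simp: dist_real_def)
   define VV where "VV = (LINT p|M3. (V p)^2)"
   have VV: "VV \<ge> 0" by (simp add: VV_def)
   \<comment> \<open>Two more shares of e/4, now for the time integral of d: a2 makes the share of V
     small at all times, and then \<delta> makes the share of the short time interval small.\<close>
   define a2 where "a2 = 4 * (VV + 1) / e"
   have a2: "a2 > 0" "VV / a2 \<le> e / 4" using VV e by (auto simp: a2_def field_simps)
   define \<delta> where "\<delta> = min (min \<delta>1 T) (e / (4 * (a2 * nB)))"
   have \<delta>: "\<delta> > 0" using d1 T e a2 nB by (auto simp: \<delta>_def)
   show "\<exists>\<delta>>0. AE t in lborel. 0 < t --> t < \<delta> --> \<bar>m t - (LINT r|lborel. indicator {0..t} r * d r) - m0\<bar> \<le> e"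
   proof (intro exI[of _ \<delta>] conjI \<delta>)
    have "AE t in lborel. integrable N (%x. (U (t, x))^2)"
     using integral_M3(3)[of "%p. (U p)^2"] sU by (simp add: sqint_def)
    then show "AE t in lborel. 0 < t --> t < \<delta> --> \<bar>m t - (LINT r|lborel. indicator {0..t} r * d r) - m0\<bar> \<le> e"
     using w(3)
    proof eventually_elim
     case (elim t)
     show ?case
     proof (intro impI)
      assume t: "0 < t" "t < \<delta>"
      then have tT: "t \<in> {0<..<T}" "t < \<delta>1" by (auto simp: \<delta>_def)
      have [measurable]: "(%x. U (t, x)) \<in> borel_measurable borel"
       by (rule measurable_compose[of "%x. (t, x)" borel borel U]) measurable
      have sUt: "sqint N (%x. U (t, x))" using elim(1) by (simp add: sqint_def)
      have wU: "AE x\<in>Omega l h in lborel. w t x = U (t, x)"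
       using elim(2) tT by (auto simp: U_def ext_def elim: eventually_mono)
      have "ennreal (LINT x|N. (U (t, x) - v x)^2) = (\<integral>\<^sup>+x. ennreal ((U (t, x) - v x)^2) \<partial>N)"
       using sqint_diff[OF sUt v] by (subst nn_integral_eq_integral) (auto simp: sqint_def)
      also have "\<dots> = (\<integral>\<^sup>+x\<in>Omega l h. ennreal ((U (t, x) - v x)^2) \<partial>lborel)" by (rule nn_integral_N) measurable
      also have "\<dots> = (\<integral>\<^sup>+x\<in>Omega l h. ennreal ((norm (w t x - v x))^2) \<partial>lborel)"
       by (rule nn_integral_cong_AE, use wU in eventually_elim) (auto simp: indicator_def)
      also have "\<dots> = (eL2norm (Omega l h) (%x. w t x - v x))^2" by (simp add: eL2norm_sq)
      also have "\<dots> \<le> (ennreal \<eta>)^2" using d1(2)[of t] tT by (intro power_mono) auto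
      also have "\<dots> = ennreal (\<eta>^2)" using \<eta> by (simp add: ennreal_power)
      finally have le: "(LINT x|N. (U (t, x) - v x)^2) \<le> a1 * (e / 4)" using \<eta> a1 e by (subst (asm) ennreal_le_iff) auto
      have sB: "sqint N (indicat_real B)"
       by (simp add: sqint_def power2_eq_square N.emeasure_eq_measure flip: indicator_inter_arith)
      have iB1: "integrable N (%x. indicator B x * U (t, x))" "integrable N (%x. indicator B x * v x)"
       using sqint_mult[OF sB sUt] sqint_mult[OF sB v] .
      have NB: "(LINT x|N. (indicat_real B x)^2) \<le> nB"
      proof -
       have "(LINT x|N. (indicat_real B x)^2) = measure N B" by (simp add: power2_eq_square flip: indicator_inter_arith)
       also have "\<dots> \<le> nB" using N.finite_measure_mono[of B UNIV] by (simp add: nB_def)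
       finally show ?thesis .
      qed
      have "m t - m0 = (LINT x|N. indicator B x * (U (t, x) - v x))"
       using iB1 by (simp add: m_def m0_def right_diff_distrib)
      then have "\<bar>m t - m0\<bar> \<le> a1 * (LINT x|N. (indicat_real B x)^2) + (LINT x|N. (U (t, x) - v x)^2) / a1"
       using sqint_Young[OF sB sqint_diff[OF sUt v] a1(1)] by simp
      also have "\<dots> \<le> a1 * nB + (a1 * (e / 4)) / a1"
       using NB le a1 by (intro add_mono mult_left_mono divide_right_mono) auto
      also have "\<dots> = e / 2" using a1 by simp
      finally have 1: "\<bar>m t - m0\<bar> \<le> e / 2" .
      have sI: "sqint M3 (%p. indicat_real {0..t} (fst p) * indicator B (snd p))"
       by (rule sqint_bound[OF sqint_time_indicator(1)[of "{0..t}"], of _ 1]) (auto simp: indicator_def intro: emeasure_bounded_finite)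
      have tB: "(LINT p|M3. (indicat_real {0..t} (fst p) * indicator B (snd p))^2) \<le> t * nB"
      proof -
       have "(LINT p|M3. (indicat_real {0..t} (fst p) * indicator B (snd p))^2) \<le> (LINT p|M3. (indicat_real {0..t} (fst p))^2)"
        using sI sqint_time_indicator(1)[of "{0..t}"]
        by (intro integral_mono) (auto simp: sqint_def indicator_def intro: emeasure_bounded_finite)
       also have "\<dots> = (LINT p|M3. indicat_real {0..t} (fst p))"
        by (intro Bochner_Integration.integral_cong) (auto simp: indicator_def)
       also have "\<dots> = t * measure N UNIV" using t by (subst sqint_time_indicator(2)) (auto intro: emeasure_bounded_finite)
       also have "\<dots> \<le> t * nB" using t by (intro mult_left_mono) (auto simp: nB_def)
       finally show ?thesis .
      qed
      have "\<bar>LINT r|lborel. indicator {0..t} r * d r\<bar> \<le> a2 * (LINT p|M3. (indicat_real {0..t} (fst p) * indicator B (snd p))^2) + VV / a2"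
       unfolding D(1) VV_def by (rule sqint_Young[OF sI sV a2(1)])
      also have "\<dots> \<le> a2 * (t * nB) + e / 4"
       using tB a2 by (intro add_mono mult_left_mono) auto
      also have "a2 * (t * nB) \<le> e / 4"
      proof -
       have "t \<le> e / (4 * (a2 * nB))" using t by (simp add: \<delta>_def)
       then have "t * (4 * (a2 * nB)) \<le> e" using a2 nB by (simp add: pos_le_divide_eq)
       then show ?thesis by (simp add: mult_ac)
      qed
      finally have "\<bar>LINT r|lborel. indicator {0..t} r * d r\<bar> \<le> e / 2" by simp
      then show "\<bar>m t - (LINT r|lborel. indicator {0..t} r * d r) - m0\<bar> \<le> e" using 1 by linarith
     qed
    qed
   qed
  qed
  moreover have "AE t in lborel. integrable N (%x. indicator B x * U (t, x))" using integral_M3(3)[OF iB[OF iU]] by simp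
  ultimately show ?thesis
  proof eventually_elim
   case (elim t)
   show ?case
   proof
    assume t: "t \<in> {0<..<T}"
    have sB: "sqint N (indicat_real B)"
     by (simp add: sqint_def power2_eq_square N.emeasure_eq_measure flip: indicator_inter_arith)
    have i: "integrable N (%x. indicator B x * v x)" "integrable N (%x. indicator B x * prim V (t, x))"
     using sqint_mult[OF sB v] sqint_mult[OF sB prim_L2(1)[OF sV, of t T]] t by auto
    have "(LINT x|N. indicator B x * R (t, x)) = (LINT x|N. indicator B x * U (t, x) - indicator B x * v x - indicator B x * prim V (t, x))"
     using t by (simp add: R_def right_diff_distrib)
    also have "\<dots> = m t - m0 - (LINT r|lborel. indicator {0..t} r * d r)"
     using elim(2) i by (simp add: m_def m0_def D(2))
    finally show "(LINT x|N. indicator B x * R (t, x)) = 0" using elim(1) t by simp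
   qed
  qed
 qed
 have iR: "integrable M3 R"
 proof -
  have sT: "sqint M3 (%p. indicator {0<..<T} (fst p) * v (snd p))"
   unfolding sqint_def
  proof
   show "(%p. indicator {0<..<T} (fst p) * v (snd p)) \<in> borel_measurable M3" by simp
   have "integrable M3 (%p. indicator {0<..<T} (fst p) * (v (snd p))^2)"
    unfolding M3_def
   proof (rule P.Fubini_integrable)
    have "(%p. indicator {0<..<T} (fst p) * (v (snd p))^2) \<in> borel_measurable M3" by simp
    then show "(%p. indicator {0<..<T} (fst p) * (v (snd p))^2) \<in> borel_measurable (lborel \<Otimes>\<^sub>M N)" by (simp only: M3_def)
   qed (use v in \<open>auto simp: sqint_def abs_mult\<close>)
   moreover have "(%p. (indicator {0<..<T} (fst p) * v (snd p))^2) = (%p. indicator {0<..<T} (fst p) * (v (snd p))^2)"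
    by (auto simp: indicator_def)
   ultimately show "integrable M3 (%p. (indicator {0<..<T} (fst p) * v (snd p))^2)" by simp
  qed
  have sP': "sqint M3 (%p. indicator {0<..<T} (fst p) * prim V p)"
   by (rule sqint_bound[OF prim_slab[OF sV, of 0 T], of _ 1]) (auto simp: indicator_def)
  have "sqint M3 (%p. U p - indicator {0<..<T} (fst p) * v (snd p) - indicator {0<..<T} (fst p) * prim V p)"
   by (intro sqint_diff sU sT sP')
  moreover have "(%p. U p - indicator {0<..<T} (fst p) * v (snd p) - indicator {0<..<T} (fst p) * prim V p) = R"
   by (auto simp: R_def U_def ext_def indicator_def)
  ultimately have "sqint M3 R" by simp
  from sqint_integrable_slab[OF this, of 0 T] show ?thesis
   by (rule Bochner_Integration.integrable_cong[THEN iffD1, rotated 2]) (auto simp: R_def indicator_def)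
 qed
 \<comment> \<open>The null set of times in \<open>main\<close> depends on B, but it disappears on
   integration in time, so the boxes can be treated one at a time.\<close>
 have "AE p in lborel. indicator (UNIV \<times> Omega l h) p * R p = 0"
 proof (rule integrable_zero_on_boxes)
  have M3d: "M3 = density lborel (%p. indicator (UNIV \<times> Omega l h) p)"
  proof (rule measure_eqI)
   fix A assume "A \<in> sets M3"
   then have "A \<in> sets borel" by simp
   then show "emeasure M3 A = emeasure (density lborel (indicator (UNIV \<times> Omega l h))) A"
    using borel_open[OF open_Times[OF open_UNIV Omega_open]]
    by (simp add: emeasure_M3 emeasure_density Int_commute indicator_inter_arith[symmetric])
  qed simp
  have O: "UNIV \<times> Omega l h \<in> sets (borel :: (real \<times> point) measure)" by (intro borel_open open_Times) auto
  have conv1: "integrable M3 F \<longleftrightarrow> integrable lborel (%p. indicator (UNIV \<times> Omega l h) p * F p)"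
   if "F \<in> borel_measurable borel" for F :: "real \<times> point => real"
   unfolding M3d using that O integrable_density[of F lborel "indicat_real (UNIV \<times> Omega l h)"]
   by (simp add: ennreal_indicator)
  have conv2: "integral\<^sup>L M3 F = (LINT p|lborel. indicator (UNIV \<times> Omega l h) p * F p)"
   if "F \<in> borel_measurable borel" for F :: "real \<times> point => real"
   unfolding M3d using that O integral_density[of F lborel "indicat_real (UNIV \<times> Omega l h)"]
   by (simp add: ennreal_indicator)
  show "integrable lborel (%p. indicator (UNIV \<times> Omega l h) p * R p)" using iR by (subst conv1[symmetric]) auto
  fix a b :: "real \<times> point"
  have bx: "indicat_real (box a b) (t, x) = indicator (box (fst a) (fst b)) t * indicator (box (snd a) (snd b)) x" for t x
   by (simp add: box_prod[of a b] indicator_times)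
  have iRb: "integrable M3 (%p. indicat_real (box a b) p * R p)"
   using integrable_mult_indicator[of "box a b" M3 R] iR by simp
  have "(LINT p|lborel. indicator (box a b) p * (indicator (UNIV \<times> Omega l h) p * R p)) = (LINT p|M3. indicat_real (box a b) p * R p)"
   by (subst conv2) (auto simp: mult.left_commute)
  also have "\<dots> = (LINT t|lborel. (LINT x|N. indicat_real (box a b) (t, x) * R (t, x)))"
   by (rule integral_M3(1)[OF iRb])
  also have "\<dots> = 0"
  proof (rule integral_eq_zero_AE)
   show "AE t in lborel. (LINT x|N. indicat_real (box a b) (t, x) * R (t, x)) = 0"
    using main[of "box (snd a) (snd b)", OF borel_open[OF open_box]]
   proof eventually_elim
    case (elim t)
    have "(LINT x|N. indicat_real (box a b) (t, x) * R (t, x)) = indicator (box (fst a) (fst b)) t * (LINT x|N. indicator (box (snd a) (snd b)) x * R (t, x))"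
     by (simp add: bx mult.assoc)
    then show ?case using elim by (cases "t \<in> {0<..<T}") (auto simp: R_def)
   qed
  qed
  finally show "(LINT p|lborel. indicator (box a b) p * (indicator (UNIV \<times> Omega l h) p * R p)) = 0" .
 qed
 then have "AE p in lborel. snd p \<in> Omega l h --> R p = 0" by eventually_elim (auto simp: indicator_def)
 then have "AE p in (lborel \<Otimes>\<^sub>M lborel :: (real \<times> point) measure). snd p \<in> Omega l h --> R p = 0"
  by (subst lborel_prod)
 then have "AE t in (lborel :: real measure). AE x in lborel. x \<in> Omega l h --> R (t, x) = 0"
  using lborel_pair.AE_pair[of "%p. snd p \<in> Omega l h --> R p = 0"] by simp
 then have "AE t in lborel. AE x in N. R (t, x) = 0" by (simp add: AE_N)
 then have "AE p in M3. R p = 0" by (rule AE_M3_I[rotated]) measurable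
 then show ?thesis by eventually_elim (auto simp: R_def U_def V_def indicator_def)
qed

end

lemma sqint_cong_AE:
 assumes "sqint M f" "g \<in> borel_measurable M" "AE x in M. f x = g x"
 shows "sqint M g"
 by (rule sqint_bound[OF assms(1,2), of 1]) (use assms(3) in eventually_elim, simp)

lemma wt_section:
 fixes F :: "real \<times> point => real"
 assumes "F \<in> borel_measurable borel"
 shows "(%x. F (t, x)) \<in> borel_measurable borel" "(%t. F (t, x)) \<in> borel_measurable borel"
 by (rule measurable_compose[OF _ assms], measurable)+

section \<open>Admissible test functions\<close>

context torus begin

lemma wgrad_iff_LINT:
 assumes b: "b \<in> Basis" and [measurable]: "f \<in> borel_measurable borel" "g \<in> borel_measurable borel"
  and F: "\<And>x. x \<in> Omega l h ==> F x = f x" "\<And>x. x \<in> Omega l h ==> G x \<bullet> b = g x"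
 shows "wgrad f g b \<longleftrightarrow> (\<forall>\<psi>. torus_test_function l h \<psi> -->
  (LINT x:Omega l h|lborel. F x * frechet_derivative \<psi> (at x) b) = - (LINT x:Omega l h|lborel. (G x \<bullet> b) * \<psi> x))"
proof -
 have e: "(LINT x|N. f x * frechet_derivative \<psi> (at x) b) = (LINT x:Omega l h|lborel. F x * frechet_derivative \<psi> (at x) b)"
  "(LINT x|N. g x * \<psi> x) = (LINT x:Omega l h|lborel. (G x \<bullet> b) * \<psi> x)" if t: "torus_test_function l h \<psi>" for \<psi>
 proof -
  have [measurable]: "\<psi> \<in> borel_measurable borel" "(%x. frechet_derivative \<psi> (at x) b) \<in> borel_measurable borel"
   using torus_test_deriv[OF t] b by (blast intro: borel_measurable_continuous_onI)+
  show "(LINT x|N. f x * frechet_derivative \<psi> (at x) b) = (LINT x:Omega l h|lborel. F x * frechet_derivative \<psi> (at x) b)"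
   by (rule LINT_Omega[symmetric]) (auto simp: F)
  show "(LINT x|N. g x * \<psi> x) = (LINT x:Omega l h|lborel. (G x \<bullet> b) * \<psi> x)"
   by (rule LINT_Omega[symmetric]) (auto simp: F)
 qed
 show ?thesis unfolding wgrad_def
 proof (intro iff_allI imp_cong refl)
  fix \<psi> assume "torus_test_function l h \<psi>"
  from e[OF this] show "((LINT x|N. f x * frechet_derivative \<psi> (at x) b) = - (LINT x|N. g x * \<psi> x)) =
   ((LINT x:Omega l h|lborel. F x * frechet_derivative \<psi> (at x) b) = - (LINT x:Omega l h|lborel. (G x \<bullet> b) * \<psi> x))"
   by simp
 qed
qed

lemma torus_weak_gradient_iff:
 assumes m: "f \<in> borel_measurable borel" "g1 \<in> borel_measurable borel" "g2 \<in> borel_measurable borel"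
  and F: "\<And>x. x \<in> Omega l h ==> F x = f x" "\<And>x. x \<in> Omega l h ==> G x = (g1 x, g2 x)"
 shows "torus_weak_gradient l h F G \<longleftrightarrow> wgrad f g1 (1, 0) \<and> wgrad f g2 (0, 1)"
proof -
 have B: "Basis = {(1, 0), (0, 1) :: point}" by (auto simp: Basis_prod_def)
 have b: "(1, 0) \<in> (Basis :: point set)" "(0, 1) \<in> (Basis :: point set)" by (auto simp: B)
 have 1: "wgrad f g1 (1, 0) \<longleftrightarrow> (\<forall>\<psi>. torus_test_function l h \<psi> -->
  (LINT x:Omega l h|lborel. F x * frechet_derivative \<psi> (at x) (1, 0)) = - (LINT x:Omega l h|lborel. (G x \<bullet> (1, 0)) * \<psi> x))"
  by (rule wgrad_iff_LINT) (use m F b in auto)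
 have 2: "wgrad f g2 (0, 1) \<longleftrightarrow> (\<forall>\<psi>. torus_test_function l h \<psi> -->
  (LINT x:Omega l h|lborel. F x * frechet_derivative \<psi> (at x) (0, 1)) = - (LINT x:Omega l h|lborel. (G x \<bullet> (0, 1)) * \<psi> x))"
  by (rule wgrad_iff_LINT) (use m F b in auto)
 show ?thesis unfolding 1 2 torus_weak_gradient_def B by blast
qed

text \<open>A pointwise form of what \<open>weak_solution\<close> asks of a test function: at almost
  every point it is an explicit primitive in time, and it vanishes identically at time T. Square
  integrability concerns the slab up to time T only, as such functions will be built from functions
  given for all times.\<close>

definition adm :: "real => (real \<times> point => real) => (real \<times> point => real) => (real \<times> point => real) => (real \<times> point => real) => bool" where
 "adm T \<phi> d g1 g2 \<longleftrightarrow>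
  (\<forall>F\<in>{\<phi>, d, g1, g2}. F \<in> borel_measurable borel \<and> sqint M3 (%p. indicator {0..T} (fst p) * F p)) \<and>
  sqint N (%x. \<phi> (0, x)) \<and>
  (AE x in N. \<forall>t\<in>{0..T}. \<phi> (t, x) = \<phi> (0, x) + (LINT s|lborel. indicator {0..t} s * d (s, x))) \<and>
  (AE t in lborel. t \<in> {0<..<T} --> wgrad (%x. \<phi> (t, x)) (%x. g1 (t, x)) (1, 0) \<and> wgrad (%x. \<phi> (t, x)) (%x. g2 (t, x)) (0, 1)) \<and>
  (\<forall>x. \<phi> (T, x) = 0)"

text \<open>Absolute continuity with Cauchy-Schwarz in time bounds the squared L2 distance of two
  slices by |t - r| times the squared norm of d. Hence \<phi> is its own continuous representative
  and its slices are its traces. The weak time derivative is \<open>AC_product\<close> with a factor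
  vanishing at both ends.\<close>

lemma adm_class:
 assumes a: "adm T \<phi> d g1 g2" and T: "T > 0"
 shows "in_L2_H1per T l h (%t x. \<phi> (t, x)) (%t x. (g1 (t, x), g2 (t, x)))"
  and "in_L2_L2 T (Omega l h) (%t x. d (t, x))"
  and "weak_time_derivative T (Omega l h) (%t x. \<phi> (t, x)) (%t x. d (t, x))"
  and "time_trace T (Omega l h) (%t x. \<phi> (t, x)) 0 (%x. \<phi> (0, x))"
  and "time_trace T (Omega l h) (%t x. \<phi> (t, x)) T (%x. 0)"
proof -
 have m[measurable]: "\<phi> \<in> borel_measurable borel" "d \<in> borel_measurable borel" "g1 \<in> borel_measurable borel" "g2 \<in> borel_measurable borel"
  and s: "sqint M3 (%p. indicator {0..T} (fst p) * \<phi> p)" "sqint M3 (%p. indicator {0..T} (fst p) * d p)"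
   "sqint M3 (%p. indicator {0..T} (fst p) * g1 p)" "sqint M3 (%p. indicator {0..T} (fst p) * g2 p)"
  and s0: "sqint N (%x. \<phi> (0, x))"
  and ac: "AE x in N. \<forall>t\<in>{0..T}. \<phi> (t, x) = \<phi> (0, x) + (LINT s|lborel. indicator {0..t} s * d (s, x))"
  and wg: "AE t in lborel. t \<in> {0<..<T} --> wgrad (%x. \<phi> (t, x)) (%x. g1 (t, x)) (1, 0) \<and> wgrad (%x. \<phi> (t, x)) (%x. g2 (t, x)) (0, 1)"
  and fin: "\<And>x. \<phi> (T, x) = 0"
  using a unfolding adm_def by auto
 note [measurable] = wt_section[OF m(1)] wt_section[OF m(2)] wt_section[OF m(3)] wt_section[OF m(4)]
 have i: "integrable M3 (%p. indicator {0<..<T} (fst p) * (F p)^2)" if "sqint M3 (%p. indicator {0..T} (fst p) * F p)" "F \<in> borel_measurable borel" for F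
 proof (rule Bochner_Integration.integrable_bound[of M3 "%p. (indicator {0..T} (fst p) * F p)^2"])
  show "integrable M3 (%p. (indicator {0..T} (fst p) * F p)^2)" using that by (simp add: sqint_def)
 qed (use that in \<open>auto simp: indicator_def\<close>)
 have 1: "in_L2_L2 T (Omega l h) (%t x. F (t, x))" if "sqint M3 (%p. indicator {0..T} (fst p) * F p)" "F \<in> borel_measurable borel" for F
  by (rule in_L2_L2I) (use that i[OF that] in auto)
 show "in_L2_L2 T (Omega l h) (%t x. d (t, x))" by (rule 1[OF s(2) m(2)])
 show "in_L2_H1per T l h (%t x. \<phi> (t, x)) (%t x. (g1 (t, x), g2 (t, x)))"
  unfolding in_L2_H1per_def
 proof (intro conjI)
  show "in_L2_L2 T (Omega l h) (%t x. \<phi> (t, x))" by (rule 1[OF s(1) m(1)])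
  show "in_L2_L2 T (Omega l h) (%t x. (g1 (t, x), g2 (t, x)))"
  proof (rule in_L2_L2I)
   have "(%p. (g1 p, g2 p)) \<in> borel_measurable borel" by (intro borel_measurable_Pair m)
   then show "(%p. (g1 (fst p, snd p), g2 (fst p, snd p))) \<in> borel_measurable borel" by simp
   have "integrable M3 (%p. indicator {0<..<T} (fst p) * (g1 p)^2 + indicator {0<..<T} (fst p) * (g2 p)^2)"
    by (intro Bochner_Integration.integrable_add i s m)
   then show "integrable M3 (%p. indicator {0<..<T} (fst p) * (norm (g1 (fst p, snd p), g2 (fst p, snd p)))^2)"
    by (simp add: norm_Pair distrib_left)
  qed
  have "torus_weak_gradient l h (%x. \<phi> (t, x)) (%x. (g1 (t, x), g2 (t, x))) \<longleftrightarrow>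
   wgrad (%x. \<phi> (t, x)) (%x. g1 (t, x)) (1, 0) \<and> wgrad (%x. \<phi> (t, x)) (%x. g2 (t, x)) (0, 1)" for t
   by (rule torus_weak_gradient_iff) auto
  then show "AE t\<in>{0<..<T} in lborel. torus_weak_gradient l h (%x. \<phi> (t, x)) (%x. (g1 (t, x), g2 (t, x)))"
   using wg by simp
 qed
 define F where "F p = indicator {0..T} (fst p) * d p" for p
 have sF: "sqint M3 F" using s(2) by (simp add: F_def[abs_def])
 have mF[measurable]: "F \<in> borel_measurable borel" using sqint_measurable[OF sF] by simp
 note [measurable] = wt_section[OF mF]
 have Fd: "(LINT s|lborel. indicator {0..t} s * d (s, x)) = (LINT s|lborel. indicator {0..t} s * F (s, x))" if "t \<in> {0..T}" for t x
  using that by (intro Bochner_Integration.integral_cong) (auto simp: F_def indicator_def)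
 have AEi: "AE x in N. integrable lborel (%s. F (s, x))"
  using integral_M3(4)[OF sqint_integrable_slab[OF sF, of 0 T]]
  by eventually_elim (simp add: F_def mult.assoc[symmetric] flip: indicator_inter_arith)
 have AEs: "AE x in N. integrable lborel (%s. (F (s, x))^2)" by (rule prim_bound(2)[OF sF, of 0 0]) simp
 show "weak_time_derivative T (Omega l h) (%t x. \<phi> (t, x)) (%t x. d (t, x))"
  unfolding weak_time_derivative_def
 proof (intro allI impI)
  fix \<psi> assume t: "test_function {0<..<T} \<psi>"
  have tc: "Ck_compact k {0<..<T} \<psi>" for k using t by (auto simp: test_function_def smooth_fun_on_def Ck_compact_def)
  note op = open_greaterThanLessThan[of 0 T]
  define \<psi>' where "\<psi>' x = frechet_derivative \<psi> (at x) 1" for x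
  have D\<psi>: "(\<psi> has_real_derivative \<psi>' x) (at x)" for x
  proof -
   have hd: "(\<psi> has_derivative frechet_derivative \<psi> (at x)) (at x)" by (rule Ck_compact_Suc(1)[OF tc[of "Suc 0"] op])
   have "frechet_derivative \<psi> (at x) = (*) (\<psi>' x)"
   proof
    fix y show "frechet_derivative \<psi> (at x) y = \<psi>' x * y"
     using linear_scale[OF has_derivative_linear[OF hd], of y 1] by (simp add: \<psi>'_def)
   qed
   then show ?thesis using hd by (simp add: has_field_derivative_def)
  qed
  have c': "continuous_on UNIV \<psi>'"
   using Ck_compact_0_continuous[OF Ck_compact_Suc(2)[OF tc[of "Suc 0"] op, of 1] op] by (simp add: \<psi>'_def[abs_def])
  have der: "deriv \<psi> = \<psi>'" using D\<psi> by (auto intro: DERIV_imp_deriv)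
  have "supp \<psi> \<subseteq> {0<..<T}" using t by (simp add: test_function_def)
  then have "0 \<notin> supp \<psi>" "T \<notin> supp \<psi>" by auto
  then have z: "\<psi> 0 = 0" "\<psi> T = 0" by (simp_all add: notin_supp)
  have "AE x in N. (LINT t:{0<..<T}|lborel. deriv \<psi> t * \<phi> (t, x)) = - (LINT t:{0<..<T}|lborel. \<psi> t * d (t, x))"
   using ac AEi
  proof eventually_elim
   case (elim x)
   have AC: "\<phi> (s, x) = \<phi> (0, x) + (LINT r|lborel. indicator {0..s} r * F (r, x))" if "s \<in> {0..T}" for s
    using bspec[OF elim(1) that] Fd[OF that, of x] by simp
   note P = AC_product[where \<xi>=\<psi> and \<xi>'=\<psi>' and A="%s. \<phi> (s, x)" and ?A0.0="\<phi> (0, x)" and b="%s. F (s, x)" and t=T,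
     OF elim(2) AC D\<psi> c' less_imp_le[OF T] wt_section(2)[OF m(1)]]
   have oc: "(LINT s|lborel. indicator {0..T} s * f s) = (LINT s:{0<..<T}|lborel. f s)" if [measurable]: "f \<in> borel_measurable borel" for f :: "real => real"
    unfolding set_lebesgue_integral_def
    by (rule integral_cong_AE, measurable, use AE_lborel_singleton[of 0] AE_lborel_singleton[of T] in eventually_elim) (auto simp: indicator_def)
   have [measurable]: "\<psi>' \<in> borel_measurable borel" "\<psi> \<in> borel_measurable borel"
    using c' Ck_compact_0_continuous[OF tc[of 0] op] by (auto intro: borel_measurable_continuous_onI)
   have "(LINT s|lborel. indicator {0..T} s * (\<psi>' s * \<phi> (s, x) + \<psi> s * F (s, x))) =
    (LINT s|lborel. indicator {0..T} s * (\<psi>' s * \<phi> (s, x)) + indicator {0..T} s * (\<psi> s * F (s, x)))"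
    by (simp add: distrib_left)
   also have "\<dots> = (LINT s|lborel. indicator {0..T} s * (\<psi>' s * \<phi> (s, x))) + (LINT s|lborel. indicator {0..T} s * (\<psi> s * F (s, x)))"
    by (rule Bochner_Integration.integral_add[OF P(3,4)])
   finally have "(LINT s|lborel. indicator {0..T} s * (\<psi>' s * \<phi> (s, x))) = - (LINT s|lborel. indicator {0..T} s * (\<psi> s * F (s, x)))"
    using P(1) z by simp
   moreover have "(LINT s|lborel. indicator {0..T} s * (\<psi> s * F (s, x))) = (LINT s|lborel. indicator {0..T} s * (\<psi> s * d (s, x)))"
    by (intro Bochner_Integration.integral_cong) (auto simp: F_def indicator_def)
   ultimately show ?case by (simp add: oc der)
  qed
  then show "AE x\<in>Omega l h in lborel. (LINT t:{0<..<T}|lborel. deriv \<psi> t * \<phi> (t, x)) = - (LINT t:{0<..<T}|lborel. \<psi> t * d (t, x))"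
   by (simp add: AE_N)
 qed
 have sN: "sqint N (%x. \<phi> (t, x))" if t: "t \<in> {0..T}" for t
 proof (rule sqint_cong_AE)
  show "sqint N (%x. \<phi> (0, x) + prim F (t, x))" by (rule sqint_add[OF s0 prim_L2(1)[OF sF t]])
  show "AE x in N. \<phi> (0, x) + prim F (t, x) = \<phi> (t, x)"
   using ac
  proof eventually_elim
   case (elim x)
   show ?case using bspec[OF elim t] Fd[OF t, of x] by (simp add: prim_def)
  qed
 qed simp
 have L2: "in_L2 (Omega l h) (%x. \<phi> (t, x))" if t: "t \<in> {0..T}" for t
 proof -
  have "(eL2norm (Omega l h) (%x. \<phi> (t, x)))^2 = (\<integral>\<^sup>+x. ennreal ((\<phi> (t, x))^2) \<partial>N)"
   by (simp add: eL2norm_sq nn_integral_N)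
  also have "\<dots> < \<infinity>" using sN[OF t] by (auto simp: sqint_def integrable_iff_bounded)
  finally have "(eL2norm (Omega l h) (%x. \<phi> (t, x)))^2 \<noteq> top" by simp
  then have "eL2norm (Omega l h) (%x. \<phi> (t, x)) \<noteq> top" by (auto simp: power2_eq_square)
  then have "eL2norm (Omega l h) (%x. \<phi> (t, x)) < \<infinity>" by (simp add: top.not_eq_extremum)
  moreover have "(%x. \<phi> (t, x)) \<in> borel_measurable (restrict_space lborel (Omega l h))"
   by (intro measurable_restrict_space1) simp
  ultimately show ?thesis by (simp add: in_L2_def)
 qed
 define Q where "Q = (LINT p|M3. (F p)^2)"
 have Q: "Q \<ge> 0" by (simp add: Q_def)
 have hold: "eL2norm (Omega l h) (%x. \<phi> (t, x) - \<phi> (r, x)) \<le> ennreal (sqrt (\<bar>t - r\<bar> * Q))" if tr: "t \<in> {0..T}" "r \<in> {0..T}" for t r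
 proof (rule eL2norm_le)
  have "AE x in N. (\<phi> (t, x) - \<phi> (r, x))^2 \<le> \<bar>t - r\<bar> * (LINT s|lborel. (F (s, x))^2)"
   using ac AEs AEi
  proof eventually_elim
   case (elim x)
   have sq: "sqint lborel (%s. F (s, x))" using elim(2) by (simp add: sqint_def)
   have *: "(\<phi> (t, x) - \<phi> (r, x))^2 \<le> (t - r) * (LINT s|lborel. (F (s, x))^2)" if tr: "t \<in> {0..T}" "r \<in> {0..T}" "r \<le> t" for t r
   proof -
    have ii: "integrable lborel (%s. indicator {0..t} s * F (s, x))" for t
     using integrable_mult_indicator[of "{0..t}" lborel "%s. F (s, x)"] elim(3) by simp
    have "\<phi> (t, x) - \<phi> (r, x) = (LINT s|lborel. indicator {0..t} s * F (s, x)) - (LINT s|lborel. indicator {0..r} s * F (s, x))"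
     using bspec[OF elim(1) tr(1)] bspec[OF elim(1) tr(2)] Fd[OF tr(1)] Fd[OF tr(2)] by simp
    also have "\<dots> = (LINT s|lborel. indicator {0..t} s * F (s, x) - indicator {0..r} s * F (s, x))"
     by (rule Bochner_Integration.integral_diff[symmetric, OF ii ii])
    also have "\<dots> = (LINT s|lborel. indicator {r..t} s * F (s, x))"
     by (rule integral_cong_AE, measurable, use AE_lborel_singleton[of r] in eventually_elim) (use tr in \<open>auto simp: indicator_def\<close>)
    finally show ?thesis using integral_interval_sq_le[OF sq tr(3)] by simp
   qed
   show ?case using *[of t r] *[of r t] tr by (cases "r \<le> t") (auto simp: power2_commute)
  qed
  then have "(\<integral>\<^sup>+x. ennreal ((\<phi> (t, x) - \<phi> (r, x))^2) \<partial>N) \<le> (\<integral>\<^sup>+x. ennreal (\<bar>t - r\<bar> * (LINT s|lborel. (F (s, x))^2)) \<partial>N)"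
   by (intro nn_integral_mono_AE) (auto elim: eventually_mono intro: ennreal_leI)
  also have "\<dots> = ennreal (\<bar>t - r\<bar> * Q)"
  proof -
   have "integrable M3 (%p. (F p)^2)" using sF by (simp add: sqint_def)
   from integral_M3(2,6)[OF this] show ?thesis
    by (subst nn_integral_eq_integral) (auto simp: Q_def)
  qed
  also have "\<dots> = ennreal ((sqrt (\<bar>t - r\<bar> * Q))^2)" using Q by simp
  finally show "(\<integral>\<^sup>+x\<in>Omega l h. ennreal ((norm (\<phi> (t, x) - \<phi> (r, x)))^2) \<partial>lborel) \<le> ennreal ((sqrt (\<bar>t - r\<bar> * Q))^2)"
   by (simp add: nn_integral_N)
 qed (use Q in simp)
 have tt: "time_trace T (Omega l h) (%t x. \<phi> (t, x)) r (%x. \<phi> (r, x))" for r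
  unfolding time_trace_def
 proof (intro exI[of _ "%t x. \<phi> (t, x)"] conjI ballI L2)
  fix r assume r: "r \<in> {0..T}"
  have "((%t. ennreal (sqrt (\<bar>t - r\<bar> * Q))) \<longlongrightarrow> ennreal (sqrt (\<bar>r - r\<bar> * Q))) (at r within {0..T})"
   by (intro tendsto_intros)
  then have "((%t. ennreal (sqrt (\<bar>t - r\<bar> * Q))) \<longlongrightarrow> 0) (at r within {0..T})" by simp
  then show "((%t. eL2norm (Omega l h) (%x. \<phi> (t, x) - \<phi> (r, x))) \<longlongrightarrow> 0) (at r within {0..T})"
   by (rule tendsto_sandwich[OF _ _ tendsto_const, rotated 2]) (use hold[OF _ r] in \<open>auto simp: eventually_at_filter\<close>)
 qed auto
 show "time_trace T (Omega l h) (%t x. \<phi> (t, x)) 0 (%x. \<phi> (0, x))" by (rule tt)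
 show "time_trace T (Omega l h) (%t x. \<phi> (t, x)) T (%x. 0)" using tt[of T] fin by simp
qed

end

lemma AE_lborel_shift: "AE t in lborel. P t ==> AE t in lborel. P (t + k :: real)"
proof -
 assume "AE t in lborel. P t"
 then have "AE t in distr lborel borel ((+) k). P t" by (subst lborel_distr_plus)
 then have "AE t in lborel. P (k + t)" by (rule AE_distrD[rotated]) simp
 then show ?thesis by (simp add: add.commute)
qed

section \<open>Functions locally square integrable in time\<close>

context torus begin

text \<open>Bounded time intervals are singled out because the continuation of the solution to
  negative times grows linearly and is in general not square integrable over all times.\<close>

definition slabs :: "(real \<times> point => real) => bool" where
 "slabs F \<longleftrightarrow> F \<in> borel_measurable borel \<and> (\<forall>a b. sqint M3 (%p. indicator {a..b} (fst p) * F p))"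

lemma slabsI: "F \<in> borel_measurable borel ==> (\<And>a b. sqint M3 (%p. indicator {a..b} (fst p) * F p)) ==> slabs F"
 by (simp add: slabs_def)

lemma slabsD: "slabs F ==> sqint M3 (%p. indicator {a..b} (fst p) * F p)"
 by (simp add: slabs_def)

lemma slabs_measurable [measurable_dest]: "slabs F ==> F \<in> borel_measurable borel"
 by (simp add: slabs_def)

lemma slabs_Shf: assumes "slabs F" shows "slabs (%p. F (Shf z p))"
 unfolding slabs_def
proof (intro conjI allI)
 have [measurable]: "F \<in> borel_measurable borel" using assms by (simp add: slabs_def)
 show "(%p. F (Shf z p)) \<in> borel_measurable borel" by measurable
 fix a b
 have "sqint M3 (%p. indicator {a + fst z..b + fst z} (fst p) * F p)" using assms by (simp add: slabs_def)
 from sqint_Shf[OF this, of z] show "sqint M3 (%p. indicator {a..b} (fst p) * F (Shf z p))"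
  by (rule arg_cong[where f="sqint M3", THEN iffD1, rotated]) (auto simp: Shf_def indicator_def)
qed

lemma slabs_diff: "slabs F ==> slabs G ==> slabs (%p. F p - G p)"
 by (rule slabsI, intro borel_measurable_diff slabs_measurable, assumption+, unfold right_diff_distrib, intro sqint_diff slabsD)

lemma slabs_add: "slabs F ==> slabs G ==> slabs (%p. F p + G p)"
 by (rule slabsI, intro borel_measurable_add slabs_measurable, assumption+, unfold distrib_left, intro sqint_add slabsD)

lemma slabs_bounded_mult:
 assumes F: "slabs F" and [measurable]: "q \<in> borel_measurable borel" and b: "\<And>t. \<bar>q t\<bar> \<le> C"
 shows "slabs (%p. q (fst p) * F p)"
 unfolding slabs_def
proof (intro conjI allI)
 show "(%p. q (fst p) * F p) \<in> borel_measurable borel" using F by measurable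
 fix a b
 have "sqint M3 (%p. q (fst p) * (indicator {a..b} (fst p) * F p))"
  by (rule sqint_bounded_mult[OF _ _ b]) (use F in \<open>auto simp: slabs_def\<close>)
 then show "sqint M3 (%p. indicator {a..b} (fst p) * (q (fst p) * F p))" by (simp add: mult.left_commute)
qed

lemma sqint_slabs: "sqint M3 F ==> slabs F"
 unfolding slabs_def
proof (intro conjI allI)
 assume F: "sqint M3 F"
 then show "F \<in> borel_measurable borel" using sqint_measurable[OF F] by simp
 fix a b
 show "sqint M3 (%p. indicator {a..b} (fst p) * F p)"
  by (rule sqint_bounded_mult[OF F, of _ 1]) (auto simp: indicator_def)
qed

lemma slabs_bounded:
 assumes [measurable]: "F \<in> borel_measurable borel" and b: "\<And>a b. \<exists>C. \<forall>p. fst p \<in> {a..b} --> \<bar>F p\<bar> \<le> C"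
 shows "slabs F"
 unfolding slabs_def
proof (intro conjI allI)
 fix a b
 obtain C where C: "\<And>p. fst p \<in> {a..b} ==> \<bar>F p\<bar> \<le> C" using b by blast
 show "sqint M3 (%p. indicator {a..b} (fst p) * F p)"
  by (rule sqint_bound[OF sqint_time_indicator(1)[of "{a..b}"], of _ C]) (use C in \<open>auto simp: indicator_def\<close>)
qed fact

lemma slabs_if:
 assumes F: "slabs F" and G: "slabs G"
 shows "slabs (%p. if fst p \<le> 0 then F p else G p)"
proof -
 have 1: "slabs (%p. indicator {..0} (fst p) * F p)" by (rule slabs_bounded_mult[OF F, of _ 1]) (auto simp: indicator_def)
 have 2: "slabs (%p. indicator {0<..} (fst p) * G p)" by (rule slabs_bounded_mult[OF G, of _ 1]) (auto simp: indicator_def)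
 have 3: "(%p. indicator {..0} (fst p) * F p + indicator {0<..} (fst p) * G p) = (%p. if fst p \<le> 0 then F p else G p)"
  by (auto simp: indicator_def)
 show ?thesis using slabs_add[OF 1 2] unfolding 3 .
qed

lemma wgrad_cong_AE:
 assumes w: "wgrad f g b" and f: "AE x in N. f x = f' x" "AE x in N. g x = g' x" and b: "b \<in> Basis"
  and [measurable]: "f \<in> borel_measurable borel" "f' \<in> borel_measurable borel" "g \<in> borel_measurable borel" "g' \<in> borel_measurable borel"
 shows "wgrad f' g' b"
 unfolding wgrad_def
proof (intro allI impI)
 fix \<psi> assume t: "torus_test_function l h \<psi>"
 have [measurable]: "\<psi> \<in> borel_measurable borel" "(%x. frechet_derivative \<psi> (at x) b) \<in> borel_measurable borel"
  using torus_test_deriv[OF t] b by (blast intro: borel_measurable_continuous_onI)+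
 have "(LINT x|N. f' x * frechet_derivative \<psi> (at x) b) = (LINT x|N. f x * frechet_derivative \<psi> (at x) b)"
  by (rule integral_cong_AE, measurable, use f(1) in eventually_elim) simp
 also have "\<dots> = - (LINT x|N. g x * \<psi> x)" using w t by (simp add: wgrad_def)
 also have "(LINT x|N. g x * \<psi> x) = (LINT x|N. g' x * \<psi> x)"
  by (rule integral_cong_AE, measurable, use f(2) in eventually_elim) simp
 finally show "(LINT x|N. f' x * frechet_derivative \<psi> (at x) b) = - (LINT x|N. g' x * \<psi> x)" .
qed

lemma wgrad_0: "wgrad (%x. 0) (%x. 0) b" by (simp add: wgrad_def)

end

text \<open>The wave equation in space-time form: \<open>R\<close>, \<open>D\<close> are the coefficients, invariant under
  translations along \<open>(1, (0, c))\<close>; \<open>U\<close>, \<open>V\<close>, \<open>G1\<close>, \<open>G2\<close> are the solution and its derivatives,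
  extended by zero in time; near the supports of the data, which lie in \<open>S\<close>, the coefficients are constant.\<close>
locale wave = torus +
 fixes T c rL dL K :: real and R D f3 U V G1 G2 :: "real \<times> point => real"
  and v1 v2 :: "point => real" and S :: "point set"
 assumes T_pos: "T > 0"
  and RD_measurable [measurable]: "R \<in> borel_measurable borel" "D \<in> borel_measurable borel"
  and RD_bound: "\<And>p. \<bar>R p\<bar> \<le> K" "\<And>p. \<bar>D p\<bar> \<le> K"
  and RD_inv: "\<And>k. AE p in M3. fst p \<in> {0<..<T} --> fst p + k \<in> {0<..<T} -->
    R (Shf (k, (0, c * k)) p) = R p \<and> D (Shf (k, (0, c * k)) p) = D p"
  and S_shift: "\<And>s. AE x in N. x \<in> S --> shf (0, s) x \<in> S"
  and S_const: "\<And>t x. t \<in> {0<..<T} ==> x \<in> S ==> R (t, x) = rL \<and> D (t, x) = dL"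
  and v1: "Ck_compact 2 (Omega l h) v1" "supp v1 \<subseteq> S"
  and v2: "Ck_compact 1 (Omega l h) v2" "supp v2 \<subseteq> S"
  and UVG: "sqint M3 U" "sqint M3 V" "sqint M3 G1" "sqint M3 G2"
  and UVG_0: "\<And>p. fst p \<notin> {0<..<T} ==> U p = 0 \<and> V p = 0 \<and> G1 p = 0 \<and> G2 p = 0"
  and UV: "AE p in M3. fst p \<in> {0<..<T} --> U p = v1 (snd p) + prim V p"
  and UG: "AE t in lborel. t \<in> {0<..<T} --> wgrad (%x. U (t, x)) (%x. G1 (t, x)) (1, 0) \<and> wgrad (%x. U (t, x)) (%x. G2 (t, x)) (0, 1)"
  and f3: "sqint M3 f3" "\<And>p. fst p \<notin> {0<..<T} ==> f3 p = 0"
  and weak: "\<And>\<phi> d g1 g2. adm T \<phi> d g1 g2 ==>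
   - (LINT p|M3. R p * V p * d p) + (LINT p|M3. D p * (G1 p * g1 p + G2 p * g2 p)) =
   (LINT p|M3. f3 p * \<phi> p) + (LINT x|N. rL * v2 x * \<phi> (0, x))"
begin

section \<open>Initial data, continuation to negative times, and the test function\<close>

lemma basis: "(1, 0) \<in> (Basis :: point set)" "(0, 1) \<in> (Basis :: point set)"
 by (auto simp: Basis_prod_def)

lemmas UVG_measurable [measurable] = UVG[THEN sqint_measurable, unfolded measurable_M3]
lemmas f3_measurable [measurable] = f3(1)[THEN sqint_measurable, unfolded measurable_M3]

definition dv1 :: "point => point => real" where "dv1 b x = frechet_derivative v1 (at x) b"
definition dv2 :: "point => point => real" where "dv2 b x = frechet_derivative v2 (at x) b"

text \<open>Lowering the order is not immediate from the recursion of \<open>Ck_on\<close>, which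
  records continuity at the last order only; it follows because differentiable functions are
  continuous.\<close>

lemma v1_C1: "Ck_compact 1 (Omega l h) v1" "b \<in> Basis ==> Ck_compact 1 (Omega l h) (dv1 b)"
proof -
 have v: "Ck_compact (Suc (Suc 0)) (Omega l h) v1" using v1(1) by (simp add: numeral_2_eq_2)
 note * = Ck_compact_Suc[OF v Omega_open]
 show b: "b \<in> Basis ==> Ck_compact 1 (Omega l h) (dv1 b)" for b using *(2)[of b] by (simp add: dv1_def[abs_def])
 have "Ck_on (Suc 0) (Omega l h) v1"
  unfolding Ck_on.simps
 proof (intro conjI ballI)
  fix x assume "x \<in> Omega l h"
  show "v1 differentiable (at x)" using *(1)[of x] unfolding differentiable_def by blast
 next
  fix b :: point assume "b \<in> Basis"
  then have "continuous_on UNIV (dv1 b)"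
   using Ck_compact_0_continuous[OF Ck_compact_Suc(3)[OF b[unfolded One_nat_def] Omega_open] Omega_open] by blast
  then show "continuous_on (Omega l h) (%x. frechet_derivative v1 (at x) b)"
   unfolding dv1_def[abs_def] by (rule continuous_on_subset) simp
 qed
 then show "Ck_compact 1 (Omega l h) v1" using v by (simp add: Ck_compact_def)
qed

lemma data_continuous:
 "continuous_on UNIV v1" "continuous_on UNIV v2"
 "b \<in> Basis ==> continuous_on UNIV (dv1 b)" "b \<in> Basis ==> continuous_on UNIV (dv2 b)"
 using Ck_compact_0_continuous[OF Ck_compact_Suc(3)[OF v1_C1(1)[unfolded One_nat_def] Omega_open] Omega_open]
  Ck_compact_0_continuous[OF Ck_compact_Suc(3)[OF v2(1)[unfolded One_nat_def] Omega_open] Omega_open]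
  Ck_compact_0_continuous[OF Ck_compact_Suc(3)[OF v1_C1(2)[unfolded One_nat_def] Omega_open] Omega_open]
  Ck_compact_0_continuous[OF Ck_compact_Suc(2)[OF v2(1)[unfolded One_nat_def] Omega_open] Omega_open]
 by (simp_all add: dv2_def[abs_def])

lemma data_measurable [measurable]:
 "v1 \<in> borel_measurable borel" "v2 \<in> borel_measurable borel"
 "dv1 (1, 0) \<in> borel_measurable borel" "dv1 (0, 1) \<in> borel_measurable borel"
 "dv2 (1, 0) \<in> borel_measurable borel" "dv2 (0, 1) \<in> borel_measurable borel"
 using data_continuous basis by (auto intro: borel_measurable_continuous_onI)

lemma data_bounded:
 "\<exists>B. \<forall>x. \<bar>v1 x\<bar> \<le> B" "\<exists>B. \<forall>x. \<bar>v2 x\<bar> \<le> B"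
 "b \<in> Basis ==> \<exists>B. \<forall>x. \<bar>dv1 b x\<bar> \<le> B" "b \<in> Basis ==> \<exists>B. \<forall>x. \<bar>dv2 b x\<bar> \<le> B"
proof -
 have "\<exists>B. \<forall>x. \<bar>f x\<bar> \<le> B" if "Ck_compact 0 (Omega l h) f" for f
  using Ck_compact_bounded[OF that Omega_open] by metis
 note b = this[OF Ck_compact_Suc(3)[OF v1_C1(1)[unfolded One_nat_def] Omega_open]]
  this[OF Ck_compact_Suc(3)[OF v2(1)[unfolded One_nat_def] Omega_open]]
  this[OF Ck_compact_Suc(3)[OF v1_C1(2)[unfolded One_nat_def] Omega_open]]
  this[OF Ck_compact_Suc(2)[OF v2(1)[unfolded One_nat_def] Omega_open], folded dv2_def]
 show "\<exists>B. \<forall>x. \<bar>v1 x\<bar> \<le> B" by (rule b(1))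
 show "\<exists>B. \<forall>x. \<bar>v2 x\<bar> \<le> B" by (rule b(2))
 show "b \<in> Basis ==> \<exists>B. \<forall>x. \<bar>dv1 b x\<bar> \<le> B" by (rule b(3))
 show "b \<in> Basis ==> \<exists>B. \<forall>x. \<bar>dv2 b x\<bar> \<le> B" by (rule b(4))
qed

lemma sqint_N_bounded:
 assumes "\<exists>B. \<forall>x. \<bar>f x\<bar> \<le> B" "f \<in> borel_measurable borel"
 shows "sqint N f"
 unfolding sqint_def
proof
 obtain B where B: "\<And>x. \<bar>f x\<bar> \<le> B" using assms by blast
 have "\<bar>(f x)^2\<bar> \<le> B^2" for x using power_mono[OF B[of x], of 2] by simp
 then show "integrable N (%x. (f x)^2)" using assms by (intro integrable_N_bounded[of _ "B^2"]) auto
qed (use assms in simp)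

lemma data_sqint: "sqint N v1" "sqint N v2" "sqint N (dv1 (1, 0))" "sqint N (dv1 (0, 1))" "sqint N (dv2 (1, 0))" "sqint N (dv2 (0, 1))"
 by (rule sqint_N_bounded, rule data_bounded basis, (rule basis)?, rule data_measurable)+

text \<open>The linear continuation keeps w absolutely continuous across time zero with velocity
  \<open>v2\<close> before it. A centred difference near time zero thus meets prescribed data on one
  side and the solution on the other.\<close>

definition w :: "real \<times> point => real" where
 "w p = (if fst p \<le> 0 then v1 (snd p) + fst p * v2 (snd p) else v1 (snd p) + prim V p)"
definition wt :: "real \<times> point => real" where
 "wt p = (if fst p \<le> 0 then v2 (snd p) else V p)"
definition w1 :: "real \<times> point => real" where
 "w1 p = (if fst p \<le> 0 then dv1 (1, 0) (snd p) + fst p * dv2 (1, 0) (snd p) else G1 p)"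
definition w2 :: "real \<times> point => real" where
 "w2 p = (if fst p \<le> 0 then dv1 (0, 1) (snd p) + fst p * dv2 (0, 1) (snd p) else G2 p)"

lemma data_slab:
 assumes a: "\<exists>B. \<forall>x. \<bar>a x\<bar> \<le> B" "\<exists>B. \<forall>x. \<bar>b x\<bar> \<le> B" "a \<in> borel_measurable borel" "b \<in> borel_measurable borel"
 shows "slabs (%p. a (snd p) + fst p * b (snd p))"
proof (rule slabs_bounded)
 note [measurable] = a(3,4)
 show "(%p. a (snd p) + fst p * b (snd p)) \<in> borel_measurable borel" by measurable
 obtain A B where A: "\<And>x. \<bar>a x\<bar> \<le> A" and B: "\<And>x. \<bar>b x\<bar> \<le> B" using a(1,2) by blast
 fix q r :: real
 have "\<bar>a x + t * b x\<bar> \<le> A + (\<bar>q\<bar> + \<bar>r\<bar>) * B" if "t \<in> {q..r}" for t x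
 proof -
  have "\<bar>t\<bar> * \<bar>b x\<bar> \<le> (\<bar>q\<bar> + \<bar>r\<bar>) * B" using that B[of x] by (intro mult_mono) auto
  then show ?thesis using A[of x] abs_triangle_ineq[of "a x" "t * b x"] by (simp add: abs_mult)
 qed
 then show "\<exists>C. \<forall>p. fst p \<in> {q..r} --> \<bar>a (snd p) + fst p * b (snd p)\<bar> \<le> C" by blast
qed

lemma w_slabs: "slabs w" "slabs wt" "slabs w1" "slabs w2"
proof -
 note bd = data_bounded(1,2) data_bounded(3,4)[OF basis(1)] data_bounded(3,4)[OF basis(2)]
 have "\<exists>B. \<forall>x::point. \<bar>0::real\<bar> \<le> B" by auto
 then have z: "slabs (%p. v1 (snd p))" "slabs (%p. v2 (snd p))"
  using data_slab[of v1 "%_. 0"] data_slab[of v2 "%_. 0"] bd by simp_all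
 have p: "slabs (prim V)" using prim_slab[OF UVG(2)] by (simp add: slabs_def)
 show "slabs w" unfolding w_def[abs_def]
  by (intro slabs_if slabs_add z p data_slab bd data_measurable)
 show "slabs wt" unfolding wt_def[abs_def]
  by (intro slabs_if z sqint_slabs UVG)
 show "slabs w1" unfolding w1_def[abs_def]
  by (intro slabs_if sqint_slabs UVG data_slab bd data_measurable)
 show "slabs w2" unfolding w2_def[abs_def]
  by (intro slabs_if sqint_slabs UVG data_slab bd data_measurable)
qed

lemmas w_measurable [measurable] = w_slabs[THEN slabs_measurable]
lemmas w_sections [measurable] = w_measurable[THEN wt_section(1)] w_measurable[THEN wt_section(2)] UVG_measurable[THEN wt_section(1)] UVG_measurable[THEN wt_section(2)]

text \<open>All times are quantified inside one \<open>AE\<close>, so that translating a single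
  exceptional set serves every time in \<open>phi_adm\<close>.\<close>

lemma w_AC:
 "AE y in N. (\<forall>a b. integrable lborel (%r. indicator {a..b} r * wt (r, y))) \<and>
  (\<forall>s t. s \<le> t --> w (t, y) - w (s, y) = (LINT r|lborel. indicator {s..t} r * wt (r, y)))"
proof -
 have slab: "indicator {0..T} (fst p) * V p = V p" for p using UVG_0[of p] by (cases "fst p \<in> {0<..<T}") auto
 have "integrable M3 V" using sqint_integrable_slab[OF UVG(2), of 0 T] by (simp add: slab)
 from integral_M3(4)[OF this] show ?thesis
 proof eventually_elim
  case (elim y)
  have iV: "integrable lborel (%r. indicator {a..b} r * V (r, y))" for a b
   using integrable_mult_indicator[of "{a..b}" lborel "%r. V (r, y)"] elim by simp
  have i: "integrable lborel (%r. indicator {a..b} r * wt (r, y))" for a b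
  proof (rule Bochner_Integration.integrable_bound)
   show "integrable lborel (%r. indicator {a..b} r * \<bar>v2 y\<bar> + \<bar>indicator {a..b} r * V (r, y)\<bar>)" using iV[of a b] by simp
  qed (auto simp: wt_def indicator_def)
  have base: "w (t, y) - w (a, y) = (LINT r|lborel. indicator {a..t} r * wt (r, y))" if a: "a \<le> 0" "a \<le> t" for a t
  proof (cases "t \<le> 0")
   case True
   have "(LINT r|lborel. indicator {a..t} r * wt (r, y)) = (LINT r|lborel. indicator {a..t} r * v2 y)"
    by (intro Bochner_Integration.integral_cong) (use True in \<open>auto simp: wt_def indicator_def\<close>)
   also have "\<dots> = (t - a) * v2 y" using a by simp
   finally show ?thesis using True a by (simp add: w_def algebra_simps)
  next
   case False
   have "(LINT r|lborel. indicator {a..t} r * wt (r, y)) = (LINT r|lborel. indicator {a..0} r * v2 y + indicator {0..t} r * V (r, y))"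
    by (rule integral_cong_AE, measurable, use AE_lborel_singleton[of 0] in eventually_elim)
     (use False a in \<open>auto simp: wt_def indicator_def\<close>)
   also have "\<dots> = - a * v2 y + prim V (t, y)" using iV[of 0 t] a by (simp add: prim_def)
   finally show ?thesis using False a by (simp add: w_def)
  qed
  have "w (t, y) - w (s, y) = (LINT r|lborel. indicator {s..t} r * wt (r, y))" if "s \<le> t" for s t
  proof -
   \<comment> \<open>Both values are compared with the one at a common time a \<le> 0, from which
     \<open>base\<close> measures increments.\<close>
   define a where "a = min s 0"
   have "a \<le> 0" "a \<le> s" "a \<le> t" using that by (auto simp: a_def)
   then have "w (t, y) - w (s, y) = (LINT r|lborel. indicator {a..t} r * wt (r, y)) - (LINT r|lborel. indicator {a..s} r * wt (r, y))"
    using base[of a t] base[of a s] by linarith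
   also have "\<dots> = (LINT r|lborel. indicator {a..t} r * wt (r, y) - indicator {a..s} r * wt (r, y))"
    by (rule Bochner_Integration.integral_diff[symmetric, OF i i])
   also have "\<dots> = (LINT r|lborel. indicator {s..t} r * wt (r, y))"
    by (rule integral_cong_AE, measurable, use AE_lborel_singleton[of s] in eventually_elim)
     (use that in \<open>auto simp: a_def indicator_def\<close>)
   finally show ?thesis .
  qed
  then show ?case using i by blast
 qed
qed

lemma w_eq_U: "AE p in M3. fst p \<in> {0<..<T} --> w p = U p"
 using UV by eventually_elim (auto simp: w_def)

text \<open>Up to time T the gradient is that of the data or of the solution. Beyond T the extended
  G1 and G2 are zero while w merely stops changing, so the statement ends at T.\<close>

lemma w_wgrad: "AE t in lborel. t < T --> wgrad (%x. w (t, x)) (%x. w1 (t, x)) (1, 0) \<and> wgrad (%x. w (t, x)) (%x. w2 (t, x)) (0, 1)"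
 using UG AE_M3_fst[OF w_eq_U] AE_lborel_singleton[of 0]
proof eventually_elim
 case (elim t)
 show ?case
 proof
  assume T: "t < T"
  show "wgrad (%x. w (t, x)) (%x. w1 (t, x)) (1, 0) \<and> wgrad (%x. w (t, x)) (%x. w2 (t, x)) (0, 1)"
  proof (cases "t \<le> 0")
   case True
   have i: "integrable N f" if "sqint N f" for f using sqint_finite_imp_integrable[OF finite_N that] .
   have "wgrad (%x. 1 * v1 x + t * v2 x) (%x. 1 * dv1 (1, 0) x + t * dv2 (1, 0) x) (1, 0)"
    unfolding dv1_def dv2_def
    by (intro wgrad_linear wgrad_C1_compact v1_C1 v2 basis i data_sqint data_sqint[unfolded dv1_def[abs_def] dv2_def[abs_def]])
   moreover have "wgrad (%x. 1 * v1 x + t * v2 x) (%x. 1 * dv1 (0, 1) x + t * dv2 (0, 1) x) (0, 1)"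
    unfolding dv1_def dv2_def
    by (intro wgrad_linear wgrad_C1_compact v1_C1 v2 basis i data_sqint data_sqint[unfolded dv1_def[abs_def] dv2_def[abs_def]])
   ultimately show ?thesis using True by (simp add: w_def w1_def w2_def)
  next
   case False
   then have t: "t \<in> {0<..<T}" using T by simp
   have e: "AE x in N. U (t, x) = w (t, x)" using elim(2) t by (auto elim: eventually_mono)
   have eq: "w1 (t, x) = G1 (t, x)" "w2 (t, x) = G2 (t, x)" for x using False by (simp_all add: w1_def w2_def)
   have "wgrad (%x. w (t, x)) (%x. G1 (t, x)) (1, 0)"
    by (rule wgrad_cong_AE[of "%x. U (t, x)" "%x. G1 (t, x)"]) (use elim(1) t e basis w_sections in simp_all)
   moreover have "wgrad (%x. w (t, x)) (%x. G2 (t, x)) (0, 1)"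
    by (rule wgrad_cong_AE[of "%x. U (t, x)" "%x. G2 (t, x)"]) (use elim(1) t e basis w_sections in simp_all)
   ultimately show ?thesis unfolding eq ..
  qed
 qed
qed

definition E :: "real => real \<times> point" where "E k = (k, (0, c * k))"

text \<open>The centred difference along the wave direction, left undivided; the factor 1/(2k)
  enters only when limits are taken.\<close>

definition wd :: "(real \<times> point => real) => real => real \<times> point => real" where
 "wd F k p = F (Shf (E k) p) - F (Shf (E (- k)) p)"

lemma Shf_E: "Shf (E k) (t, x) = (t + k, shf (0, c * k) x)"
 by (simp add: Shf_def E_def)

lemma wd_slabs: "slabs F ==> slabs (wd F k)"
 unfolding wd_def[abs_def] by (intro slabs_diff slabs_Shf)

lemma w_sqint: "sqint N (%x. w (t, x))"
proof (cases "t \<le> 0")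
 case True
 then show ?thesis using sqint_add[OF data_sqint(1) sqint_cmult[OF data_sqint(2), of t]] by (simp add: w_def)
next
 case False
 then show ?thesis using sqint_add[OF data_sqint(1) prim_L2(1)[OF UVG(2), of t t]] by (simp add: w_def)
qed

lemma slabs_section_integrable:
 assumes "slabs F" shows "AE t in lborel. integrable N (%x. F (t, x))"
proof -
 have "AE t in lborel. \<forall>n::nat. integrable N (%x. indicator {- real n..real n} t * (indicator {- real n..real n} t * F (t, x)))"
  unfolding AE_all_countable
 proof
  fix n :: nat
  show "AE t in lborel. integrable N (%x. indicator {- real n..real n} t * (indicator {- real n..real n} t * F (t, x)))"
   using integral_M3(3)[OF sqint_integrable_slab[OF slabsD[OF assms, of "- real n" "real n"], of "- real n" "real n"]] by simp
 qed
 then show ?thesis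
 proof eventually_elim
  case (elim t)
  obtain n :: nat where "\<bar>t\<bar> \<le> real n" using real_arch_simple by blast
  then show ?case using elim[rule_format, of n] by (auto simp: indicator_def abs_le_iff split: if_splits)
 qed
qed

text \<open>The cutoff vanishes from time T - k1 on and k < k1, so the forward translate reads w
  only before T, where w1 and w2 are its weak gradients. Backward translates reach negative times,
  which is what the continuation of w is for. Absolute continuity in time is the product rule with
  \<xi>.\<close>

lemma phi_adm:
 assumes x: "\<And>t. (\<xi> has_real_derivative \<xi>' t) (at t)" "continuous_on UNIV \<xi>'"
  and b: "\<And>t. \<bar>\<xi> t\<bar> \<le> C" "\<And>t. \<bar>\<xi>' t\<bar> \<le> C" and k: "0 < k" "k < k1" and z: "\<And>t. t \<ge> T - k1 ==> \<xi> t = 0"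
 shows "adm T (%p. \<xi> (fst p) * wd w k p) (%p. \<xi>' (fst p) * wd w k p + \<xi> (fst p) * wd wt k p)
  (%p. \<xi> (fst p) * wd w1 k p) (%p. \<xi> (fst p) * wd w2 k p)"
proof -
 have cx: "continuous_on UNIV \<xi>" using x(1) by (auto intro!: continuous_at_imp_continuous_on DERIV_isCont)
 have [measurable]: "\<xi> \<in> borel_measurable borel" "\<xi>' \<in> borel_measurable borel"
  using cx x(2) by (auto intro: borel_measurable_continuous_onI)
 have sl: "slabs (%p. \<xi> (fst p) * wd w k p)" "slabs (%p. \<xi>' (fst p) * wd w k p + \<xi> (fst p) * wd wt k p)"
  "slabs (%p. \<xi> (fst p) * wd w1 k p)" "slabs (%p. \<xi> (fst p) * wd w2 k p)"
  by (intro slabs_add slabs_bounded_mult[where C=C] b wd_slabs w_slabs; measurable)+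
 show ?thesis
  unfolding adm_def
 proof (intro conjI)
  show "\<forall>F\<in>{(%p. \<xi> (fst p) * wd w k p), (%p. \<xi>' (fst p) * wd w k p + \<xi> (fst p) * wd wt k p),
   (%p. \<xi> (fst p) * wd w1 k p), (%p. \<xi> (fst p) * wd w2 k p)}. F \<in> borel_measurable borel \<and> sqint M3 (%p. indicator {0..T} (fst p) * F p)"
   using sl unfolding slabs_def by blast
  show "sqint N (%x. \<xi> (fst (0, x)) * wd w k (0, x))"
   unfolding wd_def Shf_E fst_conv
   by (intro sqint_cmult sqint_diff sqint_shf[where f="%x. w (_, x)"] w_sqint)
  show "\<forall>x. \<xi> (fst (T, x)) * wd w k (T, x) = 0" using z[of T] k by simp
  show "AE x in N. \<forall>t\<in>{0..T}. \<xi> (fst (t, x)) * wd w k (t, x) = \<xi> (fst (0, x)) * wd w k (0, x) +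
   (LINT s|lborel. indicator {0..t} s * (\<xi>' (fst (s, x)) * wd w k (s, x) + \<xi> (fst (s, x)) * wd wt k (s, x)))"
   using AE_shf[OF w_AC, of "(0, c * k)"] AE_shf[OF w_AC, of "(0, c * - k)"]
  proof eventually_elim
   case (elim x)
   define y where "y = shf (0, c * k) x"
   define y' where "y' = shf (0, c * - k) x"
   define A where "A t = wd w k (t, x)" for t
   \<comment> \<open>The derivative is cut off outside the interval from 0 to T because
     \<open>AC_product\<close> wants it integrable over the line.\<close>
   define b where "b s = indicator {0..T} s * wd wt k (s, x)" for s
   have A: "A t = w (t + k, y) - w (t + - k, y')" for t by (simp only: A_def wd_def Shf_E y_def y'_def)
   have sh: "integrable lborel (%s. indicator {0..t} s * wt (s + r, z))"
    "(LINT s|lborel. indicator {0..t} s * wt (s + r, z)) = w (t + r, z) - w (r, z)"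
    if g: "(\<forall>a b. integrable lborel (%r. indicator {a..b} r * wt (r, z))) \<and>
     (\<forall>s t. s \<le> t --> w (t, z) - w (s, z) = (LINT r|lborel. indicator {s..t} r * wt (r, z)))" "t \<ge> 0" for t r z
   proof -
    have e: "(%s. indicator {r..t + r} (r + 1 * s) * wt (r + 1 * s, z)) = (%s. indicator {0..t} s * wt (s + r, z))"
     by (auto simp: indicator_def add.commute)
    show "integrable lborel (%s. indicator {0..t} s * wt (s + r, z))"
     using lborel_integrable_real_affine[of "%s. indicator {r..t + r} s * wt (s, z)" 1 r] g unfolding e by simp
    have "w (t + r, z) - w (r, z) = (LINT s|lborel. indicator {r..t + r} s * wt (s, z))" using g by simp
    also have "\<dots> = (LINT s|lborel. indicator {0..t} s * wt (s + r, z))"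
     using lborel_integral_real_affine[of 1 "%s. indicator {r..t + r} s * wt (s, z)" r] unfolding e by simp
    finally show "(LINT s|lborel. indicator {0..t} s * wt (s + r, z)) = w (t + r, z) - w (r, z)" by simp
   qed
   note s1 = sh[OF elim(1)[folded y_def]] and s2 = sh[OF elim(2)[folded y'_def]]
   have bb: "indicator {0..t} s * b s = indicator {0..t} s * wt (s + k, y) - indicator {0..t} s * wt (s + - k, y')" if "t \<in> {0..T}" for s t
    using that unfolding b_def wd_def Shf_E y_def[symmetric] y'_def[symmetric] by (auto simp: indicator_def)
   have ib: "integrable lborel b"
   proof -
    have "integrable lborel (%s. indicator {0..T} s * b s)"
     using Bochner_Integration.integrable_diff[OF s1(1)[of T k] s2(1)[of T "- k"]] T_pos bb[of T] by simp
    moreover have "(%s. indicator {0..T} s * b s) = b" by (auto simp: b_def indicator_def)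
    ultimately show ?thesis by simp
   qed
   have AC: "A s = A 0 + (LINT r|lborel. indicator {0..s} r * b r)" if s: "s \<in> {0..T}" for s
   proof -
    have "(LINT r|lborel. indicator {0..s} r * b r) = (LINT r|lborel. indicator {0..s} r * wt (r + k, y) - indicator {0..s} r * wt (r + - k, y'))"
     by (simp only: bb[OF s])
    also have "\<dots> = (w (s + k, y) - w (k, y)) - (w (s + - k, y') - w (- k, y'))"
     using s1[of s k] s2[of s "- k"] s by simp
    finally show ?thesis by (simp add: A)
   qed
   have Am: "A \<in> borel_measurable borel" unfolding A_def[abs_def]
    by (rule wt_section(2)[OF slabs_measurable[OF wd_slabs[OF w_slabs(1)]]])
   show ?case
   proof
    fix t assume t: "t \<in> {0..T}"
    have "\<xi> t * A t = \<xi> 0 * A 0 + (LINT s|lborel. indicator {0..t} s * (\<xi>' s * A s + \<xi> s * b s))"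
     by (rule AC_product(1)[where A=A and b=b and \<xi>=\<xi> and \<xi>'=\<xi>', OF ib AC x]) (use t Am in auto)
    also have "(LINT s|lborel. indicator {0..t} s * (\<xi>' s * A s + \<xi> s * b s)) = (LINT s|lborel. indicator {0..t} s * (\<xi>' s * wd w k (s, x) + \<xi> s * wd wt k (s, x)))"
     by (intro Bochner_Integration.integral_cong) (use t in \<open>auto simp: A_def b_def indicator_def\<close>)
    finally show "\<xi> (fst (t, x)) * wd w k (t, x) = \<xi> (fst (0, x)) * wd w k (0, x) +
     (LINT s|lborel. indicator {0..t} s * (\<xi>' (fst (s, x)) * wd w k (s, x) + \<xi> (fst (s, x)) * wd wt k (s, x)))"
     by (simp add: A_def)
   qed
  qed
  have iw: "AE t in lborel. integrable N (%x. w (t, x))" "AE t in lborel. integrable N (%x. w1 (t, x))" "AE t in lborel. integrable N (%x. w2 (t, x))"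
   by (intro slabs_section_integrable w_slabs)+
  have g: "AE t in lborel. t < T --> integrable N (%x. w (t, x)) \<and> integrable N (%x. w1 (t, x)) \<and> integrable N (%x. w2 (t, x)) \<and>
    wgrad (%x. w (t, x)) (%x. w1 (t, x)) (1, 0) \<and> wgrad (%x. w (t, x)) (%x. w2 (t, x)) (0, 1)"
   using iw w_wgrad by eventually_elim auto
  show "AE t in lborel. t \<in> {0<..<T} -->
   wgrad (%x. \<xi> (fst (t, x)) * wd w k (t, x)) (%x. \<xi> (fst (t, x)) * wd w1 k (t, x)) (1, 0) \<and>
   wgrad (%x. \<xi> (fst (t, x)) * wd w k (t, x)) (%x. \<xi> (fst (t, x)) * wd w2 k (t, x)) (0, 1)"
   using AE_lborel_shift[OF g, of k] AE_lborel_shift[OF g, of "- k"]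
  proof eventually_elim
   case (elim t)
   show ?case
   proof (cases "t + k < T")
    case False
    then have "\<xi> t = 0" using z k by simp
    then show ?thesis using wgrad_0 by simp
   next
    case True
    then have T': "t + - k < T" using k by simp
    have i: "integrable N (%x. F (s, shf y x))" if "integrable N (%x. F (s, x))" for F :: "real \<times> point => real" and s y
     using that integrable_shf[of "%x. F (s, x)" y] by (auto dest: borel_measurable_integrable)
    have wg: "wgrad (%x. \<xi> t * w (t + k, shf (0, c * k) x) + (- \<xi> t) * w (t + - k, shf (0, c * - k) x))
     (%x. \<xi> t * F (t + k, shf (0, c * k) x) + (- \<xi> t) * F (t + - k, shf (0, c * - k) x)) b"
     if F: "integrable N (%x. F (t + k, x))" "integrable N (%x. F (t + - k, x))"
      "wgrad (%x. w (t + k, x)) (%x. F (t + k, x)) b" "wgrad (%x. w (t + - k, x)) (%x. F (t + - k, x)) b"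
      and W: "integrable N (%x. w (t + k, x))" "integrable N (%x. w (t + - k, x))" and b: "b \<in> Basis"
     for F b
    proof -
     have m: "(%x. F (t + k, x)) \<in> borel_measurable borel" "(%x. F (t + - k, x)) \<in> borel_measurable borel"
      using F(1,2) by (auto dest: borel_measurable_integrable)
     show ?thesis
      by (rule wgrad_linear[OF wgrad_shift[OF F(3) w_sections(1) m(1) b] wgrad_shift[OF F(4) w_sections(1) m(2) b]
         i[OF W(1)] i[OF F(1)] i[OF W(2)] i[OF F(2)] b])
    qed
    have "wgrad (%x. \<xi> t * w (t + k, shf (0, c * k) x) + (- \<xi> t) * w (t + - k, shf (0, c * - k) x))
     (%x. \<xi> t * w1 (t + k, shf (0, c * k) x) + (- \<xi> t) * w1 (t + - k, shf (0, c * - k) x)) (1, 0)"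
     using elim True T' basis by (intro wg) blast+
    moreover have "wgrad (%x. \<xi> t * w (t + k, shf (0, c * k) x) + (- \<xi> t) * w (t + - k, shf (0, c * - k) x))
     (%x. \<xi> t * w2 (t + k, shf (0, c * k) x) + (- \<xi> t) * w2 (t + - k, shf (0, c * - k) x)) (0, 1)"
     using elim True T' basis by (intro wg) blast+
    ultimately show ?thesis by (simp add: wd_def Shf_E right_diff_distrib)
   qed
  qed
 qed
qed

end

lemma integrable_unit_interval_bounded:
 fixes f :: "real => real"
 assumes "f \<in> borel_measurable borel" "\<And>\<sigma>. \<bar>f \<sigma>\<bar> \<le> B"
 shows "integrable lborel (%\<sigma>. indicator {0..1} \<sigma> * f \<sigma>)"
proof (rule Bochner_Integration.integrable_bound)
 show "integrable lborel (%\<sigma>. indicat_real {0..1::real} \<sigma> * B)" by simp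
qed (use assms in \<open>auto simp: indicator_def intro: order_trans[OF _ abs_ge_self]\<close>)

lemma pred_eq_slab:
 fixes f g :: "real \<times> 'a::second_countable_topology => real"
 assumes [measurable]: "f \<in> borel_measurable borel" "g \<in> borel_measurable borel"
 shows "Measurable.pred borel (%p. fst p \<in> {t1..t2} --> f p = g p)"
 by measurable

section \<open>Limits of difference quotients along the wave direction\<close>

context torus begin

text \<open>Difference quotients of w will be means over \<sigma> of translated derivatives; here
  the mean is exchanged with the pairing. The bound does not involve z, because translations
  preserve the L2 norm, and so can dominate a whole sequence of such means.\<close>

lemma shift_mean_Fubini:
 assumes a: "sqint M3 a" and F: "sqint M3 F" and z[measurable]: "z \<in> borel_measurable borel"
 shows "(LINT p|M3. a p * (LINT \<sigma>|lborel. indicator {0..1::real} \<sigma> * F (Shf (z \<sigma>) p))) =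
   (LINT \<sigma>|lborel. indicator {0..1} \<sigma> * (LINT p|M3. a p * F (Shf (z \<sigma>) p)))"
  and "integrable M3 (%p. a p * (LINT \<sigma>|lborel. indicator {0..1::real} \<sigma> * F (Shf (z \<sigma>) p)))"
  and "\<bar>LINT p|M3. a p * F (Shf (z \<sigma>) p)\<bar> \<le> (LINT p|M3. (a p)^2) + (LINT p|M3. (F p)^2)"
  and "(%\<sigma>. LINT p|M3. a p * F (Shf (z \<sigma>) p)) \<in> borel_measurable borel"
proof -
 have [measurable]: "a \<in> borel_measurable borel" "F \<in> borel_measurable borel"
  using sqint_measurable[OF a] sqint_measurable[OF F] by simp_all
 have sf: "sigma_finite_measure M3" unfolding M3_def by (rule P.sigma_finite_measure_axioms)
 interpret M3: sigma_finite_measure M3 by (rule sf)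
 interpret Q: pair_sigma_finite lborel M3 ..
 have zm: "(%q. Shf (z (fst q)) (snd q)) \<in> borel_measurable (borel :: (real \<times> real \<times> point) measure)"
  unfolding Shf_def shf_def by measurable
 have Fm[measurable]: "(%q. F (Shf (z (fst q)) (snd q))) \<in> borel_measurable (borel :: (real \<times> real \<times> point) measure)"
  by (rule measurable_compose[OF zm]) measurable
 have sF: "sqint M3 (%p. F (Shf (z \<sigma>) p))" for \<sigma> by (rule sqint_Shf[OF F])
 have nF: "(LINT p|M3. (F (Shf (z \<sigma>) p))^2) = (LINT p|M3. (F p)^2)" for \<sigma>
  by (rule integral_Shf[where f="%p. (F p)^2"]) measurable
 define B where "B = (LINT p|M3. (a p)^2) + (LINT p|M3. (F p)^2)"
 show bd: "\<bar>LINT p|M3. a p * F (Shf (z \<sigma>) p)\<bar> \<le> (LINT p|M3. (a p)^2) + (LINT p|M3. (F p)^2)" for \<sigma>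
  using sqint_Young[OF a sF, of 1 \<sigma>] nF by simp
 have sa: "sqint M3 (%p. \<bar>a p\<bar>)" using a by (auto simp: sqint_def)
 have sFa: "sqint M3 (%p. \<bar>F (Shf (z \<sigma>) p)\<bar>)" for \<sigma> using sF[of \<sigma>] by (auto simp: sqint_def)
 have bda: "\<bar>LINT p|M3. \<bar>a p\<bar> * \<bar>F (Shf (z \<sigma>) p)\<bar>\<bar> \<le> B" for \<sigma>
  using sqint_Young[OF sa sFa, of 1 \<sigma>] nF by (simp add: B_def)
 let ?g = "%(\<sigma>, p). indicator {0..1::real} \<sigma> * (a p * F (Shf (z \<sigma>) p))"
 have gm: "?g \<in> borel_measurable (lborel \<Otimes>\<^sub>M M3)"
  using Fm by (simp add: measurable_pair_borel split_beta')
 show m1: "(%\<sigma>. LINT p|M3. a p * F (Shf (z \<sigma>) p)) \<in> borel_measurable borel"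
  using Fm by (intro borel_measurable_param_integral sf) auto
 have m2: "(%\<sigma>. LINT p|M3. \<bar>a p\<bar> * \<bar>F (Shf (z \<sigma>) p)\<bar>) \<in> borel_measurable borel"
  using Fm by (intro borel_measurable_param_integral sf) auto
 have ig: "integrable (lborel \<Otimes>\<^sub>M M3) ?g"
 proof (rule Q.Fubini_integrable[OF gm])
  have e: "(LINT p|M3. norm (?g (\<sigma>, p))) = indicator {0..1} \<sigma> * (LINT p|M3. \<bar>a p\<bar> * \<bar>F (Shf (z \<sigma>) p)\<bar>)" for \<sigma>
   by (simp add: abs_mult)
  show "integrable lborel (%\<sigma>. LINT p|M3. norm (?g (\<sigma>, p)))"
   unfolding e by (rule integrable_unit_interval_bounded[OF m2 bda])
  show "AE \<sigma> in lborel. integrable M3 (%p. ?g (\<sigma>, p))"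
   using sqint_mult[OF a sF] by simp
 qed
 have e1: "(LINT \<sigma>|lborel. ?g (\<sigma>, p)) = a p * (LINT \<sigma>|lborel. indicator {0..1::real} \<sigma> * F (Shf (z \<sigma>) p))" for p
  by (simp add: mult.left_commute[of _ "a p"])
 have e2: "(LINT p|M3. ?g (\<sigma>, p)) = indicator {0..1} \<sigma> * (LINT p|M3. a p * F (Shf (z \<sigma>) p))" for \<sigma> by simp
 show "integrable M3 (%p. a p * (LINT \<sigma>|lborel. indicator {0..1::real} \<sigma> * F (Shf (z \<sigma>) p)))"
  using Q.integrable_snd[of "%\<sigma> p. ?g (\<sigma>, p)"] ig unfolding e1[symmetric] by simp
 show "(LINT p|M3. a p * (LINT \<sigma>|lborel. indicator {0..1::real} \<sigma> * F (Shf (z \<sigma>) p))) =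
   (LINT \<sigma>|lborel. indicator {0..1} \<sigma> * (LINT p|M3. a p * F (Shf (z \<sigma>) p)))"
  unfolding e1[symmetric] e2[symmetric] using Q.Fubini_integral[of "%\<sigma> p. ?g (\<sigma>, p)"] ig by simp
qed

text \<open>For each fixed \<sigma> the translations tend to the identity and
  \<open>weak_shift\<close> applies; the uniform bound of \<open>shift_mean_Fubini\<close> permits
  dominated convergence in \<sigma>.\<close>

lemma shift_mean_limit:
 assumes a: "sqint M3 a" and F: "sqint M3 F" and z: "\<And>n. z n \<in> borel_measurable borel" "\<And>\<sigma>. (%n. z n \<sigma>) \<longlonglongrightarrow> 0"
 shows "(%n. LINT p|M3. a p * (LINT \<sigma>|lborel. indicator {0..1::real} \<sigma> * F (Shf (z n \<sigma>) p))) \<longlonglongrightarrow> (LINT p|M3. a p * F p)"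
proof -
 define B where "B = (LINT p|M3. (a p)^2) + (LINT p|M3. (F p)^2)"
 note Fub = shift_mean_Fubini[OF a F z(1)]
 have "(%n. LINT \<sigma>|lborel. indicator {0..1} \<sigma> * (LINT p|M3. a p * F (Shf (z n \<sigma>) p))) \<longlonglongrightarrow> (LINT \<sigma>|lborel. indicator {0..1::real} \<sigma> * (LINT p|M3. a p * F p))"
 proof (rule integral_dominated_convergence[where w="%\<sigma>. indicator {0..1::real} \<sigma> * B"])
  show "AE \<sigma> in lborel. (%n. indicator {0..1} \<sigma> * (LINT p|M3. a p * F (Shf (z n \<sigma>) p))) \<longlonglongrightarrow> indicator {0..1} \<sigma> * (LINT p|M3. a p * F p)"
   by (intro AE_I2 tendsto_intros weak_shift[OF a F z(2)])
  show "AE \<sigma> in lborel. norm (indicator {0..1} \<sigma> * (LINT p|M3. a p * F (Shf (z n \<sigma>) p))) \<le> indicator {0..1::real} \<sigma> * B" for n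
   using Fub(3)[of n] by (intro AE_I2) (auto simp: indicator_def B_def)
  show "(%\<sigma>. indicator {0..1} \<sigma> * (LINT p|M3. a p * F (Shf (z n \<sigma>) p))) \<in> borel_measurable lborel" for n
   using Fub(4)[of n] by simp
 qed auto
 then show ?thesis unfolding Fub(1) by simp
qed

end

context wave begin

text \<open>The increment is split into a step in time at the vertically translated point, which
  integrates V, and a vertical step at fixed time, which integrates G2. The first holds at almost
  every point for all times, the second at almost every time, so the two are combined through null
  sets of space-time. The bounds on k keep all times inside (0,T).\<close>

lemma w_difference:
 assumes t12: "0 < t1" "t2 < T" and k: "\<bar>k\<bar> < t1" "\<bar>k\<bar> < T - t2"
 shows "AE p in M3. fst p \<in> {t1..t2} --> w (Shf (E k) p) - w p =
  k * ((LINT \<sigma>|lborel. indicator {0..1} \<sigma> * V (Shf (\<sigma> * k, (0, c * k)) p))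
   + c * (LINT \<sigma>|lborel. indicator {0..1} \<sigma> * G2 (Shf (0, (0, \<sigma> * (c * k))) p)))"
proof -
 have m1: "(%p. LINT \<sigma>|lborel. indicator {0..1} \<sigma> * V (Shf (\<sigma> * k, (0, c * k)) p)) \<in> borel_measurable borel"
 proof (rule borel_measurable_param_integral)
  have "(%q. Shf (snd q * k, (0, c * k)) (fst q)) \<in> borel_measurable (borel :: ((real \<times> point) \<times> real) measure)"
   unfolding Shf_def shf_def by measurable
  then have "(%q. V (Shf (snd q * k, (0, c * k)) (fst q))) \<in> borel_measurable (borel :: ((real \<times> point) \<times> real) measure)"
   by (rule measurable_compose) measurable
  then show "(%q. indicator {0..1} (snd q) * V (Shf (snd q * k, (0, c * k)) (fst q))) \<in> borel_measurable (borel :: ((real \<times> point) \<times> real) measure)"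
   by measurable
 qed (auto intro: lborel.sigma_finite_measure_axioms)
 have m2: "(%p. LINT \<sigma>|lborel. indicator {0..1} \<sigma> * G2 (Shf (0, (0, \<sigma> * (c * k))) p)) \<in> borel_measurable borel"
 proof (rule borel_measurable_param_integral)
  have "(%q. Shf (0, (0, snd q * (c * k))) (fst q)) \<in> borel_measurable (borel :: ((real \<times> point) \<times> real) measure)"
   unfolding Shf_def shf_def by measurable
  then have "(%q. G2 (Shf (0, (0, snd q * (c * k))) (fst q))) \<in> borel_measurable (borel :: ((real \<times> point) \<times> real) measure)"
   by (rule measurable_compose) measurable
  then show "(%q. indicator {0..1} (snd q) * G2 (Shf (0, (0, snd q * (c * k))) (fst q))) \<in> borel_measurable (borel :: ((real \<times> point) \<times> real) measure)"
   by measurable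
 qed (auto intro: lborel.sigma_finite_measure_axioms)
 have 1: "AE p in M3. fst p \<in> {t1..t2} --> w (fst p + k, shf (0, c * k) (snd p)) - w (fst p, shf (0, c * k) (snd p)) =
  k * (LINT \<sigma>|lborel. indicator {0..1} \<sigma> * V (Shf (\<sigma> * k, (0, c * k)) p))"
 proof (rule AE_M3_I2)
  have "(%p. (fst p + k, shf (0, c * k) (snd p))) \<in> borel_measurable (borel :: (real \<times> point) measure)"
   "(%p. (fst p, shf (0, c * k) (snd p))) \<in> borel_measurable (borel :: (real \<times> point) measure)" by measurable
  note mw = this[THEN measurable_compose, OF w_measurable(1)]
  show "Measurable.pred borel (%p. fst p \<in> {t1..t2} --> w (fst p + k, shf (0, c * k) (snd p)) - w (fst p, shf (0, c * k) (snd p)) =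
   k * (LINT \<sigma>|lborel. indicator {0..1} \<sigma> * V (Shf (\<sigma> * k, (0, c * k)) p)))"
   by (intro pred_eq_slab borel_measurable_diff borel_measurable_times mw m1) simp
  show "AE x in N. AE t in lborel. fst (t, x) \<in> {t1..t2} --> w (fst (t, x) + k, shf (0, c * k) (snd (t, x))) - w (fst (t, x), shf (0, c * k) (snd (t, x))) =
   k * (LINT \<sigma>|lborel. indicator {0..1} \<sigma> * V (Shf (\<sigma> * k, (0, c * k)) (t, x)))"
   using AE_shf[OF w_AC, of "(0, c * k)"]
  proof eventually_elim
   case (elim x)
   define y where "y = shf (0, c * k) x"
   have "w (t + k, y) - w (t, y) = k * (LINT \<sigma>|lborel. indicator {0..1} \<sigma> * V (t + \<sigma> * k, y))" if t: "t \<in> {t1..t2}" for t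
   proof (cases "k = 0")
    case False
    have ab: "w (b, y) - w (a, y) = (LINT r|lborel. indicator {a..b} r * V (r, y))" if "0 < a" "a \<le> b" for a b
    proof -
     have "w (b, y) - w (a, y) = (LINT r|lborel. indicator {a..b} r * wt (r, y))" using elim that by (simp add: y_def)
     also have "\<dots> = (LINT r|lborel. indicator {a..b} r * V (r, y))"
      by (intro Bochner_Integration.integral_cong) (use that in \<open>auto simp: wt_def indicator_def\<close>)
     finally show ?thesis .
    qed
    show ?thesis
    proof (cases "k > 0")
     case True
     have "w (t + k, y) - w (t, y) = (LINT r|lborel. indicator {t..t + k} r * V (r, y))" using True t t12 by (intro ab) auto
     also have "\<dots> = \<bar>k\<bar> *\<^sub>R (LINT \<sigma>|lborel. indicator {t..t + k} (t + k * \<sigma>) * V (t + k * \<sigma>, y))"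
      using lborel_integral_real_affine[OF \<open>k \<noteq> 0\<close>, of "%r. indicator {t..t + k} r * V (r, y)" t] by simp
     also have "(%\<sigma>. indicator {t..t + k} (t + k * \<sigma>) * V (t + k * \<sigma>, y)) = (%\<sigma>. indicator {0..1} \<sigma> * V (t + \<sigma> * k, y))"
     proof
      fix \<sigma>
      have "t + k * \<sigma> \<in> {t..t + k} \<longleftrightarrow> \<sigma> \<in> {0..1}" using True by (simp add: zero_le_mult_iff)
      then show "indicator {t..t + k} (t + k * \<sigma>) * V (t + k * \<sigma>, y) = indicator {0..1} \<sigma> * V (t + \<sigma> * k, y)"
       by (simp only: indicator_def mult.commute)
     qed
     finally show ?thesis using True by simp
    next
     case neg: False
     then have kn: "k < 0" using False by simp
     have "w (t + k, y) - w (t, y) = - (LINT r|lborel. indicator {t + k..t} r * V (r, y))"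
      using ab[of "t + k" t] kn t k t12 by auto
     also have "(LINT r|lborel. indicator {t + k..t} r * V (r, y)) = \<bar>k\<bar> *\<^sub>R (LINT \<sigma>|lborel. indicator {t + k..t} (t + k * \<sigma>) * V (t + k * \<sigma>, y))"
      using lborel_integral_real_affine[OF \<open>k \<noteq> 0\<close>, of "%r. indicator {t + k..t} r * V (r, y)" t] by simp
     also have "(%\<sigma>. indicator {t + k..t} (t + k * \<sigma>) * V (t + k * \<sigma>, y)) = (%\<sigma>. indicator {0..1} \<sigma> * V (t + \<sigma> * k, y))"
     proof
      fix \<sigma>
      have "t + k * \<sigma> \<in> {t + k..t} \<longleftrightarrow> \<sigma> \<in> {0..1}" using kn by (auto simp: mult_le_0_iff)
      then show "indicator {t + k..t} (t + k * \<sigma>) * V (t + k * \<sigma>, y) = indicator {0..1} \<sigma> * V (t + \<sigma> * k, y)"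
       by (simp only: indicator_def mult.commute)
     qed
     finally show ?thesis using kn by simp
    qed
   qed simp
   then show ?case by (simp add: Shf_def y_def)
  qed
 qed
 have 2: "AE p in M3. fst p \<in> {t1..t2} --> w (fst p, shf (0, c * k) (snd p)) - w p =
  k * (c * (LINT \<sigma>|lborel. indicator {0..1} \<sigma> * G2 (Shf (0, (0, \<sigma> * (c * k))) p)))"
 proof (rule AE_M3_I)
  have "(%p. (fst p, shf (0, c * k) (snd p))) \<in> borel_measurable (borel :: (real \<times> point) measure)" by measurable
  note mw = this[THEN measurable_compose, OF w_measurable(1)]
  show "Measurable.pred borel (%p. fst p \<in> {t1..t2} --> w (fst p, shf (0, c * k) (snd p)) - w p =
   k * (c * (LINT \<sigma>|lborel. indicator {0..1} \<sigma> * G2 (Shf (0, (0, \<sigma> * (c * k))) p))))"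
   by (intro pred_eq_slab borel_measurable_diff borel_measurable_times mw m2 w_measurable) simp_all
  show "AE t in lborel. AE x in N. fst (t, x) \<in> {t1..t2} --> w (fst (t, x), shf (0, c * k) (snd (t, x))) - w (t, x) =
   k * (c * (LINT \<sigma>|lborel. indicator {0..1} \<sigma> * G2 (Shf (0, (0, \<sigma> * (c * k))) (t, x))))"
   using w_wgrad slabs_section_integrable[OF w_slabs(1)] slabs_section_integrable[OF w_slabs(4)]
  proof eventually_elim
   case (elim t)
   show ?case
   proof (cases "t \<in> {t1..t2}")
    case True
    then have t: "t < T" "t > 0" using t12 by auto
    have "AE x in N. w (t, shf ((c * k) *\<^sub>R (0, 1)) x) - w (t, x) = (c * k) * (LINT \<sigma>|lborel. indicator {0..1} \<sigma> * w2 (t, shf ((\<sigma> * (c * k)) *\<^sub>R (0, 1)) x))"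
     by (rule wgrad_shift_repr[of "%x. w (t, x)" "%x. w2 (t, x)"]) (use elim t basis in auto)
    then show ?thesis by eventually_elim (use t in \<open>simp add: w2_def Shf_def\<close>)
   next
    case False
    then show ?thesis by (intro AE_I2) auto
   qed
  qed
 qed
 show ?thesis using 1 2
 proof eventually_elim
  case (elim p)
  have S: "Shf (E k) p = (fst p + k, shf (0, c * k) (snd p))" by (simp add: Shf_def E_def)
  show ?case
  proof
   assume "fst p \<in> {t1..t2}"
   with elim show "w (Shf (E k) p) - w p = k * ((LINT \<sigma>|lborel. indicator {0..1} \<sigma> * V (Shf (\<sigma> * k, (0, c * k)) p))
    + c * (LINT \<sigma>|lborel. indicator {0..1} \<sigma> * G2 (Shf (0, (0, \<sigma> * (c * k))) p)))"
    unfolding S distrib_left by linarith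
  qed
 qed
qed

text \<open>Weak convergence suffices, since the quotient is always paired with a fixed square
  integrable function supported in times away from 0 and T.\<close>

lemma w_difference_quotient:
 assumes t12: "0 < t1" "t2 < T" and a: "sqint M3 a" "\<And>p. fst p \<notin> {t1..t2} ==> a p = 0"
  and k: "k \<longlonglongrightarrow> 0" "\<And>n. k n \<noteq> 0"
 shows "(%n. (LINT p|M3. a p * (w (Shf (E (k n)) p) - w p)) / k n) \<longlonglongrightarrow> (LINT p|M3. a p * (V p + c * G2 p))"
proof -
 have [measurable]: "a \<in> borel_measurable borel" using sqint_measurable[OF a(1)] by simp
 let ?z1 = "%n \<sigma>. (\<sigma> * k n, (0, c * k n)) :: real \<times> point"
 let ?z2 = "%n \<sigma>. (0, (0, \<sigma> * (c * k n))) :: real \<times> point"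
 have z0: "(%n. ?z1 n \<sigma>) \<longlonglongrightarrow> 0" "(%n. ?z2 n \<sigma>) \<longlonglongrightarrow> 0" for \<sigma>
 proof -
  have "(%n. ?z1 n \<sigma>) \<longlonglongrightarrow> (\<sigma> * 0, (0, c * 0))" by (intro tendsto_intros k)
  then show "(%n. ?z1 n \<sigma>) \<longlonglongrightarrow> 0" by (simp add: zero_prod_def)
  have "(%n. ?z2 n \<sigma>) \<longlonglongrightarrow> (0, (0, \<sigma> * (c * 0)))" by (intro tendsto_intros k)
  then show "(%n. ?z2 n \<sigma>) \<longlonglongrightarrow> 0" by (simp add: zero_prod_def)
 qed
 have zm: "?z1 n \<in> borel_measurable borel" "?z2 n \<in> borel_measurable borel" for n by measurable
 let ?I1 = "%n p. LINT \<sigma>|lborel. indicator {0..1::real} \<sigma> * V (Shf (?z1 n \<sigma>) p)"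
 let ?I2 = "%n p. LINT \<sigma>|lborel. indicator {0..1::real} \<sigma> * G2 (Shf (?z2 n \<sigma>) p)"
 have "(%n. (LINT p|M3. a p * ?I1 n p) + c * (LINT p|M3. a p * ?I2 n p)) \<longlonglongrightarrow> (LINT p|M3. a p * V p) + c * (LINT p|M3. a p * G2 p)"
  by (intro tendsto_intros shift_mean_limit a UVG zm z0)
 also have "(LINT p|M3. a p * V p) + c * (LINT p|M3. a p * G2 p) = (LINT p|M3. a p * (V p + c * G2 p))"
  using sqint_mult[OF a(1) UVG(2)] sqint_mult[OF a(1) UVG(4)] by (simp add: distrib_left mult.left_commute[of _ c])
 finally have lim: "(%n. (LINT p|M3. a p * ?I1 n p) + c * (LINT p|M3. a p * ?I2 n p)) \<longlonglongrightarrow> (LINT p|M3. a p * (V p + c * G2 p))" .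
 have "eventually (%n. \<bar>k n\<bar> < min t1 (T - t2)) sequentially"
  by (rule order_tendstoD(2)[OF tendsto_rabs_zero[OF k(1)]]) (use t12 in auto)
 then have "eventually (%n. (LINT p|M3. a p * ?I1 n p) + c * (LINT p|M3. a p * ?I2 n p) = (LINT p|M3. a p * (w (Shf (E (k n)) p) - w p)) / k n) sequentially"
 proof eventually_elim
  case (elim n)
  note I1 = shift_mean_Fubini(2)[OF a(1) UVG(2) zm(1)[of n]]
  note I2 = shift_mean_Fubini(2)[OF a(1) UVG(4) zm(2)[of n]]
  have "(LINT p|M3. a p * (w (Shf (E (k n)) p) - w p)) = (LINT p|M3. k n * (a p * ?I1 n p + c * (a p * ?I2 n p)))"
  proof (rule integral_cong_AE)
   show "AE p in M3. a p * (w (Shf (E (k n)) p) - w p) = k n * (a p * ?I1 n p + c * (a p * ?I2 n p))"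
   proof -
    have "\<bar>k n\<bar> < t1" "\<bar>k n\<bar> < T - t2" using elim by auto
    from w_difference[OF t12 this] show ?thesis
    proof eventually_elim
     case (elim p)
     then show ?case using a(2)[of p] by (cases "fst p \<in> {t1..t2}") (auto simp: algebra_simps)
    qed
   qed
   show "(%p. k n * (a p * ?I1 n p + c * (a p * ?I2 n p))) \<in> borel_measurable M3"
   proof (rule borel_measurable_integrable)
    show "integrable M3 (%p. k n * (a p * ?I1 n p + c * (a p * ?I2 n p)))"
     using I1 I2 by (intro integrable_mult_right Bochner_Integration.integrable_add)
   qed
  qed measurable
  also have "\<dots> = k n * ((LINT p|M3. a p * ?I1 n p) + c * (LINT p|M3. a p * ?I2 n p))"
   using I1 I2 by simp
  finally show ?case using k(2)[of n] by simp
 qed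
 from Lim_transform_eventually[OF lim this] show ?thesis .
qed

text \<open>The centred quotient is the mean of the quotients with steps k and -k, and
  \<open>w_difference_quotient\<close> admits both signs.\<close>

lemma wd_quotient:
 assumes t12: "0 < t1" "t2 < T" and a: "sqint M3 a" "\<And>p. fst p \<notin> {t1..t2} ==> a p = 0"
  and k: "k \<longlonglongrightarrow> 0" "\<And>n. k n \<noteq> 0"
 shows "(%n. (LINT p|M3. a p * wd w (k n) p) / (2 * k n)) \<longlonglongrightarrow> (LINT p|M3. a p * (V p + c * G2 p))"
proof -
 let ?L = "LINT p|M3. a p * (V p + c * G2 p)"
 have i: "integrable M3 (%p. a p * F p)" if "slabs F" for F
 proof -
  have "integrable M3 (%p. a p * (indicator {t1..t2} (fst p) * F p))" by (rule sqint_mult[OF a(1) slabsD[OF that]])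
  moreover have "(%p. a p * (indicator {t1..t2} (fst p) * F p)) = (%p. a p * F p)"
  proof
   fix p show "a p * (indicator {t1..t2} (fst p) * F p) = a p * F p"
    using a(2)[of p] by (cases "fst p \<in> {t1..t2}") simp_all
  qed
  ultimately show ?thesis by simp
 qed
 have "(%n. ((LINT p|M3. a p * (w (Shf (E (k n)) p) - w p)) / k n + (LINT p|M3. a p * (w (Shf (E (- k n)) p) - w p)) / (- k n)) / 2) \<longlonglongrightarrow> (?L + ?L) / 2"
  by (intro tendsto_intros w_difference_quotient[OF t12 a] k tendsto_minus_cancel_left[THEN iffD1]) (use k tendsto_minus[OF k(1)] in auto)
 note lim = this
 have e: "((LINT p|M3. a p * (w (Shf (E (k n)) p) - w p)) / k n + (LINT p|M3. a p * (w (Shf (E (- k n)) p) - w p)) / (- k n)) / 2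
   = (LINT p|M3. a p * wd w (k n) p) / (2 * k n)" for n
 proof -
  have i1: "integrable M3 (%p. a p * (w (Shf z p) - w p))" for z by (intro i slabs_diff slabs_Shf w_slabs)
  have "(LINT p|M3. a p * wd w (k n) p) = (LINT p|M3. a p * (w (Shf (E (k n)) p) - w p) - a p * (w (Shf (E (- k n)) p) - w p))"
   by (simp add: wd_def algebra_simps)
  also have "\<dots> = (LINT p|M3. a p * (w (Shf (E (k n)) p) - w p)) - (LINT p|M3. a p * (w (Shf (E (- k n)) p) - w p))"
   by (rule Bochner_Integration.integral_diff[OF i1 i1])
  finally show ?thesis using k(2)[of n] by (simp add: field_simps)
 qed
 have "(?L + ?L) / 2 = ?L" by simp
 with lim show ?thesis unfolding e by (simp only:)
qed

end

section \<open>Discrete integration by parts\<close>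

context wave begin

lemma Shf_inverse: "snd p \<in> Omega l h ==> Shf (E (- k)) (Shf (E k) p) = p"
 using shf_inverse(2)[of "snd p" "(0, c * k)"] by (simp add: Shf_def E_def)

text \<open>Discrete integration by parts along \<open>E k\<close>: shifting the second term of \<open>wd z k\<close> turns it
  into the first one at times \<open>> 0\<close>, and leaves a boundary term in the initial data at times in \<open>(-k, 0]\<close>.\<close>
lemma summation_by_parts:
 assumes A: "A \<in> borel_measurable borel" "\<And>p. \<bar>A p\<bar> \<le> K"
  and inv: "AE p in M3. fst p \<in> {0<..<T} --> fst p + k \<in> {0<..<T} --> A (Shf (E k) p) = A p"
  and aL: "\<And>t x. t \<in> {0<..<T} ==> x \<in> S ==> A (t, x) = aL"
  and Z: "sqint M3 Z" "\<And>p. fst p \<notin> {0<..<T} ==> Z p = 0"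
  and z: "slabs z" "\<And>p. fst p > 0 ==> z p = Z p" "\<And>p. fst p \<le> 0 ==> z p = q p" "\<And>p. snd p \<notin> S ==> q p = 0"
  and q: "q \<in> borel_measurable borel"
  and x: "\<xi> \<in> borel_measurable borel" "\<And>t. \<bar>\<xi> t\<bar> \<le> C" "\<And>t. t \<le> k1 ==> \<xi> t = \<xi>0"
  and k: "0 < k" "k < k1"
 shows "(LINT p|M3. A p * \<xi> (fst p) * Z p * wd z k p) =
   (LINT p|M3. (\<xi> (fst p) - \<xi> (fst p + k)) * (A p * Z p * Z (Shf (E k) p)))
   - \<xi>0 * aL * (LINT p|M3. indicator {-k<..0} (fst p) * q p * Z (Shf (E k) p))"
  and "integrable M3 (%p. A p * \<xi> (fst p) * Z p * wd z k p)"
  and "integrable M3 (%p. (\<xi> (fst p) - \<xi> (fst p + k)) * (A p * Z p * Z (Shf (E k) p)))"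
  and "integrable M3 (%p. indicator {-k<..0} (fst p) * q p * Z (Shf (E k) p))"
proof -
 note [measurable] = A(1) sqint_measurable[OF Z(1), unfolded measurable_M3] slabs_measurable[OF z(1)] q x(1)
 have C: "C \<ge> 0" using order_trans[OF abs_ge_zero x(2)] .
 have K: "K \<ge> 0" using order_trans[OF abs_ge_zero A(2)] .
 have sZ: "sqint M3 (%p. (A p * \<xi> (fst p)) * Z p)"
 proof (rule sqint_bound[OF Z(1)])
  show "AE p in M3. \<bar>(A p * \<xi> (fst p)) * Z p\<bar> \<le> (K * C) * \<bar>Z p\<bar>"
   unfolding abs_mult using A(2) x(2) K by (intro AE_I2 mult_right_mono mult_mono) auto
 qed measurable
 have i: "integrable M3 (%p. A p * \<xi> (fst p) * Z p * F p)" if "slabs F" for F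
 proof -
  have "A p * \<xi> (fst p) * Z p * (indicator {0..T} (fst p) * F p) = A p * \<xi> (fst p) * Z p * F p" for p
   using Z(2)[of p] by (cases "fst p \<in> {0<..<T}") auto
  with sqint_mult[OF sZ slabsD[OF that, of 0 T]] show ?thesis by (simp only:)
 qed
 have sh: "slabs (%p. z (Shf (E r) p))" for r by (rule slabs_Shf[OF z(1)])
 note i1 = i[OF sh[of k]] and i2 = i[OF sh[of "- k"]]
 show i3: "integrable M3 (%p. A p * \<xi> (fst p) * Z p * wd z k p)" by (rule i[OF wd_slabs[OF z(1)]])
 have sZk: "sqint M3 (%p. Z (Shf (E k) p))" by (rule sqint_Shf[OF Z(1)])
 have sdA: "sqint M3 (%p. ((\<xi> (fst p) - \<xi> (fst p + k)) * A p) * Z p)"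
 proof (rule sqint_bound[OF Z(1)])
  have "\<bar>\<xi> t - \<xi> s\<bar> \<le> 2 * C" for t s using x(2)[of t] x(2)[of s] by linarith
  then show "AE p in M3. \<bar>((\<xi> (fst p) - \<xi> (fst p + k)) * A p) * Z p\<bar> \<le> (2 * C * K) * \<bar>Z p\<bar>"
   unfolding abs_mult using A(2) C by (intro AE_I2 mult_right_mono mult_mono) auto
 qed measurable
 show i4: "integrable M3 (%p. (\<xi> (fst p) - \<xi> (fst p + k)) * (A p * Z p * Z (Shf (E k) p)))"
  using sqint_mult[OF sdA sZk] by (simp add: mult.assoc)
 have sx: "sqint M3 (%p. (\<xi> (fst p + k) * A p) * Z p)"
 proof (rule sqint_bound[OF Z(1)])
  show "AE p in M3. \<bar>(\<xi> (fst p + k) * A p) * Z p\<bar> \<le> (C * K) * \<bar>Z p\<bar>"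
   unfolding abs_mult using A(2) x(2) C by (intro AE_I2 mult_right_mono mult_mono) auto
 qed measurable
 have i6: "integrable M3 (%p. \<xi> (fst p + k) * A p * Z p * Z (Shf (E k) p))" by (rule sqint_mult[OF sx sZk])
 have qs: "sqint M3 (%p. indicator {-k<..0} (fst p) * q p)"
  by (rule sqint_bound[OF slabsD[OF z(1), of "-k" 0], of _ 1]) (auto simp: z(3) indicator_def)
 show i5: "integrable M3 (%p. indicator {-k<..0} (fst p) * q p * Z (Shf (E k) p))" by (rule sqint_mult[OF qs sZk])
 have e1: "(LINT p|M3. A p * \<xi> (fst p) * Z p * z (Shf (E k) p)) = (LINT p|M3. \<xi> (fst p) * A p * Z p * Z (Shf (E k) p))"
 proof (rule Bochner_Integration.integral_cong[OF refl])
  fix p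
  have "fst (Shf (E k) p) > 0" if "fst p > 0" using that k by (simp add: Shf_def E_def)
  then show "A p * \<xi> (fst p) * Z p * z (Shf (E k) p) = \<xi> (fst p) * A p * Z p * Z (Shf (E k) p)"
   using z(2)[of "Shf (E k) p"] Z(2)[of p] by (cases "fst p > 0") (auto simp: mult_ac)
 qed
 let ?H = "%p. A p * \<xi> (fst p) * Z p * z (Shf (E (- k)) p)"
 have "(LINT p|M3. ?H p) = (LINT p|M3. ?H (Shf (E k) p))"
  by (rule integral_Shf[symmetric]) measurable
 also have "\<dots> = (LINT p|M3. \<xi> (fst p + k) * A p * Z p * Z (Shf (E k) p) + \<xi>0 * aL * (indicator {-k<..0} (fst p) * q p * Z (Shf (E k) p)))"
 proof (rule integral_cong_AE)
  \<comment> \<open>Invariance of A compares times inside (0,T) only, so it says nothing about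
    starting times in (-k, 0]. There the data are supported in S, vertical translation stays in S,
    and A has the constant value aL at the translated point.\<close>
  have SAE: "AE p in M3. q p \<noteq> 0 --> fst (Shf (E k) p) \<in> {0<..<T} --> A (Shf (E k) p) = aL"
  proof (rule AE_M3_I)
   have "(%p. A (Shf (E k) p)) \<in> borel_measurable borel" by measurable
   note [measurable] = this
   show "Measurable.pred borel (%p. q p \<noteq> 0 --> fst (Shf (E k) p) \<in> {0<..<T} --> A (Shf (E k) p) = aL)" by measurable
   show "AE t in lborel. AE x in N. q (t, x) \<noteq> 0 --> fst (Shf (E k) (t, x)) \<in> {0<..<T} --> A (Shf (E k) (t, x)) = aL"
   proof (rule AE_I2)
    fix t
    show "AE x in N. q (t, x) \<noteq> 0 --> fst (Shf (E k) (t, x)) \<in> {0<..<T} --> A (Shf (E k) (t, x)) = aL"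
     using S_shift[of "c * k"]
    proof eventually_elim
     case (elim x)
     show ?case
     proof (intro impI)
      assume "q (t, x) \<noteq> 0" "fst (Shf (E k) (t, x)) \<in> {0<..<T}"
      then have "x \<in> S" "t + k \<in> {0<..<T}" using z(4)[of "(t, x)"] by (auto simp: Shf_E)
      then show "A (Shf (E k) (t, x)) = aL" using elim aL by (simp add: Shf_E)
     qed
    qed
   qed
  qed
  show "AE p in M3. ?H (Shf (E k) p) = \<xi> (fst p + k) * A p * Z p * Z (Shf (E k) p) + \<xi>0 * aL * (indicator {-k<..0} (fst p) * q p * Z (Shf (E k) p))"
   using inv SAE AE_M3_Omega
  proof eventually_elim
   case (elim p)
   have f: "fst (Shf (E k) p) = fst p + k" by (simp add: Shf_def E_def)
   show ?case
   proof (cases "fst p + k \<in> {0<..<T}")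
    case False
    then have "Z (Shf (E k) p) = 0" using Z(2)[of "Shf (E k) p"] f by simp
    then show ?thesis by simp
   next
    case True
    \<comment> \<open>Up to time zero Z vanishes and only the boundary term survives; after it,
      invariance of A and equality of z and Z give the interior product.\<close>
    show ?thesis
    proof (cases "fst p \<le> 0")
     case neg: True
     then have "Z p = 0" using Z(2)[of p] by auto
     moreover have "\<xi> (fst p + k) = \<xi>0" using neg k by (intro x(3)) auto
     moreover have "A (Shf (E k) p) * q p = aL * q p" using elim(2) True f by (cases "q p = 0") auto
     moreover have "fst p \<in> {-k<..0}" using neg True by auto
     ultimately show ?thesis using z(3)[OF neg] by (auto simp: Shf_inverse[OF elim(3)] f mult_ac)
    next
     case pos: False
     then have "fst p \<in> {0<..<T}" using True k by auto
     then have "A (Shf (E k) p) = A p" using elim(1) True by blast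
     moreover have "z p = Z p" using pos by (intro z(2)) auto
     ultimately show ?thesis using pos by (simp add: Shf_inverse[OF elim(3)] f mult_ac)
    qed
   qed
  qed
  show "(%p. \<xi> (fst p + k) * A p * Z p * Z (Shf (E k) p) + \<xi>0 * aL * (indicator {-k<..0} (fst p) * q p * Z (Shf (E k) p))) \<in> borel_measurable M3"
   using i5 i6 by (intro borel_measurable_integrable[of M3] Bochner_Integration.integrable_add integrable_mult_right)
  show "(%p. ?H (Shf (E k) p)) \<in> borel_measurable M3"
   using i2 integrable_Shf[of ?H "E k"] by (intro borel_measurable_integrable[of M3]) auto
 qed
 also have "\<dots> = (LINT p|M3. \<xi> (fst p + k) * A p * Z p * Z (Shf (E k) p)) + \<xi>0 * aL * (LINT p|M3. indicator {-k<..0} (fst p) * q p * Z (Shf (E k) p))"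
  using i5 i6 by (subst Bochner_Integration.integral_add) auto
 finally have e2: "(LINT p|M3. ?H p) = (LINT p|M3. \<xi> (fst p + k) * A p * Z p * Z (Shf (E k) p)) + \<xi>0 * aL * (LINT p|M3. indicator {-k<..0} (fst p) * q p * Z (Shf (E k) p))" .
 have sx0: "sqint M3 (%p. (\<xi> (fst p) * A p) * Z p)" using sZ by (simp add: mult.commute[of "A _"])
 have i7: "integrable M3 (%p. \<xi> (fst p) * A p * Z p * Z (Shf (E k) p))" by (rule sqint_mult[OF sx0 sZk])
 have "(LINT p|M3. A p * \<xi> (fst p) * Z p * wd z k p) = (LINT p|M3. A p * \<xi> (fst p) * Z p * z (Shf (E k) p) - ?H p)"
  by (simp add: wd_def right_diff_distrib)
 also have "\<dots> = (LINT p|M3. A p * \<xi> (fst p) * Z p * z (Shf (E k) p)) - (LINT p|M3. ?H p)"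
  by (rule Bochner_Integration.integral_diff[OF i1 i2])
 also have "\<dots> = ((LINT p|M3. \<xi> (fst p) * A p * Z p * Z (Shf (E k) p)) - (LINT p|M3. \<xi> (fst p + k) * A p * Z p * Z (Shf (E k) p)))
   - \<xi>0 * aL * (LINT p|M3. indicator {-k<..0} (fst p) * q p * Z (Shf (E k) p))"
  unfolding e1 e2 by simp
 also have "(LINT p|M3. \<xi> (fst p) * A p * Z p * Z (Shf (E k) p)) - (LINT p|M3. \<xi> (fst p + k) * A p * Z p * Z (Shf (E k) p))
  = (LINT p|M3. (\<xi> (fst p) - \<xi> (fst p + k)) * (A p * Z p * Z (Shf (E k) p)))"
  using i6 i7 by (subst Bochner_Integration.integral_diff[symmetric]) (auto simp: algebra_simps)
 finally show "(LINT p|M3. A p * \<xi> (fst p) * Z p * wd z k p) =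
   (LINT p|M3. (\<xi> (fst p) - \<xi> (fst p + k)) * (A p * Z p * Z (Shf (E k) p)))
   - \<xi>0 * aL * (LINT p|M3. indicator {-k<..0} (fst p) * q p * Z (Shf (E k) p))" .
qed

text \<open>After the shift only the cutoff is still differenced, so no derivative of Z is needed:
  its quotient tends boundedly to -\<xi>'/2 by the mean value theorem, while the translate of Z
  tends to Z in L2.\<close>

lemma summation_by_parts_limit:
 assumes A: "A \<in> borel_measurable borel" "\<And>p. \<bar>A p\<bar> \<le> K" and Z: "sqint M3 Z"
  and x: "\<And>t. (\<xi> has_real_derivative \<xi>' t) (at t)" "continuous_on UNIV \<xi>'" "\<And>t. \<bar>\<xi>' t\<bar> \<le> C"
  and k: "k \<longlonglongrightarrow> 0" "\<And>n. k n > 0"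
 shows "(%n. (LINT p|M3. (\<xi> (fst p) - \<xi> (fst p + k n)) * (A p * Z p * Z (Shf (E (k n)) p))) / (2 * k n)) \<longlonglongrightarrow>
  (LINT p|M3. - \<xi>' (fst p) * (A p * (Z p)^2) / 2)"
proof -
 have cx: "continuous_on UNIV \<xi>" using x(1) by (auto intro!: continuous_at_imp_continuous_on DERIV_isCont)
 have [measurable]: "\<xi> \<in> borel_measurable borel" "\<xi>' \<in> borel_measurable borel"
  using cx x(2) by (auto intro: borel_measurable_continuous_onI)
 note [measurable] = A(1) sqint_measurable[OF Z, unfolded measurable_M3]
 have K: "K \<ge> 0" using order_trans[OF abs_ge_zero A(2)] .
 define d where "d n t = (\<xi> t - \<xi> (t + k n)) / (2 * k n)" for n t
 have [measurable]: "d n \<in> borel_measurable borel" for n unfolding d_def[abs_def] by measurable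
 have db: "\<bar>d n t\<bar> \<le> C" for n t
 proof -
  have "\<exists>y. t < y \<and> y < t + k n \<and> \<xi> (t + k n) - \<xi> t = (t + k n - t) * \<xi>' y"
   using k(2)[of n] by (intro MVT2 x(1)) auto
  then obtain y where "\<xi> (t + k n) - \<xi> t = k n * \<xi>' y" by auto
  then have e: "\<xi> t - \<xi> (t + k n) = - (k n * \<xi>' y)" by simp
  have "\<bar>d n t\<bar> = \<bar>\<xi>' y\<bar> / 2" using k(2)[of n] unfolding d_def e by (simp add: abs_mult)
  also have "\<dots> \<le> C" using x(3)[of y] abs_ge_zero[of "\<xi>' y"] by linarith
  finally show ?thesis .
 qed
 have dl: "(%n. d n t) \<longlonglongrightarrow> - \<xi>' t / 2" for t
 proof -
  have "filterlim k (at 0) sequentially"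
   unfolding filterlim_at using k by (auto intro!: always_eventually less_imp_neq[symmetric])
  moreover have "(%h. (\<xi> (t + h) - \<xi> t) / h) \<midarrow>0\<rightarrow> \<xi>' t" using x(1)[of t] by (simp add: DERIV_def)
  ultimately have "(%n. (\<xi> (t + k n) - \<xi> t) / k n) \<longlonglongrightarrow> \<xi>' t" by (rule filterlim_compose[rotated])
  then have "(%n. - ((\<xi> (t + k n) - \<xi> t) / k n) / 2) \<longlonglongrightarrow> - \<xi>' t / 2" by (intro tendsto_intros) auto
  moreover have "- ((\<xi> (t + k n) - \<xi> t) / k n) / 2 = d n t" for n by (simp add: d_def minus_divide_left[symmetric] algebra_simps diff_divide_distrib)
  ultimately show ?thesis by simp
 qed
 have AZ: "sqint M3 (%p. A p * Z p)" by (rule sqint_bound[OF Z, of _ K]) (use A in \<open>measurable, auto simp: abs_mult intro!: AE_I2 mult_right_mono\<close>)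
 have Zk: "sqint M3 (%p. Z (Shf (E (k n)) p))" for n by (rule sqint_Shf[OF Z])
 have dAZ: "sqint M3 (%p. d n (fst p) * (A p * Z p))" for n
  by (rule sqint_bounded_mult[OF AZ _ db]) measurable
 have z0: "(%n. E (k n)) \<longlonglongrightarrow> 0"
 proof -
  have "(%n. (k n, (0, c * k n))) \<longlonglongrightarrow> (0, (0, c * 0))" by (intro tendsto_intros k)
  then show ?thesis by (simp add: E_def zero_prod_def)
 qed
 have L1: "(%n. LINT p|M3. d n (fst p) * (A p * (Z p)^2)) \<longlonglongrightarrow> (LINT p|M3. (- \<xi>' (fst p) / 2) * (A p * (Z p)^2))"
 proof (rule integral_dominated_convergence[where w="%p. C * K * (Z p)^2"])
  show "AE p in M3. (%n. d n (fst p) * (A p * (Z p)^2)) \<longlonglongrightarrow> (- \<xi>' (fst p) / 2) * (A p * (Z p)^2)"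
   by (intro AE_I2 tendsto_mult dl tendsto_const)
  show "AE p in M3. norm (d n (fst p) * (A p * (Z p)^2)) \<le> C * K * (Z p)^2" for n
  proof (rule AE_I2)
   fix p
   have "\<bar>d n (fst p)\<bar> * \<bar>A p\<bar> \<le> C * K" using db A(2) order_trans[OF abs_ge_zero db] by (intro mult_mono) auto
   then have "\<bar>d n (fst p)\<bar> * \<bar>A p\<bar> * (Z p)^2 \<le> C * K * (Z p)^2" by (rule mult_right_mono) simp
   then show "norm (d n (fst p) * (A p * (Z p)^2)) \<le> C * K * (Z p)^2" by (simp add: abs_mult mult.assoc)
  qed
 qed (use Z in \<open>auto simp: sqint_def\<close>)
 have L2: "(%n. LINT p|M3. (d n (fst p) * (A p * Z p)) * (Z (Shf (E (k n)) p) - Z p)) \<longlonglongrightarrow> 0"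
 proof (rule LIMSEQ_I)
  fix r :: real assume r: "r > 0"
  define Q where "Q = (C * K)^2 * (LINT p|M3. (Z p)^2) + 1"
  have Q: "Q > 0" by (simp add: Q_def add_nonneg_pos)
  define e where "e = r / (2 * Q)"
  have e: "e > 0" "e * Q = r / 2" using r Q by (auto simp: e_def)
  have dQ: "(LINT p|M3. (d n (fst p) * (A p * Z p))^2) \<le> Q" for n
  proof -
   have "(LINT p|M3. (d n (fst p) * (A p * Z p))^2) \<le> (LINT p|M3. (C * K)^2 * (Z p)^2)"
   proof (rule integral_mono)
    fix p
    have "\<bar>d n (fst p)\<bar> * \<bar>A p\<bar> \<le> C * K" using db A(2) order_trans[OF abs_ge_zero db] by (intro mult_mono) auto
    then have "(\<bar>d n (fst p)\<bar> * \<bar>A p\<bar>)^2 \<le> (C * K)^2" by (rule power_mono) simp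
    then have "(\<bar>d n (fst p)\<bar> * \<bar>A p\<bar>)^2 * (Z p)^2 \<le> (C * K)^2 * (Z p)^2" by (rule mult_right_mono) simp
    then show "(d n (fst p) * (A p * Z p))^2 \<le> (C * K)^2 * (Z p)^2" by (simp add: power_mult_distrib mult.assoc)
   qed (use dAZ[of n] Z in \<open>auto simp: sqint_def\<close>)
   also have "\<dots> \<le> Q" by (simp add: Q_def)
   finally show ?thesis .
  qed
  obtain n0 where n0: "\<And>n. n \<ge> n0 ==> (LINT p|M3. (Z (Shf (E (k n)) p) - Z p)^2) < e * (r / 2)"
   by (rule LIMSEQ_0_less[OF L2_shift[OF Z z0], of "e * (r / 2)"]) (use e r in auto)
  have "\<bar>LINT p|M3. (d n (fst p) * (A p * Z p)) * (Z (Shf (E (k n)) p) - Z p)\<bar> < r" if "n \<ge> n0" for n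
  proof -
   have "\<bar>LINT p|M3. (d n (fst p) * (A p * Z p)) * (Z (Shf (E (k n)) p) - Z p)\<bar>
    \<le> e * (LINT p|M3. (d n (fst p) * (A p * Z p))^2) + (LINT p|M3. (Z (Shf (E (k n)) p) - Z p)^2) / e"
    by (rule sqint_Young[OF dAZ sqint_diff[OF Zk Z] e(1)])
   also have "\<dots> < e * Q + r / 2"
    using mult_left_mono[OF dQ[of n] less_imp_le[OF e(1)]] n0[OF that] e by (intro add_le_less_mono) (auto simp: pos_divide_less_eq mult.commute)
   also have "\<dots> = r" using e by simp
   finally show ?thesis .
  qed
  then show "\<exists>n0. \<forall>n\<ge>n0. norm ((LINT p|M3. (d n (fst p) * (A p * Z p)) * (Z (Shf (E (k n)) p) - Z p)) - 0) < r" by auto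
 qed
 have "(LINT p|M3. d n (fst p) * (A p * (Z p)^2)) + (LINT p|M3. (d n (fst p) * (A p * Z p)) * (Z (Shf (E (k n)) p) - Z p))
  = (LINT p|M3. (\<xi> (fst p) - \<xi> (fst p + k n)) * (A p * Z p * Z (Shf (E (k n)) p))) / (2 * k n)" for n
 proof -
  have j: "integrable M3 (%p. d n (fst p) * (A p * (Z p)^2))"
   using sqint_mult[OF dAZ[of n] Z] by (simp add: power2_eq_square mult.assoc)
  have "(LINT p|M3. d n (fst p) * (A p * (Z p)^2)) + (LINT p|M3. (d n (fst p) * (A p * Z p)) * (Z (Shf (E (k n)) p) - Z p))
   = (LINT p|M3. d n (fst p) * (A p * (Z p)^2) + (d n (fst p) * (A p * Z p)) * (Z (Shf (E (k n)) p) - Z p))"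
   by (rule Bochner_Integration.integral_add[symmetric, OF j sqint_mult[OF dAZ sqint_diff[OF Zk Z]]])
  also have "\<dots> = (LINT p|M3. (\<xi> (fst p) - \<xi> (fst p + k n)) * (A p * Z p * Z (Shf (E (k n)) p)) / (2 * k n))"
  proof (rule Bochner_Integration.integral_cong[OF refl])
   fix p
   have "d n (fst p) * (A p * (Z p)^2) + (d n (fst p) * (A p * Z p)) * (Z (Shf (E (k n)) p) - Z p) = d n (fst p) * (A p * Z p * Z (Shf (E (k n)) p))"
    by (simp add: power2_eq_square algebra_simps)
   then show "d n (fst p) * (A p * (Z p)^2) + (d n (fst p) * (A p * Z p)) * (Z (Shf (E (k n)) p) - Z p)
    = (\<xi> (fst p) - \<xi> (fst p + k n)) * (A p * Z p * Z (Shf (E (k n)) p)) / (2 * k n)" by (simp add: d_def)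
  qed
  finally show ?thesis by simp
 qed
 with tendsto_add[OF L1 L2] show ?thesis by simp
qed

end

section \<open>Estimates of the initial terms\<close>

text \<open>Only pure second derivatives of \<open>v1\<close> occur: each component of the gradient
  is integrated by parts once, in its own direction.\<close>

definition data_bound :: "real => (point => real) => (point => real) => bool" where
 "data_bound B v1 v2 \<longleftrightarrow> (\<forall>x. \<bar>v1 x\<bar> \<le> B \<and> \<bar>v2 x\<bar> \<le> B \<and> (\<forall>b\<in>Basis.
  \<bar>frechet_derivative v1 (at x) b\<bar> \<le> B \<and> \<bar>frechet_derivative v2 (at x) b\<bar> \<le> B \<and>
  \<bar>frechet_derivative (%y. frechet_derivative v1 (at y) b) (at x) b\<bar> \<le> B))"

lemma (in torus) integral_N_bound:
 assumes [measurable]: "f \<in> borel_measurable borel" and le: "AE x in N. \<bar>f x\<bar> \<le> (B::real)"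
 shows "\<bar>LINT x|N. f x\<bar> \<le> B * measure N UNIV"
proof -
 interpret fN: finite_measure N by (rule finite_N)
 have i: "integrable N f" by (rule finite_measure.integrable_const_bound[OF finite_N, where B=B]) (use le in auto)
 have "\<bar>LINT x|N. f x\<bar> \<le> (LINT x|N. \<bar>f x\<bar>)" by (rule integral_abs_bound)
 also have "\<dots> \<le> (LINT x|N. B)" by (rule integral_mono_AE) (use i le in auto)
 finally show ?thesis by (simp add: mult.commute)
qed

context wave begin

context
 fixes B :: real assumes B: "data_bound B v1 v2"
begin

lemma B_bounds: "\<bar>v1 x\<bar> \<le> B" "\<bar>v2 x\<bar> \<le> B" "b \<in> Basis ==> \<bar>dv1 b x\<bar> \<le> B" "b \<in> Basis ==> \<bar>dv2 b x\<bar> \<le> B"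
 "b \<in> Basis ==> \<bar>frechet_derivative (dv1 b) (at x) b\<bar> \<le> B"
 using B unfolding data_bound_def dv1_def[abs_def] dv2_def by blast+

lemma B_nonneg: "B \<ge> 0" using B_bounds(1)[of undefined] by linarith

lemma B_square:
 assumes "\<And>x. \<bar>f x\<bar> \<le> B" "f \<in> borel_measurable borel"
 shows "(LINT x|N. (f x)^2) \<le> B^2 * measure N UNIV"
proof -
 have "\<bar>(f x)^2\<bar> \<le> B^2" for x using power_mono[OF assms(1)[of x], of 2] by simp
 then have "\<bar>LINT x|N. (f x)^2\<bar> \<le> B^2 * measure N UNIV" using assms(2) by (intro integral_N_bound) auto
 then show ?thesis by linarith
qed

text \<open>The weak shift formula takes the place of the mean value theorem, because a wrapped
  translation may cross the boundary of the rectangle and not follow a segment in it.\<close>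

lemma v1_shift: "AE x in N. \<bar>v1 (shf (0, c * k) x) - v1 x\<bar> \<le> \<bar>c * k\<bar> * B"
proof -
 have i: "integrable N f" if "sqint N f" for f using sqint_finite_imp_integrable[OF finite_N that] .
 have w: "wgrad v1 (dv1 (0, 1)) (0, 1)"
  unfolding dv1_def[abs_def] by (intro wgrad_C1_compact v1_C1 basis)
 have b: "\<bar>LINT \<sigma>|lborel. indicator {0..1::real} \<sigma> * dv1 (0, 1) (X \<sigma>)\<bar> \<le> B" for X
 proof -
  have "\<bar>LINT \<sigma>|lborel. indicator {0..1::real} \<sigma> * dv1 (0, 1) (X \<sigma>)\<bar> \<le> (LINT \<sigma>|lborel. \<bar>indicator {0..1::real} \<sigma> * dv1 (0, 1) (X \<sigma>)\<bar>)"
   by (rule integral_abs_bound)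
  also have "\<dots> \<le> (LINT \<sigma>|lborel. indicator {0..1::real} \<sigma> * B)"
  proof (rule integral_mono')
   show "integrable lborel (%\<sigma>. indicator {0..1::real} \<sigma> * B)" by (intro integrable_mult_left integrable_indicator_interval)
  qed (use B_bounds(3)[OF basis(2)] B_nonneg in \<open>auto simp: abs_mult indicator_def\<close>)
  finally show ?thesis by simp
 qed
 show ?thesis using wgrad_shift_repr[OF i[OF data_sqint(1)] i[OF data_sqint(4)] w basis(2), of "c * k"]
 proof eventually_elim
  case (elim x)
  then have "v1 (shf (0, c * k) x) - v1 x = c * k * (LINT \<sigma>|lborel. indicator {0..1::real} \<sigma> * dv1 (0, 1) (shf ((\<sigma> * (c * k)) *\<^sub>R (0, 1)) x))"
   by simp
  also have "\<bar>\<dots>\<bar> \<le> \<bar>c * k\<bar> * B" unfolding abs_mult[of "c * k"] by (intro mult_left_mono b) simp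
  finally show ?case .
 qed
qed

text \<open>Translation along the wave direction carries the time strip (-k, 0] to (0, k], where V
  integrates in time to \<open>prim V\<close> at a fixed point.\<close>

lemma initial_velocity_integral:
 assumes k: "k > 0" and i: "integrable M3 (%p. indicator {-k<..0} (fst p) * v2 (snd p) * V (Shf (E k) p))"
 shows "(LINT p|M3. indicator {-k<..0} (fst p) * v2 (snd p) * V (Shf (E k) p)) = (LINT x|N. v2 x * prim V (k, shf (0, c * k) x))"
proof -
 have "(LINT t|lborel. indicator {-k<..0} t * v2 x * V (t + k, y)) = v2 x * prim V (k, y)" for x y
 proof -
  have e: "indicator {-k<..0} t * V (t + k, y) = indicator {0..k} (k + 1 * t) * V (k + 1 * t, y)" for t
   using UVG_0[of "(t + k, y)"] by (cases "t + k = 0") (auto simp: indicator_def add.commute)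
  have "(LINT t|lborel. indicator {-k<..0} t * V (t + k, y)) = prim V (k, y)"
   using lborel_integral_real_affine[of 1 "%s. indicator {0..k} s * V (s, y)" k] unfolding e prim_def by simp
  then have "v2 x * (LINT t|lborel. indicator {-k<..0} t * V (t + k, y)) = v2 x * prim V (k, y)" by simp
  then show ?thesis by (simp only: mult_ac flip: integral_mult_right_zero)
 qed
 then show ?thesis unfolding integral_M3(2)[OF i] Shf_E by simp
qed

text \<open>The unknown \<open>prim V\<close> occurs both in the boundary term of the summation by
  parts and in the initial term of the weak formulation, and it cancels. What is left are two
  differences of \<open>v1\<close> along the wave, each at most |c| k B, and one term k
  \<open>v2\<close>; hence the factor 2|c| + 1.\<close>

lemma data_term_1:
 assumes k: "k > 0" and rL: "rL \<ge> 0"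
  and i: "integrable M3 (%p. indicator {-k<..0} (fst p) * v2 (snd p) * V (Shf (E k) p))"
 shows "\<bar>rL * (LINT p|M3. indicator {-k<..0} (fst p) * v2 (snd p) * V (Shf (E k) p)) - (LINT x|N. rL * v2 x * wd w k (0, x))\<bar>
  \<le> rL * (k * ((2 * \<bar>c\<bar> + 1) * B^2 * measure N UNIV))"
proof -
 have p: "sqint N (%x. prim V (k, shf (0, c * k) x))"
  by (rule sqint_shf[where f="%x. prim V (k, x)"]) (rule prim_L2(1)[OF UVG(2), of k k], use k in simp)
 have q: "sqint N (%x. wd w k (0, x))" unfolding wd_def Shf_E
  by (intro sqint_diff sqint_shf[where f="%x. w (_, x)"] w_sqint)
 note i1 = sqint_mult[OF data_sqint(2) p] and i2 = sqint_mult[OF data_sqint(2) q]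
 let ?m = "v1 (shf (0, c * k) x) - v1 (shf (0, c * - k) x) + k * v2 (shf (0, c * - k) x)"
 have m: "(%x. shf z x) \<in> borel_measurable borel" for z :: point unfolding shf_def by measurable
 note [measurable] = measurable_compose[OF m data_measurable(1)] measurable_compose[OF m data_measurable(2)]
 have "rL * (LINT x|N. v2 x * prim V (k, shf (0, c * k) x)) - (LINT x|N. rL * v2 x * wd w k (0, x))
  = (LINT x|N. rL * (v2 x * prim V (k, shf (0, c * k) x)) - rL * (v2 x * wd w k (0, x)))"
  using i1 i2 by (subst Bochner_Integration.integral_diff) (auto simp: mult.assoc)
 also have "\<dots> = (LINT x|N. - (rL * (v2 x * (v1 (shf (0, c * k) x) - v1 (shf (0, c * - k) x) + k * v2 (shf (0, c * - k) x)))))"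
  using k by (intro Bochner_Integration.integral_cong refl) (simp add: wd_def Shf_E w_def algebra_simps)
 also have "\<bar>\<dots>\<bar> \<le> (rL * (B * (k * ((2 * \<bar>c\<bar> + 1) * B)))) * measure N UNIV"
 proof (rule integral_N_bound)
  show "AE x in N. \<bar>- (rL * (v2 x * (v1 (shf (0, c * k) x) - v1 (shf (0, c * - k) x) + k * v2 (shf (0, c * - k) x))))\<bar> \<le> rL * (B * (k * ((2 * \<bar>c\<bar> + 1) * B)))"
   using v1_shift[of k] v1_shift[of "- k"]
  proof eventually_elim
   case (elim x)
   have tri: "\<bar>a - b + e\<bar> \<le> \<bar>a - v\<bar> + \<bar>b - v\<bar> + \<bar>e\<bar>" for a b e v :: real by linarith
   have "\<bar>k * v2 (shf (0, c * - k) x)\<bar> \<le> k * B" using k B_bounds(2) by (simp add: abs_mult)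
   moreover have "\<bar>c * k\<bar> * B = k * (\<bar>c\<bar> * B)" "\<bar>c * - k\<bar> * B = k * (\<bar>c\<bar> * B)" using k by (simp_all add: abs_mult)
   ultimately have "\<bar>v1 (shf (0, c * k) x) - v1 (shf (0, c * - k) x) + k * v2 (shf (0, c * - k) x)\<bar> \<le> k * (\<bar>c\<bar> * B) + k * (\<bar>c\<bar> * B) + k * B"
    using elim order_trans[OF tri[of "v1 (shf (0, c * k) x)" "v1 (shf (0, c * - k) x)" "k * v2 (shf (0, c * - k) x)" "v1 x"] add_mono[OF add_mono]]
    by (simp only:)
   also have "\<dots> = k * ((2 * \<bar>c\<bar> + 1) * B)" by (simp add: algebra_simps)
   finally have "\<bar>v2 x\<bar> * \<bar>v1 (shf (0, c * k) x) - v1 (shf (0, c * - k) x) + k * v2 (shf (0, c * - k) x)\<bar> \<le> B * (k * ((2 * \<bar>c\<bar> + 1) * B))"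
    using B_bounds(2)[of x] B_nonneg by (intro mult_mono) auto
   then show ?case using rL by (simp add: abs_mult mult_left_mono)
  qed
 qed measurable
 also have "\<dots> = rL * (k * ((2 * \<bar>c\<bar> + 1) * B^2 * measure N UNIV))" by (simp add: power2_eq_square)
 finally show ?thesis unfolding initial_velocity_integral[OF k i] .
qed

text \<open>G is merely square integrable, so Cauchy-Schwarz on a time strip of width k would give
  only the order k^(1/2). Since G is a weak derivative of w, it is integrated by parts at each time
  instead: w is bounded in L2 at all times up to k, and the derivative falls on
  \<open>dv1 b\<close>, which uses the C^2 regularity of \<open>v1\<close>. In the factor 3, two
  come from w^2 \<le> 2 v1^2 + 2 (prim V)^2 and one from the second derivative.\<close>

lemma data_term_2:
 assumes k: "k > 0" "k < T" and b: "b \<in> Basis" and G: "sqint M3 G"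
  and wg: "AE t in lborel. t \<in> {0<..<T} --> wgrad (%x. w (t, x)) (%x. G (t, x)) b"
  and G0: "\<And>p. fst p \<notin> {0<..<T} ==> G p = 0"
  and i: "integrable M3 (%p. indicator {-k<..0} (fst p) * dv1 b (snd p) * G (Shf (E k) p))"
 shows "\<bar>LINT p|M3. indicator {-k<..0} (fst p) * dv1 b (snd p) * G (Shf (E k) p)\<bar>
  \<le> k * (3 * (B^2 * measure N UNIV) + 2 * k * (LINT p|M3. (V p)^2))"
proof -
 let ?C = "3 * (B^2 * measure N UNIV) + 2 * k * (LINT p|M3. (V p)^2)"
 have C: "?C \<ge> 0" using k by (intro add_nonneg_nonneg mult_nonneg_nonneg) auto
 have mL: "frechet_derivative (dv1 b) (at x) b = (%y. frechet_derivative (dv1 b) (at y) b) x" for x by simp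
 have cL: "continuous_on UNIV (%y. frechet_derivative (dv1 b) (at y) b)"
  using Ck_compact_0_continuous[OF Ck_compact_Suc(2)[OF v1_C1(2)[OF b, unfolded One_nat_def] Omega_open b] Omega_open] .
 then have [measurable]: "(%y. frechet_derivative (dv1 b) (at y) b) \<in> borel_measurable borel" by (rule borel_measurable_continuous_onI)
 have sL: "sqint N (%y. frechet_derivative (dv1 b) (at y) b)"
  by (rule sqint_N_bounded) (use B_bounds(5)[OF b] in auto)
 have L2: "(LINT x|N. (frechet_derivative (dv1 b) (at x) b)^2) \<le> B^2 * measure N UNIV"
  by (rule B_square, rule B_bounds(5)[OF b], measurable)
 have ii: "integrable N f" if "sqint N f" for f using sqint_finite_imp_integrable[OF finite_N that] .
 have w2: "(LINT x|N. (w (s, x))^2) \<le> 2 * (B^2 * measure N UNIV) + 2 * k * (LINT p|M3. (V p)^2)" if s: "0 < s" "s \<le> k" for s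
 proof -
  have p: "sqint N (%x. prim V (s, x))" "(LINT x|N. (prim V (s, x))^2) \<le> s * (LINT p|M3. (V p)^2)"
   using prim_L2[OF UVG(2), of s s] s by simp_all
  have "(LINT x|N. (w (s, x))^2) \<le> (LINT x|N. 2 * (v1 x)^2 + 2 * (prim V (s, x))^2)"
  proof (rule integral_mono)
   show "(w (s, x))^2 \<le> 2 * (v1 x)^2 + 2 * (prim V (s, x))^2" for x
    using s sum_squares_bound[of "v1 x" "prim V (s, x)"] by (simp add: w_def power2_sum)
  qed (use p(1) data_sqint(1) w_sqint[of s] in \<open>auto simp: sqint_def\<close>)
  also have "\<dots> = 2 * (LINT x|N. (v1 x)^2) + 2 * (LINT x|N. (prim V (s, x))^2)"
   using p(1) data_sqint(1) by (auto simp: sqint_def)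
  also have "\<dots> \<le> 2 * (B^2 * measure N UNIV) + 2 * (k * (LINT p|M3. (V p)^2))"
  proof (intro add_mono mult_left_mono)
   show "(LINT x|N. (v1 x)^2) \<le> B^2 * measure N UNIV" by (rule B_square) (use B_bounds in auto)
   have "s * (LINT p|M3. (V p)^2) \<le> k * (LINT p|M3. (V p)^2)" using s by (intro mult_right_mono) auto
   then show "(LINT x|N. (prim V (s, x))^2) \<le> k * (LINT p|M3. (V p)^2)" using p(2) by linarith
  qed auto
  finally show ?thesis by simp
 qed
 have g: "AE t in lborel. t \<in> {0<..<T} --> wgrad (%x. w (t, x)) (%x. G (t, x)) b \<and> integrable N (%x. G (t, x))"
  using wg slabs_section_integrable[OF sqint_slabs[OF G]] by eventually_elim auto
 have [measurable]: "G \<in> borel_measurable borel" using sqint_measurable[OF G] by simp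
 have inner: "AE t in lborel. \<bar>LINT x|N. indicator {-k<..0} t * dv1 b x * G (t + k, shf (0, c * k) x)\<bar> \<le> indicator {-k<..0} t * ?C"
  using AE_lborel_shift[OF g, of k]
 proof eventually_elim
  case (elim t)
  show ?case
  proof (cases "t \<in> {-k<..0}")
   case True
   then have t: "0 < t + k" "t + k \<le> k" by auto
   then have gg: "wgrad (%x. w (t + k, x)) (%x. G (t + k, x)) b" "integrable N (%x. G (t + k, x))" using elim k by auto
   have mG: "(%x. G (t + k, x)) \<in> borel_measurable borel" using gg(2) by (auto dest: borel_measurable_integrable)
   have ws: "sqint N (%x. w (t + k, shf (0, c * k) x))" by (rule sqint_shf[where f="%x. w (t + k, x)", OF w_sqint])
   have sh2: "(LINT x|N. (w (t + k, shf (0, c * k) x))^2) = (LINT x|N. (w (t + k, x))^2)"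
    by (rule integral_shf[of "%x. (w (t + k, x))^2"]) (intro borel_measurable_power w_sections)
   have Gi: "integrable N (%x. G (t + k, shf (0, c * k) x))" using integrable_shf[of "%x. G (t + k, x)" "(0, c * k)"] mG gg(2) by simp
   have eq: "(LINT x|N. dv1 b x * G (t + k, shf (0, c * k) x)) = - (LINT x|N. w (t + k, shf (0, c * k) x) * frechet_derivative (dv1 b) (at x) b)"
    using wgrad_against_C1_compact[OF ii[OF ws] Gi wgrad_shift[OF gg(1) w_sections(1) mG b] b v1_C1(2)[OF b]] by (simp add: mult.commute)
   have "\<bar>LINT x|N. w (t + k, shf (0, c * k) x) * frechet_derivative (dv1 b) (at x) b\<bar>
     \<le> 1 * (LINT x|N. (w (t + k, shf (0, c * k) x))^2) + (LINT x|N. (frechet_derivative (dv1 b) (at x) b)^2) / 1"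
    by (rule sqint_Young[OF ws sL]) simp
   then have "\<bar>LINT x|N. dv1 b x * G (t + k, shf (0, c * k) x)\<bar> \<le> (LINT x|N. (w (t + k, x))^2) + (LINT x|N. (frechet_derivative (dv1 b) (at x) b)^2)"
    unfolding eq sh2 mult_1 div_by_1 abs_minus_cancel .
   from order_trans[OF this add_mono[OF w2[OF t] L2]]
   have "\<bar>LINT x|N. dv1 b x * G (t + k, shf (0, c * k) x)\<bar> \<le> ?C" by (simp add: algebra_simps)
   then show ?thesis using True by simp
  qed simp
 qed
 have "\<bar>LINT p|M3. indicator {-k<..0} (fst p) * dv1 b (snd p) * G (Shf (E k) p)\<bar> =
   \<bar>LINT t|lborel. (LINT x|N. indicator {-k<..0} t * dv1 b x * G (t + k, shf (0, c * k) x))\<bar>"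
  unfolding integral_M3(1)[OF i] Shf_E by simp
 also have "\<dots> \<le> (LINT t|lborel. \<bar>LINT x|N. indicator {-k<..0} t * dv1 b x * G (t + k, shf (0, c * k) x)\<bar>)"
  by (rule integral_abs_bound)
 also have "\<dots> \<le> (LINT t|lborel. indicator {-k<..0} t * ?C)"
  by (rule integral_mono_AE) (use inner integral_M3(5)[OF i] k in \<open>auto simp: Shf_E integrable_indicator_iff\<close>)
 also have "\<dots> = k * ?C" using k by simp
 finally show ?thesis .
qed

text \<open>The factor t is at most the step on the strip, so Cauchy-Schwarz is enough here and
  gives the step to the power 3/2. Writing the step as s^2 turns this into s^3, which vanishes after
  division by the step.\<close>

lemma data_term_3:
 assumes s: "s > 0" and d: "\<And>x. \<bar>d x\<bar> \<le> B" "d \<in> borel_measurable borel" and G: "sqint M3 G"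
 shows "\<bar>LINT p|M3. indicator {-s\<^sup>2<..0} (fst p) * (fst p * d (snd p)) * G (Shf (E (s^2)) p)\<bar>
  \<le> s ^ 3 * (B^2 * measure N UNIV + (LINT p|M3. (G p)^2))"
  and "integrable M3 (%p. indicator {-s\<^sup>2<..0} (fst p) * (fst p * d (snd p)) * G (Shf (E (s^2)) p))"
proof -
 note [measurable] = d(2)
 have [measurable]: "G \<in> borel_measurable borel" using sqint_measurable[OF G] by simp
 let ?a = "%p::real \<times> point. indicator {-s\<^sup>2<..0} (fst p) * (fst p * d (snd p))"
 have ind: "sqint M3 (%p. indicator {-s\<^sup>2<..0} (fst p))" "(LINT p|M3. indicator {-s\<^sup>2<..0} (fst p)) = s^2 * measure N UNIV"
  using sqint_time_indicator[of "{-s\<^sup>2<..0}"] by auto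
 have le: "\<bar>?a p\<bar> \<le> (s^2 * B) * \<bar>indicator {-s\<^sup>2<..0} (fst p)\<bar>" for p
 proof (cases "fst p \<in> {-s\<^sup>2<..0}")
  case True
  then have "\<bar>fst p\<bar> * \<bar>d (snd p)\<bar> \<le> s^2 * B" using d(1) by (intro mult_mono) auto
  then show ?thesis using True by (simp add: abs_mult)
 qed simp
 have a: "sqint M3 ?a" by (rule sqint_bound[OF ind(1), where C="s^2 * B"], measurable) (rule AE_I2, rule le)
 have Gs: "sqint M3 (%p. G (Shf (E (s^2)) p))" by (rule sqint_Shf[OF G])
 show "integrable M3 (%p. ?a p * G (Shf (E (s^2)) p))" by (rule sqint_mult[OF a Gs])
 have "(LINT p|M3. (?a p)^2) \<le> (LINT p|M3. (s^2 * B)^2 * indicator {-s\<^sup>2<..0} (fst p))"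
 proof (rule integral_mono)
  fix p
  have "\<bar>?a p\<bar>^2 \<le> ((s^2 * B) * \<bar>indicator {-s\<^sup>2<..0} (fst p)\<bar>)^2" by (rule power_mono[OF le]) simp
  also have "\<dots> = (s^2 * B)^2 * indicator {-s\<^sup>2<..0} (fst p)" by (cases "fst p \<in> {-s\<^sup>2<..0}") simp_all
  finally show "(?a p)^2 \<le> (s^2 * B)^2 * indicator {-s\<^sup>2<..0} (fst p)" unfolding power2_abs .
 next
  have "integrable M3 (%p. (indicator {-s\<^sup>2<..0} (fst p) :: real)^2)" using ind(1) by (simp add: sqint_def)
  moreover have "(indicator {-s\<^sup>2<..0} t :: real)^2 = indicator {-s\<^sup>2<..0} t" for t by (simp add: indicator_def)
  ultimately have "integrable M3 (%p. indicator {-s\<^sup>2<..0} (fst p) :: real)" by (simp only:)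
  then show "integrable M3 (%p. (s^2 * B)^2 * indicator {-s\<^sup>2<..0} (fst p))" by (rule integrable_mult_right)
 qed (use a in \<open>auto simp: sqint_def\<close>)
 also have "\<dots> = s ^ 6 * (B^2 * measure N UNIV)" using ind(2) by (simp add: power_mult_distrib flip: power_mult power_add)
 finally have a2: "(LINT p|M3. (?a p)^2) \<le> s ^ 6 * (B^2 * measure N UNIV)" .
 have G2: "(LINT p|M3. (G (Shf (E (s^2)) p))^2) = (LINT p|M3. (G p)^2)"
  by (rule integral_Shf[of "%p. (G p)^2"]) measurable
 \<comment> \<open>The weight s^(-3) balances a first factor of order s^6 against a second one of
   order 1.\<close>
 have Y: "\<bar>LINT p|M3. ?a p * G (Shf (E (s^2)) p)\<bar> \<le> (1 / s ^ 3) * (LINT p|M3. (?a p)^2) + (LINT p|M3. (G p)^2) / (1 / s ^ 3)"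
  unfolding G2[symmetric] by (rule sqint_Young[OF a Gs]) (use s in simp)
 have "(1 / s ^ 3) * (LINT p|M3. (?a p)^2) \<le> (1 / s ^ 3) * (s ^ 6 * (B^2 * measure N UNIV))" using s by (intro mult_left_mono a2) simp
 also have "\<dots> = s ^ 3 * (B^2 * measure N UNIV)" using s by (simp add: field_simps flip: power_add)
 finally show "\<bar>LINT p|M3. ?a p * G (Shf (E (s^2)) p)\<bar> \<le> s ^ 3 * (B^2 * measure N UNIV + (LINT p|M3. (G p)^2))"
  using Y by (simp add: algebra_simps)
qed

lemma data_term_gradient:
 assumes s: "s > 0" "s^2 < T" and b: "b \<in> Basis" and G: "sqint M3 G"
  and wg: "AE t in lborel. t \<in> {0<..<T} --> wgrad (%x. w (t, x)) (%x. G (t, x)) b"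
  and G0: "\<And>p. fst p \<notin> {0<..<T} ==> G p = 0"
  and i: "integrable M3 (%p. indicator {-s\<^sup>2<..0} (fst p) * (dv1 b (snd p) + fst p * dv2 b (snd p)) * G (Shf (E (s^2)) p))"
 shows "\<bar>LINT p|M3. indicator {-s\<^sup>2<..0} (fst p) * (dv1 b (snd p) + fst p * dv2 b (snd p)) * G (Shf (E (s^2)) p)\<bar>
  \<le> s^2 * (3 * (B^2 * measure N UNIV) + 2 * s^2 * (LINT p|M3. (V p)^2)) + s ^ 3 * (B^2 * measure N UNIV + (LINT p|M3. (G p)^2))"
proof -
 have m: "dv2 b \<in> borel_measurable borel" using data_continuous(4)[OF b] by (rule borel_measurable_continuous_onI)
 note t3 = data_term_3[OF s(1) B_bounds(4)[OF b] m G]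
 have i1: "integrable M3 (%p. indicator {-s\<^sup>2<..0} (fst p) * dv1 b (snd p) * G (Shf (E (s^2)) p))"
  using Bochner_Integration.integrable_diff[OF i t3(2)] by (simp add: algebra_simps)
 have "(LINT p|M3. indicator {-s\<^sup>2<..0} (fst p) * (dv1 b (snd p) + fst p * dv2 b (snd p)) * G (Shf (E (s^2)) p))
  = (LINT p|M3. indicator {-s\<^sup>2<..0} (fst p) * dv1 b (snd p) * G (Shf (E (s^2)) p) + indicator {-s\<^sup>2<..0} (fst p) * (fst p * dv2 b (snd p)) * G (Shf (E (s^2)) p))"
  by (simp only: distrib_left distrib_right)
 also have "\<dots> = (LINT p|M3. indicator {-s\<^sup>2<..0} (fst p) * dv1 b (snd p) * G (Shf (E (s^2)) p)) + (LINT p|M3. indicator {-s\<^sup>2<..0} (fst p) * (fst p * dv2 b (snd p)) * G (Shf (E (s^2)) p))"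
  by (rule Bochner_Integration.integral_add[OF i1 t3(2)])
 finally show ?thesis
  using data_term_2[OF _ s(2) b G wg G0 i1] t3(1) s(1)
  by (simp only: zero_less_power) (rule order_trans[OF abs_triangle_ineq add_mono], simp_all)
qed

end

end

section \<open>The energy inequality\<close>

context wave begin

lemma derivative_outside:
 assumes v: "Ck_compact 1 (Omega l h) v" and x: "x \<notin> supp v"
 shows "frechet_derivative v (at x) b = 0"
proof -
 have "eventually (%y. v y = 0) (nhds x)" using Ck_compact_outside[OF v x] .
 then have "(v has_derivative (%_. 0)) (at x)"
  using notin_supp[OF x] by (intro has_derivative_transform_eventually[of "%_. 0" "%_. 0" x UNIV v]) (auto simp: eventually_at_filter elim: eventually_mono)
 then show ?thesis using frechet_derivative_at by metis
qed

lemma data_outside: "x \<notin> S ==> v2 x = 0" "x \<notin> S ==> dv1 b x = 0" "x \<notin> S ==> dv2 b x = 0"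
 using derivative_outside[OF v1_C1(1)] derivative_outside[OF v2(1)] notin_supp[of x v2] v1(2) v2(2)
 unfolding dv1_def dv2_def by blast+

lemma integrable_wd:
 assumes Z: "sqint M3 Z" "\<And>p. fst p \<notin> {0<..<T} ==> Z p = 0" and F: "slabs F"
  and q: "q \<in> borel_measurable borel" "\<And>p. \<bar>q p\<bar> \<le> C"
 shows "integrable M3 (%p. q p * Z p * F p)"
proof -
 have "q p * Z p * (indicator {0..T} (fst p) * F p) = q p * Z p * F p" for p
  using Z(2)[of p] by (cases "fst p \<in> {0<..<T}") auto
 moreover have "sqint M3 (%p. q p * Z p)" by (rule sqint_bounded_mult[OF Z(1) _ q(2)]) (use q(1) in simp)
 ultimately show ?thesis using sqint_mult[OF _ slabsD[OF F, of 0 T], of "%p. q p * Z p"] by (simp only:)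
qed

text \<open>The collected bounds of the initial terms for the step s^2. Divided by 2 s^2 it tends to
  B^2 times the area times rL (2|c| + 1)/2 + 3 dL.\<close>

definition boundary_remainder :: "real => real => real" where
 "boundary_remainder B s = rL * (s^2 * ((2 * \<bar>c\<bar> + 1) * B^2 * measure N UNIV)) +
  dL * ((s^2 * (3 * (B^2 * measure N UNIV) + 2 * s^2 * (LINT p|M3. (V p)^2)) + s ^ 3 * (B^2 * measure N UNIV + (LINT p|M3. (G1 p)^2))) +
     (s^2 * (3 * (B^2 * measure N UNIV) + 2 * s^2 * (LINT p|M3. (V p)^2)) + s ^ 3 * (B^2 * measure N UNIV + (LINT p|M3. (G2 p)^2))))"

text \<open>The test function of \<open>phi_adm\<close> is inserted into the weak equation. Its time
  derivative contributes \<xi>' times the difference of w and \<xi> times the difference of the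
  velocity; the latter and the two gradient differences go through
  \<open>summation_by_parts\<close>, and the boundary terms through the data estimates.\<close>

lemma energy_step:
 assumes B: "data_bound B v1 v2"
  and x: "\<And>t. (\<xi> has_real_derivative \<xi>' t) (at t)" "continuous_on UNIV \<xi>'"
  and b: "\<And>t. \<bar>\<xi> t\<bar> \<le> C" "\<And>t. \<bar>\<xi>' t\<bar> \<le> C"
  and z: "\<And>t. t \<ge> T - k1 ==> \<xi> t = 0" and x0: "\<And>t. t \<le> k1 ==> \<xi> t = \<xi>0" "\<xi>0 \<ge> 0"
  and s: "0 < s" "s^2 < k1" "k1 < T" and L: "rL \<ge> 0" "dL \<ge> 0"
 shows "- (LINT p|M3. R p * \<xi>' (fst p) * V p * wd w (s^2) p)
  - (LINT p|M3. (\<xi> (fst p) - \<xi> (fst p + s^2)) * (R p * V p * V (Shf (E (s^2)) p)))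
  + (LINT p|M3. (\<xi> (fst p) - \<xi> (fst p + s^2)) * (D p * G1 p * G1 (Shf (E (s^2)) p)))
  + (LINT p|M3. (\<xi> (fst p) - \<xi> (fst p + s^2)) * (D p * G2 p * G2 (Shf (E (s^2)) p)))
  - (LINT p|M3. \<xi> (fst p) * f3 p * wd w (s^2) p) \<le> \<xi>0 * boundary_remainder B s"
proof -
 have cx: "continuous_on UNIV \<xi>" using x(1) by (auto intro!: continuous_at_imp_continuous_on DERIV_isCont)
 have mx [measurable]: "\<xi> \<in> borel_measurable borel" "\<xi>' \<in> borel_measurable borel"
  using cx x(2) by (auto intro: borel_measurable_continuous_onI)
 have C: "C \<ge> 0" using order_trans[OF abs_ge_zero b(1)] .
 have K: "K \<ge> 0" using order_trans[OF abs_ge_zero RD_bound(1)] .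
 have k: "0 < s^2" using s by simp
 have inv: "AE p in M3. fst p \<in> {0<..<T} --> fst p + s^2 \<in> {0<..<T} --> R (Shf (E (s^2)) p) = R p"
  "AE p in M3. fst p \<in> {0<..<T} --> fst p + s^2 \<in> {0<..<T} --> D (Shf (E (s^2)) p) = D p"
  using RD_inv[of "s^2"] unfolding E_def by (eventually_elim, blast)+
 have Z0: "fst p \<notin> {0<..<T} ==> V p = 0" "fst p \<notin> {0<..<T} ==> G1 p = 0" "fst p \<notin> {0<..<T} ==> G2 p = 0" for p
  using UVG_0[of p] by auto
 have m1: "(%p::real \<times> point. v2 (snd p)) \<in> borel_measurable borel"
  "(%p::real \<times> point. dv1 (1, 0) (snd p) + fst p * dv2 (1, 0) (snd p)) \<in> borel_measurable borel"
  "(%p::real \<times> point. dv1 (0, 1) (snd p) + fst p * dv2 (0, 1) (snd p)) \<in> borel_measurable borel"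
  by measurable
 note P1 = summation_by_parts[where A=R and Z=V and z=wt and aL=rL and q="%p. v2 (snd p)" and \<xi>=\<xi>,
   OF RD_measurable(1) RD_bound(1) inv(1) _ UVG(2) Z0(1) w_slabs(2) _ _ _ m1(1) mx(1) b(1) x0(1) k s(2)]
 note P2 = summation_by_parts[where A=D and Z=G1 and z=w1 and aL=dL and q="%p. dv1 (1, 0) (snd p) + fst p * dv2 (1, 0) (snd p)" and \<xi>=\<xi>,
   OF RD_measurable(2) RD_bound(2) inv(2) _ UVG(3) Z0(2) w_slabs(3) _ _ _ m1(2) mx(1) b(1) x0(1) k s(2)]
 note P3 = summation_by_parts[where A=D and Z=G2 and z=w2 and aL=dL and q="%p. dv1 (0, 1) (snd p) + fst p * dv2 (0, 1) (snd p)" and \<xi>=\<xi>,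
   OF RD_measurable(2) RD_bound(2) inv(2) _ UVG(4) Z0(3) w_slabs(4) _ _ _ m1(3) mx(1) b(1) x0(1) k s(2)]
 have P1: "(LINT p|M3. R p * \<xi> (fst p) * V p * wd wt (s^2) p) =
   (LINT p|M3. (\<xi> (fst p) - \<xi> (fst p + s^2)) * (R p * V p * V (Shf (E (s^2)) p)))
   - \<xi>0 * rL * (LINT p|M3. indicator {-s\<^sup>2<..0} (fst p) * v2 (snd p) * V (Shf (E (s^2)) p))"
  "integrable M3 (%p. R p * \<xi> (fst p) * V p * wd wt (s^2) p)"
  "integrable M3 (%p. indicator {-s\<^sup>2<..0} (fst p) * v2 (snd p) * V (Shf (E (s^2)) p))"
  by (rule P1(1) P1(2) P1(4); simp add: S_const wt_def data_outside)+
 have P2: "(LINT p|M3. D p * \<xi> (fst p) * G1 p * wd w1 (s^2) p) =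
   (LINT p|M3. (\<xi> (fst p) - \<xi> (fst p + s^2)) * (D p * G1 p * G1 (Shf (E (s^2)) p)))
   - \<xi>0 * dL * (LINT p|M3. indicator {-s\<^sup>2<..0} (fst p) * (dv1 (1, 0) (snd p) + fst p * dv2 (1, 0) (snd p)) * G1 (Shf (E (s^2)) p))"
  "integrable M3 (%p. D p * \<xi> (fst p) * G1 p * wd w1 (s^2) p)"
  "integrable M3 (%p. indicator {-s\<^sup>2<..0} (fst p) * (dv1 (1, 0) (snd p) + fst p * dv2 (1, 0) (snd p)) * G1 (Shf (E (s^2)) p))"
  by (rule P2(1) P2(2) P2(4); simp add: S_const w1_def data_outside)+
 have P3: "(LINT p|M3. D p * \<xi> (fst p) * G2 p * wd w2 (s^2) p) =
   (LINT p|M3. (\<xi> (fst p) - \<xi> (fst p + s^2)) * (D p * G2 p * G2 (Shf (E (s^2)) p)))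
   - \<xi>0 * dL * (LINT p|M3. indicator {-s\<^sup>2<..0} (fst p) * (dv1 (0, 1) (snd p) + fst p * dv2 (0, 1) (snd p)) * G2 (Shf (E (s^2)) p))"
  "integrable M3 (%p. D p * \<xi> (fst p) * G2 p * wd w2 (s^2) p)"
  "integrable M3 (%p. indicator {-s\<^sup>2<..0} (fst p) * (dv1 (0, 1) (snd p) + fst p * dv2 (0, 1) (snd p)) * G2 (Shf (E (s^2)) p))"
  by (rule P3(1) P3(2) P3(4); simp add: S_const w2_def data_outside)+
 have i1: "integrable M3 (%p. R p * \<xi>' (fst p) * V p * wd w (s^2) p)"
 proof (rule integrable_wd[OF UVG(2) Z0(1) wd_slabs[OF w_slabs(1)]])
  show "\<bar>R p * \<xi>' (fst p)\<bar> \<le> K * C" for p unfolding abs_mult by (intro mult_mono RD_bound b K) simp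
 qed measurable
 have W: "sqint N (%x. wd w (s^2) (0, x))" unfolding wd_def Shf_E
  by (intro sqint_diff sqint_shf[where f="%x. w (_, x)"] w_sqint)
 have wg: "AE t in lborel. t \<in> {0<..<T} --> wgrad (%x. w (t, x)) (%x. G1 (t, x)) (1, 0)"
  "AE t in lborel. t \<in> {0<..<T} --> wgrad (%x. w (t, x)) (%x. G2 (t, x)) (0, 1)"
  subgoal using w_wgrad by eventually_elim (auto simp: w1_def)
  subgoal using w_wgrad by eventually_elim (auto simp: w2_def)
  done
 have sT: "s^2 < T" using s by linarith
 note B1 = data_term_1[OF B k L(1) P1(3)]
 note B2 = data_term_gradient[OF B s(1) sT basis(1) UVG(3) wg(1) Z0(2) P2(3)]
 note B3 = data_term_gradient[OF B s(1) sT basis(2) UVG(4) wg(2) Z0(3) P3(3)]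
 note weak' = weak[OF phi_adm[OF x b k s(2) z]]
 have e1: "(LINT p|M3. R p * V p * (\<xi>' (fst p) * wd w (s^2) p + \<xi> (fst p) * wd wt (s^2) p))
  = (LINT p|M3. R p * \<xi>' (fst p) * V p * wd w (s^2) p) + (LINT p|M3. R p * \<xi> (fst p) * V p * wd wt (s^2) p)"
  using Bochner_Integration.integral_add[OF i1 P1(2)] by (simp add: distrib_left mult_ac)
 have e2: "(LINT p|M3. D p * (G1 p * (\<xi> (fst p) * wd w1 (s^2) p) + G2 p * (\<xi> (fst p) * wd w2 (s^2) p)))
  = (LINT p|M3. D p * \<xi> (fst p) * G1 p * wd w1 (s^2) p) + (LINT p|M3. D p * \<xi> (fst p) * G2 p * wd w2 (s^2) p)"
  using Bochner_Integration.integral_add[OF P2(2) P3(2)] by (simp add: distrib_left mult_ac)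
 have e3: "(LINT p|M3. f3 p * (\<xi> (fst p) * wd w (s^2) p)) = (LINT p|M3. \<xi> (fst p) * f3 p * wd w (s^2) p)" by (simp add: mult_ac)
 have e4: "(LINT x|N. rL * v2 x * (\<xi> (fst (0, x)) * wd w (s^2) (0, x))) = \<xi>0 * (LINT x|N. rL * v2 x * wd w (s^2) (0, x))"
  using x0(1)[of 0] s k by (simp add: mult_ac flip: integral_mult_right_zero)
 \<comment> \<open>With the integrals named, the weak equation and the required bound become linear
   arithmetic in real numbers.\<close>
 define JV where "JV = (LINT p|M3. (\<xi> (fst p) - \<xi> (fst p + s^2)) * (R p * V p * V (Shf (E (s^2)) p)))"
 define J1 where "J1 = (LINT p|M3. (\<xi> (fst p) - \<xi> (fst p + s^2)) * (D p * G1 p * G1 (Shf (E (s^2)) p)))"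
 define J2 where "J2 = (LINT p|M3. (\<xi> (fst p) - \<xi> (fst p + s^2)) * (D p * G2 p * G2 (Shf (E (s^2)) p)))"
 define I where "I = (LINT p|M3. R p * \<xi>' (fst p) * V p * wd w (s^2) p)"
 define F where "F = (LINT p|M3. \<xi> (fst p) * f3 p * wd w (s^2) p)"
 define b0 where "b0 = (LINT p|M3. indicator {-s\<^sup>2<..0} (fst p) * v2 (snd p) * V (Shf (E (s^2)) p))"
 define b1 where "b1 = (LINT p|M3. indicator {-s\<^sup>2<..0} (fst p) * (dv1 (1, 0) (snd p) + fst p * dv2 (1, 0) (snd p)) * G1 (Shf (E (s^2)) p))"
 define b2 where "b2 = (LINT p|M3. indicator {-s\<^sup>2<..0} (fst p) * (dv1 (0, 1) (snd p) + fst p * dv2 (0, 1) (snd p)) * G2 (Shf (E (s^2)) p))"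
 define W0 where "W0 = (LINT x|N. rL * v2 x * wd w (s^2) (0, x))"
 note defs = JV_def[symmetric] J1_def[symmetric] J2_def[symmetric] I_def[symmetric] F_def[symmetric] b0_def[symmetric] b1_def[symmetric] b2_def[symmetric] W0_def[symmetric]
 have "- (I + (JV - \<xi>0 * rL * b0)) + ((J1 - \<xi>0 * dL * b1) + (J2 - \<xi>0 * dL * b2)) = F + \<xi>0 * W0"
  using weak' unfolding e1 e2 e3 e4 P1(1) P2(1) P3(1) defs .
 then have "- I - JV + J1 + J2 - F = \<xi>0 * ((W0 - rL * b0) + dL * (b1 + b2))" by (simp add: algebra_simps)
 also have "\<dots> \<le> \<xi>0 * boundary_remainder B s"
  unfolding boundary_remainder_def
 proof (intro mult_left_mono add_mono x0(2) L(2))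
  show "W0 - rL * b0 \<le> rL * (s^2 * ((2 * \<bar>c\<bar> + 1) * B^2 * measure N UNIV))" using B1 unfolding defs by linarith
  show "b1 \<le> s^2 * (3 * (B^2 * measure N UNIV) + 2 * s^2 * (LINT p|M3. (V p)^2)) + s ^ 3 * (B^2 * measure N UNIV + (LINT p|M3. (G1 p)^2))"
   using B2 unfolding defs by linarith
  show "b2 \<le> s^2 * (3 * (B^2 * measure N UNIV) + 2 * s^2 * (LINT p|M3. (V p)^2)) + s ^ 3 * (B^2 * measure N UNIV + (LINT p|M3. (G2 p)^2))"
   using B3 unfolding defs by linarith
 qed
 finally show ?thesis unfolding defs .
qed

definition energy :: "real \<times> point => real" where
 "energy p = R p * (V p)^2 / 2 + c * R p * V p * G2 p + D p * ((G1 p)^2 + (G2 p)^2) / 2"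

text \<open>After division by 2 s^2, the \<xi>' term tends to the integral of -\<xi>' R V (V + c
  G2), and the velocity pairing contributes that of +\<xi>' R V^2/2. Together they leave -\<xi>' (R
  V^2/2 + c R V G2); the gradient pairings supply the rest of \<open>energy\<close>. The supports of
  \<xi>' and of f3 stay away from times 0 and T, as \<open>wd_quotient\<close> requires.\<close>

lemma energy_inequality:
 assumes B: "data_bound B v1 v2"
  and x: "\<And>t. (\<xi> has_real_derivative \<xi>' t) (at t)" "continuous_on UNIV \<xi>'"
  and b: "\<And>t. \<bar>\<xi> t\<bar> \<le> C" "\<And>t. \<bar>\<xi>' t\<bar> \<le> C"
  and z: "\<And>t. t \<ge> T - k1 ==> \<xi> t = 0" and x0: "\<And>t. t \<le> k1 ==> \<xi> t = \<xi>0" "\<xi>0 \<ge> 0"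
  and x'0: "\<And>t. t \<notin> {k1..T - k1} ==> \<xi>' t = 0"
  and k1: "0 < k1" "k1 < T" and L: "rL \<ge> 0" "dL \<ge> 0"
  and f: "\<tau> > 0" "\<And>p. fst p \<notin> {\<tau>..T - \<tau>} ==> f3 p = 0"
 shows "(LINT p|M3. - \<xi>' (fst p) * energy p) \<le>
  \<xi>0 * (B^2 * measure N UNIV * (rL * (2 * \<bar>c\<bar> + 1) / 2 + 3 * dL)) + (LINT p|M3. \<xi> (fst p) * f3 p * (V p + c * G2 p))"
proof -
 have cx: "continuous_on UNIV \<xi>" using x(1) by (auto intro!: continuous_at_imp_continuous_on DERIV_isCont)
 have mx [measurable]: "\<xi> \<in> borel_measurable borel" "\<xi>' \<in> borel_measurable borel"
  using cx x(2) by (auto intro: borel_measurable_continuous_onI)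
 have C: "C \<ge> 0" using order_trans[OF abs_ge_zero b(1)] .
 have K: "K \<ge> 0" using order_trans[OF abs_ge_zero RD_bound(1)] .
 \<comment> \<open>The factor sqrt k1 / 2 keeps every step s^2 below k1.\<close>
 define s where "s n = sqrt k1 / 2 * inverse (real (Suc n))" for n
 have s: "s n > 0" "(s n)^2 < k1" for n
 proof -
  show "s n > 0" using k1 by (simp add: s_def)
  have "s n \<le> sqrt k1 / 2 * 1" unfolding s_def using k1 by (intro mult_left_mono) (auto simp: field_simps)
  then have "(s n)^2 \<le> (sqrt k1 / 2)^2" using \<open>s n > 0\<close> by (intro power_mono) auto
  then show "(s n)^2 < k1" using k1 by (simp add: power_divide)
 qed
 have s0: "s \<longlonglongrightarrow> 0" unfolding s_def by (rule tendsto_eq_intros LIMSEQ_inverse_real_of_nat refl | simp)+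
 have k0: "(%n. (s n)^2) \<longlonglongrightarrow> 0" using tendsto_power[OF s0, of 2] by simp
 have kp: "(s n)^2 > 0" "(s n)^2 \<noteq> 0" for n using s(1)[of n] by simp_all
 have qb: "\<bar>R p * \<xi>' (fst p)\<bar> \<le> K * C" "\<bar>D p * \<xi>' (fst p)\<bar> \<le> K * C" for p
  unfolding abs_mult by (intro mult_mono RD_bound b K abs_ge_zero)+
 have a1: "sqint M3 (%p. R p * \<xi>' (fst p) * V p)" by (rule sqint_bounded_mult[OF UVG(2) _ qb(1)]) measurable
 have a2: "sqint M3 (%p. D p * \<xi>' (fst p) * G1 p)" by (rule sqint_bounded_mult[OF UVG(3) _ qb(2)]) measurable
 have a3: "sqint M3 (%p. D p * \<xi>' (fst p) * G2 p)" by (rule sqint_bounded_mult[OF UVG(4) _ qb(2)]) measurable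
 have af: "sqint M3 (%p. \<xi> (fst p) * f3 p)" by (rule sqint_bounded_mult[OF f3(1) _ b(1)]) measurable
 have l1: "(%n. (LINT p|M3. R p * \<xi>' (fst p) * V p * wd w ((s n)^2) p) / (2 * (s n)^2)) \<longlonglongrightarrow> (LINT p|M3. R p * \<xi>' (fst p) * V p * (V p + c * G2 p))"
  by (rule wd_quotient[of k1 "T - k1", OF _ _ a1 _ k0 kp(2)]) (use k1 x'0 in auto)
 have l2: "(%n. (LINT p|M3. \<xi> (fst p) * f3 p * wd w ((s n)^2) p) / (2 * (s n)^2)) \<longlonglongrightarrow> (LINT p|M3. \<xi> (fst p) * f3 p * (V p + c * G2 p))"
  by (rule wd_quotient[of \<tau> "T - \<tau>", OF _ _ af _ k0 kp(2)]) (use f in auto)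
 note l3 = summation_by_parts_limit[OF RD_measurable(1) RD_bound(1) UVG(2) x b(2) k0 kp(1)]
 note l4 = summation_by_parts_limit[OF RD_measurable(2) RD_bound(2) UVG(3) x b(2) k0 kp(1)]
 note l5 = summation_by_parts_limit[OF RD_measurable(2) RD_bound(2) UVG(4) x b(2) k0 kp(1)]
 note lhs = tendsto_diff[OF tendsto_add[OF tendsto_add[OF tendsto_diff[OF tendsto_minus[OF l1] l3] l4] l5] l2]
 let ?M = "B^2 * measure N UNIV"
 let ?r = "%n. \<xi>0 * ((rL * ((2 * \<bar>c\<bar> + 1) * B^2 * measure N UNIV) +
  dL * (((3 * ?M + 2 * (s n)^2 * (LINT p|M3. (V p)^2)) + s n * (?M + (LINT p|M3. (G1 p)^2))) +
     ((3 * ?M + 2 * (s n)^2 * (LINT p|M3. (V p)^2)) + s n * (?M + (LINT p|M3. (G2 p)^2))))) / 2)"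
 have rhs: "?r \<longlonglongrightarrow> \<xi>0 * ((rL * ((2 * \<bar>c\<bar> + 1) * B^2 * measure N UNIV) +
  dL * (((3 * ?M + 2 * 0 * (LINT p|M3. (V p)^2)) + 0 * (?M + (LINT p|M3. (G1 p)^2))) +
     ((3 * ?M + 2 * 0 * (LINT p|M3. (V p)^2)) + 0 * (?M + (LINT p|M3. (G2 p)^2))))) / 2)"
  by (intro tendsto_intros s0 k0) auto
 also have "\<xi>0 * ((rL * ((2 * \<bar>c\<bar> + 1) * B^2 * measure N UNIV) +
  dL * (((3 * ?M + 2 * 0 * (LINT p|M3. (V p)^2)) + 0 * (?M + (LINT p|M3. (G1 p)^2))) +
     ((3 * ?M + 2 * 0 * (LINT p|M3. (V p)^2)) + 0 * (?M + (LINT p|M3. (G2 p)^2))))) / 2)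
  = \<xi>0 * (?M * (rL * (2 * \<bar>c\<bar> + 1) / 2 + 3 * dL))" by (simp add: field_simps)
 finally have rhs: "?r \<longlonglongrightarrow> \<xi>0 * (?M * (rL * (2 * \<bar>c\<bar> + 1) / 2 + 3 * dL))" .
 have r: "\<xi>0 * boundary_remainder B (s n) / (2 * (s n)^2) = ?r n" for n
 proof -
  have "boundary_remainder B (s n) = (s n)^2 * (rL * ((2 * \<bar>c\<bar> + 1) * B^2 * measure N UNIV) +
  dL * (((3 * ?M + 2 * (s n)^2 * (LINT p|M3. (V p)^2)) + s n * (?M + (LINT p|M3. (G1 p)^2))) +
     ((3 * ?M + 2 * (s n)^2 * (LINT p|M3. (V p)^2)) + s n * (?M + (LINT p|M3. (G2 p)^2)))))"
   by (simp add: boundary_remainder_def algebra_simps power2_eq_square power3_eq_cube)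
  then show ?thesis using kp(2)[of n] by simp
 qed
 have step: "- ((LINT p|M3. R p * \<xi>' (fst p) * V p * wd w ((s n)^2) p) / (2 * (s n)^2))
  - (LINT p|M3. (\<xi> (fst p) - \<xi> (fst p + (s n)^2)) * (R p * V p * V (Shf (E ((s n)^2)) p))) / (2 * (s n)^2)
  + (LINT p|M3. (\<xi> (fst p) - \<xi> (fst p + (s n)^2)) * (D p * G1 p * G1 (Shf (E ((s n)^2)) p))) / (2 * (s n)^2)
  + (LINT p|M3. (\<xi> (fst p) - \<xi> (fst p + (s n)^2)) * (D p * G2 p * G2 (Shf (E ((s n)^2)) p))) / (2 * (s n)^2)
  - (LINT p|M3. \<xi> (fst p) * f3 p * wd w ((s n)^2) p) / (2 * (s n)^2) \<le> ?r n" for n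
  unfolding r[symmetric] minus_divide_left diff_divide_distrib[symmetric] add_divide_distrib[symmetric]
  by (intro divide_right_mono energy_step[OF B x b z x0 s k1(2) L]) simp_all
 have lim: "- (LINT p|M3. R p * \<xi>' (fst p) * V p * (V p + c * G2 p)) - (LINT p|M3. - \<xi>' (fst p) * (R p * (V p)^2) / 2)
   + (LINT p|M3. - \<xi>' (fst p) * (D p * (G1 p)^2) / 2) + (LINT p|M3. - \<xi>' (fst p) * (D p * (G2 p)^2) / 2)
   - (LINT p|M3. \<xi> (fst p) * f3 p * (V p + c * G2 p)) \<le> \<xi>0 * (?M * (rL * (2 * \<bar>c\<bar> + 1) / 2 + 3 * dL))"
  by (rule LIMSEQ_le[OF lhs rhs]) (use step in blast)
 have i1: "integrable M3 (%p. R p * \<xi>' (fst p) * V p * (V p + c * G2 p))"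
  by (rule sqint_mult[OF a1 sqint_add[OF UVG(2) sqint_cmult[OF UVG(4)]]])
 have i2: "integrable M3 (%p. - \<xi>' (fst p) * (R p * (V p)^2) / 2)"
  using integrable_minus[OF sqint_mult[OF a1 UVG(2)]] by (simp add: power2_eq_square mult_ac)
 have i3: "integrable M3 (%p. - \<xi>' (fst p) * (D p * (G1 p)^2) / 2)"
  using integrable_minus[OF sqint_mult[OF a2 UVG(3)]] by (simp add: power2_eq_square mult_ac)
 have i4: "integrable M3 (%p. - \<xi>' (fst p) * (D p * (G2 p)^2) / 2)"
  using integrable_minus[OF sqint_mult[OF a3 UVG(4)]] by (simp add: power2_eq_square mult_ac)
 have gen: "(LINT p|M3. - a p - b p + c p + d p) = - (LINT p|M3. a p) - (LINT p|M3. b p) + (LINT p|M3. c p) + (LINT p|M3. d p)"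
  if "integrable M3 a" "integrable M3 b" "integrable M3 c" "integrable M3 d" for a b c d :: "real \<times> point => real"
  using that by simp
 have "(LINT p|M3. - \<xi>' (fst p) * energy p) = (LINT p|M3. - (R p * \<xi>' (fst p) * V p * (V p + c * G2 p)) - (- \<xi>' (fst p) * (R p * (V p)^2) / 2)
  + (- \<xi>' (fst p) * (D p * (G1 p)^2) / 2) + (- \<xi>' (fst p) * (D p * (G2 p)^2) / 2))"
  by (intro Bochner_Integration.integral_cong refl) (simp add: energy_def power2_eq_square field_simps)
 also have "\<dots> = - (LINT p|M3. R p * \<xi>' (fst p) * V p * (V p + c * G2 p)) - (LINT p|M3. - \<xi>' (fst p) * (R p * (V p)^2) / 2)
   + (LINT p|M3. - \<xi>' (fst p) * (D p * (G1 p)^2) / 2) + (LINT p|M3. - \<xi>' (fst p) * (D p * (G2 p)^2) / 2)"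
  by (rule gen[OF i1 i2 i3 i4])
 finally show ?thesis using lim by linarith
qed

end

section \<open>From weights in time to bounds at almost every time\<close>

text \<open>An arbitrary continuous nonnegative weight \<zeta> thus appears as -\<xi>' in the energy
  inequality, and the initial value of the cutoff is the mass of \<zeta>. A right-hand side linear
  in that initial value then bounds the weighted mean of the energy.\<close>

lemma decreasing_primitive:
 fixes \<zeta> :: "real => real"
 assumes c: "continuous_on UNIV \<zeta>" and z: "\<And>t. 0 \<le> \<zeta> t" "\<And>t. t \<notin> {k..T - k} ==> \<zeta> t = 0" and k: "0 < k" "k < T"
 obtains \<xi> where "\<And>t. (\<xi> has_real_derivative - \<zeta> t) (at t)" "\<And>t. t \<le> k ==> \<xi> t = (LINT t|lborel. \<zeta> t)"
  "\<And>t. t \<ge> T - k ==> \<xi> t = 0" "\<And>t. 0 \<le> \<xi> t" "\<And>t. \<xi> t \<le> (LINT t|lborel. \<zeta> t)" "integrable lborel \<zeta>"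
proof -
 define P where "P t = integral {0..t} \<zeta>" for t
 have cs: "continuous_on A \<zeta>" for A using c by (rule continuous_on_subset) simp
 have io: "\<zeta> integrable_on {a..b}" for a b by (intro integrable_continuous_interval cs)
 have P0: "P t = 0" if "t \<le> k" for t
 proof -
  have "P t = integral {0..t} (%_. 0)" unfolding P_def
   by (rule integral_spike[of "{k}"]) (use that z in auto)
  then show ?thesis by simp
 qed
 have mono: "P s \<le> P t" if "s \<le> t" for s t unfolding P_def
  by (rule integral_subset_le) (use that io z in auto)
 have PT: "P t = P (T - k)" if "t \<ge> T - k" for t
 proof -
  have "P t = P (T - k) + integral {T - k..t} \<zeta>"
   unfolding P_def using Henstock_Kurzweil_Integration.integral_combine[of 0 "T - k" t \<zeta>] that k io by simp
  also have "integral {T - k..t} \<zeta> = integral {T - k..t} (%_. 0)"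
   by (rule integral_spike[of "{T - k}"]) (use that z in auto)
  finally show ?thesis by simp
 qed
 have D: "(P has_real_derivative \<zeta> t) (at t)" for t
 proof (cases "t > 0")
  case True
  have "((%x. integral {0..x} \<zeta>) has_real_derivative \<zeta> t) (at t within {0..t + 1})"
   by (rule integral_has_real_derivative) (use True cs in auto)
  then show ?thesis using True at_within_interior[of t "{0..t + 1}"] by (simp add: P_def[abs_def])
 next
  case False
  have "((%_. 0) has_real_derivative 0) (at t)" by simp
  then have "(P has_real_derivative 0) (at t)"
   by (rule DERIV_cong_ev[THEN iffD1, rotated -1]) (use False k P0 in \<open>auto intro!: eventually_nhds_in_open[of "{..<k}", THEN eventually_mono]\<close>)
  moreover have "\<zeta> t = 0" using z(2)[of t] False k by auto
  ultimately show ?thesis by simp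
 qed
 have i: "integrable lborel \<zeta>"
 proof -
  have "integrable lborel (%x. indicator {k..T - k} x *\<^sub>R \<zeta> x)"
   using borel_integrable_compact[of "{k..T - k}" \<zeta>] cs by (simp add: indicator_scaleR_eq_if)
  moreover have "indicator {k..T - k} x *\<^sub>R \<zeta> x = \<zeta> x" for x using z(2)[of x] by (auto simp: indicator_def)
  ultimately show ?thesis by (simp only:)
 qed
 have total: "(LINT t|lborel. \<zeta> t) = P (T - k)"
 proof -
  have "set_integrable lborel {0..T - k} \<zeta>" unfolding set_integrable_def
   by (rule integrable_mult_indicator[OF _ i]) simp
  from set_borel_integral_eq_integral(2)[OF this]
  have "(LINT t:{0..T - k}|lborel. \<zeta> t) = P (T - k)" by (simp add: P_def)
  moreover have "(LINT t:{0..T - k}|lborel. \<zeta> t) = (LINT t|lborel. \<zeta> t)" unfolding set_lebesgue_integral_def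
  proof (rule Bochner_Integration.integral_cong[OF refl])
   show "indicator {0..T - k} t *\<^sub>R \<zeta> t = \<zeta> t" for t
    using z(2)[of t] k by (cases "t \<in> {k..T - k}") auto
  qed
  ultimately show ?thesis by simp
 qed
 show ?thesis
 proof (rule that[of "%t. P (T - k) - P t"])
  show "((%t. P (T - k) - P t) has_real_derivative - \<zeta> t) (at t)" for t
   using DERIV_diff[OF DERIV_const D] by simp
  show "P (T - k) - P t = (LINT t|lborel. \<zeta> t)" if "t \<le> k" for t using P0[OF that] total by simp
  show "P (T - k) - P t = 0" if "t \<ge> T - k" for t using PT[OF that] by simp
  show "0 \<le> P (T - k) - P t" for t using PT[of t] mono[of t "T - k"] by linarith
  show "P (T - k) - P t \<le> (LINT t|lborel. \<zeta> t)" for t using P0[of t] mono[of k t] P0[of k] total by linarith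
 qed (rule i)
qed

text \<open>A set of positive measure where g is positive contains a compact K of positive measure,
  by inner regularity. Continuous functions decreasing to the indicator of K contradict the
  hypothesis in the limit.\<close>

lemma AE_nonpos_by_testing:
 fixes g :: "real => real"
 assumes g: "integrable lborel g"
  and test: "\<And>\<zeta> k. continuous_on UNIV \<zeta> ==> (\<And>t. 0 \<le> \<zeta> t) ==> (\<And>t. \<zeta> t \<le> 1) ==> 0 < k ==> k < T ==>
   (\<And>t. t \<notin> {k..T - k} ==> \<zeta> t = 0) ==> (LINT t|lborel. \<zeta> t * g t) \<le> 0"
 shows "AE t in lborel. t \<in> {0<..<T} --> g t \<le> 0"
proof (rule ccontr)
 have [measurable]: "g \<in> borel_measurable borel" using borel_measurable_integrable[OF g] by simp
 define A where "A = {t \<in> {0<..<T}. g t > 0}"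
 have A [measurable]: "A \<in> sets borel" unfolding A_def by measurable
 assume "\<not> (AE t in lborel. t \<in> {0<..<T} --> g t \<le> 0)"
 moreover have "{t \<in> space lborel. \<not> (t \<in> {0<..<T} --> g t \<le> 0)} = A" by (auto simp: A_def)
 ultimately have pos: "emeasure lborel A \<noteq> 0" using AE_iff_measurable[of A lborel "%t. t \<in> {0<..<T} --> g t \<le> 0"] by auto
 have fin: "emeasure lborel A < \<infinity>"
 proof -
  have "emeasure lborel A \<le> emeasure lborel {0..T}" by (rule emeasure_mono) (auto simp: A_def)
  also have "\<dots> < \<infinity>" using emeasure_bounded_finite[of "{0..T}"] by simp
  finally show ?thesis .
 qed
 then have mp: "measure lborel A > 0" using pos by (simp add: emeasure_eq_ennreal_measure less_top[symmetric] zero_less_measure_iff)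
 obtain K where K: "closed K" "K \<subseteq> A" "(A - K) \<in> lmeasurable" "emeasure lebesgue (A - K) < ennreal (measure lborel A)"
  by (rule sets_lebesgue_inner_closed[of A "measure lborel A"]) (use A mp in auto)
 have [measurable]: "K \<in> sets borel" using K(1) by (rule borel_closed)
 have Kpos: "emeasure lborel K \<noteq> 0"
 proof
  assume "emeasure lborel K = 0"
  then have "emeasure lborel (A - K) = emeasure lborel A" by (intro emeasure_Diff_null_set) auto
  moreover have "emeasure lebesgue (A - K) = emeasure lborel (A - K)" by simp
  ultimately show False using K(4) fin by (simp add: emeasure_eq_ennreal_measure less_top[symmetric])
 qed
 then have ne: "K \<noteq> {}" by auto
 have "A \<subseteq> {0..T}" by (auto simp: A_def)
 then have "bounded K" using bounded_subset[OF bounded_closed_interval[of 0 T]] K(2) by (meson order_trans)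
 then have comp: "compact K" using K(1) by (simp add: compact_eq_bounded_closed)
 obtain a b where ab: "a \<in> K" "\<And>t. t \<in> K ==> a \<le> t" "b \<in> K" "\<And>t. t \<in> K ==> t \<le> b"
  using compact_attains_inf[OF comp ne] compact_attains_sup[OF comp ne] by blast
 \<comment> \<open>K lies between times 2k and T - 2k, which leaves a margin k on both sides for
   continuous approximations of its indicator.\<close>
 define k where "k = min a (T - b) / 2"
 have "a \<in> A" "b \<in> A" using ab K(2) by auto
 then have AB: "0 < a" "a < T" "b < T" by (simp_all add: A_def)
 have "k \<le> a / 2" "0 < min a (T - b)" using AB by (simp_all add: k_def)
 then have k: "0 < k" "k < T" using AB by (simp_all add: k_def del: min_less_iff_conj)
 have k3: "2 * k \<le> t \<and> t \<le> T - 2 * k" if "t \<in> K" for t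
 proof -
  have "2 * k \<le> a" "2 * k \<le> T - b" by (simp_all add: k_def)
  then show ?thesis using ab(2,4)[OF that] by linarith
 qed
 \<comment> \<open>With m k \<ge> 1 all the functions \<zeta> n, from n = 0 on, vanish at distance k
   from K and beyond.\<close>
 obtain m :: nat where m: "real m * k \<ge> 1" using reals_Archimedean3[OF k(1)] less_imp_le by blast
 define \<zeta> where "\<zeta> n t = max 0 (1 - real (n + m) * infdist t K)" for n t
 have dist: "infdist t K \<ge> k" if "t \<notin> {k..T - k}" for t
  unfolding infdist_notempty[OF ne]
 proof (rule cINF_greatest[OF ne])
  fix y assume "y \<in> K"
  then show "k \<le> dist t y" using k3[of y] that by (auto simp: dist_real_def)
 qed
 have le0: "(LINT t|lborel. \<zeta> n t * g t) \<le> 0" for n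
 proof (rule test[OF _ _ _ k(1,2)])
  show "continuous_on UNIV (\<zeta> n)" unfolding \<zeta>_def by (intro continuous_intros)
  show "0 \<le> \<zeta> n t" for t by (simp add: \<zeta>_def)
  show "\<zeta> n t \<le> 1" for t using infdist_nonneg[of t K] by (simp add: \<zeta>_def)
  show "\<zeta> n t = 0" if "t \<notin> {k..T - k}" for t
  proof -
   have "real m * k \<le> real (n + m) * infdist t K" using dist[OF that] k(1) by (intro mult_mono) auto
   then show ?thesis using m by (simp add: \<zeta>_def)
  qed
 qed
 have lim: "(%n. LINT t|lborel. \<zeta> n t * g t) \<longlonglongrightarrow> (LINT t|lborel. indicator K t * g t)"
 proof (rule integral_dominated_convergence[where w="%t. \<bar>g t\<bar>"])
  have "\<zeta> n \<in> borel_measurable borel" for n unfolding \<zeta>_def by (intro borel_measurable_continuous_onI continuous_intros)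
  then show "(%t. \<zeta> n t * g t) \<in> borel_measurable lborel" for n by measurable
  have "\<bar>\<zeta> n t\<bar> \<le> 1" for n t using infdist_nonneg[of t K] by (simp add: \<zeta>_def)
  then show "AE t in lborel. norm (\<zeta> n t * g t) \<le> \<bar>g t\<bar>" for n by (simp add: abs_mult mult_left_le_one_le)
  show "AE t in lborel. (%n. \<zeta> n t * g t) \<longlonglongrightarrow> indicator K t * g t"
  proof (rule AE_I2, rule tendsto_mult_right)
   fix t
   show "(%n. \<zeta> n t) \<longlonglongrightarrow> indicator K t"
   proof (cases "t \<in> K")
    case True then show ?thesis by (simp add: \<zeta>_def)
   next
    case False
    then have d: "infdist t K > 0" using in_closed_iff_infdist_zero[OF K(1) ne, of t] infdist_nonneg[of t K] by linarith
    obtain j :: nat where j: "real j * infdist t K \<ge> 1" using reals_Archimedean3[OF d] less_imp_le by blast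
    have "eventually (%n. \<zeta> n t = 0) sequentially"
    proof (rule eventually_sequentiallyI[of j])
     fix n assume "j \<le> n"
     then have "real j * infdist t K \<le> real (n + m) * infdist t K" using d by (intro mult_right_mono) auto
     then show "\<zeta> n t = 0" using j by (simp add: \<zeta>_def)
    qed
    then show ?thesis using False by (simp add: tendsto_eventually)
   qed
  qed
 qed (use g in auto)
 have "(LINT t|lborel. indicator K t * g t) \<le> 0" by (rule LIMSEQ_le_const2[OF lim]) (use le0 in blast)
 moreover have nn: "0 \<le> indicator K t * g t" for t using K(2) by (auto simp: indicator_def A_def)
 moreover have Ki: "integrable lborel (%t. indicator K t * g t)" using integrable_mult_indicator[OF _ g, of K] by simp
 ultimately have "(LINT t|lborel. indicator K t * g t) = 0" by (intro antisym Bochner_Integration.integral_nonneg) auto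
 then have "AE t in lborel. indicator K t * g t = 0" using integral_nonneg_eq_0_iff_AE[OF Ki] nn by simp
 then have "AE t in lborel. t \<notin> K" by eventually_elim (use K(2) in \<open>auto simp: A_def\<close>)
 then show False using Kpos AE_iff_measurable[of K lborel "%t. t \<notin> K"] by auto
qed

context wave begin

lemma energy_integrable: "integrable M3 energy"
proof -
 have s: "sqint M3 (%p. R p * V p)" "sqint M3 (%p. D p * G1 p)" "sqint M3 (%p. D p * G2 p)"
  using sqint_bounded_mult[OF UVG(2) _ RD_bound(1)] sqint_bounded_mult[OF UVG(3) _ RD_bound(2)] sqint_bounded_mult[OF UVG(4) _ RD_bound(2)]
   RD_measurable by simp_all
 have "integrable M3 (%p. R p * V p * V p / 2 + c * (R p * V p * G2 p) + (D p * G1 p * G1 p + D p * G2 p * G2 p) / 2)"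
  using sqint_mult[OF s(1) UVG(2)] sqint_mult[OF s(1) UVG(4)] sqint_mult[OF s(2) UVG(3)] sqint_mult[OF s(3) UVG(4)] by simp
 moreover have "R p * V p * V p / 2 + c * (R p * V p * G2 p) + (D p * G1 p * G1 p + D p * G2 p * G2 p) / 2 = energy p" for p
  by (simp add: energy_def power2_eq_square algebra_simps)
 ultimately show ?thesis by (simp only:) (simp only: eta_contract_eq)?
qed

text \<open>Completing the square with the derivative V + c G2 along the wave; the coefficient left
  on G2^2 is the gap D - c^2 R.\<close>

lemma energy_eq: "energy p = R p * (V p + c * G2 p)^2 / 2 + D p * (G1 p)^2 / 2 + (D p - c^2 * R p) * (G2 p)^2 / 2"
 by (simp add: energy_def power2_eq_square field_simps)

text \<open>Absorption replaces a Gronwall argument. The source is split so that the energy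
  reappears with the factor 1/(2T); the bound A at almost every time then contains half of the time
  average of the energy. Integrating over (0,T) bounds that average by A, and absorbing A/2 gives
  the factor 2 in the conclusion.\<close>

lemma energy_bound:
 assumes B: "data_bound B v1 v2" and L: "rL > 0" "dL \<ge> 0"
  and f: "\<tau> > 0" "\<And>p. fst p \<notin> {\<tau>..T - \<tau>} ==> f3 p = 0" "\<And>p. snd p \<notin> S ==> f3 p = 0"
  and coercive: "\<And>p. 0 \<le> R p" "\<And>p. c^2 * R p \<le> D p"
 shows "AE t in lborel. t \<in> {0<..<T} --> (LINT x|N. energy (t, x)) \<le>
  2 * (B^2 * measure N UNIV * (rL * (2 * \<bar>c\<bar> + 1) / 2 + 3 * dL) + T / rL * (LINT p|M3. (f3 p)^2))"
proof -
 define C0 where "C0 = B^2 * measure N UNIV * (rL * (2 * \<bar>c\<bar> + 1) / 2 + 3 * dL)"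
 define F where "F = T / rL * (LINT p|M3. (f3 p)^2)"
 define A where "A = C0 + (LINT p|M3. energy p) / (2 * T) + F"
 define e where "e t = (LINT x|N. energy (t, x))" for t
 have D0: "0 \<le> D p" for p using coercive(2)[of p] mult_nonneg_nonneg[OF zero_le_power2 coercive(1), of c p] by linarith
 have en: "R p * (V p + c * G2 p)^2 / 2 \<le> energy p" for p
 proof -
  have "0 \<le> D p * (G1 p)^2 / 2" "0 \<le> (D p - c^2 * R p) * (G2 p)^2 / 2" using D0[of p] coercive(2)[of p] by auto
  then show ?thesis unfolding energy_eq by linarith
 qed
 have en0: "0 \<le> energy p" for p
 proof -
  have "0 \<le> R p * (V p + c * G2 p)^2 / 2" using coercive(1)[of p] by simp
  then show ?thesis using en[of p] by linarith
 qed
 \<comment> \<open>On S the density is the constant rL, so the energy controls rL X^2/2; expanding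
   the square of rL X - 2 T f3 gives the weights 1/(2T) and T/rL. Off S the source vanishes and the
   energy is nonnegative.\<close>
 have fe: "f3 p * (V p + c * G2 p) \<le> energy p / (2 * T) + T / rL * (f3 p)^2" for p
 proof (cases "fst p \<in> {0<..<T} \<and> snd p \<in> S")
  case True
  then have R: "R p = rL" using S_const[of "fst p" "snd p"] by simp
  define X where "X = V p + c * G2 p"
  have "0 \<le> (rL * X - 2 * T * f3 p)^2 / (4 * T * rL)" using L T_pos by simp
  also have "\<dots> = (rL * X^2 / 2) / (2 * T) - f3 p * X + T / rL * (f3 p)^2"
   using L T_pos by (simp add: power2_eq_square field_simps)
  also have "(rL * X^2 / 2) / (2 * T) \<le> energy p / (2 * T)" using en[of p] T_pos unfolding R X_def by (intro divide_right_mono) auto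
  finally show ?thesis unfolding X_def by simp
 next
  case False
  then have "f3 p = 0" using f(3)[of p] f3(2)[of p] by blast
  then show ?thesis using en0[of p] T_pos by simp
 qed
 note ei = energy_integrable
 have fi: "integrable M3 (%p. (f3 p)^2)" using f3(1) by (simp add: sqint_def)
 have ie: "integrable lborel e" unfolding e_def by (rule integral_M3(5)[OF ei])
 have em: "energy \<in> borel_measurable borel" using borel_measurable_integrable[OF ei] by simp
 have e0: "e t = 0" if "t \<notin> {0<..<T}" for t
  using UVG_0[of "(t, _)"] that unfolding e_def energy_def by simp
 have AT: "integrable lborel (%t. indicator {0<..<T} t * A)" by (intro integrable_mult_left integrable_indicator_interval)
 have "AE t in lborel. t \<in> {0<..<T} --> e t - indicator {0<..<T} t * A \<le> 0"
 proof (rule AE_nonpos_by_testing)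
  show "integrable lborel (%t. e t - indicator {0<..<T} t * A)" using ie AT by simp
  fix \<zeta> :: "real => real" and k
  assume \<zeta>: "continuous_on UNIV \<zeta>" "\<And>t. 0 \<le> \<zeta> t" "\<And>t. \<zeta> t \<le> 1" and k: "0 < k" "k < T" and z: "\<And>t. t \<notin> {k..T - k} ==> \<zeta> t = 0"
  have [measurable]: "\<zeta> \<in> borel_measurable borel" using \<zeta>(1) by (rule borel_measurable_continuous_onI)
  note [measurable] = em
  let ?x0 = "LINT t|lborel. \<zeta> t"
  obtain \<xi> where x: "\<And>t. (\<xi> has_real_derivative - \<zeta> t) (at t)" "\<And>t. t \<le> k ==> \<xi> t = ?x0"
   "\<And>t. t \<ge> T - k ==> \<xi> t = 0" "\<And>t. 0 \<le> \<xi> t" "\<And>t. \<xi> t \<le> ?x0" and zi: "integrable lborel \<zeta>"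
   using decreasing_primitive[OF \<zeta>(1,2) z k] by blast
  have x0: "?x0 \<ge> 0" using order_trans[OF x(4,5)] .
  have mx [measurable]: "\<xi> \<in> borel_measurable borel"
   using x(1) by (intro borel_measurable_continuous_onI) (auto intro!: continuous_at_imp_continuous_on DERIV_isCont)
  \<comment> \<open>A single constant has to bound both the cutoff, which is at most the mass of
    \<zeta>, and the weight, which is at most 1.\<close>
  have xb: "\<bar>\<xi> t\<bar> \<le> ?x0 + 1" "\<bar>- \<zeta> t\<bar> \<le> ?x0 + 1" for t using x(4,5)[of t] \<zeta>(2,3)[of t] x0 by auto
  have "(LINT p|M3. - (- \<zeta> (fst p)) * energy p) \<le> ?x0 * C0 + (LINT p|M3. \<xi> (fst p) * f3 p * (V p + c * G2 p))"
   unfolding C0_def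
   by (rule energy_inequality[where \<xi>=\<xi> and \<xi>'="%t. - \<zeta> t" and ?k1.0=k and \<tau>=\<tau> and C="?x0 + 1"])
    (use B x xb x0 z k L f(1,2) \<zeta>(1) in \<open>auto intro: continuous_intros\<close>)
  also have "(LINT p|M3. \<xi> (fst p) * f3 p * (V p + c * G2 p)) \<le> (LINT p|M3. ?x0 * (energy p / (2 * T) + T / rL * (f3 p)^2))"
  proof (rule integral_mono)
   have "sqint M3 (%p. \<xi> (fst p) * f3 p)" by (rule sqint_bounded_mult[OF f3(1) _ xb(1)]) measurable
   from sqint_mult[OF this sqint_add[OF UVG(2) sqint_cmult[OF UVG(4)]]]
   show "integrable M3 (%p. \<xi> (fst p) * f3 p * (V p + c * G2 p))" .
   show "integrable M3 (%p. ?x0 * (energy p / (2 * T) + T / rL * (f3 p)^2))" using ei fi by simp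
   fix p
   have nn: "0 \<le> energy p / (2 * T) + T / rL * (f3 p)^2" using en0[of p] T_pos L by simp
   have "\<xi> (fst p) * (f3 p * (V p + c * G2 p)) \<le> \<xi> (fst p) * (energy p / (2 * T) + T / rL * (f3 p)^2)"
    by (rule mult_left_mono[OF fe x(4)])
   also have "\<dots> \<le> ?x0 * (energy p / (2 * T) + T / rL * (f3 p)^2)" by (rule mult_right_mono[OF x(5) nn])
   finally show "\<xi> (fst p) * f3 p * (V p + c * G2 p) \<le> ?x0 * (energy p / (2 * T) + T / rL * (f3 p)^2)" by (simp only: mult.assoc)
  qed
  also have "(LINT p|M3. ?x0 * (energy p / (2 * T) + T / rL * (f3 p)^2)) = ?x0 * ((LINT p|M3. energy p) / (2 * T) + F)"
   using ei fi by (simp add: F_def)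
  finally have main: "(LINT p|M3. \<zeta> (fst p) * energy p) \<le> ?x0 * A" by (simp add: A_def distrib_left)
  have zei: "integrable M3 (%p. \<zeta> (fst p) * energy p)"
  proof (rule Bochner_Integration.integrable_bound[OF ei])
   show "AE p in M3. norm (\<zeta> (fst p) * energy p) \<le> norm (energy p)"
    using \<zeta>(2,3) by (intro AE_I2) (simp add: abs_mult mult_left_le_one_le)
  qed measurable
  have eq: "(LINT p|M3. \<zeta> (fst p) * energy p) = (LINT t|lborel. \<zeta> t * e t)" unfolding integral_M3(1)[OF zei] e_def by simp
  have ize: "integrable lborel (%t. \<zeta> t * e t)" using integral_M3(5)[OF zei] by (simp add: e_def)
  have za: "\<zeta> t * (indicator {0<..<T} t * A) = \<zeta> t * A" for t using z[of t] k by (cases "t \<in> {0<..<T}") auto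
  have "(LINT t|lborel. \<zeta> t * (e t - indicator {0<..<T} t * A)) = (LINT t|lborel. \<zeta> t * e t - \<zeta> t * A)"
   by (simp only: right_diff_distrib za)
  also have "\<dots> = (LINT t|lborel. \<zeta> t * e t) - ?x0 * A" using ize zi by simp
  also have "\<dots> \<le> 0" using main eq by simp
  finally show "(LINT t|lborel. \<zeta> t * (e t - indicator {0<..<T} t * A)) \<le> 0" .
 qed
 then have AE: "AE t in lborel. t \<in> {0<..<T} --> e t \<le> A" by eventually_elim auto
 have "(LINT p|M3. energy p) = (LINT t|lborel. e t)" unfolding integral_M3(1)[OF ei] e_def ..
 also have "\<dots> \<le> (LINT t|lborel. indicator {0<..<T} t * A)"
 proof (rule integral_mono_AE[OF ie AT])
  show "AE t in lborel. e t \<le> indicator {0<..<T} t * A" using AE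
  proof eventually_elim
   case (elim t) then show ?case using e0[of t] by (cases "t \<in> {0<..<T}") auto
  qed
 qed
 also have "\<dots> = T * A" using T_pos by simp
 finally have "(LINT p|M3. energy p) / (2 * T) \<le> T * A / (2 * T)" using T_pos by (intro divide_right_mono) auto
 also have "T * A / (2 * T) = A / 2" using T_pos by simp
 finally have "A \<le> 2 * (C0 + F)" unfolding A_def by (simp add: field_simps)
 then show ?thesis using AE unfolding e_def C0_def F_def by (auto elim!: eventually_mono)
qed

end

section \<open>Bounds and supports of the data\<close>

lemma Ck_compact_mono:
 "Ck_compact k S f ==> open S ==> S \<subseteq> S' ==> Ck_compact k S' f"
proof (induction k arbitrary: f)
 case 0
 then have "continuous_on S' f" using Ck_compact_0_continuous by (blast intro: continuous_on_subset)
 then show ?case using 0 by (auto simp: Ck_compact_def)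
next
 case (Suc k)
 have "Ck_on (Suc k) S' f"
  unfolding Ck_on.simps
 proof (intro conjI ballI)
  fix x
  show "f differentiable (at x)" using Ck_compact_Suc(1)[OF Suc.prems(1,2)] unfolding differentiable_def by blast
 next
  fix b :: 'a assume "b \<in> Basis"
  from Suc.IH[OF Ck_compact_Suc(2)[OF Suc.prems(1,2) this] Suc.prems(2,3)]
  show "Ck_on k S' (%x. frechet_derivative f (at x) b)" by (simp add: Ck_compact_def)
 qed
 then show ?case using Suc.prems by (auto simp: Ck_compact_def)
qed

text \<open>Finitely many compactly supported continuous functions are involved, so the sum of their
  individual bounds serves for all.\<close>

lemma data_bound_exists:
 assumes v1: "Ck_compact 2 S v1" and v2: "Ck_compact 1 S v2" and S: "open S"
 obtains B where "data_bound B v1 v2"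
proof -
 have v1': "Ck_compact (Suc (Suc 0)) S v1" using v1 by (simp add: numeral_2_eq_2)
 note d1 = Ck_compact_Suc(2)[OF v1' S] and d2 = Ck_compact_Suc(2)[OF v2[unfolded One_nat_def] S]
 have z: "Ck_compact 0 S v1"
  using Ck_compact_Suc(3)[OF v1' S] .
 have bd: "\<exists>B. \<forall>x. \<bar>f x\<bar> \<le> B" if "Ck_compact 0 S f" for f using Ck_compact_bounded[OF that S] by metis
 let ?F = "{v1, v2} \<union> (\<Union>b\<in>Basis. {(%x. frechet_derivative v1 (at x) b), (%x. frechet_derivative v2 (at x) b),
  (%x. frechet_derivative (%y. frechet_derivative v1 (at y) b) (at x) b)})"
 have "\<forall>f\<in>?F. \<exists>B. \<forall>x. \<bar>f x\<bar> \<le> B"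
 proof
  fix f assume "f \<in> ?F"
  then consider "f = v1" | "f = v2" | b where "b \<in> Basis" "f = (%x. frechet_derivative v1 (at x) b)"
   | b where "b \<in> Basis" "f = (%x. frechet_derivative v2 (at x) b)"
   | b where "b \<in> Basis" "f = (%x. frechet_derivative (%y. frechet_derivative v1 (at y) b) (at x) b)"
   by (elim UnE UN_E insertE emptyE) simp_all
  then show "\<exists>B. \<forall>x. \<bar>f x\<bar> \<le> B"
  proof cases
   case 1 then show ?thesis using bd[OF z] by simp
  next
   case 2 then show ?thesis using bd[OF Ck_compact_Suc(3)[OF v2[unfolded One_nat_def] S]] by simp
  next
   case (3 b) then show ?thesis using bd[OF Ck_compact_Suc(3)[OF d1[OF 3(1)] S]] by (simp only:)
  next
   case (4 b) then show ?thesis using bd[OF d2[OF 4(1)]] by (simp only:)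
  next
   case (5 b) then show ?thesis using bd[OF Ck_compact_Suc(2)[OF d1[OF 5(1)] S 5(1)]] by (simp only:)
  qed
 qed
 from bchoice[OF this] obtain b where bb: "\<forall>f\<in>?F. \<forall>x. \<bar>f x\<bar> \<le> b f" ..
 have b: "\<bar>f x\<bar> \<le> b f" if "f \<in> ?F" for f x by (rule spec[OF bspec[OF bb that]])
 have fin: "finite ?F" by auto
 have "\<bar>f x\<bar> \<le> (\<Sum>f\<in>?F. b f)" if "f \<in> ?F" for f x
 proof -
  have nn: "0 \<le> b g" if "g \<in> ?F" for g using order_trans[OF abs_ge_zero b[OF that]] .
  have "\<bar>f x\<bar> \<le> b f" by (rule b[OF that])
  also have "\<dots> \<le> (\<Sum>f\<in>?F. b f)" by (rule member_le_sum[OF that _ fin]) (use nn in blast)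
  finally show ?thesis .
 qed
 note le = this
 have m: "v1 \<in> ?F" "v2 \<in> ?F" by (rule UnI1, simp)+
 have m': "(%x. frechet_derivative v1 (at x) b) \<in> ?F" "(%x. frechet_derivative v2 (at x) b) \<in> ?F"
  "(%x. frechet_derivative (%y. frechet_derivative v1 (at y) b) (at x) b) \<in> ?F" if "b \<in> Basis" for b
  by (rule UnI2, rule UN_I[OF that], simp)+
 have "data_bound (\<Sum>f\<in>?F. b f) v1 v2" unfolding data_bound_def
  by (intro allI conjI ballI le[OF m(1)] le[OF m(2)] le[OF m'(1)] le[OF m'(2)] le[OF m'(3)])
 then show ?thesis by (rule that)
qed

text \<open>The source has to keep a positive distance from times 0 and T before the difference
  quotients can be paired with it.\<close>

lemma compact_in_time_interval:
 assumes "compact K" "K \<subseteq> {0<..<T} \<times> A" "T > 0"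
 obtains \<tau> :: real where "\<tau> > 0" "\<And>p. p \<in> K ==> fst p \<in> {\<tau>..T - \<tau>}"
proof (cases "K = {}")
 case True
 then show ?thesis using that[of 1] by simp
next
 case False
 have c: "compact (fst ` K)" using assms(1) by (intro compact_continuous_image continuous_intros)
 have ne: "fst ` K \<noteq> {}" using False by simp
 obtain a b where ab: "a \<in> fst ` K" "\<forall>t\<in>fst ` K. a \<le> t" "b \<in> fst ` K" "\<forall>t\<in>fst ` K. t \<le> b"
  using compact_attains_inf[OF c ne] compact_attains_sup[OF c ne] by blast
 have "a \<in> {0<..<T}" "b \<in> {0<..<T}" using ab(1,3) assms(2) by auto
 then have m: "min a (T - b) > 0" by simp
 have "fst p \<in> {min a (T - b)..T - min a (T - b)}" if "p \<in> K" for p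
 proof -
  have "a \<le> fst p" "fst p \<le> b" using ab(2,4) that by auto
  then show ?thesis unfolding atLeastAtMost_iff by linarith
 qed
 with m show ?thesis by (rule that)
qed

lemma int_periodic:
 fixes g :: "real => 'a"
 assumes "\<And>y. g (y + 1) = g y" shows "g (y + of_int m) = g y"
proof (induction m rule: int_induct[of _ 0])
 case (step1 i) then show ?case using assms[of "y + of_int i"] by (simp add: add.assoc)
next
 case (step2 i) then show ?case using assms[of "y + of_int (i - 1)"] by (simp add: add.assoc)
qed simp

section \<open>Norms on the left, middle and right regions\<close>

context torus begin

lemma shf_components:
 "fst x \<in> {-l<..<l} ==> fst (shf (0, s) x) = fst x" "\<exists>m::int. snd (shf (0, s) x) = snd x + s + h * of_int m"
proof -
 assume "fst x \<in> {-l<..<l}"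
 then show "fst (shf (0, s) x) = fst x" by (simp add: shf_def wrp_def wrap1_id)
next
 have "snd (shf (0, s) x) = snd x + s + h * of_int (- \<lfloor>(snd x + s) / h\<rfloor>)"
  by (simp add: shf_def wrp_def wrap1_def)
 then show "\<exists>m::int. snd (shf (0, s) x) = snd x + s + h * of_int m" by blast
qed

lemma region_norm_le:
 fixes f :: "point => 'b::real_normed_vector"
 assumes Q: "Q \<subseteq> Omega l h" "Q \<in> sets borel"
  and F: "F \<in> borel_measurable borel" "\<And>x. 0 \<le> F x" "\<And>x. x \<in> Q ==> (norm (f x))^2 = F x"
  and i: "integrable N (%x. indicator Q x * F x)" and le: "(LINT x|N. indicator Q x * F x) \<le> C" and C: "C \<ge> 0"
 shows "eL2norm Q f \<le> ennreal (sqrt C)"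
proof (rule eL2norm_le)
 note [measurable] = Q(2) F(1)
 have "(\<integral>\<^sup>+x\<in>Q. ennreal ((norm (f x))^2) \<partial>lborel) = (\<integral>\<^sup>+x\<in>Omega l h. ennreal (indicator Q x * F x) \<partial>lborel)"
 proof (rule nn_integral_cong)
  fix x
  show "ennreal ((norm (f x))^2) * indicator Q x = ennreal (indicator Q x * F x) * indicator (Omega l h) x"
   using Q(1) F(3)[of x] by (cases "x \<in> Q") auto
 qed
 also have "\<dots> = (\<integral>\<^sup>+x. ennreal (indicator Q x * F x) \<partial>N)" by (rule nn_integral_N[symmetric]) measurable
 also have "\<dots> = ennreal (LINT x|N. indicator Q x * F x)" by (rule nn_integral_eq_integral[OF i]) (use F(2) in simp)
 also have "\<dots> \<le> ennreal ((sqrt C)^2)" using le C by (intro ennreal_leI) simp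
 finally show "(\<integral>\<^sup>+x\<in>Q. ennreal ((norm (f x))^2) \<partial>lborel) \<le> ennreal ((sqrt C)^2)" .
qed (use C in simp)

text \<open>An essential supremum needs measurability in time. On (0,T) the norm of a slice agrees
  with an integral of \<open>ext T u\<close> over Q, which is measurable by Tonelli.\<close>

lemma Linf_L2_norm_le:
 fixes u :: "real => point => 'b::euclidean_space"
 assumes u: "in_L2_L2 T (Omega l h) u" and Q: "Q \<subseteq> Omega l h" "Q \<in> sets borel"
  and le: "AE t in lborel. t \<in> {0<..<T} --> eL2norm Q (u t) \<le> c"
 shows "Linf_L2_norm T Q u \<le> c"
 unfolding Linf_L2_norm_def
proof (rule esssup_I)
 note [measurable] = in_L2_L2_ext(1)[OF u] Q(2)
 define I where "I t = (\<integral>\<^sup>+ x\<in>Q. ennreal ((norm (ext T u (t, x)))^2) \<partial>lborel)" for t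
 have "(%q. ennreal ((norm (ext T u q))^2) * indicator Q (snd q)) \<in> borel_measurable (borel :: (real \<times> point) measure)" by measurable
 then have "(%q. ennreal ((norm (ext T u q))^2) * indicator Q (snd q)) \<in> borel_measurable ((lborel :: real measure) \<Otimes>\<^sub>M (lborel :: point measure))"
  by (simp add: lborel_prod)
 from lborel.borel_measurable_nn_integral_fst[OF this]
 have [measurable]: "I \<in> borel_measurable borel" unfolding I_def[abs_def] by simp
 have "(%t. if I t = \<infinity> then \<infinity> else ennreal (sqrt (enn2real (I t)))) \<in> borel_measurable (restrict_space lborel {0<..<T})"
  by (rule measurable_restrict_space1) measurable
 moreover have "eL2norm Q (u t) = (if I t = \<infinity> then \<infinity> else ennreal (sqrt (enn2real (I t))))" if "t \<in> space (restrict_space lborel {0<..<T})" for t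
 proof -
  have "(\<integral>\<^sup>+ x\<in>Q. ennreal ((norm (u t x))^2) \<partial>lborel) = I t" unfolding I_def
   by (rule nn_integral_cong) (use that Q(1) in \<open>auto simp: ext_def space_restrict_space indicator_def\<close>)
  then show ?thesis by (simp add: eL2norm_def Let_def)
 qed
 ultimately show "(%t. eL2norm Q (u t)) \<in> borel_measurable (restrict_space lborel {0<..<T})"
  by (simp only: measurable_cong[of "restrict_space lborel {0<..<T}" "%t. eL2norm Q (u t)"])
 show "AE t in restrict_space lborel {0<..<T}. eL2norm Q (u t) \<le> c"
  using le by (subst AE_restrict_space_iff) auto
qed

end

context wave begin

definition region_est :: "point set => real => real => real => bool" where
 "region_est Q a b t \<longleftrightarrow>
  integrable N (%x. indicator Q x * (V (t, x))^2) \<and> (LINT x|N. indicator Q x * (V (t, x))^2) \<le> a \<and>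
  integrable N (%x. indicator Q x * ((G1 (t, x))^2 + (G2 (t, x))^2)) \<and>
  (LINT x|N. indicator Q x * ((G1 (t, x))^2 + (G2 (t, x))^2)) \<le> a \<and>
  integrable N (%x. indicator Q x * (U (t, x))^2) \<and> (LINT x|N. indicator Q x * (U (t, x))^2) \<le> b"

text \<open>The weight \<omega> is the size of the coefficients on Q: 1 outside the layer and
  1/\<epsilon> inside. The solution is its initial value plus a primitive in time taken point by
  point, so its norm on Q is bounded through the velocity on the same Q and inherits the factor
  1/\<omega>.\<close>

lemma region_bounds:
 assumes Q: "Q \<in> sets borel" and pos: "\<omega> > 0" "\<kappa> \<ge> 0" "E0 \<ge> 0"
  and E: "AE t in lborel. t \<in> {0<..<T} --> (LINT x|N. energy (t, x)) \<le> E0"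
  and en0: "\<And>p. 0 \<le> energy p"
  and le: "\<And>t x. t \<in> {0<..<T} ==> x \<in> Q ==> \<omega> * (V (t, x))^2 \<le> \<kappa> * energy (t, x)"
   "\<And>t x. t \<in> {0<..<T} ==> x \<in> Q ==> \<omega> * ((G1 (t, x))^2 + (G2 (t, x))^2) \<le> \<kappa> * energy (t, x)"
  and v: "(LINT x|N. indicator Q x * (v1 x)^2) \<le> J / \<omega>"
 shows "AE t in lborel. t \<in> {0<..<T} -->
  region_est Q (\<kappa> * E0 / \<omega>) ((2 * J + 2 * T^2 * \<kappa> * E0) / \<omega>) t"
proof -
 note [measurable] = Q
 have ind: "\<bar>indicator Q y\<bar> \<le> (1::real)" for y by (simp add: indicator_def)
 have sq: "integrable M3 (%p. indicator Q (snd p) * (F p)^2)" if "sqint M3 F" for F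
 proof -
  have m: "F \<in> borel_measurable borel" using sqint_measurable[OF that] by simp
  have i: "integrable M3 (%p. (F p)^2)" using that by (simp add: sqint_def)
  show ?thesis
  proof (rule Bochner_Integration.integrable_bound[OF i])
   show "(%p. indicator Q (snd p) * (F p)^2) \<in> borel_measurable M3" using m by measurable
   show "AE p in M3. norm (indicator Q (snd p) * (F p)^2) \<le> norm ((F p)^2)" by (intro AE_I2) (simp add: indicator_def)
  qed
 qed
 have iG: "integrable M3 (%p. indicator Q (snd p) * ((G1 p)^2 + (G2 p)^2))"
  using Bochner_Integration.integrable_add[OF sq[OF UVG(3)] sq[OF UVG(4)]] by (simp add: distrib_left)
 have step: "(LINT x|N. indicator Q x * F x) \<le> \<kappa> * E0 / \<omega>"
  if i: "integrable N (%x. indicator Q x * F x)" and ie: "integrable N (%x. energy (t, x))" and e: "(LINT x|N. energy (t, x)) \<le> E0"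
   and F: "\<And>x. x \<in> Q ==> \<omega> * F x \<le> \<kappa> * energy (t, x)" for F t
 proof -
  have "(LINT x|N. indicator Q x * F x) \<le> (LINT x|N. (\<kappa> / \<omega>) * energy (t, x))"
  proof (rule integral_mono[OF i])
   show "integrable N (%x. (\<kappa> / \<omega>) * energy (t, x))" using ie by simp
   fix x
   show "indicator Q x * F x \<le> (\<kappa> / \<omega>) * energy (t, x)"
    using F[of x] pos en0[of "(t, x)"] by (cases "x \<in> Q") (auto simp: field_simps)
  qed
  also have "\<dots> = (\<kappa> / \<omega>) * (LINT x|N. energy (t, x))" by simp
  also have "\<dots> \<le> (\<kappa> / \<omega>) * E0" using e pos by (intro mult_left_mono) auto
  finally show ?thesis by simp
 qed
 have VG: "AE t in lborel. t \<in> {0<..<T} -->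
  integrable N (%x. indicator Q x * (V (t, x))^2) \<and> (LINT x|N. indicator Q x * (V (t, x))^2) \<le> \<kappa> * E0 / \<omega> \<and>
  integrable N (%x. indicator Q x * ((G1 (t, x))^2 + (G2 (t, x))^2)) \<and>
  (LINT x|N. indicator Q x * ((G1 (t, x))^2 + (G2 (t, x))^2)) \<le> \<kappa> * E0 / \<omega>"
  using E integral_M3(3)[OF energy_integrable] integral_M3(3)[OF sq[OF UVG(2)]] integral_M3(3)[OF iG]
 proof eventually_elim
  case (elim t)
  show ?case
  proof
   assume t: "t \<in> {0<..<T}"
   have i: "integrable N (%x. indicator Q x * (V (t, x))^2)" "integrable N (%x. indicator Q x * ((G1 (t, x))^2 + (G2 (t, x))^2))"
    using elim(3,4) by simp_all
   have e: "(LINT x|N. energy (t, x)) \<le> E0" using elim(1) t by blast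
   show "integrable N (%x. indicator Q x * (V (t, x))^2) \<and> (LINT x|N. indicator Q x * (V (t, x))^2) \<le> \<kappa> * E0 / \<omega> \<and>
    integrable N (%x. indicator Q x * ((G1 (t, x))^2 + (G2 (t, x))^2)) \<and>
    (LINT x|N. indicator Q x * ((G1 (t, x))^2 + (G2 (t, x))^2)) \<le> \<kappa> * E0 / \<omega>"
    by (intro conjI i step[OF i(1) elim(2) e le(1)[OF t]] step[OF i(2) elim(2) e le(2)[OF t]])
  qed
 qed
 let ?W = "%x. LINT s|lborel. (V (s, x))^2"
 have iV: "integrable M3 (%p. indicator Q (snd p) * (V p)^2)" by (rule sq[OF UVG(2)])
 have iW: "integrable N (%x. indicator Q x * ?W x)" using integral_M3(6)[OF iV] by simp
 have TA: "integrable lborel (%t. indicator {0<..<T} t * (\<kappa> * E0 / \<omega>))" by (intro integrable_mult_left integrable_indicator_interval)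
 have "(LINT x|N. indicator Q x * ?W x) = (LINT p|M3. indicator Q (snd p) * (V p)^2)" unfolding integral_M3(2)[OF iV] by simp
 also have "\<dots> = (LINT t|lborel. (LINT x|N. indicator Q x * (V (t, x))^2))" unfolding integral_M3(1)[OF iV] by simp
 also have "\<dots> \<le> (LINT t|lborel. indicator {0<..<T} t * (\<kappa> * E0 / \<omega>))"
 proof (rule integral_mono_AE[OF _ TA])
  show "integrable lborel (%t. LINT x|N. indicator Q x * (V (t, x))^2)" using integral_M3(5)[OF iV] by simp
  show "AE t in lborel. (LINT x|N. indicator Q x * (V (t, x))^2) \<le> indicator {0<..<T} t * (\<kappa> * E0 / \<omega>)" using VG
  proof eventually_elim
   case (elim t)
   show ?case
   proof (cases "t \<in> {0<..<T}")
    case True then show ?thesis using elim by simp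
   next
    case False
    then have "V (t, x) = 0" for x using UVG_0[of "(t, x)"] by simp
    then show ?thesis using False by simp
   qed
  qed
 qed
 also have "\<dots> = T * (\<kappa> * E0 / \<omega>)" using T_pos by simp
 finally have W: "(LINT x|N. indicator Q x * ?W x) \<le> T * (\<kappa> * E0 / \<omega>)" .
 have v1i: "integrable N (%x. indicator Q x * (v1 x)^2)"
 proof -
  have i: "integrable N (%x. (v1 x)^2)" using data_sqint(1) by (simp add: sqint_def)
  show ?thesis by (rule Bochner_Integration.integrable_bound[OF i]) (measurable, simp add: indicator_def)
 qed
 show ?thesis using VG AE_M3_fst[OF UV] integral_M3(3)[OF sq[OF UVG(1)]]
 proof eventually_elim
  case (elim t)
  show ?case
  proof
   assume t: "t \<in> {0<..<T}"
   have iU: "integrable N (%x. indicator Q x * (U (t, x))^2)" using elim(3) by simp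
   have tT: "t \<in> {0..T}" using t by simp
   have "(LINT x|N. indicator Q x * (U (t, x))^2) \<le> (LINT x|N. 2 * (indicator Q x * (v1 x)^2) + 2 * T * (indicator Q x * ?W x))"
   proof (rule integral_mono_AE[OF iU])
    show "integrable N (%x. 2 * (indicator Q x * (v1 x)^2) + 2 * T * (indicator Q x * ?W x))" using v1i iW by simp
    show "AE x in N. indicator Q x * (U (t, x))^2 \<le> 2 * (indicator Q x * (v1 x)^2) + 2 * T * (indicator Q x * ?W x)"
     using elim(2) prim_bound(1)[OF UVG(2) tT]
    proof eventually_elim
     case (elim x)
     have W0: "0 \<le> ?W x" by simp
     have "(U (t, x))^2 \<le> 2 * (v1 x)^2 + 2 * (prim V (t, x))^2"
      using elim(1) t sum_squares_bound[of "v1 x" "prim V (t, x)"] by (simp add: power2_sum)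
     also have "\<dots> \<le> 2 * (v1 x)^2 + 2 * (t * ?W x)" using elim(2) by simp
     also have "\<dots> \<le> 2 * (v1 x)^2 + 2 * (T * ?W x)" using t W0 mult_right_mono[of t T "?W x"] by simp
     finally show ?case by (cases "x \<in> Q") simp_all
    qed
   qed
   also have "\<dots> = 2 * (LINT x|N. indicator Q x * (v1 x)^2) + 2 * T * (LINT x|N. indicator Q x * ?W x)" using v1i iW by simp
   also have "\<dots> \<le> 2 * (J / \<omega>) + 2 * T * (T * (\<kappa> * E0 / \<omega>))" using v W T_pos by (intro add_mono mult_left_mono) auto
   also have "\<dots> = (2 * J + 2 * T^2 * \<kappa> * E0) / \<omega>" using pos by (simp add: field_simps power2_eq_square)
   finally show "region_est Q (\<kappa> * E0 / \<omega>) ((2 * J + 2 * T^2 * \<kappa> * E0) / \<omega>) t"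
    unfolding region_est_def using elim(1) t iU by blast
  qed
 qed
qed

text \<open>Twice the energy dominates \<omega> m (X^2 + G1^2 + G2^2) with X = V + c G2. Passing
  from X back to V costs the factor 2 (1 + c^2), which together with the 2 in front of the energy
  gives 4 (1 + c^2)/m.\<close>

lemma energy_coercive:
 assumes R: "\<omega> * m \<le> R p" and D: "\<omega> * m \<le> D p - c^2 * R p" and pos: "\<omega> > 0" "m > 0"
 shows "\<omega> * (V p)^2 \<le> 4 * (1 + c^2) / m * energy p" "\<omega> * ((G1 p)^2 + (G2 p)^2) \<le> 4 * (1 + c^2) / m * energy p"
proof -
 define X where "X = V p + c * G2 p"
 define e where "e = energy p"
 have R0: "0 \<le> R p" using order_trans[OF mult_nonneg_nonneg R] pos by auto
 have D1: "\<omega> * m \<le> D p" using D mult_nonneg_nonneg[OF zero_le_power2[of c] R0] by linarith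
 have "(\<omega> * m) * X^2 \<le> R p * X^2" "(\<omega> * m) * (G1 p)^2 \<le> D p * (G1 p)^2" "(\<omega> * m) * (G2 p)^2 \<le> (D p - c^2 * R p) * (G2 p)^2"
  by (intro mult_right_mono R D D1 zero_le_power2)+
 then have e: "(\<omega> * m) * (X^2 + (G1 p)^2 + (G2 p)^2) \<le> 2 * e" unfolding e_def energy_eq X_def distrib_left by linarith
 have expand: "2 * (1 + c^2) * (x + y + z) = 2 * x + 2 * y + 2 * z + 2 * (c^2 * x) + 2 * (c^2 * y) + 2 * (c^2 * z)" for x y z
  by (simp add: algebra_simps)
 \<comment> \<open>The difference of the two sides is exactly (V + 2 c G2)^2.\<close>
 have V: "(V p)^2 \<le> 2 * X^2 + 2 * (c^2 * (G2 p)^2)"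
 proof -
  have "0 \<le> (V p + 2 * (c * G2 p))^2" by simp
  then show ?thesis unfolding X_def by (simp add: power2_eq_square algebra_simps)
 qed
 have s: "0 \<le> X^2" "0 \<le> (G1 p)^2" "0 \<le> (G2 p)^2" "0 \<le> c^2 * X^2" "0 \<le> c^2 * (G1 p)^2" "0 \<le> c^2 * (G2 p)^2" by simp_all
 have e': "\<omega> * (2 * (1 + c^2) * (X^2 + (G1 p)^2 + (G2 p)^2)) \<le> 4 * (1 + c^2) / m * e"
 proof -
  have "(2 * (1 + c^2) / m) * ((\<omega> * m) * (X^2 + (G1 p)^2 + (G2 p)^2)) \<le> (2 * (1 + c^2) / m) * (2 * e)"
   using pos by (intro mult_left_mono e) (auto intro!: divide_nonneg_pos add_nonneg_nonneg)
  moreover have "(2 * k / m) * ((\<omega> * m) * s) = \<omega> * (2 * k * s)" for k s using pos by simp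
  moreover have "(2 * k / m) * (2 * e) = 4 * k / m * e" for k by simp
  ultimately show ?thesis by (simp only:)
 qed
 have a: "(V p)^2 \<le> 2 * (1 + c^2) * (X^2 + (G1 p)^2 + (G2 p)^2)" "(G1 p)^2 + (G2 p)^2 \<le> 2 * (1 + c^2) * (X^2 + (G1 p)^2 + (G2 p)^2)"
  unfolding expand using V s by linarith+
 show "\<omega> * (V p)^2 \<le> 4 * (1 + c^2) / m * energy p"
  by (rule order_trans[OF mult_left_mono[OF a(1) less_imp_le[OF pos(1)]] e'[unfolded e_def]])
 show "\<omega> * ((G1 p)^2 + (G2 p)^2) \<le> 4 * (1 + c^2) / m * energy p"
  by (rule order_trans[OF mult_left_mono[OF a(2) less_imp_le[OF pos(1)]] e'[unfolded e_def]])
qed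

end

section \<open>The microscopic problem in space-time form\<close>

lemma cell_coordinate:
 fixes a \<epsilon> :: real
 assumes "\<epsilon> > 0" "a \<in> {-\<epsilon>/2<..<\<epsilon>/2}" shows "a / \<epsilon> \<in> {-1/2<..<1/2}"
proof -
 have "(-\<epsilon>/2) / \<epsilon> < a / \<epsilon>" "a / \<epsilon> < (\<epsilon>/2) / \<epsilon>" using assms by (intro divide_strict_right_mono; simp)+
 then show ?thesis using assms(1) by simp
qed

text \<open>The profile is evaluated along a thin subset of its domain, so it is its continuity that
  passes to the composition. The layer is open, which permits multiplication by its
  indicator.\<close>

lemma (in torus) hat_coeff_measurable:
 assumes f: "continuous_on (profile_domain T h) f" and e: "\<epsilon> > 0" "\<epsilon> / 2 < l"
 shows "ext T (hat_coeff l h \<epsilon> aL f aR) \<in> borel_measurable (borel :: (real \<times> point) measure)"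
proof -
 let ?I = "%A::(real \<times> point) set. indicator A :: real \<times> point => real"
 let ?L = "{0<..<T} \<times> Omega_L l h \<epsilon>" and ?M = "{0<..<T} \<times> Omega_M h \<epsilon>" and ?R = "{0<..<T} \<times> Omega_R l h \<epsilon>"
 have op: "open ?L" "open ?M" "open ?R" unfolding Omega_L_def Omega_M_def Omega_R_def by (intro open_Times open_greaterThanLessThan)+
 have "continuous_on ?M (%p. f (fst p, snd (snd p), fst p / \<epsilon>, snd p /\<^sub>R \<epsilon>, snd (snd p) / \<epsilon>^2))"
 proof (rule continuous_on_compose2[OF f])
  show "continuous_on ?M (%p. (fst p, snd (snd p), fst p / \<epsilon>, snd p /\<^sub>R \<epsilon>, snd (snd p) / \<epsilon>^2))"
   using e by (intro continuous_intros) auto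
  show "(%p. (fst p, snd (snd p), fst p / \<epsilon>, snd p /\<^sub>R \<epsilon>, snd (snd p) / \<epsilon>^2)) ` ?M \<subseteq> profile_domain T h"
  proof (intro image_subsetI)
   fix p assume p: "p \<in> ?M"
   obtain t a b where tab: "p = (t, a, b)" by (cases p) auto
   have t: "t \<in> {0<..<T}" "a \<in> {-\<epsilon>/2<..<\<epsilon>/2}" "b \<in> {0<..<h}" using p by (auto simp: tab Omega_M_def)
   have eq: "inverse \<epsilon> * a = a / \<epsilon>" by (simp add: divide_inverse)
   show "(fst p, snd (snd p), fst p / \<epsilon>, snd p /\<^sub>R \<epsilon>, snd (snd p) / \<epsilon>^2) \<in> profile_domain T h"
    using cell_coordinate[OF e(1) t(2)] t(1,3) unfolding tab profile_domain_def
    by (simp only: fst_conv snd_conv scaleR_Pair mem_Times_iff real_scaleR_def eq UNIV_I)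
  qed
 qed
 then have "(%p. indicator ?M p *\<^sub>R f (fst p, snd (snd p), fst p / \<epsilon>, snd p /\<^sub>R \<epsilon>, snd (snd p) / \<epsilon>^2)) \<in> borel_measurable borel"
  by (intro borel_measurable_continuous_on_indicator borel_open op)
 then have "(%p. ?I ?L p * aL + 1 / \<epsilon> * (indicator ?M p *\<^sub>R f (fst p, snd (snd p), fst p / \<epsilon>, snd p /\<^sub>R \<epsilon>, snd (snd p) / \<epsilon>^2)) + ?I ?R p * aR) \<in> borel_measurable borel"
  by (intro borel_measurable_add borel_measurable_times borel_measurable_const borel_measurable_indicator borel_open op)
 moreover have "(ext T (hat_coeff l h \<epsilon> aL f aR) p :: real) = ?I ?L p * aL + 1 / \<epsilon> * (indicator ?M p *\<^sub>R f (fst p, snd (snd p), fst p / \<epsilon>, snd p /\<^sub>R \<epsilon>, snd (snd p) / \<epsilon>^2)) + ?I ?R p * aR" for p :: "real \<times> point"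
 proof (cases "fst p \<in> {0<..<T} \<and> snd p \<in> Omega l h")
  case False
  have "Omega_L l h \<epsilon> \<subseteq> Omega l h" "Omega_M h \<epsilon> \<subseteq> Omega l h" "Omega_R l h \<epsilon> \<subseteq> Omega l h"
   using e by (auto simp: Omega_def Omega_L_def Omega_M_def Omega_R_def)
  then have "p \<notin> ?L" "p \<notin> ?M" "p \<notin> ?R" using False by (auto simp: mem_Times_iff)
  then show ?thesis using False by (auto simp: ext_def)
 next
  case True
  have disj: "Omega_L l h \<epsilon> \<inter> Omega_M h \<epsilon> = {}" "Omega_L l h \<epsilon> \<inter> Omega_R l h \<epsilon> = {}" "Omega_M h \<epsilon> \<inter> Omega_R l h \<epsilon> = {}"
   using e by (auto simp: Omega_L_def Omega_M_def Omega_R_def)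
  have mem: "p \<in> {0<..<T} \<times> Q \<longleftrightarrow> snd p \<in> Q" for Q using True by (auto simp: mem_Times_iff)
  show ?thesis
   using True disj by (auto simp: ext_def hat_coeff_def micro_coeff_def indicator_def mem)
 qed
 ultimately show ?thesis using measurable_cong[of borel "ext T (hat_coeff l h \<epsilon> aL f aR)" _ borel] by simp
qed

text \<open>The shift keeps x2 - c t, while wrapping adds a multiple m of h to x2. Because h is n
  cells long, this amounts to n m periods of the profile. Here the condition that h is a multiple of
  \<epsilon> is used. Points sent to the boundary of the rectangle form a null set.\<close>

lemma (in torus) hat_coeff_invariant:
 assumes tw: "travelling_wave T h E c f g" and E: "\<epsilon> \<in> E" and n: "h = real n * \<epsilon>" and e: "\<epsilon> > 0" "\<epsilon> / 2 < l"
 shows "AE p in M3. fst p \<in> {0<..<T} --> fst p + k \<in> {0<..<T} -->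
  ext T (hat_coeff l h \<epsilon> aL f aR) (Shf (k, (0, c * k)) p) = ext T (hat_coeff l h \<epsilon> aL f aR) p"
 using AE_M3_Omega AE_Shf[OF AE_M3_Omega, of "(k, (0, c * k))"]
proof eventually_elim
 case (elim p)
 obtain t x where p: "p = (t, x)" by (cases p)
 define y where "y = shf (0, c * k) x"
 have x: "x \<in> Omega l h" and y: "y \<in> Omega l h" using elim by (auto simp: p y_def Shf_def)
 have fy: "fst y = fst x" unfolding y_def by (rule shf_components(1)) (use x in \<open>auto simp: Omega_def\<close>)
 obtain m :: int where m: "snd y = snd x + c * k + h * of_int m" unfolding y_def using shf_components(2) by blast
 have reg: "y \<in> Omega_L l h \<epsilon> \<longleftrightarrow> x \<in> Omega_L l h \<epsilon>" "y \<in> Omega_M h \<epsilon> \<longleftrightarrow> x \<in> Omega_M h \<epsilon>" "y \<in> Omega_R l h \<epsilon> \<longleftrightarrow> x \<in> Omega_R l h \<epsilon>"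
  using x y fy by (auto simp: Omega_def Omega_L_def Omega_M_def Omega_R_def mem_Times_iff)
 have mc: "micro_coeff f \<epsilon> (t + k) y = micro_coeff f \<epsilon> t x" if "t \<in> {0<..<T}" "t + k \<in> {0<..<T}" "x \<in> Omega_M h \<epsilon>"
 proof -
  have yM: "y \<in> Omega_M h \<epsilon>" using reg that by blast
  have "(snd y - c * (t + k)) / \<epsilon> = (snd x - c * t) / \<epsilon> + of_int (int n * m)"
   using e unfolding m n by (simp add: field_simps)
  moreover have "fst x / \<epsilon> \<in> {-1/2<..<1/2}" using that(3) by (intro cell_coordinate e(1)) (auto simp: Omega_M_def)
  then have "g (fst x / \<epsilon>) (z + 1) = g (fst x / \<epsilon>) z" for z using tw unfolding travelling_wave_def by blast
  then have "g (fst x / \<epsilon>) (z + of_int j) = g (fst x / \<epsilon>) z" for z j by (rule int_periodic)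
  ultimately have "g (fst y / \<epsilon>) ((snd y - c * (t + k)) / \<epsilon>) = g (fst x / \<epsilon>) ((snd x - c * t) / \<epsilon>)" unfolding fy by (simp only:)
  then show ?thesis using tw E that yM unfolding travelling_wave_def by simp
 qed
 show ?case using x y reg mc by (auto simp: p Shf_def ext_def hat_coeff_def simp flip: y_def)
qed

text \<open>The set S of the locale is the left region: vertical wrapped translations keep it up to
  a null set, and the coefficients are constant on it. The rest turns statements about
  \<open>u\<close>, \<open>du\<close> and \<open>Gu\<close> in Bochner spaces into statements about
  their extensions by zero.\<close>

lemma (in torus) weak_solution_wave:
 assumes T: "T > 0" and e: "\<epsilon> > 0" "\<epsilon> / 2 < l" and n: "h = real n * \<epsilon>" "\<epsilon> \<in> E"
  and prof: "continuous_on (profile_domain T h) DM" "continuous_on (profile_domain T h) rM"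
  and tw: "travelling_wave T h E c rM g1" "travelling_wave T h E c DM g2"
  and K: "\<And>p. \<bar>ext T (hat_coeff l h \<epsilon> rL rM rR) p\<bar> \<le> K" "\<And>p. \<bar>ext T (hat_coeff l h \<epsilon> dL DM dR) p\<bar> \<le> K"
  and v1: "Ck_compact 2 (Omega l h) v1" "supp v1 \<subseteq> Omega_L l h \<epsilon>"
  and v2: "Ck_compact 1 (Omega l h) v2" "supp v2 \<subseteq> Omega_L l h \<epsilon>"
  and f: "sqint M3 (%p. fL (fst p) (snd p))" "\<And>t x. t \<notin> {0<..<T} ==> fL t x = 0"
  and sol: "weak_solution T l h \<epsilon> dL dR rL rR DM rM v1 v2 fL u du Gu"
 shows "wave l h T c rL dL K (ext T (hat_coeff l h \<epsilon> rL rM rR)) (ext T (hat_coeff l h \<epsilon> dL DM dR)) (%p. fL (fst p) (snd p))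
  (ext T u) (ext T du) (%p. fst (ext T Gu p)) (%p. snd (ext T Gu p)) v1 v2 (Omega_L l h \<epsilon>)"
proof -
 have LO: "Omega_L l h \<epsilon> \<subseteq> Omega l h" using e by (auto simp: Omega_def Omega_L_def)
 have u: "in_L2_L2 T (Omega l h) u" and Gu: "in_L2_L2 T (Omega l h) Gu"
  and wg: "AE t\<in>{0<..<T} in lborel. torus_weak_gradient l h (u t) (Gu t)"
  and du: "in_L2_L2 T (Omega l h) du" and wd: "weak_time_derivative T (Omega l h) u du" and tr: "time_trace T (Omega l h) u 0 v1"
  using sol by (simp_all add: weak_solution_def in_L2_H1per_def)
 have v1': "Ck_compact (Suc (Suc 0)) (Omega l h) v1" using v1(1) by (simp add: numeral_2_eq_2)
 have c1: "Ck_compact 0 (Omega l h) v1" using Ck_compact_Suc(3)[OF v1' Omega_open] .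
 have c2: "Ck_compact 0 (Omega l h) v2" using Ck_compact_Suc(3)[OF v2(1)[unfolded One_nat_def] Omega_open] .
 have [measurable]: "v1 \<in> borel_measurable borel" "v2 \<in> borel_measurable borel"
  using Ck_compact_0_continuous[OF c1 Omega_open] Ck_compact_0_continuous[OF c2 Omega_open] by (auto intro: borel_measurable_continuous_onI)
 have sv1: "sqint N v1"
 proof -
  obtain B where B: "B \<ge> 0" "\<And>x. \<bar>v1 x\<bar> \<le> B" using Ck_compact_bounded[OF c1 Omega_open] by blast
  have "\<bar>(v1 x)^2\<bar> \<le> B^2" for x using power_mono[OF B(2)[of x], of 2] by simp
  then have "integrable N (%x. (v1 x)^2)" by (intro integrable_N_bounded[where B="B^2"]) measurable
  then show ?thesis unfolding sqint_def by simp
 qed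
 have m: "ext T u \<in> borel_measurable borel" "ext T du \<in> borel_measurable borel" "ext T Gu \<in> borel_measurable borel"
  by (rule in_L2_L2_ext(1)[OF u] in_L2_L2_ext(1)[OF du] in_L2_L2_ext(1)[OF Gu])+
 note [measurable] = m
 have mG: "(%p. fst (ext T Gu p)) \<in> borel_measurable borel" "(%p. snd (ext T Gu p)) \<in> borel_measurable borel"
  using m(3) by measurable
 have sU: "sqint M3 (ext T u)" "sqint M3 (ext T du)"
  using in_L2_L2_ext[OF u] in_L2_L2_ext[OF du] by (simp_all add: sqint_def)
 have sG: "sqint M3 (%p. fst (ext T Gu p))" "sqint M3 (%p. snd (ext T Gu p))"
 proof -
  have nrm: "(norm z)^2 = (fst z)^2 + (snd z)^2" for z :: point by (cases z) (simp add: norm_Pair)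
  have le: "norm ((fst z)^2) \<le> norm ((norm z)^2)" "norm ((snd z)^2) \<le> norm ((norm z)^2)" for z :: point unfolding nrm by simp_all
  note i = in_L2_L2_ext(2)[OF Gu]
  have "integrable M3 (%p. (fst (ext T Gu p))^2)"
   by (rule Bochner_Integration.integrable_bound[OF i]) (use mG(1) in simp, intro AE_I2 le(1))
  then show "sqint M3 (%p. fst (ext T Gu p))" using mG(1) by (simp add: sqint_def)
  have "integrable M3 (%p. (snd (ext T Gu p))^2)"
   by (rule Bochner_Integration.integrable_bound[OF i]) (use mG(2) in simp, intro AE_I2 le(2))
  then show "sqint M3 (%p. snd (ext T Gu p))" using mG(2) by (simp add: sqint_def)
 qed
 have z: "ext T u p = 0" "ext T du p = 0" "ext T Gu p = 0" if "fst p \<notin> {0<..<T}" for p using that by (auto simp: ext_def)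
 have RDm: "ext T (hat_coeff l h \<epsilon> rL rM rR) \<in> borel_measurable borel" "ext T (hat_coeff l h \<epsilon> dL DM dR) \<in> borel_measurable borel"
  by (rule hat_coeff_measurable[OF prof(2) e] hat_coeff_measurable[OF prof(1) e])+
 show ?thesis
 proof (unfold_locales)
  show "T > 0" by (rule T)
  show "ext T (hat_coeff l h \<epsilon> rL rM rR) \<in> borel_measurable borel" "ext T (hat_coeff l h \<epsilon> dL DM dR) \<in> borel_measurable borel" by (rule RDm)+
  show "\<bar>ext T (hat_coeff l h \<epsilon> rL rM rR) p\<bar> \<le> K" "\<bar>ext T (hat_coeff l h \<epsilon> dL DM dR) p\<bar> \<le> K" for p by (rule K)+
  show "AE p in M3. fst p \<in> {0<..<T} --> fst p + k \<in> {0<..<T} -->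
    ext T (hat_coeff l h \<epsilon> rL rM rR) (Shf (k, 0, c * k) p) = ext T (hat_coeff l h \<epsilon> rL rM rR) p \<and>
    ext T (hat_coeff l h \<epsilon> dL DM dR) (Shf (k, 0, c * k) p) = ext T (hat_coeff l h \<epsilon> dL DM dR) p" for k
   using hat_coeff_invariant[OF tw(1) n(2,1) e, of k rL rR] hat_coeff_invariant[OF tw(2) n(2,1) e, of k dL dR]
   by eventually_elim blast
  show "AE x in N. x \<in> Omega_L l h \<epsilon> --> shf (0, s) x \<in> Omega_L l h \<epsilon>" for s
   using AE_N_Omega AE_shf[OF AE_N_Omega, of "(0, s)"]
  proof eventually_elim
   case (elim x)
   have "fst (shf (0, s) x) = fst x" by (rule shf_components(1)) (use elim(1) in \<open>auto simp: Omega_def\<close>)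
   then show ?case using elim(2) by (auto simp: Omega_def Omega_L_def mem_Times_iff)
  qed
  show "ext T (hat_coeff l h \<epsilon> rL rM rR) (t, x) = rL \<and> ext T (hat_coeff l h \<epsilon> dL DM dR) (t, x) = dL"
   if "t \<in> {0<..<T}" "x \<in> Omega_L l h \<epsilon>" for t x using that LO by (auto simp: ext_def hat_coeff_def)
  show "Ck_compact 2 (Omega l h) v1" "supp v1 \<subseteq> Omega_L l h \<epsilon>" "Ck_compact 1 (Omega l h) v2" "supp v2 \<subseteq> Omega_L l h \<epsilon>"
   by (rule v1 v2)+
  show "sqint M3 (ext T u)" "sqint M3 (ext T du)" "sqint M3 (%p. fst (ext T Gu p))" "sqint M3 (%p. snd (ext T Gu p))"
   by (rule sU sG)+
  show "ext T u p = 0 \<and> ext T du p = 0 \<and> fst (ext T Gu p) = 0 \<and> snd (ext T Gu p) = 0" if "fst p \<notin> {0<..<T}" for p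
   using z[OF that] by simp
  show "AE p in M3. fst p \<in> {0<..<T} --> ext T u p = v1 (snd p) + prim (ext T du) p"
   by (rule solution_is_primitive[OF T u du wd tr sv1])
  show "AE t in lborel. t \<in> {0<..<T} --> wgrad (%x. ext T u (t, x)) (%x. fst (ext T Gu (t, x))) (1, 0) \<and>
    wgrad (%x. ext T u (t, x)) (%x. snd (ext T Gu (t, x))) (0, 1)"
   using wg
  proof eventually_elim
   case (elim t)
   show ?case
   proof
    assume t: "t \<in> {0<..<T}"
    have "torus_weak_gradient l h (u t) (Gu t)" using elim t by blast
    moreover have "torus_weak_gradient l h (u t) (Gu t) \<longleftrightarrow>
      wgrad (%x. ext T u (t, x)) (%x. fst (ext T Gu (t, x))) (1, 0) \<and> wgrad (%x. ext T u (t, x)) (%x. snd (ext T Gu (t, x))) (0, 1)"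
     by (rule torus_weak_gradient_iff[OF wt_section(1)[OF m(1)] wt_section(1)[OF mG(1)] wt_section(1)[OF mG(2)]])
      (use t in \<open>auto simp: ext_def\<close>)
    ultimately show "wgrad (%x. ext T u (t, x)) (%x. fst (ext T Gu (t, x))) (1, 0) \<and> wgrad (%x. ext T u (t, x)) (%x. snd (ext T Gu (t, x))) (0, 1)"
     by blast
   qed
  qed
  show "sqint M3 (%p. fL (fst p) (snd p))" by (rule f(1))
  show "fL (fst p) (snd p) = 0" if "fst p \<notin> {0<..<T}" for p by (rule f(2)[OF that])
  fix \<phi> d g1 g2 assume a: "adm T \<phi> d g1 g2"
  note cl = adm_class[OF a T]
  have weq: "- (LINT t:{0<..<T}|lborel. LINT x:Omega l h|lborel. hat_coeff l h \<epsilon> rL rM rR t x * du t x * d (t, x))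
    + (LINT t:{0<..<T}|lborel. LINT x:Omega l h|lborel. hat_coeff l h \<epsilon> dL DM dR t x * (Gu t x \<bullet> (g1 (t, x), g2 (t, x))))
    = (LINT t:{0<..<T}|lborel. LINT x:Omega l h|lborel. fL t x * \<phi> (t, x)) + (LINT x:Omega l h|lborel. rL * v2 x * \<phi> (0, x))"
   using sol cl unfolding weak_solution_def by blast
  have s: "sqint M3 (%p. indicator {0..T} (fst p) * d p)" "sqint M3 (%p. indicator {0..T} (fst p) * g1 p)"
    "sqint M3 (%p. indicator {0..T} (fst p) * g2 p)" "sqint M3 (%p. indicator {0..T} (fst p) * \<phi> p)" "\<phi> \<in> borel_measurable borel"
   using a unfolding adm_def by blast+
  have i: "integrable M3 (%p. q p * Z p * F p)"
   if "sqint M3 Z" "\<And>p. fst p \<notin> {0<..<T} ==> Z p = 0" "sqint M3 (%p. indicator {0..T} (fst p) * F p)"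
    "q \<in> borel_measurable borel" "\<And>p. \<bar>q p\<bar> \<le> K" for q Z F K
  proof -
   have "q p * Z p * (indicator {0..T} (fst p) * F p) = q p * Z p * F p" for p
    using that(2)[of p] by (cases "fst p \<in> {0<..<T}") auto
   moreover have "sqint M3 (%p. q p * Z p)" by (rule sqint_bounded_mult[OF that(1) _ that(5)]) (use that(4) in simp)
   ultimately show ?thesis using sqint_mult[OF _ that(3), of "%p. q p * Z p"] by (simp only:)
  qed
  have zf: "fst (ext T Gu p) = 0" "snd (ext T Gu p) = 0" if "fst p \<notin> {0<..<T}" for p using z(3)[OF that] by simp_all
  have "integrable M3 (%p. ext T (hat_coeff l h \<epsilon> dL DM dR) p * fst (ext T Gu p) * g1 p + ext T (hat_coeff l h \<epsilon> dL DM dR) p * snd (ext T Gu p) * g2 p)"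
   by (intro Bochner_Integration.integrable_add i[OF sG(1) zf(1) s(2) RDm(2) K(2)] i[OF sG(2) zf(2) s(3) RDm(2) K(2)])
  then have iG: "integrable M3 (%p. ext T (hat_coeff l h \<epsilon> dL DM dR) p * (fst (ext T Gu p) * g1 p + snd (ext T Gu p) * g2 p))"
   by (simp only: distrib_left mult.assoc)
  have e1: "(LINT t:{0<..<T}|lborel. LINT x:Omega l h|lborel. hat_coeff l h \<epsilon> rL rM rR t x * du t x * d (t, x))
   = (LINT p|M3. ext T (hat_coeff l h \<epsilon> rL rM rR) p * ext T du p * d p)"
   by (rule LINT_cylinder[OF i[OF sU(2) z(2) s(1) RDm(1) K(1)]]) (auto simp: ext_def)
  have e2: "(LINT t:{0<..<T}|lborel. LINT x:Omega l h|lborel. hat_coeff l h \<epsilon> dL DM dR t x * (Gu t x \<bullet> (g1 (t, x), g2 (t, x))))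
   = (LINT p|M3. ext T (hat_coeff l h \<epsilon> dL DM dR) p * (fst (ext T Gu p) * g1 p + snd (ext T Gu p) * g2 p))"
   by (rule LINT_cylinder[OF iG]) (auto simp: ext_def inner_prod_def)
  have one: "\<bar>1::real\<bar> \<le> 1" by simp
  have "integrable M3 (%p. 1 * fL (fst p) (snd p) * \<phi> p)"
   by (rule i[OF f(1) f(2) s(4) borel_measurable_const one])
  then have iF: "integrable M3 (%p. fL (fst p) (snd p) * \<phi> p)" by simp
  have e3: "(LINT t:{0<..<T}|lborel. LINT x:Omega l h|lborel. fL t x * \<phi> (t, x)) = (LINT p|M3. fL (fst p) (snd p) * \<phi> p)"
   by (rule LINT_cylinder[OF iF]) (use f(2) in auto)
  have e4: "(LINT x:Omega l h|lborel. rL * v2 x * \<phi> (0, x)) = (LINT x|N. rL * v2 x * \<phi> (0, x))"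
   by (rule LINT_Omega) (use wt_section(1)[OF s(5)] in measurable)
  show "- (LINT p|M3. ext T (hat_coeff l h \<epsilon> rL rM rR) p * ext T du p * d p) +
    (LINT p|M3. ext T (hat_coeff l h \<epsilon> dL DM dR) p * (fst (ext T Gu p) * g1 p + snd (ext T Gu p) * g2 p))
   = (LINT p|M3. fL (fst p) (snd p) * \<phi> p) + (LINT x|N. rL * v2 x * \<phi> (0, x))"
   using weq unfolding e1 e2 e3 e4 .
 qed
qed

section \<open>Estimates uniform in the width of the layer\<close>

theorem lemma2:
  fixes l h T \<epsilon>\<^sub>0 D\<^sub>L D\<^sub>R \<rho>\<^sub>L \<rho>\<^sub>R :: real
    and D\<^sub>M \<rho>\<^sub>M :: profile
    and v\<^sub>1 v\<^sub>2 :: "point \<Rightarrow> real"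
    and f\<^sub>L :: "real \<Rightarrow> point \<Rightarrow> real"
  assumes "l > 0" and "h > 0" and "T > 0"
    and "\<epsilon>\<^sub>0 > 0" and "\<epsilon>\<^sub>0 \<le> 2 * l"
    and "assumption_A1 T h (eps_range h \<epsilon>\<^sub>0) D\<^sub>L D\<^sub>R \<rho>\<^sub>L \<rho>\<^sub>R D\<^sub>M \<rho>\<^sub>M"
    and "assumption_A2 T l h (eps_range h \<epsilon>\<^sub>0) v\<^sub>1 v\<^sub>2 f\<^sub>L"
    and "assumption_B2 T h (eps_range h \<epsilon>\<^sub>0) D\<^sub>L D\<^sub>R \<rho>\<^sub>L \<rho>\<^sub>R D\<^sub>M \<rho>\<^sub>M"
  shows "\<exists>C::real. C > 0 \<and> (\<forall>\<epsilon>\<in>eps_range h \<epsilon>\<^sub>0. \<forall>u du Gu.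
    weak_solution T l h \<epsilon> D\<^sub>L D\<^sub>R \<rho>\<^sub>L \<rho>\<^sub>R D\<^sub>M \<rho>\<^sub>M v\<^sub>1 v\<^sub>2 f\<^sub>L u du Gu \<longrightarrow>
      Linf_L2_norm T (Omega_L l h \<epsilon>) u + Linf_L2_norm T (Omega_R l h \<epsilon>) u
        + ennreal (1 / sqrt \<epsilon>) * Linf_L2_norm T (Omega_M h \<epsilon>) u \<le> ennreal C \<and>
      Linf_L2_norm T (Omega_L l h \<epsilon>) du + Linf_L2_norm T (Omega_R l h \<epsilon>) du
        + ennreal (1 / sqrt \<epsilon>) * Linf_L2_norm T (Omega_M h \<epsilon>) du \<le> ennreal C \<and>
      Linf_L2_norm T (Omega_L l h \<epsilon>) Gu + Linf_L2_norm T (Omega_R l h \<epsilon>) Gu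
        + ennreal (1 / sqrt \<epsilon>) * Linf_L2_norm T (Omega_M h \<epsilon>) Gu \<le> ennreal C)"
proof -
 let ?E = "eps_range h \<epsilon>\<^sub>0"
 interpret torus l h by (unfold_locales) (use assms in auto)
 have LO: "open (Omega_left l h)" "Omega_left l h \<subseteq> Omega l h"
  unfolding Omega_left_def Omega_def using assms(1) by (auto intro!: open_Times)
 have DR: "D\<^sub>L > 0" "D\<^sub>R > 0" "\<rho>\<^sub>L > 0" "\<rho>\<^sub>R > 0"
  and prof: "continuous_on (profile_domain T h) D\<^sub>M" "continuous_on (profile_domain T h) \<rho>\<^sub>M"
  and ex: "\<exists>\<rho>min \<rho>max Dmin Dmax. \<rho>min > 0 \<and> \<rho>max > 0 \<and> Dmin > 0 \<and> Dmax > 0 \<and>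
   (\<forall>\<epsilon>\<in>?E. \<forall>t\<in>{0<..<T}. \<forall>x\<in>Omega_M h \<epsilon>.
     \<rho>min \<le> micro_coeff \<rho>\<^sub>M \<epsilon> t x \<and> micro_coeff \<rho>\<^sub>M \<epsilon> t x \<le> \<rho>max \<and>
     Dmin \<le> micro_coeff D\<^sub>M \<epsilon> t x \<and> micro_coeff D\<^sub>M \<epsilon> t x \<le> Dmax)"
  using assms(6) unfolding assumption_A1_def periodic_profile_def by simp_all
 obtain rmin rmax Dmin Dmax where A1': "rmin > 0" "rmax > 0" "Dmin > 0" "Dmax > 0"
  and bd: "\<And>\<epsilon> t x. \<epsilon> \<in> ?E ==> t \<in> {0<..<T} ==> x \<in> Omega_M h \<epsilon> ==>
   rmin \<le> micro_coeff \<rho>\<^sub>M \<epsilon> t x \<and> micro_coeff \<rho>\<^sub>M \<epsilon> t x \<le> rmax \<and> Dmin \<le> micro_coeff D\<^sub>M \<epsilon> t x \<and> micro_coeff D\<^sub>M \<epsilon> t x \<le> Dmax"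
  using ex by auto
 note A1 = DR A1'
 obtain c g1 g2 where "c > 0" and tw: "travelling_wave T h ?E c \<rho>\<^sub>M g1" "travelling_wave T h ?E c D\<^sub>M g2"
  and lam: "\<exists>lam>0. D\<^sub>L - c^2 * \<rho>\<^sub>L > lam" "\<exists>lam>0. D\<^sub>R - c^2 * \<rho>\<^sub>R > lam"
   "\<exists>lam>0. \<forall>\<epsilon>\<in>?E. \<forall>t\<in>{0<..<T}. \<forall>x\<in>Omega_M h \<epsilon>. micro_coeff D\<^sub>M \<epsilon> t x - c^2 * micro_coeff \<rho>\<^sub>M \<epsilon> t x > lam"
  using assms(8) unfolding assumption_B2_def by blast
 obtain lamL lamR lamM where lam': "lamL > 0" "lamR > 0" "lamM > 0" "D\<^sub>L - c^2 * \<rho>\<^sub>L > lamL" "D\<^sub>R - c^2 * \<rho>\<^sub>R > lamR"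
   "\<And>\<epsilon> t x. \<epsilon> \<in> ?E ==> t \<in> {0<..<T} ==> x \<in> Omega_M h \<epsilon> ==> micro_coeff D\<^sub>M \<epsilon> t x - c^2 * micro_coeff \<rho>\<^sub>M \<epsilon> t x > lamM"
  using lam by blast
 \<comment> \<open>One lower bound, independent of \<epsilon>, for the densities and for the gaps D
   - c^2 \<rho> in all three regions, in the layer before the factor 1/\<epsilon>.\<close>
 define m where "m = min (min (min \<rho>\<^sub>L \<rho>\<^sub>R) rmin) (min (min lamL lamR) lamM)"
 have m: "m > 0" "m \<le> \<rho>\<^sub>L" "m \<le> \<rho>\<^sub>R" "m \<le> rmin" "m \<le> lamL" "m \<le> lamR" "m \<le> lamM"
  using A1 lam' by (simp_all add: m_def)
 have v: "Ck_compact 2 (Omega_left l h) v\<^sub>1" "Ck_compact 1 (Omega_left l h) v\<^sub>2"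
  and fC: "Ck_compact 2 ({0<..<T} \<times> Omega_left l h) (%(t, x). f\<^sub>L t x)"
  and supp: "\<And>\<epsilon>. \<epsilon> \<in> ?E ==> supp v\<^sub>1 \<subseteq> Omega_L l h \<epsilon> \<and> supp v\<^sub>2 \<subseteq> Omega_L l h \<epsilon> \<and> supp (%(t, x). f\<^sub>L t x) \<subseteq> {0<..<T} \<times> Omega_L l h \<epsilon>"
  using assms(7) unfolding assumption_A2_def by blast+
 obtain B where B: "data_bound B v\<^sub>1 v\<^sub>2" using data_bound_exists[OF v LO(1)] .
 note v' = Ck_compact_mono[OF v(1) LO] Ck_compact_mono[OF v(2) LO]
 define f3 where "f3 p = f\<^sub>L (fst p) (snd p)" for p :: "real \<times> point"
 have f3: "(%(t, x). f\<^sub>L t x) = f3" by (auto simp: f3_def)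
 have opT: "open ({0<..<T} \<times> Omega_left l h)" by (intro open_Times LO(1)) auto
 have fC': "Ck_compact (Suc (Suc 0)) ({0<..<T} \<times> Omega_left l h) f3" using fC unfolding f3 by (simp add: numeral_2_eq_2)
 have f0: "Ck_compact 0 ({0<..<T} \<times> Omega_left l h) f3" using Ck_compact_Suc(3)[OF fC' opT] .
 have [measurable]: "f3 \<in> borel_measurable borel"
  using Ck_compact_0_continuous[OF f0 opT] by (rule borel_measurable_continuous_onI)
 have fs: "compact (supp f3)" "supp f3 \<subseteq> {0<..<T} \<times> Omega_left l h" using f0 by (auto simp: Ck_compact_def)
 obtain \<tau> where \<tau>: "\<tau> > 0" "\<And>p. p \<in> supp f3 ==> fst p \<in> {\<tau>..T - \<tau>}"
  using compact_in_time_interval[OF fs assms(3)] by blast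
 have f3_out: "f3 p = 0" if "fst p \<notin> {\<tau>..T - \<tau>} \<or> fst p \<notin> {0<..<T}" for p
 proof -
  have "p \<notin> supp f3" using that \<tau>(2)[of p] fs(2) by auto
  then show ?thesis by (rule notin_supp)
 qed
 have f3_sq: "sqint M3 f3"
 proof -
  obtain b where b: "b \<ge> 0" "\<And>x. \<bar>f3 x\<bar> \<le> b" using Ck_compact_bounded[OF f0 opT] by blast
  have ind: "sqint M3 (%p. indicator {0..T} (fst p))" by (rule sqint_time_indicator) auto
  show ?thesis
  proof (rule sqint_bound[OF ind, where C=b])
   show "AE p in M3. \<bar>f3 p\<bar> \<le> b * \<bar>indicator {0..T} (fst p)\<bar>"
   proof (rule AE_I2)
    fix p show "\<bar>f3 p\<bar> \<le> b * \<bar>indicator {0..T} (fst p)\<bar>"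
     using b(2)[of p] f3_out[of p] by (cases "fst p \<in> {0<..<T}") auto
   qed
  qed measurable
 qed
 define J where "J = B^2 * measure N UNIV"
 \<comment> \<open>Only the data, T, c, the area and the constants of the left region occur, which
   makes the energy bound independent of \<epsilon>.\<close>
 define E0 where "E0 = 2 * (B^2 * measure N UNIV * (\<rho>\<^sub>L * (2 * \<bar>c\<bar> + 1) / 2 + 3 * D\<^sub>L) + T / \<rho>\<^sub>L * (LINT p|M3. (f3 p)^2))"
 define \<kappa> where "\<kappa> = 4 * (1 + c^2) / m"
 define C where "C = \<kappa> * E0 + (2 * J + 2 * T^2 * \<kappa> * E0)"
 have J0: "J \<ge> 0" by (simp add: J_def)
 have E00: "E0 \<ge> 0" unfolding E0_def using A1 assms(3)
  by (intro mult_nonneg_nonneg add_nonneg_nonneg divide_nonneg_nonneg) auto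
 have k0: "\<kappa> \<ge> 0" unfolding \<kappa>_def using m(1) by (intro divide_nonneg_nonneg mult_nonneg_nonneg add_nonneg_nonneg) auto
 have C0: "\<kappa> * E0 \<le> C" "2 * J + 2 * T^2 * \<kappa> * E0 \<le> C" "C \<ge> 0"
  unfolding C_def using J0 mult_nonneg_nonneg[OF k0 E00] mult_nonneg_nonneg[OF zero_le_power2[of T] mult_nonneg_nonneg[OF k0 E00]]
  by (simp_all add: mult.assoc)
 \<comment> \<open>In the layer the weight 1/\<epsilon> gives a norm of at most sqrt (C \<epsilon>),
   exactly compensated by the factor 1/sqrt \<epsilon> in front.\<close>
 have main: "Linf_L2_norm T (Omega_L l h \<epsilon>) w + Linf_L2_norm T (Omega_R l h \<epsilon>) w
    + ennreal (1 / sqrt \<epsilon>) * Linf_L2_norm T (Omega_M h \<epsilon>) w \<le> ennreal (3 * sqrt C + 1)"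
  if "\<epsilon> > 0" "Linf_L2_norm T (Omega_L l h \<epsilon>) w \<le> ennreal (sqrt (C / 1))" "Linf_L2_norm T (Omega_R l h \<epsilon>) w \<le> ennreal (sqrt (C / 1))"
   "Linf_L2_norm T (Omega_M h \<epsilon>) w \<le> ennreal (sqrt (C / (1 / \<epsilon>)))" for \<epsilon> and w :: "real => point => 'b::euclidean_space"
 proof -
  have "ennreal (1 / sqrt \<epsilon>) * Linf_L2_norm T (Omega_M h \<epsilon>) w \<le> ennreal (1 / sqrt \<epsilon>) * ennreal (sqrt (C / (1 / \<epsilon>)))"
   by (intro mult_left_mono that) simp
  also have "\<dots> = ennreal (1 / sqrt \<epsilon> * sqrt (C / (1 / \<epsilon>)))" using that(1) C0(3) by (intro ennreal_mult[symmetric]) auto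
  also have "1 / sqrt \<epsilon> * sqrt (C / (1 / \<epsilon>)) = sqrt C" using that(1) by (simp add: real_sqrt_mult)
  finally have "Linf_L2_norm T (Omega_L l h \<epsilon>) w + Linf_L2_norm T (Omega_R l h \<epsilon>) w
    + ennreal (1 / sqrt \<epsilon>) * Linf_L2_norm T (Omega_M h \<epsilon>) w \<le> ennreal (sqrt C) + ennreal (sqrt C) + ennreal (sqrt C)"
   using that(2,3) by (intro add_mono) simp_all
  also have "\<dots> = ennreal (sqrt C + sqrt C + sqrt C)" using C0(3) by (simp add: ennreal_plus[symmetric] del: ennreal_plus)
  also have "\<dots> \<le> ennreal (3 * sqrt C + 1)" by (intro ennreal_leI) simp
  finally show ?thesis .
 qed
 \<comment> \<open>Since C is only known to be nonnegative, the summand 1 secures a positive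
   constant.\<close>
 have "3 * sqrt C + 1 > 0" using C0(3) by (intro add_nonneg_pos) auto
 moreover have "Linf_L2_norm T (Omega_L l h \<epsilon>) u + Linf_L2_norm T (Omega_R l h \<epsilon>) u
    + ennreal (1 / sqrt \<epsilon>) * Linf_L2_norm T (Omega_M h \<epsilon>) u \<le> ennreal (3 * sqrt C + 1) \<and>
   Linf_L2_norm T (Omega_L l h \<epsilon>) du + Linf_L2_norm T (Omega_R l h \<epsilon>) du
    + ennreal (1 / sqrt \<epsilon>) * Linf_L2_norm T (Omega_M h \<epsilon>) du \<le> ennreal (3 * sqrt C + 1) \<and>
   Linf_L2_norm T (Omega_L l h \<epsilon>) Gu + Linf_L2_norm T (Omega_R l h \<epsilon>) Gu
    + ennreal (1 / sqrt \<epsilon>) * Linf_L2_norm T (Omega_M h \<epsilon>) Gu \<le> ennreal (3 * sqrt C + 1)"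
  if \<epsilon>: "\<epsilon> \<in> ?E" and sol: "weak_solution T l h \<epsilon> D\<^sub>L D\<^sub>R \<rho>\<^sub>L \<rho>\<^sub>R D\<^sub>M \<rho>\<^sub>M v\<^sub>1 v\<^sub>2 f\<^sub>L u du Gu" for \<epsilon> u du Gu
 proof -
  obtain n where n: "h = real n * \<epsilon>" and e: "\<epsilon> > 0" "\<epsilon> / 2 < l" using \<epsilon> assms(5) unfolding eps_range_def by auto
  let ?R = "ext T (hat_coeff l h \<epsilon> \<rho>\<^sub>L \<rho>\<^sub>M \<rho>\<^sub>R)" and ?D = "ext T (hat_coeff l h \<epsilon> D\<^sub>L D\<^sub>M D\<^sub>R)"
  let ?r = "%p. micro_coeff \<rho>\<^sub>M \<epsilon> (fst p) (snd p)" and ?d = "%p. micro_coeff D\<^sub>M \<epsilon> (fst p) (snd p)"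
  have sub: "Omega_L l h \<epsilon> \<subseteq> Omega l h" "Omega_M h \<epsilon> \<subseteq> Omega l h" "Omega_R l h \<epsilon> \<subseteq> Omega l h"
   using e by (auto simp: Omega_def Omega_L_def Omega_M_def Omega_R_def)
  have bor: "Omega_L l h \<epsilon> \<in> sets borel" "Omega_M h \<epsilon> \<in> sets borel" "Omega_R l h \<epsilon> \<in> sets borel"
   unfolding Omega_L_def Omega_M_def Omega_R_def by (intro borel_open open_Times open_greaterThanLessThan)+
  have disj: "Omega_L l h \<epsilon> \<inter> Omega_M h \<epsilon> = {}" "Omega_L l h \<epsilon> \<inter> Omega_R l h \<epsilon> = {}" "Omega_M h \<epsilon> \<inter> Omega_R l h \<epsilon> = {}"
   using e by (auto simp: Omega_L_def Omega_M_def Omega_R_def)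
  have val: "snd p \<in> Omega_L l h \<epsilon> ==> ?R p = \<rho>\<^sub>L \<and> ?D p = D\<^sub>L"
   "snd p \<in> Omega_M h \<epsilon> ==> ?R p = 1 / \<epsilon> * ?r p \<and> ?D p = 1 / \<epsilon> * ?d p"
   "snd p \<in> Omega_R l h \<epsilon> ==> ?R p = \<rho>\<^sub>R \<and> ?D p = D\<^sub>R" if "fst p \<in> {0<..<T}" for p
   using that sub disj by (auto simp: ext_def hat_coeff_def)
  have cases: "?R p = 0 \<and> ?D p = 0 \<or> fst p \<in> {0<..<T} \<and> snd p \<in> Omega_L l h \<epsilon> \<or>
    fst p \<in> {0<..<T} \<and> snd p \<in> Omega_M h \<epsilon> \<or> fst p \<in> {0<..<T} \<and> snd p \<in> Omega_R l h \<epsilon>" for p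
   by (auto simp: ext_def hat_coeff_def)
  have low: "fst p \<in> {0<..<T} ==> snd p \<in> Omega_L l h \<epsilon> ==> 1 * m \<le> ?R p \<and> 1 * m \<le> ?D p - c^2 * ?R p"
   "fst p \<in> {0<..<T} ==> snd p \<in> Omega_M h \<epsilon> ==> 1 / \<epsilon> * m \<le> ?R p \<and> 1 / \<epsilon> * m \<le> ?D p - c^2 * ?R p"
   "fst p \<in> {0<..<T} ==> snd p \<in> Omega_R l h \<epsilon> ==> 1 * m \<le> ?R p \<and> 1 * m \<le> ?D p - c^2 * ?R p" for p
  proof -
   show "fst p \<in> {0<..<T} ==> snd p \<in> Omega_L l h \<epsilon> ==> 1 * m \<le> ?R p \<and> 1 * m \<le> ?D p - c^2 * ?R p" using val(1)[of p] m lam' by simp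
   show "fst p \<in> {0<..<T} ==> snd p \<in> Omega_R l h \<epsilon> ==> 1 * m \<le> ?R p \<and> 1 * m \<le> ?D p - c^2 * ?R p" using val(3)[of p] m lam' by simp
   assume p: "fst p \<in> {0<..<T}" "snd p \<in> Omega_M h \<epsilon>"
   have "m \<le> ?r p" "m \<le> ?d p - c^2 * ?r p" using bd[OF \<epsilon> p] lam'(6)[OF \<epsilon> p] m by linarith+
   from this[THEN mult_left_mono, of "1 / \<epsilon>"] e
   have "1 / \<epsilon> * m \<le> 1 / \<epsilon> * ?r p" "1 / \<epsilon> * m \<le> 1 / \<epsilon> * (?d p - c^2 * ?r p)" by simp_all
   then show "1 / \<epsilon> * m \<le> ?R p \<and> 1 / \<epsilon> * m \<le> ?D p - c^2 * ?R p"
    using val(2)[OF p] by (simp add: right_diff_distrib mult.left_commute)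
  qed
  have m\<epsilon>: "0 \<le> 1 / \<epsilon> * m" using m(1) e by simp
  \<comment> \<open>Outside the cylinder and on the two interfaces both coefficients are zero, so
    the inequalities are weak there; elsewhere they follow from \<open>low\<close>.\<close>
  have coer: "0 \<le> ?R p" "c^2 * ?R p \<le> ?D p" for p
   using cases[of p] low[of p] m(1) m\<epsilon> by fastforce+
  \<comment> \<open>This K grows like 1/\<epsilon>. It serves integrability and limits within
    \<open>wave\<close> and does not enter the bound of \<open>energy_bound\<close>.\<close>
  have "\<exists>K. \<forall>p. \<bar>?R p\<bar> \<le> K \<and> \<bar>?D p\<bar> \<le> K"
  proof (intro exI allI)
   fix p
   let ?K = "\<rho>\<^sub>L + \<rho>\<^sub>R + D\<^sub>L + D\<^sub>R + 1 / \<epsilon> * (rmax + Dmax)"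
   have pos: "0 \<le> 1 / \<epsilon> * (rmax + Dmax)" using A1 e by simp
   consider "?R p = 0 \<and> ?D p = 0" | "?R p = \<rho>\<^sub>L \<and> ?D p = D\<^sub>L" | "?R p = \<rho>\<^sub>R \<and> ?D p = D\<^sub>R"
    | "fst p \<in> {0<..<T}" "snd p \<in> Omega_M h \<epsilon>" using cases[of p] val(1,3)[of p] by blast
   then show "\<bar>?R p\<bar> \<le> ?K \<and> \<bar>?D p\<bar> \<le> ?K"
   proof cases
    case 4
    have b: "0 \<le> ?r p" "0 \<le> ?d p" "?r p \<le> rmax + Dmax" "?d p \<le> rmax + Dmax" using bd[OF \<epsilon> 4] A1 by linarith+
    from b(1,2)[THEN mult_left_mono, of "1 / \<epsilon>"] b(3,4)[THEN mult_left_mono, of "1 / \<epsilon>"] e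
    have "0 \<le> 1 / \<epsilon> * ?r p" "0 \<le> 1 / \<epsilon> * ?d p" "1 / \<epsilon> * ?r p \<le> 1 / \<epsilon> * (rmax + Dmax)" "1 / \<epsilon> * ?d p \<le> 1 / \<epsilon> * (rmax + Dmax)" by simp_all
    then show ?thesis using val(2)[OF 4] A1 by linarith
   qed (use A1 pos in linarith)+
  qed
  then obtain K where K: "\<And>p. \<bar>?R p\<bar> \<le> K" "\<And>p. \<bar>?D p\<bar> \<le> K" by blast
  have f0': "f\<^sub>L t x = 0" if "t \<notin> {0<..<T}" for t x using f3_out[of "(t, x)"] that by (simp add: f3_def)
  have f3_S: "f3 p = 0" if "snd p \<notin> Omega_L l h \<epsilon>" for p
  proof -
   have "p \<notin> supp f3" using that supp[OF \<epsilon>] unfolding f3 by auto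
   then show ?thesis by (rule notin_supp)
  qed
  have W: "wave l h T c \<rho>\<^sub>L D\<^sub>L K ?R ?D f3 (ext T u) (ext T du) (%p. fst (ext T Gu p)) (%p. snd (ext T Gu p)) v\<^sub>1 v\<^sub>2 (Omega_L l h \<epsilon>)"
   unfolding f3_def[abs_def]
   by (rule weak_solution_wave[OF assms(3) e n \<epsilon> prof tw K v'(1) _ v'(2) _ _ f0' sol])
    (use supp[OF \<epsilon>] f3_sq[unfolded f3_def[abs_def]] in auto)
  interpret W: wave l h T c \<rho>\<^sub>L D\<^sub>L K ?R ?D f3 "ext T u" "ext T du" "%p. fst (ext T Gu p)" "%p. snd (ext T Gu p)" v\<^sub>1 v\<^sub>2 "Omega_L l h \<epsilon>"
   by (rule W)
  have uu: "in_L2_L2 T (Omega l h) u" "in_L2_L2 T (Omega l h) du" "in_L2_L2 T (Omega l h) Gu"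
   using sol by (simp_all add: weak_solution_def in_L2_H1per_def)
  have EB: "AE t in lborel. t \<in> {0<..<T} --> (LINT x|N. W.energy (t, x)) \<le> E0"
   unfolding E0_def by (rule W.energy_bound[OF B A1(3) less_imp_le[OF A1(1)] \<tau>(1) _ f3_S coer]) (use f3_out in blast)
  have en0: "0 \<le> W.energy p" for p
  proof -
   have "0 \<le> ?D p" using coer(2)[of p] mult_nonneg_nonneg[OF zero_le_power2[of c] coer(1)[of p]] by linarith
   then show ?thesis unfolding W.energy_eq using coer[of p] by (intro add_nonneg_nonneg divide_nonneg_nonneg mult_nonneg_nonneg) auto
  qed
  \<comment> \<open>Applied with \<omega> = 1 to the outer regions and with \<omega> = 1/\<epsilon>
    to the layer, where both coefficients carry that factor.\<close>
  have region: "Linf_L2_norm T Q u \<le> ennreal (sqrt (C / \<omega>)) \<and> Linf_L2_norm T Q du \<le> ennreal (sqrt (C / \<omega>)) \<and> Linf_L2_norm T Q Gu \<le> ennreal (sqrt (C / \<omega>))"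
   if Q: "Q \<subseteq> Omega l h" "Q \<in> sets borel" and o: "\<omega> > 0"
    and lw: "\<And>p. fst p \<in> {0<..<T} ==> snd p \<in> Q ==> \<omega> * m \<le> ?R p \<and> \<omega> * m \<le> ?D p - c^2 * ?R p"
    and vv: "(LINT x|N. indicator Q x * (v\<^sub>1 x)^2) \<le> J / \<omega>" for Q \<omega>
  proof -
   have c1: "\<omega> * (ext T du (t, x))^2 \<le> \<kappa> * W.energy (t, x)"
    "\<omega> * ((fst (ext T Gu (t, x)))^2 + (snd (ext T Gu (t, x)))^2) \<le> \<kappa> * W.energy (t, x)" if "t \<in> {0<..<T}" "x \<in> Q" for t x
    using W.energy_coercive[of \<omega> m "(t, x)"] lw[of "(t, x)"] that o m(1) unfolding \<kappa>_def by simp_all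
   have eqs: "ext T u (t, x) = u t x" "ext T du (t, x) = du t x" "ext T Gu (t, x) = Gu t x" if "t \<in> {0<..<T}" "x \<in> Q" for t x
    using that Q by (auto simp: ext_def)
   have Cw: "\<kappa> * E0 / \<omega> \<le> C / \<omega>" "(2 * J + 2 * T^2 * \<kappa> * E0) / \<omega> \<le> C / \<omega>" "0 \<le> C / \<omega>"
    using C0 o by (auto intro: divide_right_mono)
   note sec = wt_section(1)[OF in_L2_L2_ext(1)[OF uu(1)]] wt_section(1)[OF in_L2_L2_ext(1)[OF uu(2)]]
    wt_section(1)[OF W.UVG_measurable(3)] wt_section(1)[OF W.UVG_measurable(4)]
   have nrm: "(norm z)^2 = (fst z)^2 + (snd z)^2" for z :: point by (cases z) (simp add: norm_Pair)
   have RB: "AE t in lborel. t \<in> {0<..<T} --> W.region_est Q (\<kappa> * E0 / \<omega>) ((2 * J + 2 * T^2 * \<kappa> * E0) / \<omega>) t"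
    by (rule W.region_bounds[OF Q(2) o k0 E00 EB en0 c1 vv])
   have AE: "AE t in lborel. t \<in> {0<..<T} --> eL2norm Q (u t) \<le> ennreal (sqrt (C / \<omega>)) \<and>
     eL2norm Q (du t) \<le> ennreal (sqrt (C / \<omega>)) \<and> eL2norm Q (Gu t) \<le> ennreal (sqrt (C / \<omega>))"
    using RB
   proof eventually_elim
    case (elim t)
    show ?case
    proof (intro impI)
     assume t: "t \<in> {0<..<T}"
     have r: "W.region_est Q (\<kappa> * E0 / \<omega>) ((2 * J + 2 * T^2 * \<kappa> * E0) / \<omega>) t" using elim t by blast
     note r1 = r[unfolded W.region_est_def, THEN conjunct1] and r2 = r[unfolded W.region_est_def, THEN conjunct2]
     note r3 = r2[THEN conjunct2] and r4 = r2[THEN conjunct2, THEN conjunct2] and r5 = r2[THEN conjunct2, THEN conjunct2, THEN conjunct2]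
     show "eL2norm Q (u t) \<le> ennreal (sqrt (C / \<omega>)) \<and> eL2norm Q (du t) \<le> ennreal (sqrt (C / \<omega>)) \<and> eL2norm Q (Gu t) \<le> ennreal (sqrt (C / \<omega>))"
     proof (intro conjI)
      show "eL2norm Q (u t) \<le> ennreal (sqrt (C / \<omega>))"
       by (rule region_norm_le[OF Q borel_measurable_power[OF sec(1)] zero_le_power2 _ r5[THEN conjunct1] order_trans[OF r5[THEN conjunct2] Cw(2)] Cw(3)])
        (simp add: eqs(1)[OF t])
      show "eL2norm Q (du t) \<le> ennreal (sqrt (C / \<omega>))"
       by (rule region_norm_le[OF Q borel_measurable_power[OF sec(2)] zero_le_power2 _ r1 order_trans[OF r2[THEN conjunct1] Cw(1)] Cw(3)])
        (simp add: eqs(2)[OF t])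
      show "eL2norm Q (Gu t) \<le> ennreal (sqrt (C / \<omega>))"
       by (rule region_norm_le[OF Q borel_measurable_add[OF borel_measurable_power[OF sec(3)] borel_measurable_power[OF sec(4)]]
          sum_power2_ge_zero _ r3[THEN conjunct1] order_trans[OF r4[THEN conjunct1] Cw(1)] Cw(3)])
        (simp add: nrm eqs(3)[OF t])
     qed
    qed
   qed
   show ?thesis
    by (intro conjI Linf_L2_norm_le[OF uu(1) Q] Linf_L2_norm_le[OF uu(2) Q] Linf_L2_norm_le[OF uu(3) Q]; use AE in eventually_elim; blast)
  qed
  have vL: "(LINT x|N. indicator (Omega_L l h \<epsilon>) x * (v\<^sub>1 x)^2) \<le> J / 1"
  proof -
   have bv: "\<bar>v\<^sub>1 x\<bar> \<le> B" for x by (rule W.B_bounds(1)[OF B])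
   have "(LINT x|N. indicator (Omega_L l h \<epsilon>) x * (v\<^sub>1 x)^2) \<le> (LINT x|N. (v\<^sub>1 x)^2)"
    by (rule integral_mono') (use W.data_sqint(1) in \<open>auto simp: sqint_def indicator_def\<close>)
   also have "\<dots> \<le> J" unfolding J_def by (rule W.B_square[OF B bv W.data_measurable(1)])
   finally show ?thesis by simp
  qed
  \<comment> \<open>The initial value vanishes off the left region, so even the small bound J
    \<epsilon> demanded in the layer holds.\<close>
  have v0: "(LINT x|N. indicator Q x * (v\<^sub>1 x)^2) \<le> J / \<omega>" if "Omega_L l h \<epsilon> \<inter> Q = {}" "\<omega> > 0" for Q \<omega>
  proof -
   have "indicator Q x * (v\<^sub>1 x)^2 = 0" for x
   proof (cases "x \<in> Q")
    case True
    then have "x \<notin> supp v\<^sub>1" using that(1) supp[OF \<epsilon>] by blast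
    then show ?thesis using notin_supp[of x v\<^sub>1] by simp
   qed simp
   then have "(LINT x|N. indicator Q x * (v\<^sub>1 x)^2) = 0" by (simp only: Bochner_Integration.integral_zero)
   then show ?thesis using J0 that(2) by simp
  qed
  have e1: "1 / \<epsilon> > 0" using e by simp
  note rL = region[OF sub(1) bor(1) zero_less_one low(1) vL]
  note rR = region[OF sub(3) bor(3) zero_less_one low(3) v0[OF disj(2) zero_less_one]]
  note rM = region[OF sub(2) bor(2) e1 low(2) v0[OF disj(1) e1]]
  show ?thesis using rL rR rM by (intro conjI main e(1)) blast+
 qed
 ultimately show ?thesis by blast
qed

end
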